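(* The Fuchsian equation $$\frac{d^2y}{dz^2}+P(z)\frac{dy}{dz}+Q(z)y=0$$ with the coefficients $P$, $Q$ given in the context (with $M+4$ singular points $0,1,a,\infty,b_1,\dots,b_M$ and spectral parameter $\lambda$) is `finite-gap' if and only if all points $z=b_k$ ($k=1,\dots,M$) are false singular points of the equation (for every $\lambda\in\mathbb{C}$).
   Context: **The Fuchsian equation.** Fix $a\in\mathbb{C}\setminus\{0,1\}$, an integer $M\ge 0$, nonnegative integers $m_0,m_1,m_2,m_3,n_1,\dots,n_M$, and pairwise distinct $b_1,\dots,b_M\in\mathbb{C}\setminus\{0,1,a\}$; $\lambda\in\mathbb{C}$ is a parameter (spectral parameter). Put $N=\sum_{j=0}^3 m_j+2\sum_{k=1}^M n_k$, $$P(z)=\frac12\left(\frac{1-2m_1}{z}+\frac{1-2m_2}{z-1}+\frac{1-2m_3}{z-a}\right)-2\sum_{k=1}^M\frac{n_k}{z-b_k},$$ $$Q(z)=\frac{N(N-2m_0-1)z+\lambda+R_M(z)}{4z(z-1)(z-a)},\qquad R_M(z)=2\sum_{k=1}^M\frac{n_k\rho_k}{z-b_k},$$ $$\rho_k=2(b_k-1)(b_k-a)m_1+2b_k(b_k-a)m_2+2b_k(b_k-1)m_3+(3b_k^2-2(a+1)b_k+a)n_k+4\sum_{j\ne k}\frac{b_k(b_k-1)(b_k-a)}{b_k-b_j}n_j .$$ **The associated Schrödinger equation.** Let $\wp$ be a Weierstrass function with half-periods $\omega_1,\omega_2=\omega_1+\omega_3,\omega_3$, $e_i=\wp(\omega_i)$,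 whose lattice satisfies $(e_3-e_1)/(e_2-e_1)=a$ (the lattice is determined by $a$ up to scaling, which is immaterial). Choose $\delta_k$ with $\wp(\delta_k)=e_1+(e_2-e_1)b_k$ and put $$u(x)=m_0(m_0+1)\wp(x)+\sum_{i=1}^3 m_i(m_i+1)\wp(x-\omega_i)+\sum_{k=1}^M n_k(n_k+1)\{\wp(x-\delta_k)+\wp(x+\delta_k)\}.$$ The change of variables $$\psi(x)=y(z)\,z^{-m_1/2}(z-1)^{-m_2/2}(z-a)^{-m_3/2}\prod_{k=1}^M(z-b_k)^{-n_k},\quad \wp(x)=e_1+(e_2-e_1)z,\quad E=(e_1-e_2)\lambda+\mathrm{const}$$ (with a suitable constant independent of $\lambda$) transforms $\psi_{xx}-u(x)\psi=E\psi$ into the Fuchsian equation $\frac{d^2y}{dz^2}+P(z)\frac{dy}{dz}+Q(z)y=0$. **Finite-gap.** Let $J_0=u$, and let $J_{n+1}$ be determined by $\partial_xJ_{n+1}=\partial_x^3J_n-4u\,\partial_xJ_n-2u_xJ_n$ (differential polynomials in $u$; e.g. $J_1=u_{xx}-3u^2$). The elliptic potential $u$ is finite-gap if for some $g\ge0$ there are constants $c_m,d$ with $J_g+\sum_{m=1}^g c_mJ_{g-m}=d$. The Fuchsian equation is called `finite-gap' if it is obtained, via the change of variables $\psi(x)=y(z)\,z^{-m_1/2}(z-1)^{-m_2/2}(z-a)^{-m_3/2}\prod_{k=1}^M(z-b_k)^{-n_k}$, $\wp(x)=e_1+(e_2-e_1)z$, $E=(e_1-e_2)\lambda+\mathrm{const}$,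 from the Schrödinger equation $\psi_{xx}-u\psi=E\psi$ with finite-gap potential $u$ of the form $u(x)=m_0(m_0+1)\wp(x)+\sum_{i=1}^3 m_i(m_i+1)\wp(x-\omega_i)+\sum_{k=1}^M n_k(n_k+1)\{\wp(x-\delta_k)+\wp(x+\delta_k)\}$. **False singular point.** The exponents at $z=b_k$ are $0$ and $2n_k+1$; $z=b_k$ is a false singular point if the general solution has no logarithmic singularity there (i.e. all solutions are holomorphic near $b_k$). *)

theory Defs
  imports "HOL-Complex_Analysis.Complex_Analysis" "HOL-Library.Poly_Mapping"
begin

section \<open>The Weierstrass function with half-periods \<open>\<omega>1\<close>, \<open>\<omega>2 = \<omega>1 + \<omega>3\<close>, \<open>\<omega>3\<close>\<close>

definition period_lattice :: "complex \<Rightarrow> complex \<Rightarrow> complex set" where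
  "period_lattice \<omega>1 \<omega>3 = {of_int i * (2 * \<omega>1) + of_int j * (2 * \<omega>3) | i j. True}"

text \<open>Only used for \<open>\<omega>3 / \<omega>1\<close> non-real, where the sum converges absolutely off the lattice.\<close>

definition weierstrass_p :: "complex \<Rightarrow> complex \<Rightarrow> complex \<Rightarrow> complex" where
  "weierstrass_p \<omega>1 \<omega>3 x =
     1 / x\<^sup>2 + (\<Sum>\<^sub>\<infinity>w\<in>period_lattice \<omega>1 \<omega>3 - {0}. 1 / (x - w)\<^sup>2 - 1 / w\<^sup>2)"

definition half_period :: "complex \<Rightarrow> complex \<Rightarrow> nat \<Rightarrow> complex" where
  "half_period \<omega>1 \<omega>3 i = (if i = 1 then \<omega>1 else if i = 2 then \<omega>1 + \<omega>3 else \<omega>3)"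

definition weierstrass_e :: "complex \<Rightarrow> complex \<Rightarrow> nat \<Rightarrow> complex" where
  "weierstrass_e \<omega>1 \<omega>3 i = weierstrass_p \<omega>1 \<omega>3 (half_period \<omega>1 \<omega>3 i)"


section \<open>The Fuchsian equation\<close>

text \<open>
  The spectral parameter is written \<open>\<mu>\<close>, as \<open>\<lambda>\<close> is reserved for abstraction.
  The families \<open>b\<^sub>1, \<dots>, b\<^sub>M\<close> and \<open>n\<^sub>1, \<dots>, n\<^sub>M\<close> are functions on \<open>nat\<close> of which only the values on
  \<open>{1..M}\<close> are used; for \<open>m\<close> only the values on \<open>{0..3}\<close> are used.
\<close>

definition fuchs_N :: "nat \<Rightarrow> (nat \<Rightarrow> nat) \<Rightarrow> (nat \<Rightarrow> nat) \<Rightarrow> nat" where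
  "fuchs_N M m n = (\<Sum>j=0..3. m j) + 2 * (\<Sum>k=1..M. n k)"

definition fuchs_P ::
  "complex \<Rightarrow> nat \<Rightarrow> (nat \<Rightarrow> nat) \<Rightarrow> (nat \<Rightarrow> nat) \<Rightarrow> (nat \<Rightarrow> complex) \<Rightarrow> complex \<Rightarrow> complex" where
  "fuchs_P a M m n b z =
     1 / 2 * ((1 - 2 * of_nat (m 1)) / z + (1 - 2 * of_nat (m 2)) / (z - 1)
              + (1 - 2 * of_nat (m 3)) / (z - a))
     - 2 * (\<Sum>k=1..M. of_nat (n k) / (z - b k))"

definition fuchs_rho ::
  "complex \<Rightarrow> nat \<Rightarrow> (nat \<Rightarrow> nat) \<Rightarrow> (nat \<Rightarrow> nat) \<Rightarrow> (nat \<Rightarrow> complex) \<Rightarrow> nat \<Rightarrow> complex" where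
  "fuchs_rho a M m n b k =
     2 * (b k - 1) * (b k - a) * of_nat (m 1)
     + 2 * b k * (b k - a) * of_nat (m 2)
     + 2 * b k * (b k - 1) * of_nat (m 3)
     + (3 * (b k)\<^sup>2 - 2 * (a + 1) * b k + a) * of_nat (n k)
     + 4 * (\<Sum>j\<in>{1..M} - {k}. b k * (b k - 1) * (b k - a) / (b k - b j) * of_nat (n j))"

definition fuchs_R ::
  "complex \<Rightarrow> nat \<Rightarrow> (nat \<Rightarrow> nat) \<Rightarrow> (nat \<Rightarrow> nat) \<Rightarrow> (nat \<Rightarrow> complex) \<Rightarrow> complex \<Rightarrow> complex" where
  "fuchs_R a M m n b z =
     2 * (\<Sum>k=1..M. of_nat (n k) * fuchs_rho a M m n b k / (z - b k))"

definition fuchs_Q ::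
  "complex \<Rightarrow> nat \<Rightarrow> (nat \<Rightarrow> nat) \<Rightarrow> (nat \<Rightarrow> nat) \<Rightarrow> (nat \<Rightarrow> complex) \<Rightarrow> complex \<Rightarrow>
   complex \<Rightarrow> complex" where
  "fuchs_Q a M m n b \<mu> z =
     (let N = of_nat (fuchs_N M m n)
      in (N * (N - 2 * of_nat (m 0) - 1) * z + \<mu> + fuchs_R a M m n b z)
         / (4 * z * (z - 1) * (z - a)))"

definition solves_ode2 ::
  "(complex \<Rightarrow> complex) \<Rightarrow> (complex \<Rightarrow> complex) \<Rightarrow> (complex \<Rightarrow> complex) \<Rightarrow> complex set \<Rightarrow> bool" where
  "solves_ode2 p q y U \<longleftrightarrow> (\<forall>z\<in>U. deriv (deriv y) z + p z * deriv y z + q z * y z = 0)"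

text \<open>
  Solutions near \<open>c\<close> may a priori be multivalued, so a solution is taken to be a single-valued
  branch on an arbitrary domain \<open>U\<close> in a punctured disc about \<open>c\<close>. All solutions are holomorphic
  near \<open>c\<close> iff each such branch is the restriction of a function holomorphic on the whole disc.
\<close>

definition false_singular_point ::
  "(complex \<Rightarrow> complex) \<Rightarrow> (complex \<Rightarrow> complex) \<Rightarrow> complex \<Rightarrow> bool" where
  "false_singular_point p q c \<longleftrightarrow>
     (\<exists>r>0. \<forall>U y. open U \<and> connected U \<and> U \<subseteq> ball c r - {c} \<and>
        y holomorphic_on U \<and> solves_ode2 p q y U \<longrightarrow>
        (\<exists>Y. Y holomorphic_on ball c r \<and> (\<forall>z\<in>U. Y z = y z)))"


section \<open>The associated Schroedinger equation and the change of variables\<close>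

definition elliptic_potential ::
  "complex \<Rightarrow> complex \<Rightarrow> (nat \<Rightarrow> complex) \<Rightarrow> nat \<Rightarrow> (nat \<Rightarrow> nat) \<Rightarrow> (nat \<Rightarrow> nat) \<Rightarrow>
   complex \<Rightarrow> complex" where
  "elliptic_potential \<omega>1 \<omega>3 \<delta> M m n x =
     of_nat (m 0 * (m 0 + 1)) * weierstrass_p \<omega>1 \<omega>3 x
     + (\<Sum>i=1..3. of_nat (m i * (m i + 1)) * weierstrass_p \<omega>1 \<omega>3 (x - half_period \<omega>1 \<omega>3 i))
     + (\<Sum>k=1..M. of_nat (n k * (n k + 1)) *
          (weierstrass_p \<omega>1 \<omega>3 (x - \<delta> k) + weierstrass_p \<omega>1 \<omega>3 (x + \<delta> k)))"

text \<open>The coordinate \<open>z\<close> determined by \<open>\<wp>(x) = e\<^sub>1 + (e\<^sub>2 - e\<^sub>1) z\<close>.\<close>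

definition z_coord :: "complex \<Rightarrow> complex \<Rightarrow> complex \<Rightarrow> complex" where
  "z_coord \<omega>1 \<omega>3 x =
     (weierstrass_p \<omega>1 \<omega>3 x - weierstrass_e \<omega>1 \<omega>3 1)
     / (weierstrass_e \<omega>1 \<omega>3 2 - weierstrass_e \<omega>1 \<omega>3 1)"

text \<open>
  The statement that the change of variables transforms \<open>\<psi>'' - u \<psi> = E \<psi>\<close> into
  \<open>y'' + P y' + Q y = 0\<close>, locally and for all choices of branches: \<open>S\<close> is an open set in the
  \<open>x\<close>-plane avoiding the singular points, \<open>Z\<close> is its image in the \<open>z\<close>-plane, and \<open>r1, r2, r3\<close> are
  holomorphic branches of the square roots of \<open>z\<close>, \<open>z - 1\<close>, \<open>z - a\<close> on \<open>Z\<close>.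
\<close>

definition schroedinger_transforms_to_fuchs ::
  "complex \<Rightarrow> complex \<Rightarrow> (nat \<Rightarrow> complex) \<Rightarrow>
   complex \<Rightarrow> nat \<Rightarrow> (nat \<Rightarrow> nat) \<Rightarrow> (nat \<Rightarrow> nat) \<Rightarrow> (nat \<Rightarrow> complex) \<Rightarrow>
   complex \<Rightarrow> complex \<Rightarrow> bool" where
  "schroedinger_transforms_to_fuchs \<omega>1 \<omega>3 \<delta> a M m n b E \<mu> \<longleftrightarrow>
     (\<forall>S Z r1 r2 r3 y \<psi>.
        open S \<and> S \<inter> period_lattice \<omega>1 \<omega>3 = {} \<and>
        Z = z_coord \<omega>1 \<omega>3 ` S \<and> Z \<inter> ({0, 1, a} \<union> b ` {1..M}) = {} \<and>
        r1 holomorphic_on Z \<and> (\<forall>z\<in>Z. (r1 z)\<^sup>2 = z) \<and>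
        r2 holomorphic_on Z \<and> (\<forall>z\<in>Z. (r2 z)\<^sup>2 = z - 1) \<and>
        r3 holomorphic_on Z \<and> (\<forall>z\<in>Z. (r3 z)\<^sup>2 = z - a) \<and>
        y holomorphic_on Z \<and>
        (\<forall>x\<in>S. let z = z_coord \<omega>1 \<omega>3 x in
           \<psi> x = y z * r1 z powi (- int (m 1)) * r2 z powi (- int (m 2))
                 * r3 z powi (- int (m 3)) * (\<Prod>k=1..M. (z - b k) powi (- int (n k))))
        \<longrightarrow>
        ((\<forall>x\<in>S. deriv (deriv \<psi>) x - elliptic_potential \<omega>1 \<omega>3 \<delta> M m n x * \<psi> x = E * \<psi> x)
         \<longleftrightarrow> solves_ode2 (fuchs_P a M m n b) (fuchs_Q a M m n b \<mu>) y Z))"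


section \<open>Finite-gap potentials\<close>

text \<open>
  A differential polynomial is a polynomial over the complex numbers in the indeterminates
  \<open>u, u', u'', \<dots>\<close>: the monomial with exponent vector \<open>\<alpha>\<close> is the product over
  \<open>i\<close> of the \<open>i\<close>-th derivative of \<open>u\<close> to the power \<open>\<alpha>\<^sub>i\<close>.
\<close>

type_synonym diff_poly = "(nat \<Rightarrow>\<^sub>0 nat) \<Rightarrow>\<^sub>0 complex"

definition dp_var :: "nat \<Rightarrow> diff_poly" where
  "dp_var i = Poly_Mapping.single (Poly_Mapping.single i 1) 1"

text \<open>The derivation with \<open>dp_deriv (dp_var i) = dp_var (Suc i)\<close>.\<close>

definition dp_deriv :: "diff_poly \<Rightarrow> diff_poly" where
  "dp_deriv p =
     (\<Sum>\<alpha>\<in>Poly_Mapping.keys p. \<Sum>i\<in>Poly_Mapping.keys \<alpha>.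
        Poly_Mapping.single
          (\<alpha> - Poly_Mapping.single i 1 + Poly_Mapping.single (Suc i) 1)
          (of_nat (Poly_Mapping.lookup \<alpha> i) * Poly_Mapping.lookup p \<alpha>))"

definition dp_eval :: "diff_poly \<Rightarrow> (complex \<Rightarrow> complex) \<Rightarrow> complex \<Rightarrow> complex" where
  "dp_eval p u x =
     (\<Sum>\<alpha>\<in>Poly_Mapping.keys p. Poly_Mapping.lookup p \<alpha> *
        (\<Prod>i\<in>Poly_Mapping.keys \<alpha>. ((deriv ^^ i) u x) ^ Poly_Mapping.lookup \<alpha> i))"

text \<open>
  The recursion determines \<open>J (Suc n)\<close> up to an additive constant, which is normalised to give zero
  constant term, so that \<open>J 1\<close> is \<open>u'' - 3 u\<^sup>2\<close>. Other choices of the constants would change the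
  \<open>J n\<close> only by linear combinations of lower ones and constants.
\<close>

definition kdv_sequence :: "(nat \<Rightarrow> diff_poly) \<Rightarrow> bool" where
  "kdv_sequence J \<longleftrightarrow>
     J 0 = dp_var 0 \<and>
     (\<forall>n. dp_deriv (J (Suc n)) =
            (dp_deriv ^^ 3) (J n) - 4 * dp_var 0 * dp_deriv (J n) - 2 * dp_var 1 * J n \<and>
          Poly_Mapping.lookup (J (Suc n)) 0 = 0)"

text \<open>The identity is required at all points where \<open>u\<close> is analytic, i.e. away from its poles.\<close>

definition finite_gap_potential :: "(complex \<Rightarrow> complex) \<Rightarrow> bool" where
  "finite_gap_potential u \<longleftrightarrow>
     (\<exists>J. kdv_sequence J \<and>
       (\<exists>(g :: nat) (c :: nat \<Rightarrow> complex) (d :: complex). \<forall>x. u analytic_on {x} \<longrightarrow>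
          dp_eval (J g) u x + (\<Sum>i=1..g. c i * dp_eval (J (g - i)) u x) = d))"

definition finite_gap_fuchs ::
  "complex \<Rightarrow> complex \<Rightarrow> (nat \<Rightarrow> complex) \<Rightarrow>
   complex \<Rightarrow> nat \<Rightarrow> (nat \<Rightarrow> nat) \<Rightarrow> (nat \<Rightarrow> nat) \<Rightarrow> (nat \<Rightarrow> complex) \<Rightarrow> bool" where
  "finite_gap_fuchs \<omega>1 \<omega>3 \<delta> a M m n b \<longleftrightarrow>
     finite_gap_potential (elliptic_potential \<omega>1 \<omega>3 \<delta> M m n) \<and>
     (\<exists>C. \<forall>\<mu>. schroedinger_transforms_to_fuchs \<omega>1 \<omega>3 \<delta> a M m n b
        ((weierstrass_e \<omega>1 \<omega>3 1 - weierstrass_e \<omega>1 \<omega>3 2) * \<mu> + C) \<mu>)"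

end

theory Submission
  imports Defs "HOL-Complex_Analysis.Complex_Analysis"
begin

text \<open>
  Both sides of the equivalence are shown to express one local condition on the potential. At a pole \<open>p\<close>,
  the potential has an expansion \<open>u (p + t) = \<nu> (\<nu> + 1) / t\<^sup>2 + (\<Sum>i\<ge>0. U\<^sub>i * t ^ i)\<close>, and the condition is that
  \<open>U\<^sub>i = 0\<close> for all odd \<open>i < 2 \<nu> + 1\<close>. At the lattice points and the half-periods it holds by symmetry, and at \<open>- \<delta>\<^sub>k\<close>
  it is equivalent to the condition at \<open>\<delta>\<^sub>k\<close>, where \<open>\<nu> = n\<^sub>k\<close>.

  The potential is finite-gap iff the condition holds at every pole. On Laurent series, the recursion for the
  \<open>J\<^sub>n\<close> multiplies a coefficient by \<open>(i + 1) (i - 2 \<nu>) (i + 2 \<nu> + 2)\<close> and adds a convolution with the regular part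
  of \<open>u\<close>. Under the condition, the zeros of this factor keep all poles of order at most \<open>2 \<nu>\<close>
  (\<open>bounded_poles\<close>). The principal parts of the \<open>J\<^sub>n(u)\<close> then span a finite-dimensional space, and Liouville's
  theorem makes some linear combination constant (\<open>finite_gap_if_odd_coeffs_zero\<close>). If the condition fails and
  \<open>2 q - 1\<close> is the first odd index with a nonzero coefficient, tracking signs shows that every
  \<open>J\<^sub>g(u)\<close> has a nonzero coefficient to which the earlier members do not contribute, so that no linear relation is
  possible (\<open>unbounded_poles\<close>). The \<open>J\<^sub>n\<close> themselves exist as differential polynomials
  because they are the coefficients of a series satisfying a quadratic equation (\<open>gelfand_dikii_lenard\<close>).

  The point \<open>b\<^sub>k\<close> is a false singular point for all \<open>\<mu>\<close> iff the condition holds at \<open>\<delta>\<^sub>k\<close>. Near \<open>\<delta>\<^sub>k\<close> the function \<open>z\<close> is a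
  chart, and the gauge factor has the form \<open>H(z) (z - b\<^sub>k) powi (- n\<^sub>k)\<close> with \<open>H\<close> regular and nonvanishing. Hence \<open>b\<^sub>k\<close> is a
  false singular point iff \<open>\<psi>'' = (u + E) \<psi>\<close> has a Laurent solution starting with \<open>t powi (- n\<^sub>k)\<close>. The method of
  Frobenius produces one if the condition holds (\<open>formal_solution_exists\<close>). Conversely, the obstruction to such a
  solution is a polynomial in \<open>E\<close>; if the first odd index with a nonzero coefficient is \<open>2 q - 1\<close>, its leading
  coefficient, in degree \<open>n\<^sub>k - q\<close>, is a nonzero multiple of \<open>U\<^bsub>2 q - 1\<^esub>\<close>. It cannot vanish for every \<open>E\<close>
  (\<open>all_energies_imp_odd_coeffs_zero\<close>).

  The change of variables transforms the one equation into the other for every choice of the parameters. The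
  identities \<open>wp_ode\<close>, \<open>wp_shift_half_period\<close> and \<open>wp_pair\<close> turn the potential into a rational function of \<open>z\<close>, and
  \<open>rational_identity\<close>, a computation with partial fractions, matches the coefficients \<open>P\<close> and \<open>Q\<close>.
\<close>

section \<open>The period lattice\<close>

locale complex_lattice =
  fixes \<omega>1 \<omega>3 :: complex
  assumes omega1_nz: "\<omega>1 \<noteq> 0" and Im_nz: "Im (\<omega>3 / \<omega>1) \<noteq> 0"
begin

abbreviation "\<Lambda> \<equiv> period_lattice \<omega>1 \<omega>3"
abbreviation "wp \<equiv> weierstrass_p \<omega>1 \<omega>3"

definition lat :: "int \<times> int \<Rightarrow> complex" where
  "lat p = of_int (fst p) * (2 * \<omega>1) + of_int (snd p) * (2 * \<omega>3)"

lemma lattice_eq_range: "\<Lambda> = range lat"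
  unfolding period_lattice_def lat_def by (auto simp: image_iff) metis

lemma zero_in_lattice [simp]: "0 \<in> \<Lambda>"
  unfolding period_lattice_def by (force intro: exI[of _ "0::int"])

lemma lattice_add: "u \<in> \<Lambda> \<Longrightarrow> v \<in> \<Lambda> \<Longrightarrow> u + v \<in> \<Lambda>"
  unfolding period_lattice_def
  apply clarify
  subgoal for i i' j j'
    by (rule exI[of _ "i+i'"], rule exI[of _ "j+j'"]) (simp add: algebra_simps)
  done

lemma lattice_uminus: "u \<in> \<Lambda> \<Longrightarrow> - u \<in> \<Lambda>"
  unfolding period_lattice_def
  apply clarify
  subgoal for i j
    by (rule exI[of _ "-i"], rule exI[of _ "-j"]) (simp add: algebra_simps)
  done

lemma lattice_uminus_iff [simp]: "- u \<in> \<Lambda> \<longleftrightarrow> u \<in> \<Lambda>"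
  using lattice_uminus[of u] lattice_uminus[of "-u"] by auto

lemma lattice_diff: "u \<in> \<Lambda> \<Longrightarrow> v \<in> \<Lambda> \<Longrightarrow> u - v \<in> \<Lambda>"
  using lattice_add[of u "-v"] lattice_uminus[of v] by simp

lemma lattice_add_iff: "v \<in> \<Lambda> \<Longrightarrow> u + v \<in> \<Lambda> \<longleftrightarrow> u \<in> \<Lambda>"
  using lattice_add[of u v] lattice_diff[of "u + v" v] by auto

lemma lattice_diff_iff: "v \<in> \<Lambda> \<Longrightarrow> u - v \<in> \<Lambda> \<longleftrightarrow> u \<in> \<Lambda>"
  using lattice_add_iff[of "-v" u] lattice_uminus[of v] by simp

lemma two_omega1_in_lattice: "2 * \<omega>1 \<in> \<Lambda>"
  unfolding period_lattice_def by (rule CollectI, rule exI[of _ 1], rule exI[of _ 0]) simp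

lemma two_omega3_in_lattice: "2 * \<omega>3 \<in> \<Lambda>"
  unfolding period_lattice_def by (rule CollectI, rule exI[of _ 0], rule exI[of _ 1]) simp

text \<open>
  Quantitative form of the linear independence of the two periods over the reals.
\<close>
lemma norm_lattice_ge:
  obtains c where "c > 0"
    "\<And>x y :: real. c * \<bar>x\<bar> \<le> cmod (of_real x * (2 * \<omega>1) + of_real y * (2 * \<omega>3))"
    "\<And>x y :: real. c * \<bar>y\<bar> \<le> cmod (of_real x * (2 * \<omega>1) + of_real y * (2 * \<omega>3))"
proof -
  define \<tau> where "\<tau> = \<omega>3 / \<omega>1"
  define s where "s = \<bar>Im \<tau>\<bar>"
  have s: "s > 0" using Im_nz by (simp add: s_def \<tau>_def)
  define K where "K = 1 + (1 + cmod \<tau>) / s"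
  have K: "K > 0" using s by (auto simp: K_def intro!: add_pos_nonneg)
  have fac: "cmod (of_real x * (2 * \<omega>1) + of_real y * (2 * \<omega>3)) = 2 * cmod \<omega>1 * cmod (of_real x + of_real y * \<tau>)" for x y
  proof -
    have "of_real x * (2 * \<omega>1) + of_real y * (2 * \<omega>3) = (2 * \<omega>1) * (of_real x + of_real y * \<tau>)"
      using omega1_nz by (simp add: \<tau>_def field_simps)
    thus ?thesis by (simp add: norm_mult)
  qed
  have y: "\<bar>y\<bar> * s \<le> cmod (of_real x + of_real y * \<tau>)" for x y
    using abs_Im_le_cmod[of "of_real x + of_real y * \<tau>"] by (simp add: s_def abs_mult)
  have x: "\<bar>x\<bar> \<le> cmod (of_real x + of_real y * \<tau>) + \<bar>y\<bar> * cmod \<tau>" for x y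
    using norm_triangle_ineq4[of "of_real x + of_real y * \<tau>" "of_real y * \<tau>"]
    by (simp add: norm_mult)
  have ys: "\<bar>y\<bar> \<le> cmod (of_real x + of_real y * \<tau>) / s" for x y
    using y[of y x] s by (simp add: field_simps)
  show ?thesis
  proof (rule that[of "2 * cmod \<omega>1 / K"])
    show "2 * cmod \<omega>1 / K > 0" using K omega1_nz by simp
    fix x y :: real
    let ?N = "cmod (of_real x + of_real y * \<tau>)"
    have "\<bar>y\<bar> \<le> ?N / s" by (rule ys)
    also have "\<dots> \<le> ?N * K" using s by (simp add: K_def field_simps)
    finally have 1: "\<bar>y\<bar> \<le> ?N * K" .
    have "\<bar>x\<bar> \<le> ?N + ?N / s * cmod \<tau>"
      using x[of x y] ys[of y x] by (smt (verit) mult_right_mono norm_ge_zero)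
    also have "\<dots> \<le> ?N * K" using s by (simp add: K_def field_simps)
    finally have 2: "\<bar>x\<bar> \<le> ?N * K" .
    show "2 * cmod \<omega>1 / K * \<bar>x\<bar> \<le> cmod (of_real x * (2 * \<omega>1) + of_real y * (2 * \<omega>3))"
      unfolding fac using 2 K omega1_nz by (simp add: field_simps)
    show "2 * cmod \<omega>1 / K * \<bar>y\<bar> \<le> cmod (of_real x * (2 * \<omega>1) + of_real y * (2 * \<omega>3))"
      unfolding fac using 1 K omega1_nz by (simp add: field_simps)
  qed
qed

lemma lattice_independent:
  fixes x y :: real
  assumes "of_real x * (2 * \<omega>1) + of_real y * (2 * \<omega>3) = 0"
  shows "x = 0" "y = 0"
proof -
  obtain c where c: "c > 0" "\<And>x y :: real. c * \<bar>x\<bar> \<le> cmod (of_real x * (2 * \<omega>1) + of_real y * (2 * \<omega>3))"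
    "\<And>x y :: real. c * \<bar>y\<bar> \<le> cmod (of_real x * (2 * \<omega>1) + of_real y * (2 * \<omega>3))"
    using norm_lattice_ge by blast
  show "x = 0" using c(1) c(2)[of x y] assms by (simp add: mult_le_0_iff)
  show "y = 0" using c(1) c(3)[of y x] assms by (simp add: mult_le_0_iff)
qed

lemma norm_lat_ge:
  obtains c where "c > 0" "\<And>p. c * of_int (max \<bar>fst p\<bar> \<bar>snd p\<bar>) \<le> cmod (lat p)"
proof -
  obtain c where c: "c > 0" "\<And>x y :: real. c * \<bar>x\<bar> \<le> cmod (of_real x * (2 * \<omega>1) + of_real y * (2 * \<omega>3))"
    "\<And>x y :: real. c * \<bar>y\<bar> \<le> cmod (of_real x * (2 * \<omega>1) + of_real y * (2 * \<omega>3))"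
    using norm_lattice_ge by blast
  show ?thesis
  proof (rule that[OF c(1)])
    fix p :: "int \<times> int"
    show "c * of_int (max \<bar>fst p\<bar> \<bar>snd p\<bar>) \<le> cmod (lat p)"
      using c(2)[of "of_int (fst p)" "of_int (snd p)"] c(3)[of "of_int (snd p)" "of_int (fst p)"]
      by (auto simp: lat_def max_def)
  qed
qed

lemma inj_lat: "inj lat"
proof (rule injI)
  fix p q assume eq: "lat p = lat q"
  have "of_real (of_int (fst p - fst q)) * (2 * \<omega>1) + of_real (of_int (snd p - snd q)) * (2 * \<omega>3) = 0"
    using eq by (simp add: lat_def algebra_simps)
  from lattice_independent[OF this] show "p = q" by (auto simp: prod_eq_iff)
qed

lemma lat_0 [simp]: "lat (0, 0) = 0" by (simp add: lat_def)

lemma lattice_minus_0: "\<Lambda> - {0} = lat ` (UNIV - {(0,0)})"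
  unfolding lattice_eq_range using inj_lat
  by (subst image_set_diff) (auto simp del: lat_0 simp: lat_0[symmetric])

lemma finite_lattice_Int_cball: "finite (\<Lambda> \<inter> cball 0 R)"
proof -
  obtain c where c: "c > 0" "\<And>p. c * of_int (max \<bar>fst p\<bar> \<bar>snd p\<bar>) \<le> cmod (lat p)"
    using norm_lat_ge by blast
  define m where "m = \<lceil>R / c\<rceil>"
  have "\<Lambda> \<inter> cball 0 R \<subseteq> lat ` ({-m..m} \<times> {-m..m})"
  proof
    fix w assume w: "w \<in> \<Lambda> \<inter> cball 0 R"
    then obtain p where p: "w = lat p" by (auto simp: lattice_eq_range)
    have "c * of_int (max \<bar>fst p\<bar> \<bar>snd p\<bar>) \<le> R" using c(2)[of p] w p by auto
    hence "of_int (max \<bar>fst p\<bar> \<bar>snd p\<bar>) \<le> R / c" using c(1) by (simp add: field_simps)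
    hence "max \<bar>fst p\<bar> \<bar>snd p\<bar> \<le> m" unfolding m_def using le_ceiling_iff
      by (smt (verit, best) ceiling_mono ceiling_of_int)
    thus "w \<in> lat ` ({-m..m} \<times> {-m..m})"
      using p by (intro image_eqI[of _ _ p]) (auto simp: mem_Times_iff)
  qed
  thus ?thesis by (rule finite_subset) auto
qed

lemma lattice_discrete:
  obtains r where "r > 0" "\<And>w. w \<in> \<Lambda> \<Longrightarrow> dist w p < r \<Longrightarrow> w = p"
proof -
  have "finite ((\<Lambda> \<inter> cball 0 (cmod p + 1)) - {p})" using finite_lattice_Int_cball by auto
  then obtain d where d: "d > 0" "\<And>w. w \<in> (\<Lambda> \<inter> cball 0 (cmod p + 1)) - {p} \<Longrightarrow> d \<le> dist p w"
    using finite_set_avoid[of "(\<Lambda> \<inter> cball 0 (cmod p + 1)) - {p}" p] by blast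
  show ?thesis
  proof (rule that[of "min d 1"])
    fix w assume w: "w \<in> \<Lambda>" "dist w p < min d 1"
    have "cmod w \<le> cmod p + 1" using w(2) norm_triangle_ineq2[of w p] by (simp add: dist_norm)
    thus "w = p" using d(2)[of w] w by (force simp: dist_commute)
  qed (use d in auto)
qed

lemma summable_on_int_powr:
  "(\<lambda>i::int. (1 + \<bar>of_int i\<bar>) powr (-3/2) :: real) summable_on UNIV"
proof -
  have "summable (\<lambda>n. real (Suc n) powr (-3/2))"
    using summable_Suc_iff[of "\<lambda>n. real n powr (-3/2)"] by (simp only: summable_real_powr_iff)
  hence nat: "(\<lambda>n::nat. (1 + real n) powr (-3/2)) summable_on UNIV"
    by (subst summable_on_UNIV_nonneg_real_iff) (simp_all add: algebra_simps)
  have 1: "(\<lambda>i::int. (1 + \<bar>of_int i\<bar>) powr (-3/2) :: real) summable_on range int"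
    by (subst summable_on_reindex) (use nat in \<open>auto simp: o_def\<close>)
  have 2: "(\<lambda>i::int. (1 + \<bar>of_int i\<bar>) powr (-3/2) :: real) summable_on range (\<lambda>n. - int n)"
    by (subst summable_on_reindex) (use nat in \<open>auto simp: o_def inj_def\<close>)
  have "i \<in> range int \<union> range (\<lambda>n. - int n)" for i :: int
    by (cases "i \<ge> 0") (auto intro: range_eqI[of _ _ "nat i"] range_eqI[of _ _ "nat (-i)"])
  hence "(UNIV::int set) = range int \<union> range (\<lambda>n. - int n)" by blast
  moreover have "(\<lambda>i::int. (1 + \<bar>of_int i\<bar>) powr (-3/2) :: real) summable_on (range int \<union> range (\<lambda>n. - int n))"
    using 1 2 summable_on_union by blast
  ultimately show ?thesis by metis
qed

text \<open>
  Up to a constant, \<open>max \<bar>i\<bar> \<bar>j\<bar>\<close> to the power \<open>-3\<close> is at most the product of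
  \<open>(1 + \<bar>i\<bar>) powr (-3/2)\<close> and \<open>(1 + \<bar>j\<bar>) powr (-3/2)\<close>, so the sum over the lattice is dominated by a
  product of two convergent one-dimensional sums.
\<close>
lemma summable_on_lattice_cube: "(\<lambda>w. 1 / cmod w ^ 3) summable_on (\<Lambda> - {0})"
proof -
  obtain c where c: "c > 0" "\<And>p. c * of_int (max \<bar>fst p\<bar> \<bar>snd p\<bar>) \<le> cmod (lat p)"
    using norm_lat_ge by blast
  define g where "g = (\<lambda>i::int. (1 + \<bar>of_int i\<bar>) powr (-3/2) :: real)"
  have g: "g summable_on UNIV" unfolding g_def by (rule summable_on_int_powr)
  have g0: "g i \<ge> 0" for i by (simp add: g_def)
  have "(\<lambda>p. norm (g (fst p) * g (snd p))) summable_on (UNIV \<times> UNIV)"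
    unfolding Infinite_Sum.abs_summable_on_Sigma_iff
  proof
    show "\<forall>x\<in>UNIV. (\<lambda>y. norm (g (fst (x, y)) * g (snd (x, y)))) summable_on UNIV"
      using g g0 by (auto simp: abs_mult intro!: summable_on_cmult_right)
    have "(\<lambda>x. infsum (\<lambda>y. norm (g (fst (x, y)) * g (snd (x, y)))) UNIV) = (\<lambda>x. g x * infsum g UNIV)"
      using g0 by (auto simp: infsum_cmult_right' abs_mult)
    thus "(\<lambda>x. norm (\<Sum>\<^sub>\<infinity>y. norm (g (fst (x, y)) * g (snd (x, y))))) summable_on UNIV"
      using g g0 by (auto simp: abs_mult infsum_nonneg intro!: summable_on_cmult_left)
  qed
  hence "(\<lambda>p. (8 / c^3) * norm (g (fst p) * g (snd p))) summable_on UNIV"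
    by (intro summable_on_cmult_right) simp
  hence "(\<lambda>p. (8 / c^3) * norm (g (fst p) * g (snd p))) summable_on (UNIV - {(0,0)})"
    by (rule summable_on_subset_banach) auto
  hence "(\<lambda>p. 1 / cmod (lat p) ^ 3) summable_on (UNIV - {(0,0)})"
  proof (rule summable_on_comparison_test)
    fix p :: "int \<times> int" assume p: "p \<in> UNIV - {(0,0)}"
    define m :: real where "m = of_int (max \<bar>fst p\<bar> \<bar>snd p\<bar>)"
    have m1: "m \<ge> 1" unfolding m_def using p by (cases p) (auto simp: max_def)
    have le: "1 + \<bar>of_int (fst p)\<bar> \<le> 2 * m" "1 + \<bar>of_int (snd p)\<bar> \<le> 2 * m"
      using m1 by (auto simp: m_def)
    have ge: "g i \<ge> (2 * m) powr (-3/2)" if "1 + \<bar>of_int i\<bar> \<le> 2 * m" for i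
      unfolding g_def using that by (intro powr_mono2') auto
    have "(2 * m) powr (-3/2) * (2 * m) powr (-3/2) \<le> g (fst p) * g (snd p)"
      by (intro mult_mono ge le) (auto simp: g0)
    moreover have "(2 * m) powr (-3/2) * (2 * m) powr (-3/2) = 1 / (8 * m ^ 3)"
    proof -
      have "(2 * m) powr (-3/2) * (2 * m) powr (-3/2) = (2 * m) powr (- 3)"
        by (simp flip: powr_add)
      also have "\<dots> = 1 / ((2 * m) ^ 3)"
        using m1 by (simp add: powr_minus powr_numeral field_simps)
      finally show ?thesis by (simp add: power_mult_distrib)
    qed
    ultimately have "1 / (8 * m ^ 3) \<le> g (fst p) * g (snd p)" by simp
    hence "8 / c ^ 3 * (1 / (8 * m ^ 3)) \<le> 8 / c ^ 3 * (g (fst p) * g (snd p))"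
      using c(1) by (intro mult_left_mono) auto
    hence 1: "1 / (c * m) ^ 3 \<le> 8 / c ^ 3 * (g (fst p) * g (snd p))"
      by (simp add: power_mult_distrib)
    have cm: "0 < c * m" "c * m \<le> cmod (lat p)" using c(1) c(2)[of p] m1 by (auto simp: m_def)
    have "1 / cmod (lat p) ^ 3 \<le> 1 / (c * m) ^ 3"
      using cm less_le_trans[OF cm] by (intro divide_left_mono power_mono mult_pos_pos[OF zero_less_power zero_less_power]) auto
    with 1 g0 show "1 / cmod (lat p) ^ 3 \<le> 8 / c ^ 3 * norm (g (fst p) * g (snd p))"
      by (simp add: abs_mult)
  qed auto
  hence "(\<lambda>w. 1 / cmod w ^ 3) summable_on (lat ` (UNIV - {(0,0)}))"
    by (subst summable_on_reindex) (auto intro: inj_on_subset[OF inj_lat] simp: o_def)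
  thus ?thesis by (simp only: lattice_minus_0)
qed

end

section \<open>The Weierstrass function\<close>

lemma analytic_at_shift:
  assumes "f analytic_on {p + v :: complex}"
  shows "(\<lambda>x. f (x + v)) analytic_on {p}"
proof -
  have "(\<lambda>x. x + v) analytic_on {p}" by (intro analytic_intros)
  from analytic_on_compose_gen[OF this assms] show ?thesis by (simp add: o_def)
qed

context complex_lattice begin

text \<open>
  The difference equals \<open>x (2 w - x) / (w\<^sup>2 (x - w)\<^sup>2)\<close>, which decays like the inverse cube of \<open>w\<close>,
  uniformly for \<open>x\<close> in a disc. This is what makes the defining sum converge absolutely and locally
  uniformly.
\<close>
lemma norm_wp_term_le:
  assumes "cmod x \<le> R" "cmod w > 2 * R"
  shows "cmod (1 / (x - w)\<^sup>2 - 1 / w\<^sup>2) \<le> 10 * R * (1 / cmod w ^ 3)"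
proof -
  have R: "R \<ge> 0" using assms(1) norm_ge_zero[of x] by linarith
  have w: "cmod w > 0" using assms R by linarith
  have xw: "cmod (x - w) \<ge> cmod w / 2" 
    using norm_triangle_ineq2[of w x] assms by (simp add: norm_minus_commute)
  hence nz: "x - w \<noteq> 0" "w \<noteq> 0" using w by auto
  have eq: "1 / (x - w)\<^sup>2 - 1 / w\<^sup>2 = x * (2 * w - x) / ((x - w)\<^sup>2 * w\<^sup>2)"
  proof -
    have "w\<^sup>2 - (x - w)\<^sup>2 = x * (2 * w - x)" by (simp add: power2_eq_square algebra_simps)
    thus ?thesis using nz by (subst diff_frac_eq) simp_all
  qed
  have le1: "cmod (2 * w - x) \<le> 5 / 2 * cmod w"
    using norm_triangle_ineq4[of "2 * w" x] assms by (simp add: norm_mult)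
  have "cmod (1 / (x - w)\<^sup>2 - 1 / w\<^sup>2) = cmod x * cmod (2 * w - x) / (cmod (x - w) ^ 2 * cmod w ^ 2)"
    unfolding eq by (simp add: norm_divide norm_mult norm_power)
  also have "\<dots> \<le> (R * (5 / 2 * cmod w)) / ((cmod w / 2)\<^sup>2 * cmod w ^ 2)"
    using assms w le1 xw R by (intro frac_le mult_mono mult_pos_pos zero_less_power power_mono mult_nonneg_nonneg) auto
  also have "\<dots> = 10 * R * (1 / cmod w ^ 3)"
    using w by (simp add: field_simps power2_eq_square power3_eq_cube)
  finally show ?thesis .
qed

lemma wp_tail_summable:
  assumes "cmod x \<le> R"
  shows "(\<lambda>w. 1 / (x - w)\<^sup>2 - 1 / w\<^sup>2) summable_on (\<Lambda> - cball 0 (2 * R))"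
proof -
  have R: "R \<ge> 0" using assms(1) norm_ge_zero[of x] by linarith
  have "(\<lambda>w. 10 * R * (1 / cmod w ^ 3)) summable_on (\<Lambda> - cball 0 (2 * R))"
    using summable_on_lattice_cube R
    by (intro summable_on_cmult_right summable_on_subset_banach[OF summable_on_lattice_cube]) auto
  hence "(\<lambda>w. norm (1 / (x - w)\<^sup>2 - 1 / w\<^sup>2)) summable_on (\<Lambda> - cball 0 (2 * R))"
    by (rule Infinite_Sum.abs_summable_on_comparison_test') (use norm_wp_term_le[OF assms] in auto)
  thus ?thesis by (rule abs_summable_summable)
qed

lemma lattice_split:
  assumes "R \<ge> 0"
  shows "\<Lambda> - {0} = (\<Lambda> - cball 0 R) \<union> (\<Lambda> \<inter> cball 0 R - {0})"
    "(\<Lambda> - cball 0 R) \<inter> (\<Lambda> \<inter> cball 0 R - {0}) = {}"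
  using assms by auto

lemma wp_summable: "(\<lambda>w. 1 / (x - w)\<^sup>2 - 1 / w\<^sup>2) summable_on (\<Lambda> - {0})"
proof -
  have "(\<lambda>w. 1 / (x - w)\<^sup>2 - 1 / w\<^sup>2) summable_on (\<Lambda> \<inter> cball 0 (2 * cmod x) - {0})"
    by (intro summable_on_finite finite_Diff finite_lattice_Int_cball)
  thus ?thesis
    using lattice_split[of "2 * cmod x"] wp_tail_summable[of x "cmod x"] by (simp add: summable_on_Un_disjoint)
qed

text \<open>
  Only finitely many summands have a pole near the disc; the others form a uniform limit of
  holomorphic functions.
\<close>
lemma wp_local_form:
  assumes "R > 0"
  obtains h where "h holomorphic_on ball 0 R"
    "\<And>x. x \<in> ball 0 R \<Longrightarrow> wp x = (\<Sum>w\<in>\<Lambda> \<inter> cball 0 (2 * R). 1 / (x - w)\<^sup>2) + h x"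
proof -
  define T where "T = \<Lambda> - cball 0 (2 * R)"
  define F where "F = \<Lambda> \<inter> cball 0 (2 * R) - {0}"
  define g where "g = (\<lambda>x. \<Sum>\<^sub>\<infinity>w\<in>T. 1 / (x - w)\<^sup>2 - 1 / w\<^sup>2)"
  have finF: "finite F" unfolding F_def by (intro finite_Diff finite_lattice_Int_cball)
  have "(\<lambda>w. 10 * R * (1 / cmod w ^ 3)) summable_on T"
    unfolding T_def using assms
    by (intro summable_on_cmult_right summable_on_subset_banach[OF summable_on_lattice_cube]) auto
  hence ul: "uniform_limit (cball 0 R) (\<lambda>X x. \<Sum>w\<in>X. 1 / (x - w)\<^sup>2 - 1 / w\<^sup>2) g (finite_subsets_at_top T)"
    unfolding g_def by (intro Weierstrass_m_test_general[OF norm_wp_term_le]) (auto simp: T_def)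
  have hol: "(\<lambda>x. \<Sum>w\<in>X. 1 / (x - w)\<^sup>2 - 1 / w\<^sup>2) holomorphic_on cball 0 R" if "X \<subseteq> T" for X
    using that assms by (intro holomorphic_intros) (force simp: T_def)+
  have "g holomorphic_on ball 0 R"
  proof (rule holomorphic_uniform_limit[OF _ ul])
    show "\<forall>\<^sub>F X in finite_subsets_at_top T.
       continuous_on (cball 0 R) (\<lambda>x. \<Sum>w\<in>X. 1 / (x - w)\<^sup>2 - 1 / w\<^sup>2) \<and>
       (\<lambda>x. \<Sum>w\<in>X. 1 / (x - w)\<^sup>2 - 1 / w\<^sup>2) holomorphic_on ball 0 R"
      using hol by (intro eventually_finite_subsets_at_top_weakI conjI holomorphic_on_imp_continuous_on)
         (auto intro: holomorphic_on_subset[OF _ ball_subset_cball])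
  qed auto
  hence "(\<lambda>x. g x - (\<Sum>w\<in>F. 1 / w\<^sup>2)) holomorphic_on ball 0 R"
    by (intro holomorphic_intros)
  moreover have "wp x = (\<Sum>w\<in>\<Lambda> \<inter> cball 0 (2 * R). 1 / (x - w)\<^sup>2) + (g x - (\<Sum>w\<in>F. 1 / w\<^sup>2))"
    if x: "x \<in> ball 0 R" for x
  proof -
    have "(\<Sum>\<^sub>\<infinity>w\<in>\<Lambda> - {0}. 1 / (x - w)\<^sup>2 - 1 / w\<^sup>2) = g x + (\<Sum>\<^sub>\<infinity>w\<in>F. 1 / (x - w)\<^sup>2 - 1 / w\<^sup>2)"
      unfolding g_def using assms x lattice_split[of "2 * R"] finF unfolding T_def F_def
      by (simp add: infsum_Un_disjoint wp_tail_summable)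
    also have "(\<Sum>\<^sub>\<infinity>w\<in>F. 1 / (x - w)\<^sup>2 - 1 / w\<^sup>2) = (\<Sum>w\<in>F. 1 / (x - w)\<^sup>2 - 1 / w\<^sup>2)"
      using finF by (rule infsum_finite)
    also have "\<dots> = (\<Sum>w\<in>F. 1 / (x - w)\<^sup>2) - (\<Sum>w\<in>F. 1 / w\<^sup>2)"
      by (rule sum_subtractf)
    finally have "wp x = 1 / (x - 0)\<^sup>2 + (\<Sum>w\<in>F. 1 / (x - w)\<^sup>2) + (g x - (\<Sum>w\<in>F. 1 / w\<^sup>2))"
      unfolding weierstrass_p_def by simp
    also have "1 / (x - 0)\<^sup>2 + (\<Sum>w\<in>F. 1 / (x - w)\<^sup>2) = (\<Sum>w\<in>insert 0 F. 1 / (x - w)\<^sup>2)"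
      using finF by (subst sum.insert) (auto simp: F_def)
    also have "insert 0 F = \<Lambda> \<inter> cball 0 (2 * R)" using assms by (auto simp: F_def)
    finally show ?thesis .
  qed
  ultimately show ?thesis by (rule that)
qed

lemma wp_principal_part:
  obtains H where "H analytic_on {p}"
    "eventually (\<lambda>x. wp x = (if p \<in> \<Lambda> then 1 / (x - p)\<^sup>2 else 0) + H x) (nhds p)"
proof -
  define R where "R = cmod p + 1"
  have R: "R > 0" by (simp add: R_def add_nonneg_pos)
  obtain h where h: "h holomorphic_on ball 0 R"
    "\<And>x. x \<in> ball 0 R \<Longrightarrow> wp x = (\<Sum>w\<in>\<Lambda> \<inter> cball 0 (2 * R). 1 / (x - w)\<^sup>2) + h x"
    using wp_local_form[OF R] by blast
  define F where "F = \<Lambda> \<inter> cball 0 (2 * R)"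
  have finF: "finite F" unfolding F_def by (intro finite_lattice_Int_cball)
  have pR: "p \<in> ball 0 R" by (simp add: R_def)
  have ha: "h analytic_on {p}"
    using h(1) pR analytic_on_open analytic_on_subset by (metis empty_subsetI insert_subset open_ball)
  show ?thesis
  proof (rule that[of "\<lambda>x. (\<Sum>w\<in>F - {p}. 1 / (x - w)\<^sup>2) + h x"])
    show "(\<lambda>x. (\<Sum>w\<in>F - {p}. 1 / (x - w)\<^sup>2) + h x) analytic_on {p}"
      by (intro analytic_intros ha) auto
    have "eventually (\<lambda>x. x \<in> ball 0 R) (nhds p)" using pR by (intro eventually_nhds_in_open) auto
    thus "eventually (\<lambda>x. wp x = (if p \<in> \<Lambda> then 1 / (x - p)\<^sup>2 else 0) + ((\<Sum>w\<in>F - {p}. 1 / (x - w)\<^sup>2) + h x)) (nhds p)"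
    proof eventually_elim
      case (elim x)
      have "(\<Sum>w\<in>F. 1 / (x - w)\<^sup>2) = (if p \<in> \<Lambda> then 1 / (x - p)\<^sup>2 else 0) + (\<Sum>w\<in>F - {p}. 1 / (x - w)\<^sup>2)"
      proof (cases "p \<in> F")
        case True
        thus ?thesis using finF by (simp add: sum.remove F_def)
      next
        case False
        hence "p \<notin> \<Lambda>" using pR R by (auto simp: F_def)
        thus ?thesis using False by simp
      qed
      thus ?case using h(2)[OF elim] by (simp add: F_def)
    qed
  qed
qed

lemma wp_analytic [analytic_intros]:
  assumes "p \<notin> \<Lambda>"
  shows "wp analytic_on {p}"
proof -
  obtain H where H: "H analytic_on {p}"
    "eventually (\<lambda>x. wp x = (if p \<in> \<Lambda> then 1 / (x - p)\<^sup>2 else 0) + H x) (nhds p)"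
    using wp_principal_part by blast
  show ?thesis using assms H by (subst analytic_at_cong[of _ H]) auto
qed

lemma wp_even: "wp (- x) = wp x"
proof -
  have "(\<Sum>\<^sub>\<infinity>w\<in>\<Lambda> - {0}. 1 / (- x - w)\<^sup>2 - 1 / w\<^sup>2) = (\<Sum>\<^sub>\<infinity>w\<in>\<Lambda> - {0}. 1 / (x - w)\<^sup>2 - 1 / w\<^sup>2)"
  proof -
    have "bij_betw uminus (\<Lambda> - {0}) (\<Lambda> - {0})"
      by (rule bij_betwI[of _ _ _ uminus]) auto
    from infsum_reindex_bij_betw[OF this, of "\<lambda>w. 1 / (x - w)\<^sup>2 - 1 / w\<^sup>2"]
    have "(\<Sum>\<^sub>\<infinity>w\<in>\<Lambda> - {0}. 1 / (x - w)\<^sup>2 - 1 / w\<^sup>2) = (\<Sum>\<^sub>\<infinity>w\<in>\<Lambda> - {0}. 1 / (x - - w)\<^sup>2 - 1 / (- w)\<^sup>2)"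
      by simp
    also have "\<dots> = (\<Sum>\<^sub>\<infinity>w\<in>\<Lambda> - {0}. 1 / (- x - w)\<^sup>2 - 1 / w\<^sup>2)"
      by (intro infsum_cong) (simp add: power2_eq_square algebra_simps)
    finally show ?thesis by simp
  qed
  thus ?thesis by (simp add: weierstrass_p_def)
qed

lemma complex_lattice_coords:
  obtains \<alpha> \<beta> :: real where "x = of_real \<alpha> * (2 * \<omega>1) + of_real \<beta> * (2 * \<omega>3)"
proof -
  define \<tau> where "\<tau> = \<omega>3 / \<omega>1"
  define y where "y = x / (2 * \<omega>1)"
  define \<beta> where "\<beta> = Im y / Im \<tau>"
  define \<alpha> where "\<alpha> = Re y - \<beta> * Re \<tau>"
  have "Im \<tau> \<noteq> 0" using Im_nz by (simp add: \<tau>_def)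
  hence "y = of_real \<alpha> + of_real \<beta> * \<tau>" by (simp add: complex_eq_iff \<alpha>_def \<beta>_def)
  hence "x = (2 * \<omega>1) * (of_real \<alpha> + of_real \<beta> * \<tau>)" using omega1_nz by (simp add: y_def field_simps)
  also have "\<dots> = of_real \<alpha> * (2 * \<omega>1) + of_real \<beta> * (2 * \<omega>3)"
    using omega1_nz by (simp add: \<tau>_def field_simps)
  finally show ?thesis by (rule that)
qed

lemma lattice_fundamental_cell:
  obtains w y where "w \<in> \<Lambda>" "x = y + w" "cmod y \<le> 2 * cmod \<omega>1 + 2 * cmod \<omega>3"
proof -
  obtain \<alpha> \<beta> :: real where x: "x = of_real \<alpha> * (2 * \<omega>1) + of_real \<beta> * (2 * \<omega>3)"
    using complex_lattice_coords by blast
  define w where "w = of_int \<lfloor>\<alpha>\<rfloor> * (2 * \<omega>1) + of_int \<lfloor>\<beta>\<rfloor> * (2 * \<omega>3)"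
  define y where "y = of_real (frac \<alpha>) * (2 * \<omega>1) + of_real (frac \<beta>) * (2 * \<omega>3)"
  show ?thesis
  proof (rule that)
    show "w \<in> \<Lambda>" by (auto simp: w_def period_lattice_def)
    show "x = y + w" unfolding x y_def w_def frac_def by (simp add: algebra_simps)
    have "cmod y \<le> frac \<alpha> * (2 * cmod \<omega>1) + frac \<beta> * (2 * cmod \<omega>3)"
      unfolding y_def by (rule order_trans[OF norm_triangle_ineq]) (simp add: norm_mult)
    also have "\<dots> \<le> 1 * (2 * cmod \<omega>1) + 1 * (2 * cmod \<omega>3)"
      by (intro add_mono mult_right_mono) (auto simp: frac_lt_1 less_imp_le)
    finally show "cmod y \<le> 2 * cmod \<omega>1 + 2 * cmod \<omega>3" by simp
  qed
qed

text \<open>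
  Liouville's theorem: once the singularities are removed, the function is entire and takes all its
  values on a bounded fundamental region. The hypotheses concern punctured neighbourhoods because the
  functions to which the lemma is applied, such as combinations of \<open>wp\<close>, have meaningless values at their
  singularities.
\<close>
lemma elliptic_without_poles_const:
  assumes loc: "\<And>p. \<exists>H. H analytic_on {p} \<and> eventually (\<lambda>x. f x = H x) (at p)"
    and per: "\<And>p v. v \<in> \<Lambda> \<Longrightarrow> eventually (\<lambda>x. f (x + v) = f x) (at p)"
  obtains c where "\<And>p. eventually (\<lambda>x. f x = c) (at p)" "\<And>p. f analytic_on {p} \<Longrightarrow> f p = c"
proof -
  define g where "g = remove_sings f"
  have lim: "f \<midarrow>p\<rightarrow> g p" and gan: "g analytic_on {p}" and gf: "eventually (\<lambda>x. g x = f x) (at p)" for p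
  proof -
    obtain H where H: "H analytic_on {p}" "eventually (\<lambda>x. f x = H x) (at p)" using loc by blast
    have "H \<midarrow>p\<rightarrow> H p" using H(1) analytic_at_imp_isCont isContD by blast
    hence 1: "f \<midarrow>p\<rightarrow> H p" using H(2) by (simp cong: filterlim_cong)
    hence "g p = H p" unfolding g_def by (rule remove_sings_eqI)
    with 1 show "f \<midarrow>p\<rightarrow> g p" by simp
    have "isolated_singularity_at H p" using H(1) by (simp add: isolated_singularity_at_analytic)
    hence iso: "isolated_singularity_at f p" using H(2) isolated_singularity_at_cong by blast
    show "g analytic_on {p}" unfolding g_def by (rule remove_sings_analytic_at[OF iso 1])
    show "eventually (\<lambda>x. g x = f x) (at p)" unfolding g_def by (rule eventually_remove_sings_eq_at[OF iso])
  qed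
  have "g analytic_on UNIV" using gan by (subst analytic_on_analytic_at) auto
  hence hol: "g holomorphic_on UNIV" using analytic_imp_holomorphic by blast
  have gper: "g (p + v) = g p" if "v \<in> \<Lambda>" for p v
  proof -
    have "((\<lambda>x. f (x + v)) \<longlongrightarrow> g (p + v)) (at p)"
      using LIM_offset[OF lim[of "p + v"], of v] by simp
    moreover have "((\<lambda>x. f (x + v)) \<longlongrightarrow> g p) (at p)"
      by (subst tendsto_cong[OF per[OF that]]) (rule lim)
    ultimately show ?thesis by (rule tendsto_unique[OF trivial_limit_at])
  qed
  let ?B = "cball 0 (2 * cmod \<omega>1 + 2 * cmod \<omega>3)"
  have "compact (g ` ?B)"
    by (intro compact_continuous_image holomorphic_on_imp_continuous_on holomorphic_on_subset[OF hol]) auto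
  hence "bounded (g ` ?B)" by (rule compact_imp_bounded)
  moreover have "range g \<subseteq> g ` ?B"
  proof clarify
    fix x
    obtain w y where "w \<in> \<Lambda>" "x = y + w" "cmod y \<le> 2 * cmod \<omega>1 + 2 * cmod \<omega>3"
      using lattice_fundamental_cell by blast
    thus "g x \<in> g ` ?B" using gper[of w y] by auto
  qed
  ultimately have "bounded (range g)" by (rule bounded_subset)
  hence "g constant_on UNIV" using Liouville_theorem[OF hol] by blast
  then obtain c where c: "g x = c" for x unfolding constant_on_def by blast
  show ?thesis
  proof (rule that[of c])
    fix p show "eventually (\<lambda>x. f x = c) (at p)" using gf[of p] by (simp add: c eq_commute)
    assume "f analytic_on {p}"
    hence "g p = f p" unfolding g_def by simp
    thus "f p = c" by (simp add: c)
  qed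
qed

lemma eventually_not_in_lattice: "eventually (\<lambda>x. x \<notin> \<Lambda>) (at p)"
proof -
  obtain r where r: "r > 0" "\<And>w. w \<in> \<Lambda> \<Longrightarrow> dist w p < r \<Longrightarrow> w = p" using lattice_discrete by blast
  show ?thesis unfolding eventually_at using r by blast
qed

text \<open>
  The difference \<open>D x = wp (x + v) - wp x\<close> is a sum over the whole lattice, so that reindexing shows it to
  be periodic itself. Its poles cancel, hence it is constant, and \<open>D (- x - v) = - D x\<close> makes the constant
  zero.
\<close>
lemma wp_periodic:
  assumes v: "v \<in> \<Lambda>" and x: "x \<notin> \<Lambda>"
  shows "wp (x + v) = wp x"
proof -
  define t where "t = (\<lambda>x w. 1 / (x + v - w)\<^sup>2 - 1 / (x - w)\<^sup>2)"
  define S where "S = (\<lambda>x. \<Sum>\<^sub>\<infinity>w\<in>\<Lambda>. t x w)"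
  define D where "D = (\<lambda>x. wp (x + v) - wp x)"
  have DS: "D x = S x" for x
  proof -
    have eq: "t x = (\<lambda>w. (1 / (x + v - w)\<^sup>2 - 1 / w\<^sup>2) + - (1 / (x - w)\<^sup>2 - 1 / w\<^sup>2))" for x
      by (simp add: t_def)
    have um: "(\<lambda>w. - (1 / (x - w)\<^sup>2 - 1 / w\<^sup>2)) summable_on (\<Lambda> - {0})"
      using wp_summable[of x] by (subst summable_on_uminus)
    have sm: "t x summable_on (\<Lambda> - {0})"
      unfolding eq by (rule summable_on_add[OF wp_summable um])
    have "(\<Sum>\<^sub>\<infinity>w\<in>\<Lambda> - {0}. t x w) = 
       (\<Sum>\<^sub>\<infinity>w\<in>\<Lambda> - {0}. 1 / (x + v - w)\<^sup>2 - 1 / w\<^sup>2) + (\<Sum>\<^sub>\<infinity>w\<in>\<Lambda> - {0}. - (1 / (x - w)\<^sup>2 - 1 / w\<^sup>2))"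
      unfolding eq by (rule infsum_add[OF wp_summable um])
    also have "(\<Sum>\<^sub>\<infinity>w\<in>\<Lambda> - {0}. - (1 / (x - w)\<^sup>2 - 1 / w\<^sup>2)) = - (\<Sum>\<^sub>\<infinity>w\<in>\<Lambda> - {0}. 1 / (x - w)\<^sup>2 - 1 / w\<^sup>2)"
      by (rule infsum_uminus)
    finally have "(\<Sum>\<^sub>\<infinity>w\<in>\<Lambda> - {0}. t x w) = 
       (\<Sum>\<^sub>\<infinity>w\<in>\<Lambda> - {0}. 1 / (x + v - w)\<^sup>2 - 1 / w\<^sup>2) - (\<Sum>\<^sub>\<infinity>w\<in>\<Lambda> - {0}. 1 / (x - w)\<^sup>2 - 1 / w\<^sup>2)"
      by simp
    moreover have "S x = (\<Sum>\<^sub>\<infinity>w\<in>\<Lambda> - {0}. t x w) + t x 0"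
    proof -
      have "\<Lambda> = (\<Lambda> - {0}) \<union> {0}" by auto
      hence "S x = (\<Sum>\<^sub>\<infinity>w\<in>(\<Lambda> - {0}) \<union> {0}. t x w)" unfolding S_def by simp
      also have "\<dots> = (\<Sum>\<^sub>\<infinity>w\<in>\<Lambda> - {0}. t x w) + t x 0"
        using sm by (subst infsum_Un_disjoint) auto
      finally show ?thesis .
    qed
    ultimately show ?thesis by (simp add: D_def weierstrass_p_def t_def)
  qed
  have Sper: "S (x + u) = S x" if u: "u \<in> \<Lambda>" for u x
  proof -
    have "S (x + u) = (\<Sum>\<^sub>\<infinity>w\<in>\<Lambda>. t x (w - u))" unfolding S_def t_def by (simp add: algebra_simps)
    also have "\<dots> = S x" unfolding S_def
      by (rule infsum_reindex_bij_betw, rule bij_betwI[of _ _ _ "\<lambda>w. w + u"])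
         (use u in \<open>auto simp: lattice_add lattice_diff\<close>)
    finally show ?thesis .
  qed
  obtain c where c: "\<And>p. eventually (\<lambda>x. D x = c) (at p)" "\<And>p. D analytic_on {p} \<Longrightarrow> D p = c"
  proof (rule elliptic_without_poles_const)
    fix p
    obtain H1 where H1: "H1 analytic_on {p}"
      "eventually (\<lambda>x. wp x = (if p \<in> \<Lambda> then 1 / (x - p)\<^sup>2 else 0) + H1 x) (nhds p)"
      using wp_principal_part by blast
    obtain H2 where H2: "H2 analytic_on {p + v}"
      "eventually (\<lambda>x. wp x = (if p + v \<in> \<Lambda> then 1 / (x - (p + v))\<^sup>2 else 0) + H2 x) (nhds (p + v))"
      using wp_principal_part by blast
    have "eventually (\<lambda>x. wp (x + v) = (if p + v \<in> \<Lambda> then 1 / (x + v - (p + v))\<^sup>2 else 0) + H2 (x + v)) (nhds p)"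
      using H2(2) by (rule eventually_compose_filterlim) (intro tendsto_add filterlim_ident tendsto_const)
    with H1(2) have "eventually (\<lambda>x. D x = H2 (x + v) - H1 x) (nhds p)"
      by eventually_elim (auto simp: D_def lattice_add_iff[OF v])
    hence "eventually (\<lambda>x. D x = H2 (x + v) - H1 x) (at p)" 
      by (simp add: eventually_nhds_conv_at)
    moreover have "(\<lambda>x. H2 (x + v) - H1 x) analytic_on {p}"
      using H1(1) analytic_at_shift[OF H2(1)] by (intro analytic_on_diff)
    ultimately show "\<exists>H. H analytic_on {p} \<and> eventually (\<lambda>x. D x = H x) (at p)" by blast
    show "eventually (\<lambda>x. D (x + u) = D x) (at p)" if "u \<in> \<Lambda>" for u
      using that by (auto simp: DS Sper)
  qed (rule that)
  have anal: "D analytic_on {x}" if "x \<notin> \<Lambda>" for x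
    unfolding D_def using that lattice_add_iff[OF v]
    by (intro analytic_on_diff analytic_at_shift wp_analytic) auto
  have odd: "D (- x - v) = - D x" for x
    unfolding D_def using wp_even[of x] wp_even[of "x + v"] by simp
  have "- x - v \<notin> \<Lambda>" using x v by (metis lattice_diff_iff lattice_uminus_iff)
  hence "D (- x - v) = c" by (intro c(2) anal)
  moreover have "D x = c" by (intro c(2) anal x)
  ultimately have "c = - c" using odd[of x] by simp
  hence "c = 0" by simp
  thus ?thesis using \<open>D x = c\<close> by (simp add: D_def)
qed

end

section \<open>Laurent expansions\<close>

unbundle fps_syntax

lemma fls_times_nth_interval:
  fixes f g :: "'a :: comm_semiring_0 fls"
  assumes f: "\<And>i. i < r \<Longrightarrow> f $$ i = 0" and g: "\<And>i. i < s \<Longrightarrow> g $$ i = 0"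
  shows "(f * g) $$ k = (\<Sum>i=r..k - s. f $$ i * g $$ (k - i))"
proof (cases "f = 0 \<or> g = 0")
  case False
  have r: "r \<le> fls_subdegree f" using False f by (intro fls_subdegree_geI) auto
  have s: "s \<le> fls_subdegree g" using False g by (intro fls_subdegree_geI) auto
  have "(f * g) $$ k = (\<Sum>i=fls_subdegree f..k - fls_subdegree g. f $$ i * g $$ (k - i))"
    by (rule fls_times_nth)
  also have "\<dots> = (\<Sum>i=r..k - s. f $$ i * g $$ (k - i))"
    using r s by (intro sum.mono_neutral_left) auto
  finally show ?thesis .
qed auto

lemma fls_nth_sum: "(\<Sum>i\<in>A. f i) $$ k = (\<Sum>i\<in>A. f i $$ k :: 'a :: comm_monoid_add)"
  by (induction A rule: infinite_finite_induct) auto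

lemma fls_times_nth_below:
  fixes f g :: "'a :: comm_semiring_0 fls"
  assumes f: "\<And>i. i < r \<Longrightarrow> f $$ i = 0" and g: "\<And>i. i < s \<Longrightarrow> g $$ i = 0" and "k < r + s"
  shows "(f * g) $$ k = 0"
  using assms(3) by (subst fls_times_nth_interval[OF f g]) auto

lemma fls_times_nth_odd:
  fixes f g :: "'a :: comm_semiring_0 fls"
  assumes f: "\<And>i. odd i \<Longrightarrow> f $$ i = 0" and g: "\<And>i. odd i \<Longrightarrow> g $$ i = 0" and "odd k"
  shows "(f * g) $$ k = 0"
proof -
  have "(f * g) $$ k = (\<Sum>i=fls_subdegree f..k - fls_subdegree g. f $$ i * g $$ (k - i))"
    by (rule fls_times_nth)
  also have "\<dots> = 0"
  proof (intro sum.neutral ballI)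
    fix i show "f $$ i * g $$ (k - i) = 0"
      using f[of i] g[of "k - i"] \<open>odd k\<close> by (cases "odd i") auto
  qed
  finally show ?thesis .
qed

lemma analytic_has_laurent_expansion:
  assumes "f analytic_on {p}"
  obtains F where "(\<lambda>t. f (p + t)) has_laurent_expansion F"
    "\<And>i. i < 0 \<Longrightarrow> F $$ i = 0" "F $$ 0 = f p" "F $$ 1 = deriv f p"
proof (rule that)
  have A: "(\<lambda>x. f (p + x)) has_fps_expansion fps_expansion f p"
    by (rule analytic_at_imp_has_fps_expansion[OF assms])
  show "(\<lambda>x. f (p + x)) has_laurent_expansion fps_to_fls (fps_expansion f p)"
    by (rule has_laurent_expansion_fps[OF A])
  show "fps_to_fls (fps_expansion f p) $$ i = 0" if "i < 0" for i using that by simp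
  show "fps_to_fls (fps_expansion f p) $$ 0 = f p" by (simp add: fps_expansion_def)
  show "fps_to_fls (fps_expansion f p) $$ 1 = deriv f p" by (simp add: fps_expansion_def)
qed

lemma deriv_shift_fun: "deriv (\<lambda>t. f (p + t)) = (\<lambda>t. deriv f (p + t :: complex))"
proof
  fix t
  show "deriv (\<lambda>t. f (p + t)) t = deriv f (p + t)"
    using deriv_shift_0'[where f = "\<lambda>t. f (p + t)" and z = t] deriv_shift_0'[where f = f and z = "p + t"] by (simp add: o_def add.assoc)
qed

lemma has_laurent_expansion_deriv_shift:
  assumes "(\<lambda>t. f (p + t)) has_laurent_expansion F"
  shows "(\<lambda>t. deriv f (p + t)) has_laurent_expansion fls_deriv F"
  using has_laurent_expansion_deriv[OF assms] by (simp add: deriv_shift_fun)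

lemma laurent_regular_imp_analytic:
  assumes F: "(\<lambda>t. f (p + t)) has_laurent_expansion F" and reg: "\<And>i. i < 0 \<Longrightarrow> F $$ i = 0"
  obtains H where "H analytic_on {p}" "eventually (\<lambda>x. f x = H x) (at p)" "H p = F $$ 0"
proof -
  have sub: "fls_subdegree F \<ge> 0" using reg by (rule fls_subdegree_ge0I)
  have F': "F = fps_to_fls (fls_regpart F)" using sub by simp
  define h where "h = (\<lambda>z. if z = 0 then fps_nth (fls_regpart F) 0 else f (p + z))"
  have h: "h has_fps_expansion fls_regpart F"
    unfolding h_def by (rule has_fps_expansion_fps_to_fls) (use F F' in simp)
  hence "h analytic_on {0}" by (rule has_fps_expansion_imp_analytic_0)
  show ?thesis
  proof (rule that[of "\<lambda>x. h (x - p)"])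
    have "(\<lambda>x. x - p) analytic_on {p}" by (intro analytic_intros)
    moreover have "h analytic_on {p - p}" using \<open>h analytic_on {0}\<close> by simp
    ultimately show "(\<lambda>x. h (x - p)) analytic_on {p}"
      using analytic_on_compose_gen[of "\<lambda>x. x - p" "{p}" h "{p - p}"] by (simp add: o_def)
    show "eventually (\<lambda>x. f x = h (x - p)) (at p)"
      by (auto simp: h_def eventually_at_filter)
    show "h (p - p) = F $$ 0" by (simp add: h_def)
  qed
qed

lemma laurent_expansion_reflect:
  assumes F: "f has_laurent_expansion F" and G: "(\<lambda>x. f (- x)) has_laurent_expansion G" and i: "odd i"
  shows "G $$ i = - (F $$ i :: complex)"
proof -
  have X: "uminus has_laurent_expansion fps_to_fls (- fps_X :: complex fps)"
    using has_laurent_expansion_minus[OF has_laurent_expansion_fps_X] by (simp add: fls_X_conv_shift_1)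
  have "(f \<circ> uminus) has_laurent_expansion fls_compose_fps F (- fps_X)"
    by (rule has_laurent_expansion_compose[OF F X]) auto
  moreover have "(f \<circ> uminus) has_laurent_expansion G" using G by (simp add: o_def)
  ultimately have eq: "fls_compose_fps F (- fps_X) = G" by (rule has_laurent_expansion_unique)
  have "fls_nth (fls_compose_fps F (fps_const (-1) * fps_X)) i = F $$ i * (- 1) powi i"
    by (subst fls_nth_fls_compose_fps_linear) auto
  with eq have "G $$ i = F $$ i * (- 1) powi i" by (simp flip: fps_const_neg)
  moreover have "(- 1 :: complex) powi i = - 1" using i by (simp add: power_int_minus_left_odd)
  ultimately show ?thesis by simp
qed

lemma laurent_expansion_even:
  assumes F: "f has_laurent_expansion F" and even: "eventually (\<lambda>x. f (- x) = f x) (at 0)" and "odd i"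
  shows "F $$ i = (0 :: complex)"
proof -
  have "(\<lambda>x. f (- x)) has_laurent_expansion F" using F has_laurent_expansion_cong[OF even refl] by simp
  from laurent_expansion_reflect[OF F this \<open>odd i\<close>] show ?thesis by simp
qed

section \<open>Elliptic functions\<close>

context complex_lattice begin

lemma has_laurent_expansion_translate:
  assumes F: "(\<lambda>t. f (p + t)) has_laurent_expansion F" and per: "eventually (\<lambda>x. f (x + v) = f x) (at p)"
  shows "(\<lambda>t. f (p + v + t)) has_laurent_expansion F"
proof -
  have "eventually (\<lambda>t. f (p + v + t) = f (p + t)) (at 0)"
    using per by (simp add: eventually_at_to_0[of _ p] algebra_simps)
  thus ?thesis using F has_laurent_expansion_cong[of "\<lambda>t. f (p + v + t)" "\<lambda>t. f (p + t)" F F] by simp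
qed

lemma elliptic_regular_const:
  assumes loc: "\<And>p. \<exists>F. (\<lambda>t. f (p + t)) has_laurent_expansion F \<and> (\<forall>i<0. F $$ i = 0)"
    and per: "\<And>p v. v \<in> \<Lambda> \<Longrightarrow> eventually (\<lambda>x. f (x + v) = f x) (at p)"
  obtains c where "\<And>p. f analytic_on {p} \<Longrightarrow> f p = c"
proof (rule elliptic_without_poles_const[OF _ per])
  fix p
  obtain F where "(\<lambda>t. f (p + t)) has_laurent_expansion F" "\<And>i. i < 0 \<Longrightarrow> F $$ i = 0" using loc by blast
  from laurent_regular_imp_analytic[OF this] show "\<exists>H. H analytic_on {p} \<and> eventually (\<lambda>x. f x = H x) (at p)"
    by metis
qed (assumption, rule that, assumption)

lemma wp_laurent:
  obtains W where "(\<lambda>t. wp (p + t)) has_laurent_expansion W" "\<And>i. i < -2 \<Longrightarrow> W $$ i = 0"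
    "W $$ (-1) = 0" "W $$ (-2) = (if p \<in> \<Lambda> then 1 else 0)"
proof -
  obtain H where H: "H analytic_on {p}"
    "eventually (\<lambda>x. wp x = (if p \<in> \<Lambda> then 1 / (x - p)\<^sup>2 else 0) + H x) (nhds p)"
    using wp_principal_part by blast
  obtain F where F: "(\<lambda>t. H (p + t)) has_laurent_expansion F" "\<And>i. i < 0 \<Longrightarrow> F $$ i = 0"
    using analytic_has_laurent_expansion[OF H(1)] by blast
  define P :: "complex fls" where "P = (if p \<in> \<Lambda> then fls_X_intpow (-2) else 0)"
  have "(\<lambda>t::complex. t powi (-2)) has_laurent_expansion fls_X_intpow (-2)"
    using has_laurent_expansion_fps_X_power_int[of "-2"] by simp
  hence "(\<lambda>t. if p \<in> \<Lambda> then t powi (-2) else 0) has_laurent_expansion P"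
    by (auto simp: P_def)
  hence "(\<lambda>t. (if p \<in> \<Lambda> then t powi (-2) else 0) + H (p + t)) has_laurent_expansion P + F"
    by (intro laurent_expansion_intros F)
  moreover have "eventually (\<lambda>t. wp (p + t) = (if p \<in> \<Lambda> then t powi (-2) else 0) + H (p + t)) (at 0)"
  proof -
    have "eventually (\<lambda>x. wp x = (if p \<in> \<Lambda> then 1 / (x - p)\<^sup>2 else 0) + H x) (at p)"
      using H(2) by (simp add: eventually_nhds_conv_at)
    hence "eventually (\<lambda>t. wp (t + p) = (if p \<in> \<Lambda> then 1 / (t + p - p)\<^sup>2 else 0) + H (t + p)) (at 0)"
      by (subst (asm) eventually_at_to_0[of _ p])
    thus ?thesis by eventually_elim (auto simp: power_int_def add.commute field_simps)
  qed
  ultimately have "(\<lambda>t. wp (p + t)) has_laurent_expansion P + F"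
    using has_laurent_expansion_cong[of "\<lambda>t. wp (p + t)" "\<lambda>t. (if p \<in> \<Lambda> then t powi (-2) else 0) + H (p + t)" "P + F" "P + F"] by simp
  thus ?thesis by (rule that) (auto simp: P_def F)
qed

lemma wp_periodic_ev: "v \<in> \<Lambda> \<Longrightarrow> eventually (\<lambda>x. wp (x + v) = wp x) (at p)"
  using eventually_not_in_lattice[of p] by eventually_elim (rule wp_periodic)

lemma lattice_open_complement: "open (- \<Lambda>)"
proof (rule openI)
  fix p assume p: "p \<in> - \<Lambda>"
  obtain r where "r > 0" "\<And>w. w \<in> \<Lambda> \<Longrightarrow> dist w p < r \<Longrightarrow> w = p" using lattice_discrete by blast
  thus "\<exists>e>0. ball p e \<subseteq> - \<Lambda>" using p by (metis ComplD ComplI dist_commute mem_ball subsetI)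
qed

lemma deriv_wp_periodic:
  assumes v: "v \<in> \<Lambda>" and x: "x \<notin> \<Lambda>"
  shows "deriv wp (x + v) = deriv wp x"
proof -
  have "eventually (\<lambda>y. y \<in> - \<Lambda>) (nhds x)" using x lattice_open_complement by (intro eventually_nhds_in_open) auto
  hence "eventually (\<lambda>y. wp (y + v) = wp y) (nhds x)" by eventually_elim (use wp_periodic[OF v] in auto)
  hence "deriv (\<lambda>y. wp (y + v)) x = deriv wp x" by (intro deriv_cong_ev) auto
  moreover have "deriv (\<lambda>y. wp (y + v)) x = deriv wp (x + v)"
  proof -
    have "wp field_differentiable at (x + v)"
      using analytic_on_imp_differentiable_at[OF wp_analytic[of "x + v"]] x lattice_add_iff[OF v] by auto
    hence "(wp has_field_derivative deriv wp (x + v)) (at (x + v))" by (simp add: DERIV_deriv_iff_field_differentiable)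
    hence "((\<lambda>y. wp (y + v)) has_field_derivative deriv wp (x + v)) (at x)" by (simp add: DERIV_shift)
    thus ?thesis by (rule DERIV_imp_deriv)
  qed
  ultimately show ?thesis by simp
qed

lemma wp_DERIV: "x \<notin> \<Lambda> \<Longrightarrow> (wp has_field_derivative deriv wp x) (at x)"
  using analytic_on_imp_differentiable_at[OF wp_analytic[of x]] by (simp add: DERIV_deriv_iff_field_differentiable)

lemma deriv_wp_odd:
  assumes x: "x \<notin> \<Lambda>"
  shows "deriv wp (- x) = - deriv wp x"
proof -
  have "((\<lambda>y. wp (- y)) has_field_derivative deriv wp (- x) * (- 1)) (at x)"
    by (rule DERIV_chain2[OF wp_DERIV]) (use x in \<open>auto intro!: derivative_eq_intros\<close>)
  hence "(wp has_field_derivative - deriv wp (- x)) (at x)" by (simp add: wp_even)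
  from DERIV_unique[OF this wp_DERIV[OF x]] show ?thesis by (metis minus_minus)
qed

lemma deriv_wp_analytic: "x \<notin> \<Lambda> \<Longrightarrow> deriv wp analytic_on {x}"
  by (intro analytic_deriv wp_analytic)

abbreviation "hp \<equiv> half_period \<omega>1 \<omega>3"
abbreviation "we \<equiv> weierstrass_e \<omega>1 \<omega>3"

lemma of_real_coord_in_lattice:
  fixes \<alpha> \<beta> :: real
  assumes "of_real \<alpha> * (2 * \<omega>1) + of_real \<beta> * (2 * \<omega>3) \<in> \<Lambda>"
  shows "\<alpha> \<in> \<int>" "\<beta> \<in> \<int>"
proof -
  obtain i j where "of_real \<alpha> * (2 * \<omega>1) + of_real \<beta> * (2 * \<omega>3) = of_int i * (2 * \<omega>1) + of_int j * (2 * \<omega>3)"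
    using assms unfolding period_lattice_def by blast
  hence "of_real (\<alpha> - of_int i) * (2 * \<omega>1) + of_real (\<beta> - of_int j) * (2 * \<omega>3) = 0"
    by (simp add: algebra_simps)
  from lattice_independent[OF this] show "\<alpha> \<in> \<int>" "\<beta> \<in> \<int>" by auto
qed

lemma half_not_int: "(1/2::real) \<notin> \<int>"
proof
  assume "(1/2::real) \<in> \<int>"
  then obtain k :: int where "1/2 = real_of_int k" by (auto elim: Ints_cases)
  hence "1 = real_of_int (2 * k)" by simp
  hence "1 = 2 * k" by linarith
  thus False by presburger
qed

lemma half_period_notin_lattice: "hp i \<notin> \<Lambda>"
proof
  assume "hp i \<in> \<Lambda>"
  hence "of_real (if i = 1 \<or> i = 2 then 1/2 else 0) * (2 * \<omega>1) + of_real (if i = 1 then 0 else 1/2) * (2 * \<omega>3) \<in> \<Lambda>"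
    by (auto simp: half_period_def split: if_splits)
  from of_real_coord_in_lattice[OF this] half_not_int show False by (auto split: if_splits)
qed

lemma two_half_period: "2 * hp i \<in> \<Lambda>"
  using two_omega1_in_lattice two_omega3_in_lattice lattice_add[OF two_omega1_in_lattice two_omega3_in_lattice]
  by (auto simp: half_period_def algebra_simps)

lemma half_lattice_cases:
  assumes "2 * x \<in> \<Lambda>"
  shows "x \<in> \<Lambda> \<or> (\<exists>i\<in>{1,2,3}. x - hp i \<in> \<Lambda>)"
proof -
  obtain i j :: int where ij: "2 * x = of_int i * (2 * \<omega>1) + of_int j * (2 * \<omega>3)"
    using assms unfolding period_lattice_def by blast
  hence "2 * x = 2 * (of_int i * \<omega>1 + of_int j * \<omega>3)" by (simp add: algebra_simps)
  hence x: "x = of_int i * \<omega>1 + of_int j * \<omega>3" by (subst (asm) mult_left_cancel) simp_all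
  have lat: "of_int k * (2 * \<omega>1) + of_int l * (2 * \<omega>3) \<in> \<Lambda>" for k l unfolding period_lattice_def by blast
  consider "even i" "even j" | "odd i" "even j" | "even i" "odd j" | "odd i" "odd j" by blast
  thus ?thesis
  proof cases
    case 1
    then obtain k l where "i = 2 * k" "j = 2 * l" by (auto elim!: evenE)
    hence "x = of_int k * (2 * \<omega>1) + of_int l * (2 * \<omega>3)" using x by simp
    thus ?thesis using lat by metis
  next
    case 2
    then obtain k l where "i = 2 * k + 1" "j = 2 * l" by (auto elim!: evenE oddE)
    hence "x - hp 1 = of_int k * (2 * \<omega>1) + of_int l * (2 * \<omega>3)" using x by (simp add: half_period_def algebra_simps)
    thus ?thesis using lat by (metis insertI1)
  next
    case 3
    then obtain k l where "i = 2 * k" "j = 2 * l + 1" by (auto elim!: evenE oddE)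
    hence "x - hp 3 = of_int k * (2 * \<omega>1) + of_int l * (2 * \<omega>3)" using x by (simp add: half_period_def algebra_simps)
    thus ?thesis using lat by (metis insertI1 insertI2)
  next
    case 4
    then obtain k l where "i = 2 * k + 1" "j = 2 * l + 1" by (auto elim!: oddE)
    hence "x - hp 2 = of_int k * (2 * \<omega>1) + of_int l * (2 * \<omega>3)" using x by (simp add: half_period_def algebra_simps)
    thus ?thesis using lat by (metis insertI1 insertI2)
  qed
qed

text \<open>
  The derivative is odd and periodic, and a half-period is congruent to its negative.
\<close>
lemma deriv_wp_half_period: "deriv wp (hp i) = 0"
proof -
  have "deriv wp (- hp i + 2 * hp i) = deriv wp (- hp i)"
    by (rule deriv_wp_periodic[OF two_half_period]) (use half_period_notin_lattice in auto)
  also have "\<dots> = - deriv wp (hp i)" by (rule deriv_wp_odd[OF half_period_notin_lattice])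
  finally show ?thesis by simp
qed

lemma wp_cong_lattice:
  assumes "x - y \<in> \<Lambda>" "y \<notin> \<Lambda>"
  shows "wp x = wp y"
  using wp_periodic[OF assms] by simp

text \<open>
  Evenness leaves only the coefficients of index \<open>-4\<close> and \<open>-2\<close> in the principal part at the lattice
  points. Subtracting multiples of \<open>wp\<^sup>2\<close> and \<open>wp\<close> removes them, and what remains has no poles.
\<close>
lemma even_elliptic_order_four:
  assumes F0: "f has_laurent_expansion F" "\<And>i. i < -4 \<Longrightarrow> F $$ i = 0"
    and even: "eventually (\<lambda>x. f (- x) = f x) (at 0)"
    and per: "\<And>p v. v \<in> \<Lambda> \<Longrightarrow> eventually (\<lambda>x. f (x + v) = f x) (at p)"
    and reg: "\<And>p. p \<notin> \<Lambda> \<Longrightarrow> \<exists>F. (\<lambda>t. f (p + t)) has_laurent_expansion F \<and> (\<forall>i<0. F $$ i = 0)"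
  obtains A B C where "\<And>x. x \<notin> \<Lambda> \<Longrightarrow> f analytic_on {x} \<Longrightarrow> f x = A * (wp x)\<^sup>2 + B * wp x + C"
proof -
  obtain W where W: "wp has_laurent_expansion W" "\<And>i. i < -2 \<Longrightarrow> W $$ i = 0" "W $$ (-1) = 0" "W $$ (-2) = 1"
    using wp_laurent[of 0] by auto
  have Fodd: "F $$ i = 0" if "odd i" for i using laurent_expansion_even[OF F0(1) _ that] even by simp
  have Wodd: "W $$ i = 0" if "odd i" for i using laurent_expansion_even[OF W(1) _ that] wp_even by simp
  define V where "V = W * W"
  have V1: "V $$ i = 0" if "i < -4" for i unfolding V_def using W(2) that by (intro fls_times_nth_below[of "-2" _ "-2"]) auto
  have V2: "V $$ i = 0" if "odd i" for i unfolding V_def using Wodd that by (intro fls_times_nth_odd) auto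
  have V3: "V $$ (-4) = 1"
    unfolding V_def by (subst fls_times_nth_interval[of "-2" _ "-2"]) (use W in auto)
  define A where "A = F $$ (-4)"
  define B where "B = F $$ (-2) - A * V $$ (-2)"
  define g where "g = (\<lambda>x. f x - A * (wp x * wp x) - B * wp x)"
  define D where "D = F - fls_const A * V - fls_const B * W"
  have D: "g has_laurent_expansion D" unfolding g_def D_def V_def by (intro laurent_expansion_intros F0 W)
  have D0: "D $$ i = 0" if "i < 0" for i
  proof -
    have "i < -4 \<or> odd i \<or> i = -4 \<or> i = -2" using that by presburger
    then consider "i < -4" | "odd i" | "i = -4" | "i = -2" by blast
    thus ?thesis using F0(2)[of i] V1[of i] V2[of i] V3 W Fodd[of i] Wodd[of i]
      by cases (auto simp: D_def A_def B_def)
  qed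
  have gper: "eventually (\<lambda>x. g (x + v) = g x) (at p)" if "v \<in> \<Lambda>" for p v
    using per[OF that, of p] wp_periodic_ev[OF that, of p] by eventually_elim (simp add: g_def)
  obtain C where C: "\<And>p. g analytic_on {p} \<Longrightarrow> g p = C"
  proof (rule elliptic_regular_const[OF _ gper])
    fix p
    show "\<exists>F. (\<lambda>t. g (p + t)) has_laurent_expansion F \<and> (\<forall>i<0. F $$ i = 0)"
    proof (cases "p \<in> \<Lambda>")
      case True
      have "(\<lambda>t. g (0 + p + t)) has_laurent_expansion D"
        by (rule has_laurent_expansion_translate) (use D gper[OF True] in auto)
      thus ?thesis using D0 by auto
    next
      case False
      then obtain G where G: "(\<lambda>t. f (p + t)) has_laurent_expansion G" "\<And>i. i < 0 \<Longrightarrow> G $$ i = 0" using reg by blast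
      obtain U where U: "(\<lambda>t. wp (p + t)) has_laurent_expansion U" "\<And>i. i < 0 \<Longrightarrow> U $$ i = 0"
        using analytic_has_laurent_expansion[OF wp_analytic[OF False]] by metis
      have "(\<lambda>t. g (p + t)) has_laurent_expansion G - fls_const A * (U * U) - fls_const B * U"
        unfolding g_def by (intro laurent_expansion_intros G U)
      moreover have "(U * U) $$ i = 0" if "i < 0" for i using U(2) that by (intro fls_times_nth_below[of 0 _ 0]) auto
      ultimately show ?thesis using G(2) U(2) by (intro exI conjI) auto
    qed
  qed auto
  show ?thesis
  proof (rule that)
    fix x assume x: "x \<notin> \<Lambda>" "f analytic_on {x}"
    hence "g analytic_on {x}" unfolding g_def by (intro analytic_intros) auto
    from C[OF this] show "f x = A * (wp x)\<^sup>2 + B * wp x + C" by (simp add: g_def power2_eq_square algebra_simps)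
  qed
qed

section \<open>Identities between shifted Weierstrass functions\<close>

lemma wp_minus_e_double_zero:
  assumes "p - hp i \<in> \<Lambda>"
  obtains B where "(\<lambda>t. wp (p + t) - we i) has_laurent_expansion B" "\<And>j. j < 2 \<Longrightarrow> B $$ j = 0"
proof -
  have p: "p \<notin> \<Lambda>" using assms half_period_notin_lattice[of i] lattice_diff[of p "p - hp i"] by auto
  obtain P where P: "(\<lambda>t. wp (p + t)) has_laurent_expansion P" "\<And>i. i < 0 \<Longrightarrow> P $$ i = 0"
    "P $$ 0 = wp p" "P $$ 1 = deriv wp p"
    using analytic_has_laurent_expansion[OF wp_analytic[OF p]] by blast
  have P0: "P $$ 0 = we i" using wp_cong_lattice[OF assms half_period_notin_lattice] P(3) by (simp add: weierstrass_e_def)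
  have P1: "P $$ 1 = 0" 
    using deriv_wp_periodic[OF assms half_period_notin_lattice[of i]] P(4) deriv_wp_half_period[of i] by (simp del: deriv_wp_half_period)
  show ?thesis
  proof (rule that[of "P - fls_const (we i)"])
    show "(\<lambda>t. wp (p + t) - we i) has_laurent_expansion P - fls_const (we i)"
      by (intro laurent_expansion_intros P)
    fix j :: int assume "j < 2"
    then consider "j < 0" | "j = 0" | "j = 1" by linarith
    thus "(P - fls_const (we i)) $$ j = 0" by cases (auto simp: P(2) P0 P1)
  qed
qed

text \<open>
  The double poles of each factor meet the double zeros of the other one.
\<close>
lemma wp_half_period_product_const:
  obtains c where "\<And>x. x \<notin> \<Lambda> \<Longrightarrow> x - hp i \<notin> \<Lambda> \<Longrightarrow> (wp x - we i) * (wp (x - hp i) - we i) = c"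
proof -
  define f where "f = (\<lambda>x. (wp x - we i) * (wp (x - hp i) - we i))"
  obtain c where c: "\<And>p. f analytic_on {p} \<Longrightarrow> f p = c"
  proof (rule elliptic_regular_const)
    fix p
    obtain W where W: "(\<lambda>t. wp (p + t)) has_laurent_expansion W" "\<And>i. i < -2 \<Longrightarrow> W $$ i = 0"
      "p \<notin> \<Lambda> \<Longrightarrow> (\<forall>i<0. W $$ i = 0)"
      using wp_laurent[of p] analytic_has_laurent_expansion[OF wp_analytic[of p]] has_laurent_expansion_unique by metis
    obtain V where V: "(\<lambda>t. wp (p - hp i + t)) has_laurent_expansion V" "\<And>i. i < -2 \<Longrightarrow> V $$ i = 0"
      "p - hp i \<notin> \<Lambda> \<Longrightarrow> (\<forall>i<0. V $$ i = 0)"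
      using wp_laurent[of "p - hp i"] analytic_has_laurent_expansion[OF wp_analytic[of "p - hp i"]] has_laurent_expansion_unique by metis
    define W' where "W' = W - fls_const (we i)"
    define V' where "V' = V - fls_const (we i)"
    have W': "(\<lambda>t. wp (p + t) - we i) has_laurent_expansion W'" unfolding W'_def by (intro laurent_expansion_intros W)
    have V': "(\<lambda>t. wp (p - hp i + t) - we i) has_laurent_expansion V'" unfolding V'_def by (intro laurent_expansion_intros V)
    have fe: "(\<lambda>t. f (p + t)) has_laurent_expansion W' * V'"
      using has_laurent_expansion_mult[OF W' V'] by (simp add: f_def algebra_simps)
    have W2: "W' $$ j = 0" if "j < -2" for j using that W(2) by (simp add: W'_def)
    have V2: "V' $$ j = 0" if "j < -2" for j using that V(2) by (simp add: V'_def)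
    have "(W' * V') $$ j = 0" if "j < 0" for j
    proof -
      consider "p \<in> \<Lambda>" | "p - hp i \<in> \<Lambda>" | "p \<notin> \<Lambda>" "p - hp i \<notin> \<Lambda>" by blast
      thus ?thesis
      proof cases
        case 1
        have "p - hp i - hp i \<in> \<Lambda>" using lattice_diff[OF 1 two_half_period[of i]] by simp
        then obtain B where B: "(\<lambda>t. wp (p - hp i + t) - we i) has_laurent_expansion B" "\<And>j. j < 2 \<Longrightarrow> B $$ j = 0"
          using wp_minus_e_double_zero by blast
        have "V' = B" using V' B(1) by (rule has_laurent_expansion_unique)
        thus ?thesis using W2 B(2) that by (intro fls_times_nth_below[of "-2" _ 2]) auto
      next
        case 2
        then obtain B where B: "(\<lambda>t. wp (p + t) - we i) has_laurent_expansion B" "\<And>j. j < 2 \<Longrightarrow> B $$ j = 0"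
          using wp_minus_e_double_zero by blast
        have "W' = B" using W' B(1) by (rule has_laurent_expansion_unique)
        thus ?thesis using V2 B(2) that by (intro fls_times_nth_below[of 2 _ "-2"]) auto
      next
        case 3
        thus ?thesis using W(3) V(3) that
          by (intro fls_times_nth_below[of 0 _ 0]) (auto simp: W'_def V'_def)
      qed
    qed
    thus "\<exists>F. (\<lambda>t. f (p + t)) has_laurent_expansion F \<and> (\<forall>i<0. F $$ i = 0)" using fe by blast
  next
    fix p v assume v: "v \<in> \<Lambda>"
    have "eventually (\<lambda>x. wp (x - hp i + v) = wp (x - hp i)) (at p)"
      using wp_periodic_ev[OF v, of "p - hp i"] 
      by (simp add: eventually_at_to_0[of _ p] eventually_at_to_0[of _ "p - hp i"] algebra_simps)
    with wp_periodic_ev[OF v, of p] show "eventually (\<lambda>x. f (x + v) = f x) (at p)"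
      by eventually_elim (simp add: f_def algebra_simps)
  qed auto
  show ?thesis
  proof (rule that)
    fix x assume "x \<notin> \<Lambda>" "x - hp i \<notin> \<Lambda>"
    hence "f analytic_on {x}" unfolding f_def
      using analytic_at_shift[of wp x "- hp i"] wp_analytic[of "x - hp i"] by (intro analytic_intros) auto
    from c[OF this] show "(wp x - we i) * (wp (x - hp i) - we i) = c" by (simp add: f_def)
  qed
qed

end

locale nondegenerate_lattice = complex_lattice +
  assumes e_distinct: "we 1 \<noteq> we 2" "we 1 \<noteq> we 3" "we 2 \<noteq> we 3"
begin

lemma wp_half_period_value: "wp (hp i) = we i" by (simp add: weierstrass_e_def)

text \<open>
  The constant value of the product is found by evaluation at another half-period, where both factors
  are differences of the \<open>e\<^sub>i\<close>.
\<close>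
lemma wp_shift_half_period:
  assumes "x \<notin> \<Lambda>" "x - hp i \<notin> \<Lambda>" "(i, j, k) \<in> {(1,2,3), (2,1,3), (3,1,2)}"
  shows "(wp x - we i) * (wp (x - hp i) - we i) = (we i - we j) * (we i - we k)"
proof -
  obtain c where c: "\<And>x. x \<notin> \<Lambda> \<Longrightarrow> x - hp i \<notin> \<Lambda> \<Longrightarrow> (wp x - we i) * (wp (x - hp i) - we i) = c"
    using wp_half_period_product_const by blast
  have "\<exists>j' k'. {j', k'} = {j, k} \<and> hp j' - hp i \<notin> \<Lambda> \<and> wp (hp j' - hp i) = we k'"
  proof -
    consider "i = 1" "j = 2" "k = 3" | "i = 2" "j = 1" "k = 3" | "i = 3" "j = 1" "k = 2" using assms(3) by auto
    thus ?thesis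
    proof cases
      case 1
      have "hp 2 - hp 1 = hp 3" by (simp add: half_period_def)
      thus ?thesis using 1 by (intro exI[of _ 2] exI[of _ 3]) (auto simp: half_period_notin_lattice wp_half_period_value)
    next
      case 2
      have "hp 1 - hp 2 = - hp 3" by (simp add: half_period_def)
      thus ?thesis using 2 by (intro exI[of _ 1] exI[of _ 3]) (auto simp: half_period_notin_lattice wp_half_period_value wp_even)
    next
      case 3
      have "hp 2 - hp 3 = hp 1" by (simp add: half_period_def)
      thus ?thesis using 3 by (intro exI[of _ 2] exI[of _ 1]) (auto simp: half_period_notin_lattice wp_half_period_value)
    qed
  qed
  then obtain j' k' where jk: "{j', k'} = {j, k}" "hp j' - hp i \<notin> \<Lambda>" "wp (hp j' - hp i) = we k'" by blast
  have "c = (we j' - we i) * (we k' - we i)"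
    using c[of "hp j'"] jk half_period_notin_lattice by (simp add: wp_half_period_value)
  also have "\<dots> = (we i - we j) * (we i - we k)"
    using jk(1) by (auto simp: doubleton_eq_iff algebra_simps)
  finally show ?thesis using c[OF assms(1,2)] by simp
qed

text \<open>
  The difference of the two sides is an even elliptic function whose terms of order \<open>-6\<close> cancel, hence a
  quadratic polynomial in \<open>wp\<close>. It vanishes at the half-periods, where \<open>wp\<close> takes three distinct values,
  so it is zero.
\<close>
theorem wp_ode:
  assumes "x \<notin> \<Lambda>"
  shows "(deriv wp x)\<^sup>2 = 4 * (wp x - we 1) * (wp x - we 2) * (wp x - we 3)"
proof -
  define f where "f = (\<lambda>x. deriv wp x * deriv wp x - 4 * ((wp x - we 1) * (wp x - we 2) * (wp x - we 3)))"
  obtain W where W: "wp has_laurent_expansion W" "\<And>i. i < -2 \<Longrightarrow> W $$ i = 0" "W $$ (-1) = 0" "W $$ (-2) = 1"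
    using wp_laurent[of 0] by auto
  define D where "D = fls_deriv W"
  have D: "deriv wp has_laurent_expansion D" unfolding D_def by (intro laurent_expansion_intros W)
  have D1: "D $$ i = 0" if "i < -3" for i using that W(2) by (simp add: D_def)
  have D2: "D $$ (-3) = -2" using W by (simp add: D_def)
  define V where "V i = W - fls_const (we i)" for i
  have V: "V i $$ j = 0" if "j < -2" for i j using W(2) that by (simp add: V_def)
  have V': "V i $$ (-2) = 1" for i using W by (simp add: V_def)
  have VV: "(V 1 * V 2) $$ j = 0" if "j < -4" for j using V that by (intro fls_times_nth_below[of "-2" _ "-2"]) auto
  have VV': "(V 1 * V 2) $$ (-4) = 1" by (subst fls_times_nth_interval[of "-2" _ "-2"]) (auto simp: V V')
  define F where "F = D * D - 4 * (V 1 * V 2 * V 3)"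
  have F: "f has_laurent_expansion F"
    unfolding f_def F_def V_def by (intro laurent_expansion_intros D W)
  have ev: "eventually (\<lambda>x. f (- x) = f x) (at 0)"
    using eventually_not_in_lattice[of 0] by eventually_elim (simp add: f_def deriv_wp_odd wp_even)
  have fan: "f analytic_on {p}" if "p \<notin> \<Lambda>" for p
    unfolding f_def using that by (intro analytic_intros deriv_wp_analytic)
  obtain A B C where ABC: "\<And>x. x \<notin> \<Lambda> \<Longrightarrow> f analytic_on {x} \<Longrightarrow> f x = A * (wp x)\<^sup>2 + B * wp x + C"
  proof (rule even_elliptic_order_four[OF F _ ev])
    fix i :: int assume "i < -4"
    then consider "i < -6" | "i = -6" | "odd i"
    proof -
      have "i < -6 \<or> i = -6 \<or> odd i" using \<open>i < -4\<close> by presburger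
      thus ?thesis using that by blast
    qed
    thus "F $$ i = 0"
    proof cases
      case 1
      have "(D * D) $$ i = 0" using D1 1 by (intro fls_times_nth_below[of "-3" _ "-3"]) auto
      moreover have "(V 1 * V 2 * V 3) $$ i = 0" by (rule fls_times_nth_below[of "-4" _ "-2"]) (use VV V 1 in auto)
      ultimately show ?thesis by (simp add: F_def fls_mult_const_nth flip: fls_const_numeral)
    next
      case 2
      have "(D * D) $$ (-6) = 4" by (subst fls_times_nth_interval[of "-3" _ "-3"]) (auto simp: D1 D2)
      moreover have "(V 1 * V 2 * V 3) $$ (-6) = 1" by (subst fls_times_nth_interval[of "-4" _ "-2"]) (auto simp: VV VV' V V' simp del: One_nat_def)
      ultimately show ?thesis using 2 by (simp add: F_def fls_mult_const_nth flip: fls_const_numeral)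
    next
      case 3
      thus ?thesis by (rule laurent_expansion_even[OF F ev])
    qed
  next
    fix p v assume "v \<in> \<Lambda>"
    thus "eventually (\<lambda>x. f (x + v) = f x) (at p)"
      using eventually_not_in_lattice[of p] by (auto elim!: eventually_mono simp: f_def wp_periodic deriv_wp_periodic)
  next
    fix p assume "p \<notin> \<Lambda>"
    from analytic_has_laurent_expansion[OF fan[OF this]]
    show "\<exists>F. (\<lambda>t. f (p + t)) has_laurent_expansion F \<and> (\<forall>i<0. F $$ i = 0)" by metis
  qed (rule that)
  have z: "A * (we i)\<^sup>2 + B * we i + C = 0" if "i \<in> {1,2,3}" for i
    using ABC[OF half_period_notin_lattice fan[OF half_period_notin_lattice], of i] that
    by (auto simp: f_def deriv_wp_half_period wp_half_period_value)
  have 1: "(we 1 - we 2) * (A * (we 1 + we 2) + B) = 0"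
  proof -
    have "(we 1 - we 2) * (A * (we 1 + we 2) + B) = (A * (we 1)\<^sup>2 + B * we 1 + C) - (A * (we 2)\<^sup>2 + B * we 2 + C)"
      by (simp add: power2_eq_square algebra_simps)
    also have "\<dots> = 0" by (simp only: z insert_iff simp_thms diff_self)
    finally show ?thesis .
  qed
  have 2: "(we 1 - we 3) * (A * (we 1 + we 3) + B) = 0"
  proof -
    have "(we 1 - we 3) * (A * (we 1 + we 3) + B) = (A * (we 1)\<^sup>2 + B * we 1 + C) - (A * (we 3)\<^sup>2 + B * we 3 + C)"
      by (simp add: power2_eq_square algebra_simps)
    also have "\<dots> = 0" by (simp only: z insert_iff simp_thms diff_self)
    finally show ?thesis .
  qed
  have "A * (we 2 - we 3) = (A * (we 1 + we 2) + B) - (A * (we 1 + we 3) + B)" by (simp add: algebra_simps)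
  also have "\<dots> = 0" using 1 2 e_distinct by simp
  finally have "A * (we 2 - we 3) = 0" .
  hence A: "A = 0" using e_distinct by simp
  hence B: "B = 0" using 1 e_distinct by simp
  hence "C = 0" using z[of 1] A by simp
  thus ?thesis using ABC[OF assms fan[OF assms]] A B by (simp add: f_def power2_eq_square algebra_simps)
qed

text \<open>
  The double zeros of \<open>(wp x - d)\<^sup>2\<close> at \<open>\<delta>\<close> and \<open>- \<delta>\<close> cancel the poles of the sum, so the left-hand side is
  again a quadratic polynomial in \<open>wp\<close>. Its coefficients with respect to powers of \<open>wp x - d\<close> can be read
  off at \<open>\<delta>\<close>: they are \<open>wp' \<delta>\<^sup>2\<close> and \<open>wp'' \<delta>\<close>, which the differential equation expresses through \<open>d\<close>. This
  is how the potential becomes a rational function of \<open>z\<close>.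
\<close>
lemma wp_pair:
  fixes \<delta> :: complex
  defines "d \<equiv> wp \<delta>"
  assumes \<delta>: "2 * \<delta> \<notin> \<Lambda>"
  obtains A where "\<And>x. x \<notin> \<Lambda> \<Longrightarrow> x - \<delta> \<notin> \<Lambda> \<Longrightarrow> x + \<delta> \<notin> \<Lambda> \<Longrightarrow>
     (wp x - d)\<^sup>2 * (wp (x - \<delta>) + wp (x + \<delta>)) = 4 * (d - we 1) * (d - we 2) * (d - we 3)
       + 2 * ((d - we 2) * (d - we 3) + (d - we 1) * (d - we 3) + (d - we 1) * (d - we 2)) * (wp x - d)
       + A * (wp x - d)\<^sup>2"
proof -
  have \<delta>': "\<delta> \<notin> \<Lambda>" using \<delta> lattice_add[of \<delta> \<delta>] by auto
  have \<delta>hp: "\<delta> - hp i \<notin> \<Lambda>" for i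
  proof
    assume "\<delta> - hp i \<in> \<Lambda>"
    from lattice_add[OF lattice_add[OF this this] two_half_period[of i]] \<delta> show False by (simp add: algebra_simps)
  qed
  define a where "a i = d - we i" for i
  have a0: "a i \<noteq> 0" if "i \<in> {1,2,3}" for i
  proof -
    have "(we 1 - we 2) * (we 1 - we 3) \<noteq> 0" "(we 2 - we 1) * (we 2 - we 3) \<noteq> 0" "(we 3 - we 1) * (we 3 - we 2) \<noteq> 0"
      using e_distinct by auto
    thus ?thesis using wp_shift_half_period[OF \<delta>' \<delta>hp, of i] that by (auto simp: a_def d_def)
  qed
  define f where "f = (\<lambda>x. (wp x - d) * (wp x - d) * (wp (x - \<delta>) + wp (x + \<delta>)))"
  have wpl: "\<exists>W. (\<lambda>t. wp (p + t)) has_laurent_expansion W \<and> (\<forall>i< -2. W $$ i = 0) \<and> (p \<notin> \<Lambda> \<longrightarrow> (\<forall>i<0. W $$ i = 0) \<and> W $$ 0 = wp p)" for p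
  proof -
    obtain W where W: "(\<lambda>t. wp (p + t)) has_laurent_expansion W" "\<And>i. i < -2 \<Longrightarrow> W $$ i = 0"
      using wp_laurent[of p] by metis
    have "(\<forall>i<0. W $$ i = 0) \<and> W $$ 0 = wp p" if p: "p \<notin> \<Lambda>"
    proof -
      obtain V where V: "(\<lambda>t. wp (p + t)) has_laurent_expansion V" "\<And>i. i < 0 \<Longrightarrow> V $$ i = 0" "V $$ 0 = wp p"
        using analytic_has_laurent_expansion[OF wp_analytic[OF p]] by metis
      have "W = V" using W(1) V(1) by (rule has_laurent_expansion_unique)
      thus ?thesis using V by simp
    qed
    thus ?thesis using W by blast
  qed
  have fan: "f analytic_on {p}" if "p \<notin> \<Lambda>" "p - \<delta> \<notin> \<Lambda>" "p + \<delta> \<notin> \<Lambda>" for p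
    unfolding f_def using that analytic_at_shift[of wp p "-\<delta>"] analytic_at_shift[of wp p \<delta>] wp_analytic[of "p - \<delta>"] wp_analytic[of "p + \<delta>"]
    by (intro analytic_intros) auto
  have fl: "\<exists>P S. (\<lambda>t. f (p + t)) has_laurent_expansion (P - fls_const d) * (P - fls_const d) * S \<and>
     (\<lambda>t. wp (p + t)) has_laurent_expansion P \<and> (\<forall>i< -2. P $$ i = 0) \<and> (\<forall>i< -2. S $$ i = 0) \<and>
     (p \<notin> \<Lambda> \<longrightarrow> (\<forall>i<0. P $$ i = 0) \<and> P $$ 0 = wp p) \<and>
     (p - \<delta> \<notin> \<Lambda> \<longrightarrow> p + \<delta> \<notin> \<Lambda> \<longrightarrow> (\<forall>i<0. S $$ i = 0))" for p
  proof -
    obtain P where P: "(\<lambda>t. wp (p + t)) has_laurent_expansion P" "\<forall>i< -2. P $$ i = 0" "p \<notin> \<Lambda> \<longrightarrow> (\<forall>i<0. P $$ i = 0) \<and> P $$ 0 = wp p"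
      using wpl by blast
    obtain S1 where S1: "(\<lambda>t. wp (p - \<delta> + t)) has_laurent_expansion S1" "\<forall>i< -2. S1 $$ i = 0" "p - \<delta> \<notin> \<Lambda> \<longrightarrow> (\<forall>i<0. S1 $$ i = 0)"
      using wpl by blast
    obtain S2 where S2: "(\<lambda>t. wp (p + \<delta> + t)) has_laurent_expansion S2" "\<forall>i< -2. S2 $$ i = 0" "p + \<delta> \<notin> \<Lambda> \<longrightarrow> (\<forall>i<0. S2 $$ i = 0)"
      using wpl by blast
    have "(\<lambda>t. (wp (p + t) - d) * (wp (p + t) - d) * (wp (p - \<delta> + t) + wp (p + \<delta> + t))) has_laurent_expansion
       (P - fls_const d) * (P - fls_const d) * (S1 + S2)"
      by (intro laurent_expansion_intros P S1 S2)
    hence "(\<lambda>t. f (p + t)) has_laurent_expansion (P - fls_const d) * (P - fls_const d) * (S1 + S2)"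
      by (simp add: f_def algebra_simps)
    thus ?thesis using P S1 S2 by (intro exI[of _ P] exI[of _ "S1 + S2"]) auto
  qed
  have shift_ev: "eventually (\<lambda>x. Q (x + c)) (at p)" if "eventually Q (at (p + c))" for Q p and c :: complex
    using that unfolding eventually_at_to_0[of _ p] eventually_at_to_0[of _ "p + c"] by (simp add: add.assoc)
  obtain A B C where ABC: "\<And>x. x \<notin> \<Lambda> \<Longrightarrow> f analytic_on {x} \<Longrightarrow> f x = A * (wp x)\<^sup>2 + B * wp x + C"
  proof -
    obtain P S where PS: "f has_laurent_expansion (P - fls_const d) * (P - fls_const d) * S"
     "\<forall>i< -2. P $$ i = 0" "\<forall>i<0. S $$ i = 0" using fl[of 0] \<delta>' by auto
    have 1: "((P - fls_const d) * (P - fls_const d) * S) $$ i = 0" if "i < -4" for i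
    proof (rule fls_times_nth_below[of "-4" _ 0])
      fix j :: int assume "j < -4"
      thus "((P - fls_const d) * (P - fls_const d)) $$ j = 0" using PS by (intro fls_times_nth_below[of "-2" _ "-2"]) auto
    qed (use that PS in auto)
    have 2: "eventually (\<lambda>x. f (- x) = f x) (at 0)"
    proof (intro always_eventually allI)
      fix x
      have "- x - \<delta> = - (x + \<delta>)" "- x + \<delta> = - (x - \<delta>)" by simp_all
      thus "f (- x) = f x" unfolding f_def by (simp only: wp_even) (simp add: add.commute)
    qed
    have 3: "eventually (\<lambda>x. f (x + v) = f x) (at p)" if v: "v \<in> \<Lambda>" for p v
      using wp_periodic_ev[OF v, of p] shift_ev[OF wp_periodic_ev[OF v, of "p + \<delta>"]] shift_ev[of _ p "- \<delta>", OF wp_periodic_ev[OF v]]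
      by eventually_elim (simp add: f_def algebra_simps)
    have 4: "\<exists>F. (\<lambda>t. f (p + t)) has_laurent_expansion F \<and> (\<forall>i<0. F $$ i = 0)" if p: "p \<notin> \<Lambda>" for p
    proof -
      obtain P S where PS: "(\<lambda>t. f (p + t)) has_laurent_expansion (P - fls_const d) * (P - fls_const d) * S"
         "\<forall>i< -2. S $$ i = 0" "\<forall>i<0. P $$ i = 0" "P $$ 0 = wp p" "p - \<delta> \<notin> \<Lambda> \<longrightarrow> p + \<delta> \<notin> \<Lambda> \<longrightarrow> (\<forall>i<0. S $$ i = 0)"
        using fl[of p] p by blast
      have "((P - fls_const d) * (P - fls_const d) * S) $$ i = 0" if i: "i < 0" for i
      proof (cases "p - \<delta> \<in> \<Lambda> \<or> p + \<delta> \<in> \<Lambda>")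
        case True
        hence "wp p = d"
        proof
          assume "p + \<delta> \<in> \<Lambda>"
          hence "wp p = wp (- \<delta>)" using \<delta>' by (intro wp_cong_lattice) auto
          thus ?thesis by (simp add: wp_even d_def)
        qed (use \<delta>' wp_cong_lattice in \<open>auto simp: d_def\<close>)
        have z: "(P - fls_const d) $$ j = 0" if "j < 1" for j
          using PS(3,4) \<open>wp p = d\<close> that by (cases "j = 0") auto
        show ?thesis
        proof (rule fls_times_nth_below[of 2 _ "-2"])
          fix j :: int assume "j < 2"
          thus "((P - fls_const d) * (P - fls_const d)) $$ j = 0" using z by (intro fls_times_nth_below[of 1 _ 1]) auto
        qed (use i PS in auto)
      next
        case False
        show ?thesis
        proof (rule fls_times_nth_below[of 0 _ 0])
          fix j :: int assume "j < 0"
          thus "((P - fls_const d) * (P - fls_const d)) $$ j = 0" using PS by (intro fls_times_nth_below[of 0 _ 0]) auto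
        qed (use i PS False in auto)
      qed
      thus ?thesis using PS(1) by blast
    qed
    show ?thesis using even_elliptic_order_four[OF PS(1) 1 2 3 4] that by blast
  qed
  define B' where "B' = 2 * A * d + B"
  define C' where "C' = A * d ^ 2 + B * d + C"
  have eq: "f x = A * ((wp x - d) * (wp x - d)) + B' * (wp x - d) + C'" 
    if "x \<notin> \<Lambda>" "x - \<delta> \<notin> \<Lambda>" "x + \<delta> \<notin> \<Lambda>" for x
    using ABC[OF that(1) fan[OF that]] by (simp add: B'_def C'_def power2_eq_square algebra_simps)
  obtain P where P: "(\<lambda>t. wp (\<delta> + t)) has_laurent_expansion P" "\<And>i. i < 0 \<Longrightarrow> P $$ i = 0" "P $$ 0 = d" "P $$ 1 = deriv wp \<delta>"
    using analytic_has_laurent_expansion[OF wp_analytic[OF \<delta>']] unfolding d_def by metis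
  define Q where "Q = P - fls_const d"
  define s1 where "s1 = deriv wp \<delta>"
  define s2 where "s2 = P $$ 2"
  have Q: "(\<lambda>t. wp (\<delta> + t) - d) has_laurent_expansion Q" unfolding Q_def by (intro laurent_expansion_intros P)
  have Q0: "Q $$ i = 0" if "i < 1" for i using P(2,3) that by (cases "i = 0") (auto simp: Q_def)
  have Q1: "Q $$ 1 = s1" and Q2: "Q $$ 2 = s2" by (auto simp: Q_def s1_def s2_def P)
  have QQ0: "(Q * Q) $$ i = 0" if "i < 2" for i using that Q0 by (intro fls_times_nth_below[of 1 _ 1]) auto
  have QQ2: "(Q * Q) $$ 2 = s1 * s1" by (subst fls_times_nth_interval[of 1 _ 1]) (auto simp: Q0 Q1)
  have QQ3: "(Q * Q) $$ 3 = 2 * s1 * s2"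
  proof -
    have "{1..3 - 1 :: int} = {1, 2}" by auto
    thus ?thesis by (subst fls_times_nth_interval[of 1 _ 1]) (auto simp: Q0 Q1 Q2)
  qed
  have QQQ0: "(Q * Q * Q) $$ i = 0" if "i < 3" for i by (rule fls_times_nth_below[of 2 _ 1]) (use that Q0 QQ0 in auto)
  \<comment> \<open>the differential equation at \<open>\<delta>\<close>, to first order\<close>
  define D where "D = fls_deriv P"
  have "(\<lambda>t. deriv wp (\<delta> + t)) has_laurent_expansion D"
  proof -
    show ?thesis unfolding D_def by (rule has_laurent_expansion_deriv_shift[OF P(1)])
  qed
  hence DD: "(\<lambda>t. deriv wp (\<delta> + t) * deriv wp (\<delta> + t)) has_laurent_expansion D * D" by (intro laurent_expansion_intros)
  have "(\<lambda>t. 4 * ((wp (\<delta> + t) - d + a 1) * (wp (\<delta> + t) - d + a 2) * (wp (\<delta> + t) - d + a 3))) has_laurent_expansion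
     4 * ((Q + fls_const (a 1)) * (Q + fls_const (a 2)) * (Q + fls_const (a 3)))"
    by (intro laurent_expansion_intros Q)
  moreover have "eventually (\<lambda>t. deriv wp (\<delta> + t) * deriv wp (\<delta> + t) = 
      4 * ((wp (\<delta> + t) - d + a 1) * (wp (\<delta> + t) - d + a 2) * (wp (\<delta> + t) - d + a 3))) (at 0)"
  proof -
    have "eventually (\<lambda>t. t + \<delta> \<notin> \<Lambda>) (at 0)"
      using eventually_not_in_lattice[of \<delta>] by (simp add: eventually_at_to_0[of _ \<delta>])
    thus ?thesis
    proof eventually_elim
      case (elim t)
      thus ?case using wp_ode[of "\<delta> + t"] by (simp add: a_def power2_eq_square add.commute mult.assoc)
    qed
  qed
  ultimately have "(\<lambda>t. deriv wp (\<delta> + t) * deriv wp (\<delta> + t)) has_laurent_expansion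
     4 * ((Q + fls_const (a 1)) * (Q + fls_const (a 2)) * (Q + fls_const (a 3)))"
    by (subst has_laurent_expansion_cong) auto
  with DD have "D * D = 4 * ((Q + fls_const (a 1)) * (Q + fls_const (a 2)) * (Q + fls_const (a 3)))"
    by (rule has_laurent_expansion_unique)
  also have "\<dots> = fls_const 4 * (Q * Q * Q) + fls_const (4 * (a 1 + a 2 + a 3)) * (Q * Q) + fls_const (4 * (a 2 * a 3 + a 1 * a 3 + a 1 * a 2)) * Q
      + fls_const (4 * a 1 * a 2 * a 3)"
    by (simp flip: fls_const_mult_const fls_plus_const fls_const_numeral add: algebra_simps)
  finally have DDeq: "D * D = \<dots>" .
  have D0: "D $$ i = 0" if "i < 0" for i using that P(2)[of "i + 1"] by (cases "i = -1") (auto simp: D_def)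
  have D1: "D $$ 0 = s1" "D $$ 1 = 2 * s2" by (auto simp: D_def s1_def s2_def P)
  have "(D * D) $$ 0 = s1 * s1" by (subst fls_times_nth_interval[of 0 _ 0]) (auto simp: D0 D1)
  hence s1: "s1 * s1 = 4 * a 1 * a 2 * a 3" unfolding DDeq by (simp add: QQQ0 QQ0 Q0)
  hence s1nz: "s1 \<noteq> 0" using a0 by auto
  have "(D * D) $$ 1 = 4 * s1 * s2"
  proof -
    have "{0..1 - 0 :: int} = {0, 1}" by auto
    thus ?thesis by (subst fls_times_nth_interval[of 0 _ 0]) (auto simp: D0 D1)
  qed
  hence "4 * (a 2 * a 3 + a 1 * a 3 + a 1 * a 2) * s1 = 4 * s1 * s2" unfolding DDeq by (simp add: QQQ0 QQ0 Q1)
  moreover have "(4 * s1) * (s2 - (a 2 * a 3 + a 1 * a 3 + a 1 * a 2)) = 4 * s1 * s2 - 4 * (a 2 * a 3 + a 1 * a 3 + a 1 * a 2) * s1"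
    by (simp add: algebra_simps)
  ultimately have "(4 * s1) * (s2 - (a 2 * a 3 + a 1 * a 3 + a 1 * a 2)) = 0" by (simp only: diff_self)
  hence s2: "s2 = a 2 * a 3 + a 1 * a 3 + a 1 * a 2" using s1nz by simp
  \<comment> \<open>comparison of both sides at \<open>\<delta>\<close>, to first order\<close>
  obtain W where W: "wp has_laurent_expansion W" "\<And>i. i < -2 \<Longrightarrow> W $$ i = 0" "W $$ (-1) = 0" "W $$ (-2) = 1"
    using wp_laurent[of 0] by auto
  obtain V where V: "(\<lambda>t. wp (2 * \<delta> + t)) has_laurent_expansion V" "\<And>i. i < 0 \<Longrightarrow> V $$ i = 0"
    using analytic_has_laurent_expansion[OF wp_analytic[OF \<delta>]] by metis
  define S where "S = W + V"
  have S: "S $$ i = 0" if "i < -2" for i using W(2) V(2) that by (simp add: S_def)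
  have S': "S $$ (-1) = 0" "S $$ (-2) = 1" by (simp_all add: S_def W V)
  have L1: "(\<lambda>t. (wp (\<delta> + t) - d) * (wp (\<delta> + t) - d) * (wp t + wp (2 * \<delta> + t))) has_laurent_expansion Q * Q * S"
    unfolding S_def by (intro laurent_expansion_intros Q W V)
  have L2: "(\<lambda>t. A * ((wp (\<delta> + t) - d) * (wp (\<delta> + t) - d)) + B' * (wp (\<delta> + t) - d) + C') has_laurent_expansion
     fls_const A * (Q * Q) + fls_const B' * Q + fls_const C'"
    by (intro laurent_expansion_intros Q)
  have L3: "eventually (\<lambda>t. (wp (\<delta> + t) - d) * (wp (\<delta> + t) - d) * (wp t + wp (2 * \<delta> + t)) = 
       A * ((wp (\<delta> + t) - d) * (wp (\<delta> + t) - d)) + B' * (wp (\<delta> + t) - d) + C') (at 0)"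
  proof -
    have "eventually (\<lambda>t. t + \<delta> \<notin> \<Lambda>) (at 0)" "eventually (\<lambda>t. t + 2 * \<delta> \<notin> \<Lambda>) (at 0)" "eventually (\<lambda>t. t \<notin> \<Lambda>) (at 0)"
      using shift_ev[of "\<lambda>t. t \<notin> \<Lambda>" 0] eventually_not_in_lattice by auto
    thus ?thesis
    proof eventually_elim
      case (elim t)
      thus ?case using eq[of "\<delta> + t"] by (simp add: f_def algebra_simps)
    qed
  qed
  have eq2: "Q * Q * S = fls_const A * (Q * Q) + fls_const B' * Q + fls_const C'"
    by (rule has_laurent_expansion_unique[OF L1]) (use L2 has_laurent_expansion_cong[OF L3 refl] in blast)
  have "(Q * Q * S) $$ 0 = s1 * s1"
    by (subst fls_times_nth_interval[of 2 _ "-2"]) (auto simp: QQ0 S S' QQ2)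
  hence C': "C' = s1 * s1" unfolding eq2 by (simp add: QQ0 Q0)
  have "(Q * Q * S) $$ 1 = 2 * s1 * s2"
  proof -
    have "{2..1 - -2 :: int} = {2, 3}" by auto
    thus ?thesis by (subst fls_times_nth_interval[of 2 _ "-2"]) (auto simp: QQ0 S S' QQ2 QQ3)
  qed
  hence "B' * s1 = 2 * s1 * s2" unfolding eq2 by (simp add: QQ0 Q1)
  hence B': "B' = 2 * s2" using s1nz by simp
  show ?thesis
  proof (rule that[of A])
    fix x assume x: "x \<notin> \<Lambda>" "x - \<delta> \<notin> \<Lambda>" "x + \<delta> \<notin> \<Lambda>"
    show "(wp x - d)\<^sup>2 * (wp (x - \<delta>) + wp (x + \<delta>)) = 4 * (d - we 1) * (d - we 2) * (d - we 3)
       + 2 * ((d - we 2) * (d - we 3) + (d - we 1) * (d - we 3) + (d - we 1) * (d - we 2)) * (wp x - d)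
       + A * (wp x - d)\<^sup>2"
      using eq[OF x] unfolding C' B' s1 s2 by (simp add: f_def a_def power2_eq_square algebra_simps)
  qed
qed

end

section \<open>The Lenard recursion at a pole\<close>

text \<open>
  The right-hand side of the recursion for the \<open>J\<^sub>n\<close>, on Laurent series at a point.
\<close>
definition lenard_step :: "complex fls \<Rightarrow> complex fls \<Rightarrow> complex fls" where
  "lenard_step U F = (fls_deriv ^^ 3) F - 4 * U * fls_deriv F - 2 * fls_deriv U * F"

text \<open>
  A potential \<open>n (n + 1) / t\<^sup>2 + O(1)\<close>; its Schroedinger equation has the exponents \<open>- n\<close> and \<open>n + 1\<close> at
  \<open>t = 0\<close>.
\<close>
definition pole_strength :: "nat \<Rightarrow> complex fls \<Rightarrow> bool" where
  "pole_strength n U \<longleftrightarrow> (\<forall>i< -2. U $$ i = 0) \<and> U $$ (-2) = of_nat (n * (n + 1)) \<and> U $$ (-1) = 0"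

lemma least_odd_coeff:
  assumes U: "pole_strength n U" and i: "odd i" "i < 2 * int n + 1" "U $$ i \<noteq> 0"
  obtains q where "1 \<le> q" "q \<le> n" "U $$ (2 * int q - 1) \<noteq> 0" "\<And>l. odd l \<Longrightarrow> l < 2 * int q - 1 \<Longrightarrow> U $$ l = 0"
proof -
  define P where "P q \<longleftrightarrow> U $$ (2 * int q - 1) \<noteq> 0" for q
  have neg: "U $$ l = 0" if "odd l" "l < 0" for l
  proof -
    have "l = -1 \<or> l < -2" using that by presburger
    thus ?thesis using U by (auto simp: pole_strength_def)
  qed
  have "\<not> i < 0" using neg[OF i(1)] i(3) by blast
  moreover have "i \<noteq> 0" using i(1) by auto
  ultimately have "i \<ge> 1" by linarith
  obtain l where l: "i = 2 * l + 1" using i(1) by (rule oddE)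
  define q0 where "q0 = nat (l + 1)"
  have q0: "i = 2 * int q0 - 1" using l \<open>i \<ge> 1\<close> by (simp add: q0_def)
  define q where "q = (LEAST q. P q)"
  have P0: "P q0" using i q0 by (simp add: P_def)
  show ?thesis
  proof (rule that[of q])
    have Pq: "P q" unfolding q_def by (rule LeastI[of _ q0]) (rule P0)
    thus "U $$ (2 * int q - 1) \<noteq> 0" by (simp add: P_def)
    show "q \<le> n" using Least_le[of P q0, OF P0] i q0 by (auto simp: q_def)
    show "1 \<le> q"
    proof (rule ccontr)
      assume "\<not> 1 \<le> q"
      hence "q = 0" by simp
      thus False using Pq U by (simp add: P_def pole_strength_def)
    qed
    fix l assume l: "odd l" "l < 2 * int q - 1"
    show "U $$ l = 0"
    proof (cases "l < 0")
      case False
      define q' where "q' = nat ((l + 1) div 2)"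
      have q': "l = 2 * int q' - 1" using False l(1) unfolding q'_def by (simp; presburger)
      have "\<not> P q'" using not_less_Least[of q' P] l(2) q' unfolding q_def by auto
      thus ?thesis by (simp add: P_def q')
    qed (rule neg[OF l(1)])
  qed
qed

text \<open>
  The coefficient of \<open>U\<close> of index \<open>-2\<close> combines with the third derivative to a product of three linear
  factors. Its zeros at \<open>i = -1\<close> and \<open>i = - 2 n - 2\<close> keep the poles bounded under the recursion when the odd
  coefficients vanish.
\<close>
lemma lenard_step_nth:
  assumes U: "pole_strength n U" and F: "\<And>i. i < r \<Longrightarrow> F $$ i = 0"
  shows "lenard_step U F $$ (i - 1) =
    of_int ((i + 1) * (i - 2 * int n) * (i + 2 * int n + 2)) * F $$ (i + 2)
    - (\<Sum>l=0..i - r. of_int (4 * i - 2 * l) * U $$ l * F $$ (i - l))"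
proof -
  have U2: "U $$ l = 0" if "l < -2" for l using U that by (auto simp: pole_strength_def)
  have U2': "fls_deriv U $$ l = 0" if "l < -3" for l using U that by (auto simp: pole_strength_def)
  have F': "fls_deriv F $$ l = 0" if "l < r - 1" for l using F that by auto
  have a: "(U * fls_deriv F) $$ (i - 1) = (\<Sum>l=-2..i - r. of_int (i - l) * U $$ l * F $$ (i - l))"
    by (subst fls_times_nth_interval[of "-2" _ "r - 1", OF U2 F']) (auto intro!: sum.cong simp: algebra_simps)
  have b: "(fls_deriv U * F) $$ (i - 1) = (\<Sum>l=-2..i - r. of_int l * U $$ l * F $$ (i - l))"
  proof -
    have "(fls_deriv U * F) $$ (i - 1) = (\<Sum>l=-3..i - 1 - r. fls_deriv U $$ l * F $$ (i - 1 - l))"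
      by (rule fls_times_nth_interval[OF U2' F])
    also have "\<dots> = (\<Sum>l=-2..i - r. fls_deriv U $$ (l - 1) * F $$ (i - l))"
      by (rule sum.reindex_bij_witness[of _ "\<lambda>l. l - 1" "\<lambda>l. l + 1"]) (auto simp: algebra_simps)
    also have "\<dots> = (\<Sum>l=-2..i - r. of_int l * U $$ l * F $$ (i - l))"
      by (intro sum.cong) auto
    finally show ?thesis .
  qed
  define T where "T l = of_int (4 * i - 2 * l) * U $$ l * F $$ (i - l)" for l
  have "lenard_step U F $$ (i - 1) = of_int (i * (i + 1) * (i + 2)) * F $$ (i + 2) -
     (4 * (U * fls_deriv F) $$ (i - 1) + 2 * (fls_deriv U * F) $$ (i - 1))"
  proof -
    have "lenard_step U F = (fls_deriv ^^ 3) F - fls_const 4 * (U * fls_deriv F) - fls_const 2 * (fls_deriv U * F)"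
      by (simp add: lenard_step_def mult.assoc)
    moreover have "(fls_deriv ^^ 3) F $$ (i - 1) = of_int (i * (i + 1) * (i + 2)) * F $$ (i + 2)"
      by (simp add: eval_nat_numeral algebra_simps)
    ultimately show ?thesis by (simp add: fls_mult_const_nth)
  qed
  also have "4 * (U * fls_deriv F) $$ (i - 1) + 2 * (fls_deriv U * F) $$ (i - 1) = (\<Sum>l=-2..i - r. T l)"
    unfolding a b sum_distrib_left sum.distrib[symmetric] T_def
    by (intro sum.cong refl) (simp add: algebra_simps)
  also have "\<dots> = T (-2) + T (-1) + (\<Sum>l=0..i - r. T l)"
  proof (cases "i - r \<ge> -2")
    case True
    have "{-2..i - r} = insert (-2) {-1..i - r}" using True by auto
    hence "(\<Sum>l=-2..i - r. T l) = T (-2) + (\<Sum>l=-1..i - r. T l)" by simp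
    moreover have "(\<Sum>l=-1..i - r. T l) = T (-1) + (\<Sum>l=0..i - r. T l)"
    proof (cases "i - r \<ge> -1")
      case True
      hence "{-1..i - r} = insert (-1) {0..i - r}" by auto
      thus ?thesis by simp
    next
      case False
      thus ?thesis using F by (auto simp: T_def)
    qed
    ultimately show ?thesis by simp
  next
    case False
    thus ?thesis using F by (auto simp: T_def)
  qed
  also have "T (-1) = 0" using U by (simp add: T_def pole_strength_def)
  also have "T (-2) = of_int (4 * (i + 1) * int n * (int n + 1)) * F $$ (i + 2)"
    using U by (simp add: T_def pole_strength_def algebra_simps)
  finally show ?thesis by (simp add: T_def algebra_simps)
qed

locale lenard_series =
  fixes n :: nat and U :: "complex fls" and F :: "nat \<Rightarrow> complex fls"
  assumes U: "pole_strength n U" and F0: "F 0 = U"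
    and step: "\<And>j. fls_deriv (F (Suc j)) = lenard_step U (F j)"
begin

lemma step_nth:
  assumes "\<And>i. i < r \<Longrightarrow> F j $$ i = 0"
  shows "of_int i * F (Suc j) $$ i =
    of_int ((i + 1) * (i - 2 * int n) * (i + 2 * int n + 2)) * F j $$ (i + 2)
    - (\<Sum>l=0..i - r. of_int (4 * i - 2 * l) * U $$ l * F j $$ (i - l))"
proof -
  have "of_int i * F (Suc j) $$ i = fls_deriv (F (Suc j)) $$ (i - 1)" by simp
  also have "\<dots> = lenard_step U (F j) $$ (i - 1)" by (simp only: step)
  also have "\<dots> = of_int ((i + 1) * (i - 2 * int n) * (i + 2 * int n + 2)) * F j $$ (i + 2)
    - (\<Sum>l=0..i - r. of_int (4 * i - 2 * l) * U $$ l * F j $$ (i - l))"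
    by (rule lenard_step_nth[OF U assms])
  finally show ?thesis .
qed

text \<open>
  The forbidden indices are those below \<open>- 2 n\<close> and the odd ones below \<open>1\<close>. The recursion shifts indices
  by two; it would lead out of the permitted range only for \<open>i + 2 = - 2 n\<close> and \<open>i + 2 = 1\<close>, where the
  product of the three linear factors is zero. The convolution sum respects the range because the low odd
  coefficients of \<open>U\<close> vanish.
\<close>
lemma bounded_poles:
  assumes odd: "\<And>i. odd i \<Longrightarrow> i < 2 * int n + 1 \<Longrightarrow> U $$ i = 0"
  shows "i < - 2 * int n \<or> (odd i \<and> i < 1) \<Longrightarrow> F j $$ i = 0"
proof (induction j arbitrary: i)
  case 0
  show ?case
  proof (cases "n = 0")
    case True
    thus ?thesis using 0 U odd by (cases "i < -2"; cases "i = -2"; cases "i = -1") (auto simp: F0 pole_strength_def)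
  next
    case False
    thus ?thesis using 0 U odd[of i] by (cases "i < -2") (auto simp: F0 pole_strength_def)
  qed
next
  case (Suc j)
  have i: "i < 0" using Suc.prems by (auto elim!: oddE)
  have "of_int i * F (Suc j) $$ i =
    of_int ((i + 1) * (i - 2 * int n) * (i + 2 * int n + 2)) * F j $$ (i + 2)
    - (\<Sum>l=0..i - (- 2 * int n). of_int (4 * i - 2 * l) * U $$ l * F j $$ (i - l))"
    by (rule step_nth) (use Suc.IH in auto)
  also have "(\<Sum>l=0..i - (- 2 * int n). of_int (4 * i - 2 * l) * U $$ l * F j $$ (i - l)) = 0"
  proof (intro sum.neutral ballI)
    fix l assume l: "l \<in> {0..i - (- 2 * int n)}"
    show "of_int (4 * i - 2 * l) * U $$ l * F j $$ (i - l) = 0"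
    proof (cases "odd l")
      case True
      thus ?thesis using odd[of l] l i by auto
    next
      case False
      thus ?thesis using Suc.prems l i Suc.IH[of "i - l"] by auto
    qed
  qed
  also have "of_int ((i + 1) * (i - 2 * int n) * (i + 2 * int n + 2)) * F j $$ (i + 2) = 0"
  proof (cases "i = -1 \<or> i = - 2 * int n - 2")
    case True
    thus ?thesis by auto
  next
    case False
    have "i + 2 < - 2 * int n \<or> (odd (i + 2) \<and> i + 2 < 1)" using Suc.prems False i by presburger
    hence "F j $$ (i + 2) = 0" by (rule Suc.IH)
    thus ?thesis by simp
  qed
  finally show ?case using i by simp
qed

text \<open>
  Here \<open>2 q - 1\<close> is the first odd index with a nonzero coefficient \<open>c\<close>. The leading even coefficient of
  \<open>F j\<close>, at \<open>- 2 j - 2\<close>, has the sign \<open>(-1)^j\<close> for \<open>j < n\<close> and is zero afterwards. The leading odd coefficient,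
  at \<open>2 q - 1 - 2 j\<close>, has two sources: the preceding leading odd coefficient, and \<open>c\<close> times the preceding
  leading even one. For \<open>q \<le> j \<le> n\<close> these have the same sign relative to \<open>c\<close>, so they cannot cancel; for larger
  \<open>j\<close> only the first source is left, and its factor is nonzero because the index is odd.
\<close>
lemma unbounded_poles:
  assumes q: "1 \<le> q" "q \<le> n" and c: "U $$ (2 * int q - 1) = c" "c \<noteq> 0"
    and least: "\<And>i. odd i \<Longrightarrow> i < 2 * int q - 1 \<Longrightarrow> U $$ i = 0"
  shows "(\<forall>i < - 2 * int j - 2. F j $$ i = 0)
    \<and> (\<forall>i < 2 * int q - 1 - 2 * int j. odd i \<longrightarrow> F j $$ i = 0)
    \<and> (\<exists>t::real. F j $$ (- 2 * int j - 2) = of_real ((-1) ^ j * t) \<and> t \<ge> 0 \<and> (j < n \<longrightarrow> t > 0) \<and> (j \<ge> n \<longrightarrow> t = 0))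
    \<and> (\<exists>s::real. F j $$ (2 * int q - 1 - 2 * int j) = c * of_real ((-1) ^ j * s) \<and> (q \<le> j \<longrightarrow> s \<noteq> 0) \<and> (q \<le> j \<longrightarrow> j \<le> n \<longrightarrow> s > 0))"
proof (induction j)
  case 0
  have n: "n > 0" using q by simp
  have 1: "F 0 $$ i = 0" if "i < -2" for i using U that by (auto simp: F0 pole_strength_def)
  have 2: "F 0 $$ (- 2) = of_real ((-1) ^ 0 * real (n * (n + 1)))" using U by (simp add: F0 pole_strength_def)
  have "\<exists>t::real. F 0 $$ (- 2) = of_real ((-1) ^ 0 * t) \<and> t \<ge> 0 \<and> (0 < n \<longrightarrow> t > 0) \<and> (0 \<ge> n \<longrightarrow> t = 0)"
    using 2 n by (intro exI[of _ "real (n * (n + 1))"]) (auto simp: add_pos_nonneg)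
  moreover have "\<exists>s::real. F 0 $$ (2 * int q - 1) = c * of_real ((-1) ^ 0 * s) \<and> (q \<le> 0 \<longrightarrow> s \<noteq> 0) \<and> (q \<le> 0 \<longrightarrow> 0 \<le> n \<longrightarrow> s > 0)"
    using c by (intro exI[of _ 1]) (simp add: F0)
  ultimately show ?case using 1 least by (simp add: F0)
next
  case (Suc j)
  note IH1 = conjunct1[OF Suc.IH] and IH2 = conjunct1[OF conjunct2[OF Suc.IH]]
    and IH3 = conjunct1[OF conjunct2[OF conjunct2[OF Suc.IH]]] and IH4 = conjunct2[OF conjunct2[OF conjunct2[OF Suc.IH]]]
  have below: "\<And>i. i < - 2 * int j - 2 \<Longrightarrow> F j $$ i = 0" using IH1 by simp
  have oddbelow: "\<And>i. odd i \<Longrightarrow> i < 2 * int q - 1 - 2 * int j \<Longrightarrow> F j $$ i = 0" using IH2 by simp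
  obtain t :: real where t: "F j $$ (- 2 * int j - 2) = of_real ((-1) ^ j * t)" "t \<ge> 0" "j < n \<Longrightarrow> t > 0" "j \<ge> n \<Longrightarrow> t = 0"
    using IH3 by (elim exE conjE) simp
  obtain s :: real where s: "F j $$ (2 * int q - 1 - 2 * int j) = c * of_real ((-1) ^ j * s)" "q \<le> j \<Longrightarrow> s \<noteq> 0" "q \<le> j \<Longrightarrow> j \<le> n \<Longrightarrow> s > 0"
    using IH4 by blast
  have rec: "of_int i * F (Suc j) $$ i =
    of_int ((i + 1) * (i - 2 * int n) * (i + 2 * int n + 2)) * F j $$ (i + 2)
    - (\<Sum>l=0..i - (- 2 * int j - 2). of_int (4 * i - 2 * l) * U $$ l * F j $$ (i - l))" for i
    by (rule step_nth) (rule below)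
  have 1: "F (Suc j) $$ i = 0" if "i < - 2 * int (Suc j) - 2" for i
    using rec[of i] that below[of "i + 2"] by simp
  have "\<exists>t'. F (Suc j) $$ (- 2 * int (Suc j) - 2) = of_real ((-1) ^ Suc j * t') \<and> t' \<ge> 0 \<and> (Suc j < n \<longrightarrow> t' > 0) \<and> (Suc j \<ge> n \<longrightarrow> t' = 0)"
  proof -
    define i where "i = - 2 * int (Suc j) - 2"
    define k where "k = real_of_int (i + 1) / real_of_int i * ((2 * real n - real_of_int i) * (real_of_int i + 2 * real n + 2))"
    have i: "real_of_int i < 0" "real_of_int i + 1 < 0" by (auto simp: i_def)
    have "of_int i * F (Suc j) $$ i = of_int ((i + 1) * (i - 2 * int n) * (i + 2 * int n + 2)) * F j $$ (i + 2)"
      using rec[of i] by (simp add: i_def)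
    also have i2: "i + 2 = - 2 * int j - 2" by (simp add: i_def)
    also have "F j $$ (- 2 * int j - 2) = of_real ((-1) ^ j * t)" by (rule t(1))
    also have "of_int ((i + 1) * (i - 2 * int n) * (i + 2 * int n + 2)) * of_real ((-1) ^ j * t) = of_int i * (of_real ((-1) ^ Suc j * (k * t)) :: complex)"
    proof -
      have "real_of_int ((i + 1) * (i - 2 * int n) * (i + 2 * int n + 2)) * ((-1) ^ j * t) = real_of_int i * ((-1) ^ Suc j * (k * t))"
      proof -
        have ik: "real_of_int i * k = real_of_int (i + 1) * ((2 * real n - real_of_int i) * (real_of_int i + 2 * real n + 2))"
          using i by (simp add: k_def)
        have "real_of_int i * ((-1) ^ Suc j * (k * t)) = - (real_of_int i * k) * ((-1) ^ j * t)" by simp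
        thus ?thesis unfolding ik by (simp add: algebra_simps)
      qed
      thus ?thesis by (metis of_real_mult of_real_of_int_eq)
    qed
    finally have "F (Suc j) $$ i = of_real ((-1) ^ Suc j * (k * t))"
      using i(1) by (simp only: mult_cancel_left of_int_eq_0_iff) auto
    moreover have pos: "k > 0" if "Suc j < n"
    proof -
      have "real_of_int i + 2 * real n + 2 > 0" "2 * real n - real_of_int i > 0" using that by (auto simp: i_def)
      moreover have "real_of_int (i + 1) / real_of_int i > 0" using i by (intro divide_neg_neg) auto
      ultimately show ?thesis unfolding k_def by (intro mult_pos_pos)
    qed
    moreover have "k * t = 0" if "Suc j \<ge> n"
    proof (cases "Suc j = n")
      case True
      hence "real_of_int i + 2 * real n + 2 = 0" by (auto simp: i_def)
      thus ?thesis by (simp add: k_def)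
    qed (use that t in auto)
    ultimately have "F (Suc j) $$ i = of_real ((-1) ^ Suc j * (k * t)) \<and> k * t \<ge> 0 \<and> (Suc j < n \<longrightarrow> k * t > 0) \<and> (Suc j \<ge> n \<longrightarrow> k * t = 0)"
      using t by (cases "Suc j < n") auto
    thus ?thesis unfolding i_def by blast
  qed
  moreover have oddrec: "of_int i * F (Suc j) $$ i = of_int ((i + 1) * (i - 2 * int n) * (i + 2 * int n + 2)) * F j $$ (i + 2)
     - (if i = 2 * int q - 1 - 2 * int (Suc j) then of_int (4 * i - 4 * int q + 2) * c * F j $$ (- 2 * int j - 2) else 0)"
    if i: "odd i" "i \<le> 2 * int q - 1 - 2 * int (Suc j)" for i
  proof -
    let ?T = "\<lambda>l. of_int (4 * i - 2 * l) * U $$ l * F j $$ (i - l)"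
    have z: "?T l = 0" if "l \<ge> 0" "l \<noteq> 2 * int q - 1 \<or> i \<noteq> 2 * int q - 1 - 2 * int (Suc j)" for l
    proof (cases "odd l")
      case True
      show ?thesis
      proof (cases "l < 2 * int q - 1")
        case True
        thus ?thesis using least[OF \<open>odd l\<close>] by simp
      next
        case False
        hence "i - l < - 2 * int j - 2" using i that by auto
        thus ?thesis using below by simp
      qed
    next
      case False
      hence "odd (i - l)" "i - l < 2 * int q - 1 - 2 * int j" using i that by auto
      thus ?thesis using oddbelow by simp
    qed
    show ?thesis
    proof (cases "i = 2 * int q - 1 - 2 * int (Suc j)")
      case True
      have "(\<Sum>l=0..i - (- 2 * int j - 2). ?T l) = (\<Sum>l\<in>{2 * int q - 1}. ?T l)"
        using q True by (intro sum.mono_neutral_right ballI z) auto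
      also have "\<dots> = of_int (4 * i - 4 * int q + 2) * c * F j $$ (- 2 * int j - 2)"
      proof -
        have "4 * i - 2 * (2 * int q - 1) = 4 * i - 4 * int q + 2" "i - (2 * int q - 1) = - 2 * int j - 2"
          using True by simp_all
        note e = this
        have "(\<Sum>l\<in>{2 * int q - 1}. ?T l) = ?T (2 * int q - 1)" by simp
        thus ?thesis by (simp only: e c(1))
      qed
      finally show ?thesis unfolding rec[of i] by (simp only: True if_True simp_thms)
    next
      case False
      hence "(\<Sum>l=0..i - (- 2 * int j - 2). ?T l) = 0" by (intro sum.neutral ballI z) simp_all
      thus ?thesis unfolding rec[of i] by (simp only: False if_False simp_thms)
    qed
  qed
  moreover have "F (Suc j) $$ i = 0" if i: "odd i" "i < 2 * int q - 1 - 2 * int (Suc j)" for i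
  proof -
    have "F j $$ (i + 2) = 0" using i by (intro oddbelow) auto
    moreover have "i \<le> 2 * int q - 1 - 2 * int (Suc j)" "i \<noteq> 2 * int q - 1 - 2 * int (Suc j)" using i by simp_all
    ultimately have "of_int i * F (Suc j) $$ i = 0" using oddrec[OF i(1)] by (simp only: if_False mult_zero_right diff_zero)
    moreover have "i \<noteq> 0" using i by auto
    ultimately show ?thesis by simp
  qed
  moreover have "\<exists>s'. F (Suc j) $$ (2 * int q - 1 - 2 * int (Suc j)) = c * of_real ((-1) ^ Suc j * s') \<and> (q \<le> Suc j \<longrightarrow> s' \<noteq> 0) \<and> (q \<le> Suc j \<longrightarrow> Suc j \<le> n \<longrightarrow> s' > 0)"
  proof -
    define i where "i = 2 * int q - 1 - 2 * int (Suc j)"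
    define k where "k = real_of_int (i + 1) / real_of_int i * ((2 * real n - real_of_int i) * (real_of_int i + 2 * real n + 2))"
    define k' where "k' = real_of_int (4 * i - 4 * int q + 2) / real_of_int i"
    have i0: "i \<noteq> 0" unfolding i_def by presburger
    have i2: "i + 2 = 2 * int q - 1 - 2 * int j" "odd i" by (auto simp: i_def)
    have Fi2: "F j $$ (i + 2) = c * of_real ((-1) ^ j * s)" using s(1) unfolding i2(1) .
    have "of_int i * F (Suc j) $$ i = of_int ((i + 1) * (i - 2 * int n) * (i + 2 * int n + 2)) * (c * of_real ((-1) ^ j * s))
       - of_int (4 * i - 4 * int q + 2) * c * of_real ((-1) ^ j * t)"
    proof -
      have "i \<le> 2 * int q - 1 - 2 * int (Suc j)" by (simp add: i_def)
      from oddrec[OF i2(2) this] show ?thesis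
        by (simp only: i_def[symmetric] simp_thms if_True Fi2 t(1))
    qed
    also have "\<dots> = of_int i * (c * of_real ((-1) ^ Suc j * (k * s + k' * t)))"
    proof -
      have "real_of_int ((i + 1) * (i - 2 * int n) * (i + 2 * int n + 2)) * ((-1) ^ j * s)
       - real_of_int (4 * i - 4 * int q + 2) * ((-1) ^ j * t) = real_of_int i * ((-1) ^ Suc j * (k * s + k' * t))"
      proof -
        have ik: "real_of_int i * k = real_of_int (i + 1) * ((2 * real n - real_of_int i) * (real_of_int i + 2 * real n + 2))"
          using i0 by (simp add: k_def)
        have ik': "real_of_int i * k' = real_of_int (4 * i - 4 * int q + 2)" using i0 by (simp add: k'_def)
        have "real_of_int i * ((-1) ^ Suc j * (k * s + k' * t)) = - (real_of_int i * k) * ((-1) ^ j * s) - (real_of_int i * k') * ((-1) ^ j * t)"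
          by (simp add: algebra_simps)
        thus ?thesis unfolding ik ik' by (simp add: algebra_simps)
      qed
      from arg_cong[OF this, of "\<lambda>x. c * of_real x"] show ?thesis
        by (simp only: of_real_mult of_real_of_int_eq of_real_diff right_diff_distrib mult.left_commute mult.assoc)
    qed
    finally have "F (Suc j) $$ i = c * of_real ((-1) ^ Suc j * (k * s + k' * t))"
      using i0 by (simp only: mult_cancel_left of_int_eq_0_iff) auto
    moreover have "k * s + k' * t > 0" if "q \<le> Suc j" "Suc j \<le> n"
    proof -
      have ineg: "i \<le> -1" using that by (simp add: i_def)
      have "k' > 0" unfolding k'_def using ineg q by (intro divide_neg_neg) auto
      hence "k' * t > 0" using t(3) that by simp
      moreover have "k * s \<ge> 0"
      proof (cases "q = Suc j")
        case True
        hence "i = -1" by (simp add: i_def)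
        thus ?thesis by (simp add: k_def)
      next
        case False
        hence "s > 0" using s(3) that by auto
        moreover have "k \<ge> 0" unfolding k_def using that ineg
          by (intro mult_nonneg_nonneg divide_nonpos_nonpos) (auto simp: i_def)
        ultimately show ?thesis by simp
      qed
      ultimately show ?thesis by simp
    qed
    moreover have "k * s + k' * t \<noteq> 0" if "q \<le> Suc j" "\<not> Suc j \<le> n"
    proof -
      have "t = 0" using t(4) that by simp
      have "q \<le> j" using that q by auto
      hence "s \<noteq> 0" by (rule s(2))
      have "i \<le> -3" using that q \<open>q \<le> j\<close> by (simp add: i_def)
      moreover have "2 * int n - i \<noteq> 0" "i + 2 * int n + 2 \<noteq> 0" using i2(2) by presburger+
      moreover have "k = real_of_int (i + 1) / real_of_int i * (real_of_int (2 * int n - i) * real_of_int (i + 2 * int n + 2))"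
        by (simp add: k_def)
      ultimately have "k \<noteq> 0" by (simp only: mult_eq_0_iff divide_eq_0_iff of_int_eq_0_iff) auto
      thus ?thesis using \<open>s \<noteq> 0\<close> \<open>t = 0\<close> by simp
    qed
    ultimately have "F (Suc j) $$ i = c * of_real ((-1) ^ Suc j * (k * s + k' * t)) \<and> (q \<le> Suc j \<longrightarrow> k * s + k' * t \<noteq> 0)
        \<and> (q \<le> Suc j \<longrightarrow> Suc j \<le> n \<longrightarrow> k * s + k' * t > 0)"
      by (cases "Suc j \<le> n") auto
    thus ?thesis unfolding i_def by blast
  qed
  ultimately show ?case using 1 by (intro conjI allI impI) assumption
qed

text \<open>
  If an odd coefficient survived, \<open>F g\<close> would have a nonzero coefficient, at \<open>2 q - 1 - 2 g\<close> if \<open>q \<le> g\<close> and at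
  \<open>- 2 g - 2\<close> otherwise, to which neither the earlier members nor a constant contribute.
\<close>
theorem linear_relation_imp_odd_coeffs_zero:
  assumes rel: "F g + (\<Sum>m=1..g. fls_const (k m) * F (g - m)) = fls_const d"
  shows "odd i \<Longrightarrow> i < 2 * int n + 1 \<Longrightarrow> U $$ i = 0"
proof (rule ccontr)
  assume i: "odd i" "i < 2 * int n + 1" "U $$ i \<noteq> 0"
  obtain q where q: "1 \<le> q" "q \<le> n" "U $$ (2 * int q - 1) \<noteq> 0" "\<And>l. odd l \<Longrightarrow> l < 2 * int q - 1 \<Longrightarrow> U $$ l = 0"
    using least_odd_coeff[OF U i] by blast
  note * = unbounded_poles[OF q(1,2) refl q(3,4)]
  show False
  proof (cases "g \<ge> q")
    case True
    let ?i = "2 * int q - 1 - 2 * int g"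
    have "F g $$ ?i \<noteq> 0" using *[of g] True q(3) by auto
    moreover have "F (g - m) $$ ?i = 0" if "m \<in> {1..g}" for m
      using *[of "g - m"] that by (auto simp: of_nat_diff)
    hence "(\<Sum>m=1..g. fls_const (k m) * F (g - m)) $$ ?i = 0" by (auto simp: fls_nth_sum intro!: sum.neutral)
    moreover have "fls_const d $$ ?i = 0"
    proof -
      have "?i \<noteq> 0" by presburger
      thus ?thesis by simp
    qed
    ultimately show False using arg_cong[OF rel, of "\<lambda>A. A $$ ?i"] by simp
  next
    case False
    let ?i = "- 2 * int g - 2"
    have "F g $$ ?i \<noteq> 0" using *[of g] False q(2) by auto
    moreover have "F (g - m) $$ ?i = 0" if "m \<in> {1..g}" for m
      using *[of "g - m"] that by (auto simp: of_nat_diff)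
    hence "(\<Sum>m=1..g. fls_const (k m) * F (g - m)) $$ ?i = 0" by (auto simp: fls_nth_sum intro!: sum.neutral)
    moreover have "fls_const d $$ ?i = 0" by simp
    ultimately show False using arg_cong[OF rel, of "\<lambda>A. A $$ ?i"] by simp
  qed
qed

end

section \<open>Differential polynomials\<close>

type_synonym monom = "nat \<Rightarrow>\<^sub>0 nat"

lemma poly_mapping_sum_single:
  fixes p :: "'a \<Rightarrow>\<^sub>0 'b :: comm_monoid_add"
  shows "p = (\<Sum>k\<in>Poly_Mapping.keys p. Poly_Mapping.single k (Poly_Mapping.lookup p k))"
proof (rule poly_mapping_eqI)
  fix k
  show "Poly_Mapping.lookup p k = Poly_Mapping.lookup (\<Sum>k\<in>Poly_Mapping.keys p. Poly_Mapping.single k (Poly_Mapping.lookup p k)) k"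
    by (simp add: lookup_sum lookup_single when_def sum.delta' not_in_keys_iff_lookup_eq_zero)
qed

lemma poly_mapping_single_induct:
  fixes p :: "'a \<Rightarrow>\<^sub>0 'b :: comm_monoid_add"
  assumes "\<And>k v. P (Poly_Mapping.single k v)" and "\<And>p q. P p \<Longrightarrow> P q \<Longrightarrow> P (p + q)"
  shows "P p"
proof -
  have "P (\<Sum>k\<in>A. Poly_Mapping.single k (Poly_Mapping.lookup p k))" if "finite A" for A
    using that
  proof (induction A rule: finite_induct)
    case empty
    show ?case using assms(1)[of undefined 0] by simp
  qed (use assms in auto)
  from this[of "Poly_Mapping.keys p"] show ?thesis using poly_mapping_sum_single[of p] by simp
qed

lemma monom_induct:
  fixes \<alpha> :: monom
  assumes "P 0" and "\<And>i. P (Poly_Mapping.single i 1)" and "\<And>\<alpha> \<beta>. P \<alpha> \<Longrightarrow> P \<beta> \<Longrightarrow> P (\<alpha> + \<beta>)"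
  shows "P \<alpha>"
proof (rule poly_mapping_single_induct)
  fix i k
  show "P (Poly_Mapping.single i k)"
  proof (induction k)
    case (Suc k)
    have "Poly_Mapping.single i (Suc k) = Poly_Mapping.single i k + Poly_Mapping.single i 1"
      by (simp flip: single_add)
    thus ?case using assms Suc by simp
  qed (use assms in simp)
qed (use assms in blast)

definition monom_deriv :: "monom \<Rightarrow> diff_poly" where
  "monom_deriv \<alpha> = (\<Sum>i\<in>Poly_Mapping.keys \<alpha>. Poly_Mapping.single
     (\<alpha> - Poly_Mapping.single i 1 + Poly_Mapping.single (Suc i) 1) (of_nat (Poly_Mapping.lookup \<alpha> i)))"

lemma monom_deriv_superset:
  assumes "finite A" "Poly_Mapping.keys \<alpha> \<subseteq> A"
  shows "monom_deriv \<alpha> = (\<Sum>i\<in>A. Poly_Mapping.single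
     (\<alpha> - Poly_Mapping.single i 1 + Poly_Mapping.single (Suc i) 1) (of_nat (Poly_Mapping.lookup \<alpha> i)))"
  unfolding monom_deriv_def using assms
  by (intro sum.mono_neutral_left) (auto simp: not_in_keys_iff_lookup_eq_zero)

lemma dp_deriv_superset:
  assumes "finite A" "Poly_Mapping.keys p \<subseteq> A"
  shows "dp_deriv p = (\<Sum>\<alpha>\<in>A. Poly_Mapping.single 0 (Poly_Mapping.lookup p \<alpha>) * monom_deriv \<alpha>)"
proof -
  have "dp_deriv p = (\<Sum>\<alpha>\<in>Poly_Mapping.keys p. Poly_Mapping.single 0 (Poly_Mapping.lookup p \<alpha>) * monom_deriv \<alpha>)"
    unfolding dp_deriv_def monom_deriv_def sum_distrib_left
    by (intro sum.cong refl) (simp add: mult_single mult.commute)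
  also have "\<dots> = (\<Sum>\<alpha>\<in>A. Poly_Mapping.single 0 (Poly_Mapping.lookup p \<alpha>) * monom_deriv \<alpha>)"
    using assms by (intro sum.mono_neutral_left) (auto simp: not_in_keys_iff_lookup_eq_zero)
  finally show ?thesis .
qed

lemma dp_deriv_single: "dp_deriv (Poly_Mapping.single \<alpha> c) = Poly_Mapping.single 0 c * monom_deriv \<alpha>"
  by (subst dp_deriv_superset[of "{\<alpha>}"]) (auto split: if_splits)

lemma dp_deriv_add: "dp_deriv (p + q) = dp_deriv p + dp_deriv q"
proof -
  let ?A = "Poly_Mapping.keys p \<union> Poly_Mapping.keys q"
  show ?thesis
    using keys_add[of p q]
    by (simp add: dp_deriv_superset[of ?A] lookup_add single_add distrib_right sum.distrib)
qed

lemma monom_deriv_0 [simp]: "monom_deriv 0 = 0"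
  by (simp add: monom_deriv_def)

lemma dp_deriv_const [simp]: "dp_deriv (Poly_Mapping.single 0 c) = 0"
  by (simp add: dp_deriv_single)

lemma dp_deriv_0 [simp]: "dp_deriv 0 = 0"
  using dp_deriv_const[of 0] by simp

lemma dp_deriv_minus: "dp_deriv (- p) = - dp_deriv p"
  using dp_deriv_add[of p "- p"] by (simp add: eq_neg_iff_add_eq_0 add.commute)

lemma dp_deriv_diff: "dp_deriv (p - q) = dp_deriv p - dp_deriv q"
  using dp_deriv_add[of p "- q"] by (simp add: dp_deriv_minus)

lemma dp_deriv_sum: "dp_deriv (\<Sum>i\<in>A. f i) = (\<Sum>i\<in>A. dp_deriv (f i))"
  by (induction A rule: infinite_finite_induct) (auto simp: dp_deriv_add)

lemma monom_shift_add:
  fixes \<alpha> \<beta> :: monom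
  assumes "Poly_Mapping.lookup \<alpha> i \<noteq> 0"
  shows "\<alpha> + \<beta> - Poly_Mapping.single i 1 + \<gamma> = (\<alpha> - Poly_Mapping.single i 1 + \<gamma>) + \<beta>"
  by (rule poly_mapping_eqI) (use assms in \<open>auto simp: lookup_add lookup_minus lookup_single when_def\<close>)

lemma monom_deriv_add:
  "monom_deriv (\<alpha> + \<beta>) = monom_deriv \<alpha> * Poly_Mapping.single \<beta> 1 + Poly_Mapping.single \<alpha> 1 * monom_deriv \<beta>"
proof -
  let ?A = "Poly_Mapping.keys \<alpha> \<union> Poly_Mapping.keys \<beta>"
  let ?s = "\<lambda>\<alpha> i. \<alpha> - Poly_Mapping.single i 1 + Poly_Mapping.single (Suc i) 1"
  have "monom_deriv (\<alpha> + \<beta>) = (\<Sum>i\<in>?A. Poly_Mapping.single (?s (\<alpha> + \<beta>) i) (of_nat (Poly_Mapping.lookup (\<alpha> + \<beta>) i)))"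
    using keys_add[of \<alpha> \<beta>] by (intro monom_deriv_superset) auto
  also have "\<dots> = (\<Sum>i\<in>?A. Poly_Mapping.single (?s \<alpha> i) (of_nat (Poly_Mapping.lookup \<alpha> i)) * Poly_Mapping.single \<beta> 1
      + Poly_Mapping.single \<alpha> 1 * Poly_Mapping.single (?s \<beta> i) (of_nat (Poly_Mapping.lookup \<beta> i)))"
  proof (intro sum.cong refl)
    fix i
    have a: "Poly_Mapping.single (?s (\<alpha> + \<beta>) i) (of_nat (Poly_Mapping.lookup \<alpha> i) :: complex)
       = Poly_Mapping.single (?s \<alpha> i + \<beta>) (of_nat (Poly_Mapping.lookup \<alpha> i))"
      by (cases "Poly_Mapping.lookup \<alpha> i = 0") (simp_all only: monom_shift_add of_nat_0 single_zero not_False_eq_True)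
    have b: "Poly_Mapping.single (?s (\<alpha> + \<beta>) i) (of_nat (Poly_Mapping.lookup \<beta> i) :: complex)
       = Poly_Mapping.single (\<alpha> + ?s \<beta> i) (of_nat (Poly_Mapping.lookup \<beta> i))"
      unfolding add.commute[of \<alpha>]
      by (cases "Poly_Mapping.lookup \<beta> i = 0") (simp_all only: monom_shift_add of_nat_0 single_zero not_False_eq_True)
    show "Poly_Mapping.single (?s (\<alpha> + \<beta>) i) (of_nat (Poly_Mapping.lookup (\<alpha> + \<beta>) i)) =
       Poly_Mapping.single (?s \<alpha> i) (of_nat (Poly_Mapping.lookup \<alpha> i)) * Poly_Mapping.single \<beta> 1
      + Poly_Mapping.single \<alpha> 1 * (Poly_Mapping.single (?s \<beta> i) (of_nat (Poly_Mapping.lookup \<beta> i)) :: diff_poly)"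
      unfolding lookup_add of_nat_add single_add a b mult_single by simp
  qed
  also have "\<dots> = monom_deriv \<alpha> * Poly_Mapping.single \<beta> 1 + Poly_Mapping.single \<alpha> 1 * monom_deriv \<beta>"
    by (simp only: sum.distrib sum_distrib_left sum_distrib_right monom_deriv_superset[of ?A] finite_UnI finite_keys Un_upper1 Un_upper2)
  finally show ?thesis .
qed

lemma single_split: "Poly_Mapping.single (\<alpha> :: monom) (c :: complex) = Poly_Mapping.single 0 c * Poly_Mapping.single \<alpha> 1"
  by (simp add: mult_single)

lemma dp_deriv_mult: "dp_deriv (p * q) = dp_deriv p * q + p * dp_deriv q"
proof (induction p rule: poly_mapping_single_induct)
  case (1 \<alpha> c)
  show ?case
  proof (induction q rule: poly_mapping_single_induct)
    case (1 \<beta> d)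
    have "dp_deriv (Poly_Mapping.single \<alpha> c * Poly_Mapping.single \<beta> d) = Poly_Mapping.single 0 c * Poly_Mapping.single 0 d * monom_deriv (\<alpha> + \<beta>)"
      by (simp add: mult_single dp_deriv_single)
    also have "\<dots> = (Poly_Mapping.single 0 c * monom_deriv \<alpha>) * (Poly_Mapping.single 0 d * Poly_Mapping.single \<beta> 1) +
       (Poly_Mapping.single 0 c * Poly_Mapping.single \<alpha> 1) * (Poly_Mapping.single 0 d * monom_deriv \<beta>)"
      unfolding monom_deriv_add by (simp add: algebra_simps)
    also have "\<dots> = dp_deriv (Poly_Mapping.single \<alpha> c) * Poly_Mapping.single \<beta> d + Poly_Mapping.single \<alpha> c * dp_deriv (Poly_Mapping.single \<beta> d)"
      by (simp only: dp_deriv_single single_split[symmetric])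
    finally show ?case .
  qed (simp add: distrib_left dp_deriv_add algebra_simps)
qed (simp add: distrib_right dp_deriv_add algebra_simps)

lemma dp_deriv_var: "dp_deriv (dp_var i) = dp_var (Suc i)"
  by (simp add: dp_var_def dp_deriv_single monom_deriv_def)

section \<open>Evaluation at Laurent series\<close>

definition monom_fls :: "complex fls \<Rightarrow> monom \<Rightarrow> complex fls" where
  "monom_fls U \<alpha> = (\<Prod>i\<in>Poly_Mapping.keys \<alpha>. ((fls_deriv ^^ i) U) ^ Poly_Mapping.lookup \<alpha> i)"

definition dp_fls :: "complex fls \<Rightarrow> diff_poly \<Rightarrow> complex fls" where
  "dp_fls U p = (\<Sum>\<alpha>\<in>Poly_Mapping.keys p. fls_const (Poly_Mapping.lookup p \<alpha>) * monom_fls U \<alpha>)"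

lemma dp_fls_superset:
  assumes "finite A" "Poly_Mapping.keys p \<subseteq> A"
  shows "dp_fls U p = (\<Sum>\<alpha>\<in>A. fls_const (Poly_Mapping.lookup p \<alpha>) * monom_fls U \<alpha>)"
  unfolding dp_fls_def using assms by (intro sum.mono_neutral_left) (auto simp: not_in_keys_iff_lookup_eq_zero)

lemma monom_fls_superset:
  assumes "finite A" "Poly_Mapping.keys \<alpha> \<subseteq> A"
  shows "monom_fls U \<alpha> = (\<Prod>i\<in>A. ((fls_deriv ^^ i) U) ^ Poly_Mapping.lookup \<alpha> i)"
  unfolding monom_fls_def using assms by (intro prod.mono_neutral_left) (auto simp: not_in_keys_iff_lookup_eq_zero)

lemma monom_fls_add: "monom_fls U (\<alpha> + \<beta>) = monom_fls U \<alpha> * monom_fls U \<beta>"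
  using keys_add[of \<alpha> \<beta>]
  by (simp add: monom_fls_superset[of "Poly_Mapping.keys \<alpha> \<union> Poly_Mapping.keys \<beta>"] lookup_add power_add prod.distrib)

lemma dp_fls_single: "dp_fls U (Poly_Mapping.single \<alpha> c) = fls_const c * monom_fls U \<alpha>"
  by (subst dp_fls_superset[of "{\<alpha>}"]) (auto split: if_splits)

lemma dp_fls_add: "dp_fls U (p + q) = dp_fls U p + dp_fls U q"
  using keys_add[of p q]
  by (simp add: dp_fls_superset[of "Poly_Mapping.keys p \<union> Poly_Mapping.keys q"] lookup_add distrib_right sum.distrib flip: fls_plus_const)

lemma dp_fls_0 [simp]: "dp_fls U 0 = 0" by (simp add: dp_fls_def)

lemma dp_fls_minus: "dp_fls U (- p) = - dp_fls U p"
  using dp_fls_add[of U p "- p"] by (simp add: eq_neg_iff_add_eq_0 add.commute)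

lemma dp_fls_diff: "dp_fls U (p - q) = dp_fls U p - dp_fls U q"
  using dp_fls_add[of U p "- q"] by (simp add: dp_fls_minus)

lemma dp_fls_mult: "dp_fls U (p * q) = dp_fls U p * dp_fls U q"
proof (induction p rule: poly_mapping_single_induct)
  case (1 \<alpha> c)
  show ?case
  proof (induction q rule: poly_mapping_single_induct)
    case (1 \<beta> d)
    show ?case by (simp add: mult_single dp_fls_single monom_fls_add flip: fls_const_mult_const)
  qed (simp add: distrib_left dp_fls_add)
qed (simp add: distrib_right dp_fls_add)

lemma monom_fls_0 [simp]: "monom_fls U 0 = 1"
  by (simp add: monom_fls_def)

lemma dp_fls_const [simp]: "dp_fls U (Poly_Mapping.single 0 c) = fls_const c"
  by (simp add: dp_fls_single monom_fls_def)

lemma dp_fls_numeral [simp]: "dp_fls U (numeral n) = numeral n"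
  using dp_fls_const[of U "numeral n"] by (simp del: dp_fls_const)

lemma monom_fls_single_1: "monom_fls U (Poly_Mapping.single i 1) = (fls_deriv ^^ i) U"
  by (simp add: monom_fls_def)

lemma dp_fls_var [simp]: "dp_fls U (dp_var i) = (fls_deriv ^^ i) U"
  unfolding dp_var_def dp_fls_single monom_fls_single_1 by simp

lemma dp_fls_monom_deriv: "dp_fls U (monom_deriv \<alpha>) = fls_deriv (monom_fls U \<alpha>)"
proof (induction \<alpha> rule: monom_induct)
  case 1
  show ?case by (simp add: monom_fls_def)
next
  case (2 i)
  have "monom_deriv (Poly_Mapping.single i 1) = dp_var (Suc i)"
    by (simp add: monom_deriv_def dp_var_def)
  thus ?case by (simp only: dp_fls_var monom_fls_single_1) simp
next
  case (3 \<alpha> \<beta>)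
  thus ?case by (simp add: monom_deriv_add monom_fls_add dp_fls_add dp_fls_mult dp_fls_single)
qed

lemma dp_fls_deriv: "dp_fls U (dp_deriv p) = fls_deriv (dp_fls U p)"
  by (induction p rule: poly_mapping_single_induct)
     (auto simp: dp_deriv_single dp_deriv_add dp_fls_add dp_fls_mult dp_fls_single dp_fls_monom_deriv)

lemma higher_deriv_has_laurent_expansion:
  assumes "(\<lambda>t. u (p + t)) has_laurent_expansion U"
  shows "(\<lambda>t. (deriv ^^ i) u (p + t)) has_laurent_expansion (fls_deriv ^^ i) U"
  by (induction i) (use assms has_laurent_expansion_deriv_shift in auto)

lemma dp_eval_has_laurent_expansion:
  assumes "(\<lambda>t. u (p + t)) has_laurent_expansion U"
  shows "(\<lambda>t. dp_eval q u (p + t)) has_laurent_expansion dp_fls U q"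
  unfolding dp_eval_def dp_fls_def monom_fls_def
  by (intro laurent_expansion_intros higher_deriv_has_laurent_expansion assms)

lemma kdv_sequence_lenard_series:
  assumes "kdv_sequence J" "pole_strength n U"
  shows "lenard_series n U (\<lambda>j. dp_fls U (J j))"
proof
  show "pole_strength n U" by fact
  show "dp_fls U (J 0) = U" using assms(1) by (simp add: kdv_sequence_def)
  fix j
  have "dp_deriv (J (Suc j)) = (dp_deriv ^^ 3) (J j) - 4 * dp_var 0 * dp_deriv (J j) - 2 * dp_var 1 * J j"
    using assms(1) by (simp add: kdv_sequence_def)
  hence "fls_deriv (dp_fls U (J (Suc j))) = dp_fls U ((dp_deriv ^^ 3) (J j) - 4 * dp_var 0 * dp_deriv (J j) - 2 * dp_var 1 * J j)"
    by (simp flip: dp_fls_deriv)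
  thus "fls_deriv (dp_fls U (J (Suc j))) = lenard_step U (dp_fls U (J j))"
    by (simp add: lenard_step_def dp_fls_diff dp_fls_mult dp_fls_deriv eval_nat_numeral)
qed

section \<open>Existence of the KdV sequence\<close>

text \<open>
  The generating series \<open>\<Lambda> = (\<Sum>k. gelfand_dikii k * s ^ k)\<close> is the root with constant term \<open>- 1 / 2\<close> of
  \<open>\<Lambda>\<^sup>2 = s (2 \<Lambda> \<Lambda>'' - \<Lambda>'\<^sup>2 - 4 u \<Lambda>\<^sup>2) + 1 / 4\<close>, the equation of the diagonal of the resolvent. In contrast to
  the differential recursion, this one yields each member without an integration, so that it shows the
  \<open>J\<^sub>n\<close> to be differential polynomials.
\<close>
function gelfand_dikii :: "nat \<Rightarrow> diff_poly" where
  "gelfand_dikii 0 = Poly_Mapping.single 0 (- 1 / 2)"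
| "gelfand_dikii (Suc k) = (\<Sum>i\<in>{1..k}. gelfand_dikii i * gelfand_dikii (Suc k - i))
     - (\<Sum>i\<in>{..k}. 2 * gelfand_dikii i * dp_deriv (dp_deriv (gelfand_dikii (k - i)))
         - dp_deriv (gelfand_dikii i) * dp_deriv (gelfand_dikii (k - i))
         - 4 * dp_var 0 * gelfand_dikii i * gelfand_dikii (k - i))"
  by pat_completeness auto
termination by (relation "Wellfounded.measure id") auto

declare gelfand_dikii.simps(2) [simp del]

lemma sum_flip: "(\<Sum>i\<le>k. f i (k - i)) = (\<Sum>i\<le>k. f (k - i) i :: 'a :: comm_monoid_add)" for k :: nat
  by (rule sum.reindex_bij_witness[of _ "\<lambda>i. k - i" "\<lambda>i. k - i"]) auto

lemma gelfand_dikii_0: "2 * gelfand_dikii 0 = -1"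
proof -
  have "2 * gelfand_dikii 0 = Poly_Mapping.single 0 2 * Poly_Mapping.single 0 (- 1 / 2)" by simp
  also have "\<dots> = Poly_Mapping.single 0 (- 1)" by (simp only: mult_single) simp
  also have "\<dots> = - 1" by (simp add: single_uminus)
  finally show ?thesis .
qed

lemma gelfand_dikii_quadratic:
  "(\<Sum>i\<le>Suc k. gelfand_dikii i * gelfand_dikii (Suc k - i)) =
     (\<Sum>i\<le>k. 2 * gelfand_dikii i * dp_deriv (dp_deriv (gelfand_dikii (k - i)))
         - dp_deriv (gelfand_dikii i) * dp_deriv (gelfand_dikii (k - i))
         - 4 * dp_var 0 * gelfand_dikii i * gelfand_dikii (k - i))"
proof -
  have "{..Suc k} = insert 0 (insert (Suc k) {1..k})" by auto
  hence "(\<Sum>i\<le>Suc k. gelfand_dikii i * gelfand_dikii (Suc k - i)) =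
     (2 * gelfand_dikii 0) * gelfand_dikii (Suc k) + (\<Sum>i\<in>{1..k}. gelfand_dikii i * gelfand_dikii (Suc k - i))"
    by (simp add: algebra_simps)
  thus ?thesis unfolding gelfand_dikii_0 by (simp add: gelfand_dikii.simps(2))
qed

text \<open>
  Let \<open>E k\<close> be the defect in the asserted recursion. Differentiating the quadratic relation shows that the
  convolution of \<open>2 \<Lambda>\<close> with the sequence of defects is zero. As \<open>2 \<Lambda>\<close> has constant term \<open>-1\<close>, the defects
  vanish one after the other.
\<close>
lemma gelfand_dikii_lenard:
  "dp_deriv (gelfand_dikii (Suc k)) = (dp_deriv ^^ 3) (gelfand_dikii k)
     - 4 * dp_var 0 * dp_deriv (gelfand_dikii k) - 2 * dp_var 1 * gelfand_dikii k"
proof -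
  let ?G = gelfand_dikii and ?D = dp_deriv and ?v = "dp_var 0"
  define L where "L = (\<lambda>p. ?D (?D (?D p)) - 4 * ?v * ?D p - 2 * dp_var 1 * p)"
  define E where "E k = ?D (?G (Suc k)) - L (?G k)" for k
  have num: "?D (numeral n) = 0" for n using dp_deriv_const[of "numeral n"] by (simp del: dp_deriv_const)
  have conv: "(\<Sum>i\<le>k. 2 * ?G i * E (k - i)) = 0" for k
  proof -
    have "(\<Sum>i\<le>k. 2 * ?G i * ?D (?G (Suc (k - i)))) = ?D (\<Sum>i\<le>Suc k. ?G i * ?G (Suc k - i))"
    proof -
      have "?D (\<Sum>i\<le>Suc k. ?G i * ?G (Suc k - i)) = (\<Sum>i\<le>Suc k. ?D (?G i) * ?G (Suc k - i)) + (\<Sum>i\<le>Suc k. ?G i * ?D (?G (Suc k - i)))"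
        by (simp only: dp_deriv_sum dp_deriv_mult sum.distrib)
      also have "(\<Sum>i\<le>Suc k. ?D (?G i) * ?G (Suc k - i)) = (\<Sum>i\<le>Suc k. ?D (?G (Suc k - i)) * ?G i)"
        by (rule sum_flip)
      also have "\<dots> + (\<Sum>i\<le>Suc k. ?G i * ?D (?G (Suc k - i))) = (\<Sum>i\<le>Suc k. 2 * ?G i * ?D (?G (Suc k - i)))"
        by (simp add: algebra_simps flip: sum.distrib)
      also have "\<dots> = (\<Sum>i\<le>k. 2 * ?G i * ?D (?G (Suc k - i)))" by simp
      also have "\<dots> = (\<Sum>i\<le>k. 2 * ?G i * ?D (?G (Suc (k - i))))"
        by (intro sum.cong refl) (simp add: Suc_diff_le)
      finally show ?thesis by simp
    qed
    also have "\<dots> = (\<Sum>i\<le>k. 2 * ?D (?G i) * ?D (?D (?G (k - i))) + 2 * ?G i * ?D (?D (?D (?G (k - i))))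
        - (?D (?D (?G i)) * ?D (?G (k - i)) + ?D (?G i) * ?D (?D (?G (k - i))))
        - (4 * dp_var 1 * ?G i * ?G (k - i) + 4 * ?v * ?D (?G i) * ?G (k - i) + 4 * ?v * ?G i * ?D (?G (k - i))))"
      unfolding gelfand_dikii_quadratic dp_deriv_sum
      by (intro sum.cong refl) (simp add: dp_deriv_diff dp_deriv_add dp_deriv_mult num dp_deriv_var algebra_simps)
    also have "\<dots> = 2 * (\<Sum>i\<le>k. ?D (?G i) * ?D (?D (?G (k - i)))) + (\<Sum>i\<le>k. 2 * ?G i * ?D (?D (?D (?G (k - i)))))
        - (\<Sum>i\<le>k. ?D (?D (?G i)) * ?D (?G (k - i))) - (\<Sum>i\<le>k. ?D (?G i) * ?D (?D (?G (k - i))))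
        - (\<Sum>i\<le>k. 4 * dp_var 1 * ?G i * ?G (k - i)) - (\<Sum>i\<le>k. 4 * ?v * ?D (?G i) * ?G (k - i)) - (\<Sum>i\<le>k. 4 * ?v * ?G i * ?D (?G (k - i)))"
      by (simp only: sum.distrib sum_subtractf sum_distrib_left mult.assoc) (simp add: algebra_simps)
    also have "(\<Sum>i\<le>k. ?D (?D (?G i)) * ?D (?G (k - i))) = (\<Sum>i\<le>k. ?D (?G i) * ?D (?D (?G (k - i))))"
      by (subst sum_flip) (simp add: mult.commute)
    also have "(\<Sum>i\<le>k. 4 * ?v * ?D (?G i) * ?G (k - i)) = (\<Sum>i\<le>k. 4 * ?v * ?G i * ?D (?G (k - i)))"
      by (subst sum_flip) (simp add: mult_ac)
    finally have "(\<Sum>i\<le>k. 2 * ?G i * ?D (?G (Suc (k - i)))) = (\<Sum>i\<le>k. 2 * ?G i * ?D (?D (?D (?G (k - i)))))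
        - (\<Sum>i\<le>k. 4 * dp_var 1 * ?G i * ?G (k - i)) - 2 * (\<Sum>i\<le>k. 4 * ?v * ?G i * ?D (?G (k - i)))"
      by (simp add: algebra_simps)
    also have "\<dots> = (\<Sum>i\<le>k. 2 * ?G i * L (?G (k - i)))"
      unfolding sum_distrib_left sum_subtractf[symmetric] L_def by (intro sum.cong refl) (simp add: algebra_simps)
    finally show ?thesis unfolding E_def by (simp only: right_diff_distrib sum_subtractf diff_self)
  qed
  have "E k = 0" for k
  proof (induction k rule: less_induct)
    case (less k)
    have "{..k} = insert 0 {1..k}" by auto
    hence "(\<Sum>i\<le>k. 2 * ?G i * E (k - i)) = (2 * ?G 0) * E k + (\<Sum>i\<in>{1..k}. 2 * ?G i * E (k - i))" by simp
    also have "(\<Sum>i\<in>{1..k}. 2 * ?G i * E (k - i)) = 0" using less by (intro sum.neutral) auto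
    finally show ?case using conv[of k] unfolding gelfand_dikii_0 by simp
  qed
  thus ?thesis by (simp add: E_def L_def eval_nat_numeral)
qed

lemma lookup_0_mult: "Poly_Mapping.lookup (p * q :: diff_poly) 0 = Poly_Mapping.lookup p 0 * Poly_Mapping.lookup q 0"
proof (induction p rule: poly_mapping_single_induct)
  case (1 \<alpha> c)
  show ?case
  proof (induction q rule: poly_mapping_single_induct)
    case (1 \<beta> d)
    have "\<alpha> + \<beta> = 0 \<longleftrightarrow> \<alpha> = 0 \<and> \<beta> = 0"
      by (auto simp: poly_mapping_eq_iff fun_eq_iff lookup_add)
    thus ?case by (auto simp: mult_single lookup_single when_def)
  qed (simp add: distrib_left lookup_add)
qed (simp add: distrib_right lookup_add)

lemma lookup_0_dp_deriv [simp]: "Poly_Mapping.lookup (dp_deriv p) 0 = 0"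
proof (induction p rule: poly_mapping_single_induct)
  case (1 \<alpha> c)
  have "\<alpha> - Poly_Mapping.single i 1 + Poly_Mapping.single (Suc i) (1::nat) \<noteq> 0" for i
  proof
    assume "\<alpha> - Poly_Mapping.single i 1 + Poly_Mapping.single (Suc i) (1::nat) = 0"
    from arg_cong[OF this, of "\<lambda>\<gamma>. Poly_Mapping.lookup \<gamma> (Suc i)"] show False by (simp add: lookup_add)
  qed
  hence "Poly_Mapping.lookup (monom_deriv \<alpha>) 0 = 0"
    by (simp add: monom_deriv_def lookup_sum lookup_single when_def)
  thus ?case by (simp add: dp_deriv_single lookup_0_mult)
qed (simp add: dp_deriv_add lookup_add)

lemma lookup_0_gelfand_dikii: "k > 0 \<Longrightarrow> Poly_Mapping.lookup (gelfand_dikii k) 0 = 0"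
proof (induction k rule: less_induct)
  case (less k)
  then obtain k' where k: "k = Suc k'" by (cases k) auto
  have "Poly_Mapping.single 0 1 \<noteq> (0 :: monom)"
    by (metis lookup_single_eq lookup_zero zero_neq_one)
  hence v: "Poly_Mapping.lookup (dp_var 0) 0 = 0" by (simp add: dp_var_def lookup_single when_def)
  show ?case using less.IH unfolding k gelfand_dikii.simps(2)
    by (simp add: lookup_minus lookup_sum lookup_0_mult v)
qed

lemma kdv_sequence_gelfand_dikii: "kdv_sequence (\<lambda>k. gelfand_dikii (Suc k))"
  unfolding kdv_sequence_def
proof (intro conjI allI)
  have "gelfand_dikii (Suc 0) = (2 * gelfand_dikii 0) * (2 * gelfand_dikii 0) * dp_var 0"
    unfolding gelfand_dikii.simps(2) by (simp add: algebra_simps)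
  thus "gelfand_dikii (Suc 0) = dp_var 0" by (simp add: gelfand_dikii_0 del: gelfand_dikii.simps)
qed (use gelfand_dikii_lenard lookup_0_gelfand_dikii in auto)

lemma kdv_sequence_exists: "\<exists>J. kdv_sequence J"
  using kdv_sequence_gelfand_dikii by blast

section \<open>Formal solutions at a pole\<close>

text \<open>
  The linear factors are those of the indicial polynomial with roots \<open>- n\<close> and \<open>n + 1\<close>.
\<close>
lemma schroedinger_nth:
  assumes V: "pole_strength n V" and A: "\<And>i. i < - int n \<Longrightarrow> A $$ i = 0"
  shows "(fls_deriv (fls_deriv A) - V * A) $$ (i - 2) =
    of_int ((i + int n) * (i - int n - 1)) * A $$ i - (\<Sum>l=0..i - 2 + int n. V $$ l * A $$ (i - 2 - l))"
proof -
  have V2: "V $$ l = 0" if "l < -2" for l using V that by (auto simp: pole_strength_def)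
  define T where "T l = V $$ l * A $$ (i - 2 - l)" for l
  have "(V * A) $$ (i - 2) = (\<Sum>l=-2..i - 2 - (- int n). T l)"
    unfolding T_def by (rule fls_times_nth_interval[OF V2 A])
  also have "\<dots> = T (-2) + T (-1) + (\<Sum>l=0..i - 2 + int n. T l)"
  proof (cases "i + int n \<ge> 1")
    case True
    have "{-2..i - 2 - (- int n)} = insert (-2) (insert (-1) {0..i - 2 + int n})" using True by auto
    thus ?thesis by simp
  next
    case False
    show ?thesis
    proof (cases "i + int n = 0")
      case True
      have s: "{-2..i - 2 - (- int n)} = {-2}" "{0..i - 2 + int n} = {}" using True by auto
      have "T (-1) = 0" using True A by (simp add: T_def)
      thus ?thesis unfolding s by simp
    next
      case False
      thus ?thesis using A \<open>\<not> i + int n \<ge> 1\<close> by (simp add: T_def)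
    qed
  qed
  also have "T (-1) = 0" using V by (simp add: T_def pole_strength_def)
  also have "T (-2) = of_int (int n * (int n + 1)) * A $$ i" using V by (simp add: T_def pole_strength_def algebra_simps)
  finally have X: "(V * A) $$ (i - 2) = of_int (int n * (int n + 1)) * A $$ i + (\<Sum>l=0..i - 2 + int n. T l)" by simp
  have Y: "fls_deriv (fls_deriv A) $$ (i - 2) = of_int (i * (i - 1)) * A $$ i"
    by (simp add: algebra_simps)
  have e: "(i + int n) * (i - int n - 1) = i * (i - 1) - int n * (int n + 1)" by (simp add: algebra_simps)
  have Z: "of_int ((i + int n) * (i - int n - 1)) * A $$ i = of_int (i * (i - 1)) * A $$ i - of_int (int n * (int n + 1)) * A $$ i"
    unfolding e of_int_diff left_diff_distrib ..
  show ?thesis unfolding fls_minus_nth X Y Z T_def by (simp only: diff_diff_eq)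
qed

lemma formal_solution_recursion:
  assumes V: "pole_strength n V" and A: "\<And>i. i < - int n \<Longrightarrow> A $$ i = 0"
    and eq: "fls_deriv (fls_deriv A) = V * A"
  shows "of_int ((i + int n) * (i - int n - 1)) * A $$ i = (\<Sum>l=0..i - 2 + int n. V $$ l * A $$ (i - 2 - l))"
proof -
  have "0 = of_int ((i + int n) * (i - int n - 1)) * A $$ i - (\<Sum>l=0..i - 2 + int n. V $$ l * A $$ (i - 2 - l))"
    using schroedinger_nth[OF V A, of i] unfolding eq by (simp only: diff_self fls_zero_nth)
  from this[symmetric] show ?thesis by (simp only: right_minus_eq)
qed

lemma fls_conv_radius_bound:
  assumes "fls_conv_radius V > 0"
  obtains K R where "K > 0" "R \<ge> 1" "\<And>l. l \<ge> 0 \<Longrightarrow> cmod (V $$ l) \<le> K * R ^ nat l"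
proof -
  have "fps_conv_radius (fls_regpart V) > 0" using assms by (simp add: fps_conv_radius_fls_regpart)
  then obtain r where r: "0 < ereal r" "ereal r < fps_conv_radius (fls_regpart V)"
    using ereal_dense2 by blast
  hence r0: "r > 0" by simp
  have "summable (\<lambda>l. fps_nth (fls_regpart V) l * of_real r ^ l)"
    using r by (intro summable_fps) auto
  hence "bounded (range (\<lambda>l. fps_nth (fls_regpart V) l * of_real r ^ l))"
    using summable_LIMSEQ_zero convergent_imp_bounded by (metis convergentI)
  then obtain B where B: "B > 0" "\<And>l. cmod (fps_nth (fls_regpart V) l * of_real r ^ l) \<le> B"
    unfolding bounded_pos by auto
  define R where "R = max 1 (1 / r)"
  show ?thesis
  proof (rule that[of B R])
    show "B > 0" by fact
    show "R \<ge> 1" by (simp add: R_def)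
    fix l :: int assume l: "l \<ge> 0"
    have "cmod (V $$ l) * r ^ nat l \<le> B" using B(2)[of "nat l"] l r0 by (simp add: norm_mult norm_power)
    hence "cmod (V $$ l) \<le> B * (1 / r) ^ nat l" using r0 by (simp add: field_simps)
    also have "\<dots> \<le> B * R ^ nat l" using B(1) r0 by (intro mult_left_mono power_mono) (auto simp: R_def)
    finally show "cmod (V $$ l) \<le> B * R ^ nat l" .
  qed
qed

text \<open>
  Beyond the second exponent, the factor on the left of the recursion is at least \<open>k\<close>, which compensates
  for the number of terms on the right. A geometric bound \<open>D * R ^ k\<close> therefore propagates as soon as
  \<open>R\<^sup>2\<close> is at least the constant in the bound on the coefficients of \<open>V\<close>.
\<close>
lemma formal_solution_converges:
  assumes V: "pole_strength n V" and rad: "fls_conv_radius V > 0" and A: "\<And>i. i < - int n \<Longrightarrow> A $$ i = 0"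
    and eq: "fls_deriv (fls_deriv A) = V * A"
  shows "fls_conv_radius A > 0"
proof -
  obtain K R0 where K: "K > 0" "R0 \<ge> 1" "\<And>l. l \<ge> 0 \<Longrightarrow> cmod (V $$ l) \<le> K * R0 ^ nat l"
    using fls_conv_radius_bound[OF rad] by blast
  define R where "R = max R0 (sqrt K)"
  have R: "R \<ge> 1" using K by (simp add: R_def)
  have KR: "K \<le> R ^ 2"
  proof -
    have "K = sqrt K ^ 2" using K by simp
    also have "\<dots> \<le> R ^ 2" using K by (intro power_mono) (auto simp: R_def)
    finally show ?thesis .
  qed
  have VR: "cmod (V $$ int l) \<le> K * R ^ l" for l
  proof -
    have "cmod (V $$ int l) \<le> K * R0 ^ l" using K(3)[of "int l"] by simp
    also have "\<dots> \<le> K * R ^ l" using K by (intro mult_left_mono power_mono) (auto simp: R_def)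
    finally show ?thesis .
  qed
  define a where "a k = A $$ (int k - int n)" for k
  define D where "D = (\<Sum>k\<le>2*n+1. cmod (a k))"
  have D0: "D \<ge> 0" unfolding D_def by (intro sum_nonneg) auto
  have bound: "cmod (a k) \<le> D * R ^ k" for k
  proof (induction k rule: less_induct)
    case (less k)
    show ?case
    proof (cases "k \<le> 2 * n + 1")
      case True
      hence "cmod (a k) \<le> D" unfolding D_def by (intro member_le_sum) auto
      also have "\<dots> \<le> D * R ^ k" using R D0 mult_left_mono[of 1 "R ^ k" D] by (simp add: one_le_power)
      finally show ?thesis .
    next
      case False
      define i where "i = int k - int n"
      have fac: "int k \<le> (i + int n) * (i - int n - 1)"
        using False mult_left_mono[of 1 "i - int n - 1" "int k"] by (simp add: i_def)
      have "real k * cmod (a k) \<le> real_of_int ((i + int n) * (i - int n - 1)) * cmod (a k)"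
      proof (rule mult_right_mono[OF _ norm_ge_zero])
        show "real k \<le> real_of_int ((i + int n) * (i - int n - 1))"
          using fac by (metis of_int_le_iff of_int_of_nat_eq)
      qed
      also have "\<dots> = cmod (of_int ((i + int n) * (i - int n - 1)) * A $$ i)"
      proof -
        have "0 \<le> (i + int n) * (i - int n - 1)" using fac by linarith
        thus ?thesis by (simp only: norm_mult norm_of_int abs_of_nonneg of_int_0_le_iff a_def i_def)
      qed
      also have "\<dots> = cmod (\<Sum>l=0..i - 2 + int n. V $$ l * A $$ (i - 2 - l))"
        by (simp only: formal_solution_recursion[OF V A eq])
      also have "(\<Sum>l=0..i - 2 + int n. V $$ l * A $$ (i - 2 - l)) = (\<Sum>l\<le>k-2. V $$ int l * a (k - 2 - l))"
        by (rule sum.reindex_bij_witness[of _ int nat]) (use False in \<open>auto simp: i_def a_def of_nat_diff algebra_simps\<close>)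
      also have "cmod \<dots> \<le> (\<Sum>l\<le>k-2. K * D * R ^ (k - 2))"
      proof (rule sum_norm_le)
        fix l assume l: "l \<in> {..k-2}"
        have "cmod (V $$ int l * a (k - 2 - l)) \<le> (K * R ^ l) * (D * R ^ (k - 2 - l))"
          unfolding norm_mult using less[of "k - 2 - l"] VR[of l] False K R by (intro mult_mono) auto
        also have "\<dots> = K * D * (R ^ l * R ^ (k - 2 - l))" by simp
        also have "R ^ l * R ^ (k - 2 - l) = R ^ (l + (k - 2 - l))" by (rule power_add[symmetric])
        also have "l + (k - 2 - l) = k - 2" using l by simp
        finally show "cmod (V $$ int l * a (k - 2 - l)) \<le> K * D * R ^ (k - 2)" .
      qed
      also have "\<dots> = real (k - 1) * (K * (D * R ^ (k - 2)))" using False by (simp add: of_nat_diff)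
      also have "\<dots> \<le> real k * (R ^ 2 * (D * R ^ (k - 2)))"
        using KR D0 R K by (intro mult_mono mult_right_mono) auto
      also have "R ^ 2 * (D * R ^ (k - 2)) = D * R ^ k"
      proof -
        have "R ^ 2 * R ^ (k - 2) = R ^ (2 + (k - 2))" by (rule power_add[symmetric])
        also have "2 + (k - 2) = k" using False by simp
        finally show ?thesis by (simp only: mult.left_commute)
      qed
      finally have "real k * cmod (a k) \<le> real k * (D * R ^ k)" .
      moreover have "real k > 0" using False by simp
      ultimately show ?thesis by (rule mult_left_le_imp_le)
    qed
  qed
  have "summable (\<lambda>k. fps_nth (fls_regpart A) k * of_real (1 / (2 * R)) ^ k)"
  proof (rule summable_comparison_test')
    show "summable (\<lambda>k. D * R ^ n * (1 / 2) ^ k)" by (intro summable_mult summable_geometric) auto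
    fix k
    have "norm (fps_nth (fls_regpart A) k * of_real (1 / (2 * R)) ^ k) = cmod (a (k + n)) * (1 / (2 * R)) ^ k"
      using R by (simp add: a_def norm_mult norm_power norm_divide)
    also have "\<dots> \<le> (D * R ^ (k + n)) * (1 / (2 * R)) ^ k"
      by (intro mult_right_mono bound) (use R in auto)
    also have "\<dots> = D * R ^ n * (1 / 2) ^ k" using R by (simp add: power_add power_divide power_mult_distrib)
    finally show "norm (fps_nth (fls_regpart A) k * of_real (1 / (2 * R)) ^ k) \<le> D * R ^ n * (1 / 2) ^ k" .
  qed
  hence le: "ereal (norm (of_real (1 / (2 * R)) :: complex)) \<le> conv_radius (fps_nth (fls_regpart A))"
    by (rule conv_radius_geI)
  have "0 < ereal (norm (of_real (1 / (2 * R)) :: complex))" using R by simp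
  from less_le_trans[OF this le] show ?thesis unfolding fls_conv_radius_def fps_conv_radius_def .
qed

lemma has_laurent_expansion_0_imp_eventually:
  assumes "(\<lambda>t. f (p + t)) has_laurent_expansion 0"
  shows "eventually (\<lambda>x. f x = 0) (at p)"
  using has_laurent_expansion_eventually_zero_iff[OF assms] by simp

lemma formal_solution_realize:
  assumes v: "(\<lambda>t. v (p + t)) has_laurent_expansion V" and V: "pole_strength n V"
    and A: "\<And>i. i < - int n \<Longrightarrow> A $$ i = 0" and eq: "fls_deriv (fls_deriv A) = V * A"
  obtains \<psi> \<rho> where "\<rho> > 0" "\<psi> holomorphic_on ball p \<rho> - {p}" "(\<lambda>t. \<psi> (p + t)) has_laurent_expansion A"
    "\<And>x. x \<in> ball p \<rho> - {p} \<Longrightarrow> deriv (deriv \<psi>) x = v x * \<psi> x"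
proof -
  have "fls_conv_radius V > 0" using v by (simp add: has_laurent_expansion_def)
  hence rad: "fls_conv_radius A > 0" using formal_solution_converges V A eq by blast
  define \<psi> where "\<psi> = (\<lambda>x. eval_fls A (x - p))"
  have \<psi>: "(\<lambda>t. \<psi> (p + t)) has_laurent_expansion A"
    using rad by (simp add: \<psi>_def eval_fls_has_laurent_expansion)
  have "(\<lambda>t. deriv (deriv \<psi>) (p + t) - v (p + t) * \<psi> (p + t)) has_laurent_expansion fls_deriv (fls_deriv A) - V * A"
    by (intro has_laurent_expansion_diff has_laurent_expansion_mult has_laurent_expansion_deriv_shift \<psi> v)
  hence "eventually (\<lambda>x. deriv (deriv \<psi>) x - v x * \<psi> x = 0) (at p)"
    using eq by (intro has_laurent_expansion_0_imp_eventually) simp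
  then obtain r1 where r1: "r1 > 0" "\<And>x. x \<noteq> p \<Longrightarrow> dist x p < r1 \<Longrightarrow> deriv (deriv \<psi>) x - v x * \<psi> x = 0"
    unfolding eventually_at by blast
  obtain r2 where r2: "0 < ereal r2" "ereal r2 < fls_conv_radius A" using rad ereal_dense2 by blast
  show ?thesis
  proof (rule that[of "min r1 r2" \<psi>])
    show "min r1 r2 > 0" using r1 r2 by simp
    show "\<psi> holomorphic_on ball p (min r1 r2) - {p}"
    proof -
      have *: "eval_fls A holomorphic_on ball 0 r2 - {0}"
      proof (rule holomorphic_on_eval_fls)
        have "ball 0 r2 \<subseteq> eball 0 (fls_conv_radius A)" by (rule ball_eball_mono) (use r2 in simp)
        thus "ball 0 r2 - {0} \<subseteq> eball 0 (fls_conv_radius A) - (if 0 \<le> fls_subdegree A then {} else {0})"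
          by (auto simp del: mem_ball in_eball_iff)
      qed
      have "eval_fls A \<circ> (\<lambda>x. x - p) holomorphic_on ball p (min r1 r2) - {p}"
        by (intro holomorphic_on_compose_gen[OF _ *]) (auto intro!: holomorphic_intros simp: dist_norm norm_minus_commute)
      thus ?thesis by (simp add: \<psi>_def o_def)
    qed
  qed (use r1 \<psi> in \<open>auto simp: dist_commute\<close>)
qed

section \<open>Existence of formal solutions\<close>

text \<open>
  The coefficient at the exponent \<open>k - n\<close> of the solution with the prescribed values \<open>\<alpha>\<close> and \<open>\<beta>\<close> at the two
  roots of the indicial polynomial.
\<close>
function frob_coeff :: "nat \<Rightarrow> complex fls \<Rightarrow> complex \<Rightarrow> complex \<Rightarrow> nat \<Rightarrow> complex" where
  "frob_coeff n V \<alpha> \<beta> k = (if k = 0 then \<alpha> else if k = 2 * n + 1 then \<beta>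
     else (\<Sum>j\<in>{..<k-1}. V $$ (int k - 2 - int j) * frob_coeff n V \<alpha> \<beta> j) / of_int (int k * (int k - 2 * int n - 1)))"
  by auto
termination by (relation "Wellfounded.measure (\<lambda>(n, V, \<alpha>, \<beta>, k). k)") auto
declare frob_coeff.simps [simp del]

text \<open>
  The recursion is obstructed only at \<open>i = n + 1\<close>, the step \<open>k = 2 n + 1\<close> counted from the exponent \<open>- n\<close>.
  Since the low odd coefficients of \<open>V\<close> vanish, so do the coefficients of the solution in the odd steps below
  \<open>2 n + 1\<close>, and every term on the right-hand side of the obstructed equation contains a factor of one of these
  two kinds.
\<close>
lemma formal_solution_exists:
  assumes V: "pole_strength n V" and odd: "\<And>i. odd i \<Longrightarrow> i < 2 * int n + 1 \<Longrightarrow> V $$ i = 0"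
  obtains A where "fls_deriv (fls_deriv A) = V * A" "\<And>i. i < - int n \<Longrightarrow> A $$ i = 0"
    "A $$ (- int n) = \<alpha>" "A $$ (int n + 1) = \<beta>"
proof -
  define a where "a = frob_coeff n V \<alpha> \<beta>"
  define A where "A = fls_shift (int n) (fps_to_fls (Abs_fps a))"
  have A: "A $$ i = (if i < - int n then 0 else a (nat (i + int n)))" for i :: int
    by (simp add: A_def)
  have Aodd: "a k = 0" if "odd k" "k < 2 * n + 1" for k
    using that
  proof (induction k rule: less_induct)
    case (less k)
    have "(\<Sum>j\<in>{..<k-1}. V $$ (int k - 2 - int j) * a j) = 0"
    proof (intro sum.neutral ballI)
      fix j assume j: "j \<in> {..<k-1}"
      show "V $$ (int k - 2 - int j) * a j = 0"
      proof (cases "odd j")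
        case True
        thus ?thesis using less.IH[of j] j less.prems by auto
      next
        case False
        hence "odd (int k - 2 - int j)" using less.prems by auto
        thus ?thesis using odd[of "int k - 2 - int j"] less.prems by auto
      qed
    qed
    thus ?case using less.prems unfolding a_def by (subst frob_coeff.simps) (auto elim: oddE)
  qed
  have rec: "of_int (int k * (int k - 2 * int n - 1)) * a k = (\<Sum>j\<in>{..<k-1}. V $$ (int k - 2 - int j) * a j)" for k
  proof -
    consider "k = 0" | "k = 2 * n + 1" | "k \<noteq> 0" "k \<noteq> 2 * n + 1" by blast
    thus ?thesis
    proof cases
      case 2
      have "(\<Sum>j\<in>{..<k-1}. V $$ (int k - 2 - int j) * a j) = 0"
      proof (intro sum.neutral ballI)
        fix j assume j: "j \<in> {..<k-1}"
        show "V $$ (int k - 2 - int j) * a j = 0"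
        proof (cases "odd j")
          case True
          thus ?thesis using Aodd[of j] j 2 by auto
        next
          case False
          hence "odd (int k - 2 - int j)" using 2 by auto
          thus ?thesis using odd[of "int k - 2 - int j"] 2 by auto
        qed
      qed
      thus ?thesis using 2 by simp
    next
      case 3
      have "int k * (int k - 2 * int n - 1) \<noteq> 0" using 3 by auto
      hence "(of_int (int k * (int k - 2 * int n - 1)) :: complex) \<noteq> 0" by (simp only: of_int_eq_0_iff not_False_eq_True)
      thus ?thesis using 3 unfolding a_def by (subst frob_coeff.simps) simp
    qed simp
  qed
  have A0: "A $$ i = 0" if "i < - int n" for i using that by (simp add: A)
  have "fls_deriv (fls_deriv A) - V * A = 0"
  proof (rule fls_eqI)
    fix j :: int
    define i where "i = j + 2"
    have "(fls_deriv (fls_deriv A) - V * A) $$ (i - 2) = 0"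
    proof (cases "i < - int n")
      case True
      thus ?thesis by (subst schroedinger_nth[OF V A0]) (simp_all add: A0)
    next
      case False
      define k where "k = nat (i + int n)"
      have k: "i = int k - int n" using False by (simp add: k_def)
      have "(\<Sum>l=0..i - 2 + int n. V $$ l * A $$ (i - 2 - l)) = (\<Sum>j\<in>{..<k-1}. V $$ (int k - 2 - int j) * a j)"
      proof (rule sum.reindex_bij_witness[of _ "\<lambda>j. int k - 2 - int j" "\<lambda>l. nat (int k - 2 - l)"])
        fix l assume l: "l \<in> {0..i - 2 + int n}"
        hence l': "0 \<le> l" "l \<le> int k - 2" by (auto simp: k)
        thus "int k - 2 - int (nat (int k - 2 - l)) = l" "nat (int k - 2 - l) \<in> {..<k - 1}" by auto
        have "i - 2 - l + int n = int k - 2 - l" "\<not> i - 2 - l < - int n" using l' k by linarith+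
        hence "A $$ (i - 2 - l) = a (nat (int k - 2 - l))" unfolding A by (simp only: if_False)
        thus "V $$ (int k - 2 - int (nat (int k - 2 - l))) * a (nat (int k - 2 - l)) = V $$ l * A $$ (i - 2 - l)"
          using l' by simp
      qed (auto simp: k)
      moreover have "(i + int n) * (i - int n - 1) = int k * (int k - 2 * int n - 1)" by (simp add: k algebra_simps)
      moreover have "A $$ i = a k" by (simp add: A k)
      ultimately show ?thesis by (subst schroedinger_nth[OF V A0]) (simp_all only: rec diff_self)
    qed
    thus "(fls_deriv (fls_deriv A) - V * A) $$ j = 0 $$ j" by (simp add: i_def)
  qed
  thus ?thesis
  proof (intro that[of A])
    show "A $$ (- int n) = \<alpha>" by (simp add: A a_def frob_coeff.simps)
    have "nat (2 * int n + 1) = 2 * n + 1" by simp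
    thus "A $$ (int n + 1) = \<beta>" by (simp add: A a_def frob_coeff.simps)
  qed (auto simp: A0)
qed

text \<open>
  The recursion has no freedom except at the two exponents.
\<close>
lemma formal_solution_coeff_zero:
  assumes V: "pole_strength n V" and A: "\<And>i. i < - int n \<Longrightarrow> A $$ i = 0"
    and eq: "fls_deriv (fls_deriv A) = V * A" and init: "A $$ (- int n) = 0"
    and i: "A $$ (int n + 1) = 0 \<or> i < int n + 1"
  shows "A $$ i = 0"
proof -
  have coeff: "A $$ (int n + 1) = 0 \<or> int k - int n < int n + 1 \<Longrightarrow> A $$ (int k - int n) = 0" for k
  proof (induction k rule: less_induct)
    case (less k)
    define i where "i = int k - int n"
    have "(\<Sum>l=0..i - 2 + int n. V $$ l * A $$ (i - 2 - l)) = 0"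
    proof (intro sum.neutral ballI)
      fix l assume l: "l \<in> {0..i - 2 + int n}"
      have *: "int (nat (i - 2 - l + int n)) - int n = i - 2 - l" "nat (i - 2 - l + int n) < k" using l by (auto simp: i_def)
      have "A $$ (int n + 1) = 0 \<or> i - 2 - l < int n + 1" using less.prems l by (auto simp: i_def)
      hence "A $$ (i - 2 - l) = 0" using less.IH[OF *(2)] unfolding *(1) by blast
      thus "V $$ l * A $$ (i - 2 - l) = 0" by simp
    qed
    hence "of_int ((i + int n) * (i - int n - 1)) * A $$ i = 0"
      using formal_solution_recursion[OF V A eq, of i] by simp
    hence "i + int n = 0 \<or> i - int n - 1 = 0 \<or> A $$ i = 0" by (simp only: mult_eq_0_iff of_int_eq_0_iff) auto
    moreover have "i = - int n" if "i + int n = 0" using that by simp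
    moreover have "i = int n + 1" if "i - int n - 1 = 0" using that by simp
    ultimately have "A $$ i = 0 \<or> i = int n + 1" using init by metis
    thus ?case using less.prems unfolding i_def[symmetric] by auto
  qed
  show ?thesis using A[of i] coeff[of "nat (i + int n)"] i by (cases "i < - int n") auto
qed

section \<open>Dependence on the energy\<close>

text \<open>
  The leading coefficients below have a known sign but an unwieldy absolute value. Recording the sign
  relative to \<open>c\<close> suffices because all contributions to them agree in sign.
\<close>
definition sgn_val :: "nat \<Rightarrow> complex \<Rightarrow> complex \<Rightarrow> bool" where
  "sgn_val j c w \<longleftrightarrow> (\<exists>t>0. w = c * of_real ((-1) ^ j * t))"

lemma sgn_val_add: "sgn_val j c v \<Longrightarrow> sgn_val j c w \<Longrightarrow> sgn_val j c (v + w)"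
proof -
  assume "sgn_val j c v" "sgn_val j c w"
  then obtain s t where "s > 0" "v = c * of_real ((-1) ^ j * s)" "t > 0" "w = c * of_real ((-1) ^ j * t)"
    unfolding sgn_val_def by blast
  thus ?thesis unfolding sgn_val_def by (intro exI[of _ "s + t"]) (simp add: algebra_simps)
qed

lemma sgn_val_mult: "sgn_val j 1 v \<Longrightarrow> sgn_val j c (c * v)"
  unfolding sgn_val_def by auto

lemma sgn_val_divide_neg:
  assumes "sgn_val j c v" "x < (0::real)"
  shows "sgn_val (Suc j) c (v / of_real x)"
proof -
  obtain t where "t > 0" "v = c * of_real ((-1) ^ j * t)" using assms unfolding sgn_val_def by blast
  thus ?thesis unfolding sgn_val_def using assms(2)
    by (intro exI[of _ "t / - x"]) (simp add: divide_pos_neg)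
qed

lemma sgn_val_nonzero: "sgn_val j c v \<Longrightarrow> c \<noteq> 0 \<Longrightarrow> v \<noteq> 0"
  unfolding sgn_val_def by auto

text \<open>
  The coefficient at the exponent \<open>k - n\<close> of a formal solution with leading coefficient \<open>1\<close> for the potential
  \<open>U + E\<close>, as a polynomial in the energy \<open>E\<close>.
\<close>
function frob_poly :: "nat \<Rightarrow> complex fls \<Rightarrow> nat \<Rightarrow> complex poly" where
  "frob_poly n U k = (if k = 0 then 1 else
     smult (1 / of_real (real k * (real k - 2 * real n - 1)))
       ((\<Sum>j\<in>{..<k-1}. smult (U $$ (int k - 2 - int j)) (frob_poly n U j))
        + (if k \<ge> 2 then pCons 0 (frob_poly n U (k - 2)) else 0)))"
  by auto
termination by (relation "Wellfounded.measure (\<lambda>(n, U, k). k)") auto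
declare frob_poly.simps [simp del]

text \<open>
  The right-hand side of the same recursion. At \<open>k = 2 n + 1\<close> it is the obstruction to a formal solution
  starting at the exponent \<open>- n\<close>.
\<close>
definition frob_rhs :: "nat \<Rightarrow> complex fls \<Rightarrow> nat \<Rightarrow> complex poly" where
  "frob_rhs n U k = (\<Sum>j\<in>{..<k-1}. smult (U $$ (int k - 2 - int j)) (frob_poly n U j))
        + (if k \<ge> 2 then pCons 0 (frob_poly n U (k - 2)) else 0)"

lemma frob_poly_pos: "k > 0 \<Longrightarrow> frob_poly n U k = smult (1 / of_real (real k * (real k - 2 * real n - 1))) (frob_rhs n U k)"
  unfolding frob_rhs_def by (subst frob_poly.simps) simp

text \<open>
  For \<open>0 < k \<le> 2 n\<close> the recursion divides by the negative number \<open>k (k - 2 n - 1)\<close>, so signs alternate with the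
  degree. In even steps the degree is \<open>k / 2\<close>; in odd steps it is \<open>(k - 1) / 2 - q\<close>, and the leading coefficient
  arises from \<open>c\<close> times that of an even step and from that of the odd step \<open>k - 2\<close>, which have the same sign
  relative to \<open>c\<close>. The predicate \<open>C P k s\<close> records degree and sign, the latter shifted by \<open>s\<close> so that it serves
  before and after the division.
\<close>
lemma frob_poly_coeffs:
  assumes q: "1 \<le> q" "q \<le> n" and c: "U $$ (2 * int q - 1) = c"
    and least: "\<And>i. odd i \<Longrightarrow> i < 2 * int q - 1 \<Longrightarrow> U $$ i = 0"
  defines "C \<equiv> (\<lambda>P k s. \<forall>i.
      (even k \<longrightarrow> (2 * i > k \<longrightarrow> coeff P i = 0) \<and> (2 * i = k \<longrightarrow> sgn_val (i + s) 1 (coeff P i)))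
    \<and> (odd k \<longrightarrow> (2 * i + 2 * q + 1 > k \<longrightarrow> coeff P i = 0) \<and> (2 * i + 2 * q + 1 = k \<longrightarrow> sgn_val (Suc i + s) c (coeff P i))))"
  shows "k \<le> 2 * n \<Longrightarrow> C (frob_poly n U k) k 0"
    and "0 < k \<Longrightarrow> k \<le> 2 * n + 1 \<Longrightarrow> C (frob_rhs n U k) k 1"
proof -
  have rhs: "C (frob_rhs n U k) k 1" if IH: "\<And>j. j < k - 1 \<Longrightarrow> C (frob_poly n U j) j 0" and k: "k > 0" for k
    unfolding C_def
  proof (intro allI conjI impI)
    fix i
    have co: "coeff (frob_rhs n U k) i = (\<Sum>j\<in>{..<k-1}. U $$ (int k - 2 - int j) * coeff (frob_poly n U j) i)
       + (if k \<ge> 2 \<and> i \<ge> 1 then coeff (frob_poly n U (k - 2)) (i - 1) else 0)"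
      by (cases i) (auto simp: frob_rhs_def coeff_sum)
    have e0: "coeff (frob_poly n U j) i = 0" if "j < k - 1" "even j" "2 * i > j" for j i
      using IH[of j] that unfolding C_def by blast
    have o0: "coeff (frob_poly n U j) i = 0" if "j < k - 1" "odd j" "2 * i + 2 * q + 1 > j" for j i
      using IH[of j] that unfolding C_def by blast
    have e1: "sgn_val i 1 (coeff (frob_poly n U j) i)" if "j < k - 1" "even j" "2 * i = j" for j i
      using IH[of j] that unfolding C_def by (metis add_0_right)
    have o1: "sgn_val (Suc i) c (coeff (frob_poly n U j) i)" if "j < k - 1" "odd j" "2 * i + 2 * q + 1 = j" for j i
      using IH[of j] that unfolding C_def by (metis add_0_right)
    have U0: "U $$ (int k - 2 - int j) = 0" if "odd (k + j)" "int k - 2 - int j < 2 * int q - 1" for j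
      using that by (intro least) auto
    {
      assume ev: "even k" and i: "2 * i > k"
      have "(\<Sum>j\<in>{..<k-1}. U $$ (int k - 2 - int j) * coeff (frob_poly n U j) i) = 0"
      proof (intro sum.neutral ballI)
        fix j assume "j \<in> {..<k-1}"
        thus "U $$ (int k - 2 - int j) * coeff (frob_poly n U j) i = 0"
          using e0[of j i] o0[of j i] i by (cases "even j") auto
      qed
      moreover have "coeff (frob_poly n U (k - 2)) (i - 1) = 0" if "k \<ge> 2 \<and> i \<ge> 1"
        using ev i that by (intro e0) auto
      ultimately show "coeff (frob_rhs n U k) i = 0" unfolding co by auto
    next
      assume ev: "even k" and i: "2 * i = k"
      have "(\<Sum>j\<in>{..<k-1}. U $$ (int k - 2 - int j) * coeff (frob_poly n U j) i) = 0"
      proof (intro sum.neutral ballI)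
        fix j assume "j \<in> {..<k-1}"
        thus "U $$ (int k - 2 - int j) * coeff (frob_poly n U j) i = 0"
          using e0[of j i] o0[of j i] i by (cases "even j") auto
      qed
      moreover have ki: "k \<ge> 2 \<and> i \<ge> 1" using i k by auto
      moreover have "sgn_val (i - 1) 1 (coeff (frob_poly n U (k - 2)) (i - 1))"
        using ev i ki by (intro e1) auto
      ultimately have "sgn_val (i - 1) 1 (coeff (frob_rhs n U k) i)" unfolding co by simp
      moreover have "sgn_val (i + 1) 1 w" if "sgn_val (i - 1) 1 w" for w
        using that ki by (cases i) (auto simp: sgn_val_def)
      ultimately show "sgn_val (i + 1) 1 (coeff (frob_rhs n U k) i)" by blast
    next
      assume od: "odd k" and i: "2 * i + 2 * q + 1 > k"
      have "(\<Sum>j\<in>{..<k-1}. U $$ (int k - 2 - int j) * coeff (frob_poly n U j) i) = 0"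
      proof (intro sum.neutral ballI)
        fix j assume j: "j \<in> {..<k-1}"
        show "U $$ (int k - 2 - int j) * coeff (frob_poly n U j) i = 0"
        proof (cases "even j")
          case False
          thus ?thesis using o0[of j i] i j by auto
        next
          case True
          show ?thesis
          proof (cases "2 * i > j")
            case True
            thus ?thesis using e0[of j i] j \<open>even j\<close> by auto
          next
            case False
            hence "U $$ (int k - 2 - int j) = 0" using od \<open>even j\<close> i by (intro U0) auto
            thus ?thesis by simp
          qed
        qed
      qed
      moreover have "coeff (frob_poly n U (k - 2)) (i - 1) = 0" if "k \<ge> 2 \<and> i \<ge> 1"
        using od i that by (intro o0) auto
      ultimately show "coeff (frob_rhs n U k) i = 0" unfolding co by auto
    next
      assume od: "odd k" and i: "2 * i + 2 * q + 1 = k"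
      have "(\<Sum>j\<in>{..<k-1}. U $$ (int k - 2 - int j) * coeff (frob_poly n U j) i) =
        (\<Sum>j\<in>{2 * i}. U $$ (int k - 2 - int j) * coeff (frob_poly n U j) i)"
      proof (intro sum.mono_neutral_right ballI)
        show "{2 * i} \<subseteq> {..<k - 1}" using i q by auto
        fix j assume j: "j \<in> {..<k-1} - {2 * i}"
        show "U $$ (int k - 2 - int j) * coeff (frob_poly n U j) i = 0"
        proof (cases "even j")
          case False
          thus ?thesis using o0[of j i] i j by auto
        next
          case True
          show ?thesis
          proof (cases "2 * i > j")
            case True
            thus ?thesis using e0[of j i] j \<open>even j\<close> by auto
          next
            case False
            hence "U $$ (int k - 2 - int j) = 0" using od \<open>even j\<close> i j by (intro U0) auto
            thus ?thesis by simp
          qed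
        qed
      qed simp
      also have "\<dots> = c * coeff (frob_poly n U (2 * i)) i"
      proof -
        have e: "int k - 2 - int (2 * i) = 2 * int q - 1" using i by auto
        have "(\<Sum>j\<in>{2 * i}. U $$ (int k - 2 - int j) * coeff (frob_poly n U j) i) = U $$ (int k - 2 - int (2 * i)) * coeff (frob_poly n U (2 * i)) i"
          by simp
        thus ?thesis unfolding e c .
      qed
      finally have sum: "(\<Sum>j\<in>{..<k-1}. U $$ (int k - 2 - int j) * coeff (frob_poly n U j) i) = c * coeff (frob_poly n U (2 * i)) i" .
      have a: "sgn_val i c (c * coeff (frob_poly n U (2 * i)) i)"
        using i q by (intro sgn_val_mult e1) auto
      have "sgn_val i c (coeff (frob_rhs n U k) i)"
      proof (cases "i \<ge> 1")
        case True
        have "sgn_val (Suc (i - 1)) c (coeff (frob_poly n U (k - 2)) (i - 1))"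
          using od i True by (intro o1) auto
        hence "sgn_val i c (coeff (frob_poly n U (k - 2)) (i - 1))" using True by simp
        moreover have "k \<ge> 2" using i True by auto
        ultimately show ?thesis unfolding co sum using True sgn_val_add[OF a] by simp
      next
        case False
        thus ?thesis unfolding co sum using a by simp
      qed
      thus "sgn_val (Suc i + 1) c (coeff (frob_rhs n U k) i)" by (auto simp: sgn_val_def)
    }
  qed
  have poly: "k \<le> 2 * n \<Longrightarrow> C (frob_poly n U k) k 0" for k
  proof (induction k rule: less_induct)
    case (less k)
    show ?case
    proof (cases "k = 0")
      case True
      have "sgn_val 0 1 1" by (auto simp: sgn_val_def intro: exI[of _ 1])
      thus ?thesis using True by (auto simp: C_def frob_poly.simps)
    next
      case False
      have R: "C (frob_rhs n U k) k 1" by (rule rhs) (use less False in auto)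
      define x where "x = real k * (real k - 2 * real n - 1)"
      have x: "x < 0" unfolding x_def using False less.prems by (intro mult_pos_neg) auto
      have co: "coeff (frob_poly n U k) i = coeff (frob_rhs n U k) i / of_real x" for i
        using False by (simp add: frob_poly_pos x_def)
      have sg: "sgn_val (j + 0) d (w / of_real x)" if "sgn_val (j + 1) d w" for j d w
      proof -
        have "sgn_val (Suc (j + 1)) d (w / of_real x)" by (rule sgn_val_divide_neg[OF that x])
        thus ?thesis by (auto simp: sgn_val_def)
      qed
      show ?thesis unfolding C_def co using R[unfolded C_def] sg by (intro allI conjI impI) auto
    qed
  qed
  show "k \<le> 2 * n \<Longrightarrow> C (frob_poly n U k) k 0" by (rule poly)
  show "0 < k \<Longrightarrow> k \<le> 2 * n + 1 \<Longrightarrow> C (frob_rhs n U k) k 1" by (rule rhs) (auto intro!: poly)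
qed

lemma pole_strength_add_const: "pole_strength n U \<Longrightarrow> pole_strength n (U + fls_const E)"
  by (simp add: pole_strength_def)

text \<open>
  The obstruction polynomial vanishes at every energy. If \<open>2 q - 1\<close> were the first odd index with a nonzero
  coefficient, its coefficient of degree \<open>n - q\<close> would be a nonzero multiple of that coefficient.
\<close>
theorem all_energies_imp_odd_coeffs_zero:
  assumes U: "pole_strength n U"
    and sol: "\<And>E. \<exists>A. fls_deriv (fls_deriv A) = (U + fls_const E) * A \<and> (\<forall>i< - int n. A $$ i = 0) \<and> A $$ (- int n) \<noteq> 0"
    and i: "odd i" "i < 2 * int n + 1"
  shows "U $$ i = 0"
proof (rule ccontr)
  assume "U $$ i \<noteq> 0"
  then obtain q where q: "1 \<le> q" "q \<le> n" "U $$ (2 * int q - 1) \<noteq> 0" "\<And>l. odd l \<Longrightarrow> l < 2 * int q - 1 \<Longrightarrow> U $$ l = 0"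
    using least_odd_coeff[OF U i] by blast
  have rhs0: "poly (frob_rhs n U (2 * n + 1)) E = 0" for E
  proof -
    obtain A where A: "fls_deriv (fls_deriv A) = (U + fls_const E) * A" "\<And>i. i < - int n \<Longrightarrow> A $$ i = 0" "A $$ (- int n) \<noteq> 0"
      using sol by blast
    define \<alpha> where "\<alpha> = A $$ (- int n)"
    define a where "a k = A $$ (int k - int n)" for k
    have rec: "of_real (real k * (real k - 2 * real n - 1)) * a k =
      (\<Sum>j\<in>{..<k-1}. U $$ (int k - 2 - int j) * a j) + (if k \<ge> 2 then E * a (k - 2) else 0)" for k
    proof -
      define i where "i = int k - int n"
      have "of_int ((i + int n) * (i - int n - 1)) * A $$ i = (\<Sum>l=0..i - 2 + int n. (U + fls_const E) $$ l * A $$ (i - 2 - l))"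
        by (rule formal_solution_recursion[OF pole_strength_add_const[OF U] A(2) A(1)])
      also have "\<dots> = (\<Sum>j\<in>{..<k-1}. (U + fls_const E) $$ (int k - 2 - int j) * a j)"
      proof (rule sum.reindex_bij_witness[of _ "\<lambda>j. int k - 2 - int j" "\<lambda>l. nat (int k - 2 - l)"])
        fix l assume l: "l \<in> {0..i - 2 + int n}"
        hence l': "0 \<le> l" "l \<le> int k - 2" by (auto simp: i_def)
        thus "int k - 2 - int (nat (int k - 2 - l)) = l" "nat (int k - 2 - l) \<in> {..<k - 1}" by auto
        have e: "int (nat (int k - 2 - l)) - int n = i - 2 - l" using l' i_def by linarith
        show "(U + fls_const E) $$ (int k - 2 - int (nat (int k - 2 - l))) * a (nat (int k - 2 - l)) = (U + fls_const E) $$ l * A $$ (i - 2 - l)"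
          unfolding a_def e using l' by simp
      qed (auto simp: i_def)
      also have "\<dots> = (\<Sum>j\<in>{..<k-1}. U $$ (int k - 2 - int j) * a j) + (\<Sum>j\<in>{..<k-1}. if j = k - 2 then E * a j else 0)"
        unfolding sum.distrib[symmetric] by (intro sum.cong refl) (auto simp: algebra_simps)
      also have "(\<Sum>j\<in>{..<k-1}. if j = k - 2 then E * a j else 0) = (if k \<ge> 2 then E * a (k - 2) else 0)"
        by (subst sum.delta) auto
      also have "of_int ((i + int n) * (i - int n - 1)) = (of_real (real k * (real k - 2 * real n - 1)) :: complex)"
        by (simp add: i_def algebra_simps)
      finally show ?thesis by (simp add: a_def i_def)
    qed
    have ap: "k \<le> 2 * n \<Longrightarrow> a k = \<alpha> * poly (frob_poly n U k) E" for k
    proof (induction k rule: less_induct)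
      case (less k)
      show ?case
      proof (cases "k = 0")
        case True
        thus ?thesis by (simp add: a_def \<alpha>_def frob_poly.simps)
      next
        case False
        have nz: "(of_real (real k * (real k - 2 * real n - 1)) :: complex) \<noteq> 0"
          using False less.prems by (simp only: of_real_eq_0_iff mult_eq_0_iff) auto
        have "(\<Sum>j\<in>{..<k-1}. U $$ (int k - 2 - int j) * a j) = (\<Sum>j\<in>{..<k-1}. \<alpha> * (U $$ (int k - 2 - int j) * poly (frob_poly n U j) E))"
          using less by (intro sum.cong refl) auto
        hence "of_real (real k * (real k - 2 * real n - 1)) * a k = \<alpha> * poly (frob_rhs n U k) E"
          unfolding rec frob_rhs_def using less by (auto simp: poly_sum sum_distrib_left algebra_simps)
        hence "a k = \<alpha> * poly (frob_rhs n U k) E / of_real (real k * (real k - 2 * real n - 1))"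
          using nz by (metis nonzero_eq_divide_eq mult.commute)
        thus ?thesis using False by (simp add: frob_poly_pos)
      qed
    qed
    let ?k = "2 * n + 1"
    have "(\<Sum>j\<in>{..<?k-1}. U $$ (int ?k - 2 - int j) * a j) = (\<Sum>j\<in>{..<?k-1}. \<alpha> * (U $$ (int ?k - 2 - int j) * poly (frob_poly n U j) E))"
      using ap by (intro sum.cong refl) auto
    hence "of_real (real ?k * (real ?k - 2 * real n - 1)) * a ?k = \<alpha> * poly (frob_rhs n U ?k) E"
      unfolding rec frob_rhs_def using ap[of "?k - 2"] by (auto simp: poly_sum sum_distrib_left algebra_simps)
    thus ?thesis using A(3) by (simp add: \<alpha>_def)
  qed
  have "frob_rhs n U (2 * n + 1) = 0" using rhs0 by (simp add: poly_eq_poly_eq_iff[symmetric] fun_eq_iff)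
  moreover have "sgn_val (Suc (n - q) + 1) (U $$ (2 * int q - 1)) (coeff (frob_rhs n U (2 * n + 1)) (n - q))"
  proof -
    have "2 * (n - q) + 2 * q + 1 = 2 * n + 1" using q by auto
    thus ?thesis using frob_poly_coeffs(2)[OF q(1,2) refl q(4), of "2 * n + 1"] by auto
  qed
  ultimately show False using sgn_val_nonzero q(3) by fastforce
qed

section \<open>Wronskians\<close>

definition wronskian :: "(complex \<Rightarrow> complex) \<Rightarrow> (complex \<Rightarrow> complex) \<Rightarrow> complex \<Rightarrow> complex" where
  "wronskian f g x = f x * deriv g x - deriv f x * g x"

lemma wronskian_constant:
  assumes S: "open S" "connected S" and f: "f holomorphic_on S" and g: "g holomorphic_on S"
    and fe: "\<And>x. x \<in> S \<Longrightarrow> deriv (deriv f) x = v x * f x" and ge: "\<And>x. x \<in> S \<Longrightarrow> deriv (deriv g) x = v x * g x"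
  obtains c where "\<And>x. x \<in> S \<Longrightarrow> wronskian f g x = c"
proof -
  have d: "(h has_field_derivative deriv h x) (at x)" if "h holomorphic_on S" "x \<in> S" for h x
    using that S by (meson holomorphic_derivI)
  have "(wronskian f g has_field_derivative 0) (at x)" if x: "x \<in> S" for x
  proof -
    have "(wronskian f g has_field_derivative
       (f x * deriv (deriv g) x + deriv f x * deriv g x) - (deriv f x * deriv g x + deriv (deriv f) x * g x)) (at x)"
      unfolding wronskian_def[abs_def]
      by (rule derivative_eq_intros d[OF f x] d[OF g x] d[OF holomorphic_deriv[OF f S(1)] x] d[OF holomorphic_deriv[OF g S(1)] x] refl)+ (simp add: algebra_simps)
    thus ?thesis using fe[OF x] ge[OF x] by (simp add: algebra_simps)
  qed
  hence "wronskian f g constant_on S"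
    using S by (intro has_field_derivative_0_imp_constant_on) auto
  thus ?thesis using that unfolding constant_on_def by metis
qed

text \<open>
  Cramer's rule: the Wronskians of the third solution with the two given ones are constant.
\<close>
lemma solution_space_two_dimensional:
  assumes S: "open S" "connected S" and f: "f holomorphic_on S" and g: "g holomorphic_on S" and h: "h holomorphic_on S"
    and fe: "\<And>x. x \<in> S \<Longrightarrow> deriv (deriv f) x = v x * f x" and ge: "\<And>x. x \<in> S \<Longrightarrow> deriv (deriv g) x = v x * g x"
    and he: "\<And>x. x \<in> S \<Longrightarrow> deriv (deriv h) x = v x * h x"
    and w: "\<And>x. x \<in> S \<Longrightarrow> wronskian f g x = w" "w \<noteq> 0"
  obtains \<alpha> \<beta> where "\<And>x. x \<in> S \<Longrightarrow> h x = \<alpha> * f x + \<beta> * g x"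
proof -
  obtain c1 where c1: "\<And>x. x \<in> S \<Longrightarrow> wronskian h g x = c1" using wronskian_constant[OF S h g he ge] by metis
  obtain c2 where c2: "\<And>x. x \<in> S \<Longrightarrow> wronskian f h x = c2" using wronskian_constant[OF S f h fe he] by metis
  show ?thesis
  proof (rule that[of "c1 / w" "c2 / w"])
    fix x assume x: "x \<in> S"
    have "c1 * f x + c2 * g x = wronskian h g x * f x + wronskian f h x * g x" by (simp add: c1 c2 x)
    also have "\<dots> = h x * wronskian f g x" by (simp add: wronskian_def algebra_simps)
    finally have "c1 * f x + c2 * g x = h x * w" by (simp only: w(1)[OF x])
    thus "h x = c1 / w * f x + c2 / w * g x" using w(2) by (simp add: field_simps)
  qed
qed

text \<open>
  The two formal solutions begin with \<open>t powi (- n)\<close> and \<open>t ^ (n + 1)\<close>, which gives the value \<open>2 n + 1\<close> of the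
  Wronskian.
\<close>
lemma local_solution_basis:
  assumes v: "(\<lambda>t. v (p + t)) has_laurent_expansion V" and V: "pole_strength n V"
    and odd: "\<And>i. odd i \<Longrightarrow> i < 2 * int n + 1 \<Longrightarrow> V $$ i = 0"
  obtains \<rho> f g A B where "\<rho> > 0" "f holomorphic_on ball p \<rho> - {p}" "g holomorphic_on ball p \<rho> - {p}"
    "\<And>x. x \<in> ball p \<rho> - {p} \<Longrightarrow> deriv (deriv f) x = v x * f x"
    "\<And>x. x \<in> ball p \<rho> - {p} \<Longrightarrow> deriv (deriv g) x = v x * g x"
    "\<And>x. x \<in> ball p \<rho> - {p} \<Longrightarrow> wronskian f g x = 2 * of_nat n + 1"
    "(\<lambda>t. f (p + t)) has_laurent_expansion A" "(\<lambda>t. g (p + t)) has_laurent_expansion B"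
    "\<And>i. i < - int n \<Longrightarrow> A $$ i = 0" "\<And>i. i < - int n \<Longrightarrow> B $$ i = 0"
proof -
  obtain A where A: "fls_deriv (fls_deriv A) = V * A" "\<And>i. i < - int n \<Longrightarrow> A $$ i = 0" "A $$ (- int n) = 1" "A $$ (int n + 1) = 0"
    using formal_solution_exists[OF V odd] by metis
  obtain B where B: "fls_deriv (fls_deriv B) = V * B" "\<And>i. i < - int n \<Longrightarrow> B $$ i = 0" "B $$ (- int n) = 0" "B $$ (int n + 1) = 1"
    using formal_solution_exists[OF V odd] by metis
  obtain r1 f where f: "r1 > 0" "f holomorphic_on ball p r1 - {p}" "(\<lambda>t. f (p + t)) has_laurent_expansion A"
    "\<And>x. x \<in> ball p r1 - {p} \<Longrightarrow> deriv (deriv f) x = v x * f x"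
    using formal_solution_realize[OF v V A(2,1)] by metis
  obtain r2 g where g: "r2 > 0" "g holomorphic_on ball p r2 - {p}" "(\<lambda>t. g (p + t)) has_laurent_expansion B"
    "\<And>x. x \<in> ball p r2 - {p} \<Longrightarrow> deriv (deriv g) x = v x * g x"
    using formal_solution_realize[OF v V B(2,1)] by metis
  define W where "W = A * fls_deriv B - fls_deriv A * B"
  have B0: "B $$ i = 0" if "i < int n + 1" for i
    by (rule formal_solution_coeff_zero[OF V B(2,1,3)]) (use that in auto)
  have dA: "fls_deriv A $$ i = 0" if "i < - int n - 1" for i using A(2)[of "i + 1"] that by simp
  have dB: "fls_deriv B $$ i = 0" if "i < int n" for i using B0[of "i + 1"] that by simp
  have "fls_deriv W = 0" unfolding W_def by (simp add: A(1) B(1) algebra_simps)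
  hence Wi: "of_int i * W $$ i = 0" for i using fls_deriv_nth[of W "i - 1"] by simp
  have W: "W $$ i = 0" if "i \<noteq> 0" for i using Wi[of i] that by simp
  have "W $$ 0 = 2 * of_nat n + 1"
  proof -
    have "(A * fls_deriv B) $$ 0 = of_nat n + 1"
      using B(4) by (subst fls_times_nth_interval[OF A(2) dB]) (auto simp: A(3) add.commute)
    moreover have "(fls_deriv A * B) $$ 0 = - of_nat n"
    proof -
      have e: "{- int n - 1..0 - (int n + 1)} = {- int n - 1}" by auto
      have "(fls_deriv A * B) $$ 0 = (\<Sum>i=- int n - 1..0 - (int n + 1). fls_deriv A $$ i * B $$ (0 - i))"
        by (rule fls_times_nth_interval) (use dA B0 in auto)
      thus ?thesis unfolding e using B(4) by (simp add: A(3) add.commute)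
    qed
    ultimately show ?thesis by (simp add: W_def)
  qed
  hence Weq: "W = fls_const (2 * of_nat n + 1)" using W by (intro fls_eqI) auto
  have "(\<lambda>t. wronskian f g (p + t) - (2 * of_nat n + 1)) has_laurent_expansion W - fls_const (2 * of_nat n + 1)"
    unfolding wronskian_def W_def by (intro laurent_expansion_intros has_laurent_expansion_deriv_shift f g)
  hence "(\<lambda>t. wronskian f g (p + t) - (2 * of_nat n + 1)) has_laurent_expansion 0" by (simp add: Weq)
  from has_laurent_expansion_0_imp_eventually[OF this]
  obtain r3 where r3: "r3 > 0" "\<And>x. x \<noteq> p \<Longrightarrow> dist x p < r3 \<Longrightarrow> wronskian f g x - (2 * of_nat n + 1) = 0"
    unfolding eventually_at by blast
  define \<rho> where "\<rho> = min r1 (min r2 r3)"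
  show ?thesis
  proof (rule that[of \<rho> f g A B])
    show "\<rho> > 0" using f g r3 by (simp add: \<rho>_def)
    show "f holomorphic_on ball p \<rho> - {p}" "g holomorphic_on ball p \<rho> - {p}"
      by (rule holomorphic_on_subset[OF f(2)] holomorphic_on_subset[OF g(2)], auto simp: \<rho>_def)+
    fix x assume x: "x \<in> ball p \<rho> - {p}"
    show "deriv (deriv f) x = v x * f x" using f(4)[of x] x by (auto simp: \<rho>_def)
    show "deriv (deriv g) x = v x * g x" using g(4)[of x] x by (auto simp: \<rho>_def)
    show "wronskian f g x = 2 * of_nat n + 1" using r3(2)[of x] x by (auto simp: \<rho>_def dist_commute)
  qed (use f g A B in auto)
qed

section \<open>False singular points and formal solutions\<close>

lemma has_laurent_expansion_divide_power:
  assumes F: "(\<lambda>t. f (p + t)) has_laurent_expansion F" and G: "(\<lambda>t. g (p + t)) has_laurent_expansion G"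
    and G0: "\<And>i. i < 1 \<Longrightarrow> G $$ i = 0" "G $$ 1 \<noteq> 0"
    and F0: "\<And>i. i < r \<Longrightarrow> F $$ i = 0"
  obtains P where "(\<lambda>t. f (p + t) / g (p + t) ^ n) has_laurent_expansion P" "\<And>i. i < r - int n \<Longrightarrow> P $$ i = 0"
proof (rule that)
  show "(\<lambda>t. f (p + t) / g (p + t) ^ n) has_laurent_expansion F / G ^ n"
    by (intro laurent_expansion_intros F G)
  fix i assume i: "i < r - int n"
  show "(F / G ^ n) $$ i = 0"
  proof (cases "F = 0")
    case False
    have "G \<noteq> 0" using G0(2) by auto
    moreover have "fls_subdegree G = 1" by (rule fls_subdegree_eqI) (use G0 in auto)
    moreover have "fls_subdegree F \<ge> r" using False F0 by (intro fls_subdegree_geI) auto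
    ultimately have "fls_subdegree (F / G ^ n) \<ge> r - int n"
      using False by (simp add: fls_divide_subdegree fls_subdegree_pow)
    thus ?thesis using i by (intro fls_eq0_below_subdegree) auto
  qed simp
qed

lemma has_laurent_expansion_mult_power:
  assumes F: "(\<lambda>t. f (p + t)) has_laurent_expansion F" and G: "(\<lambda>t. g (p + t)) has_laurent_expansion G"
    and G0: "\<And>i. i < 1 \<Longrightarrow> G $$ i = 0"
    and F0: "\<And>i. i < r \<Longrightarrow> F $$ i = 0"
  obtains P where "(\<lambda>t. f (p + t) * g (p + t) ^ n) has_laurent_expansion P" "\<And>i. i < r + int n \<Longrightarrow> P $$ i = 0"
proof (rule that)
  show "(\<lambda>t. f (p + t) * g (p + t) ^ n) has_laurent_expansion F * G ^ n"
    by (intro laurent_expansion_intros F G)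
  have Gn: "(G ^ n) $$ i = 0" if "i < int n" for i
    using that
  proof (induction n arbitrary: i)
    case (Suc n)
    show ?case using Suc.IH G0 Suc.prems unfolding power_Suc by (intro fls_times_nth_below[of 1 _ "int n"]) auto
  qed simp
  show "(F * G ^ n) $$ i = 0" if "i < r + int n" for i
    using F0 Gn that by (intro fls_times_nth_below[of r _ "int n"]) auto
qed

lemma holomorphic_extension_limit:
  assumes "f holomorphic_on ball b r - {b}" "(f \<longlongrightarrow> L) (at b)" "r > 0"
  obtains g where "g holomorphic_on ball b r" "\<And>z. z \<in> ball b r - {b} \<Longrightarrow> g z = f z"
proof -
  have "((\<lambda>z. (z - b) * f z) \<longlongrightarrow> (b - b) * L) (at b)"
    by (intro tendsto_intros assms)
  hence "((\<lambda>z. (z - b) * f z) \<longlongrightarrow> 0) (at b)" by simp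
  moreover have "b \<in> interior (ball b r)" using assms(3) by simp
  ultimately show ?thesis using holomorphic_on_extend_lim[OF assms(1)] that by blast
qed

lemma laurent_zero_on_punctured_ball:
  assumes "(\<lambda>t. f (p + t)) has_laurent_expansion 0" "f holomorphic_on ball p s - {p}" "s > 0" "x \<in> ball p s - {p}"
  shows "f x = 0"
proof -
  obtain e where e: "e > 0" "\<And>x. x \<noteq> p \<Longrightarrow> dist x p < e \<Longrightarrow> f x = 0"
    using has_laurent_expansion_0_imp_eventually[OF assms(1)] unfolding eventually_at by blast
  define B where "B = ball p (min e s) - {p}"
  have conn: "connected (ball p s - {p})" by (rule connected_punctured_ball) simp
  have "B \<noteq> {}"
  proof -
    have "p + of_real (min e s / 2) \<in> B" using e assms(3) by (auto simp: B_def dist_norm)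
    thus ?thesis by blast
  qed
  show ?thesis
    by (rule analytic_continuation_open[of B "ball p s - {p}" f "\<lambda>_. 0"])
       (use \<open>B \<noteq> {}\<close> conn assms e in \<open>auto simp: B_def dist_commute\<close>)
qed

text \<open>
  The change of variables near a single singular point, detached from elliptic functions: \<open>\<zeta>\<close> is the chart
  \<open>x \<mapsto> z\<close> around \<open>d\<close>, the gauge factor is \<open>H z / (z - b) ^ n\<close> with \<open>H\<close> regular and nonvanishing, and \<open>v\<close> is the
  potential including the energy.
\<close>
locale singular_point_transfer =
  fixes \<zeta> H v p q :: "complex \<Rightarrow> complex" and n :: nat and V :: "complex fls" and d b :: complex and r0 :: real
  assumes r0: "r0 > 0" and \<zeta>: "\<zeta> holomorphic_on ball d r0" "inj_on \<zeta> (ball d r0)" "\<zeta> d = b"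
    and H: "H holomorphic_on \<zeta> ` ball d r0" "\<And>z. z \<in> \<zeta> ` ball d r0 \<Longrightarrow> H z \<noteq> 0"
    and v: "(\<lambda>t. v (d + t)) has_laurent_expansion V" "pole_strength n V" "v holomorphic_on ball d r0 - {d}"
    and transfer: "\<And>S y. open S \<Longrightarrow> S \<subseteq> ball d r0 - {d} \<Longrightarrow> y holomorphic_on \<zeta> ` S \<Longrightarrow>
       (\<forall>x\<in>S. deriv (deriv (\<lambda>x. y (\<zeta> x) * H (\<zeta> x) / (\<zeta> x - b) ^ n)) x = v x * (y (\<zeta> x) * H (\<zeta> x) / (\<zeta> x - b) ^ n))
       \<longleftrightarrow> solves_ode2 p q y (\<zeta> ` S)"
begin

lemma \<zeta>_expansion:
  obtains Z where "(\<lambda>t. \<zeta> (d + t) - b) has_laurent_expansion Z" "\<And>i. i < 1 \<Longrightarrow> Z $$ i = 0" "Z $$ 1 \<noteq> 0"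
proof -
  have an: "\<zeta> analytic_on {d}" using \<zeta>(1) r0 by (auto simp: analytic_at intro!: exI[of _ "ball d r0"])
  obtain F where F: "(\<lambda>t. \<zeta> (d + t)) has_laurent_expansion F" "\<And>i. i < 0 \<Longrightarrow> F $$ i = 0" "F $$ 0 = \<zeta> d" "F $$ 1 = deriv \<zeta> d"
    using analytic_has_laurent_expansion[OF an] by blast
  have "deriv \<zeta> d \<noteq> 0"
    by (rule holomorphic_injective_imp_regular[OF \<zeta>(1) open_ball \<zeta>(2)]) (use r0 in simp)
  show ?thesis
  proof (rule that[of "F - fls_const b"])
    show "(\<lambda>t. \<zeta> (d + t) - b) has_laurent_expansion F - fls_const b" by (intro laurent_expansion_intros F)
    show "(F - fls_const b) $$ i = 0" if "i < 1" for i using F(2,3) \<zeta>(3) that by (cases "i = 0") auto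
    show "(F - fls_const b) $$ 1 \<noteq> 0" using F(4) \<open>deriv \<zeta> d \<noteq> 0\<close> by simp
  qed
qed

lemma \<zeta>_neq: "x \<in> ball d r0 - {d} \<Longrightarrow> \<zeta> x \<noteq> b"
  using inj_on_eq_iff[OF \<zeta>(2), of x d] \<zeta>(3) r0 by simp

lemma inverse_chart:
  assumes "0 < s" "s \<le> r0"
  obtains \<xi> where "\<xi> holomorphic_on \<zeta> ` ball d s" "\<And>x. x \<in> ball d s \<Longrightarrow> \<xi> (\<zeta> x) = x" "open (\<zeta> ` ball d s)"
proof -
  have sub: "ball d s \<subseteq> ball d r0" using assms by auto
  note h = holomorphic_on_subset[OF \<zeta>(1) sub] inj_on_subset[OF \<zeta>(2) sub]
  obtain g where g: "g holomorphic_on (\<zeta> ` ball d s)" "\<And>z. z \<in> ball d s \<Longrightarrow> g (\<zeta> z) = z"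
    using holomorphic_has_inverse[OF h(1) open_ball h(2)] by metis
  have "open (\<zeta> ` ball d s)" by (rule open_mapping_thm3[OF h(1) open_ball h(2)])
  thus ?thesis using g that by blast
qed

text \<open>
  Every solution on the \<open>x\<close>-side is a combination of two Laurent solutions with poles of order at most \<open>n\<close>.
  The factor \<open>(z - b) ^ n\<close> of the gauge cancels these poles, so the combination extends the given branch to
  the whole disc.
\<close>
lemma false_if_odd_coeffs_zero:
  assumes odd: "\<And>i. odd i \<Longrightarrow> i < 2 * int n + 1 \<Longrightarrow> V $$ i = 0"
  shows "false_singular_point p q b"
proof -
  obtain \<rho> f g A B where sol: "\<rho> > 0" "f holomorphic_on ball d \<rho> - {d}" "g holomorphic_on ball d \<rho> - {d}"
    "\<And>x. x \<in> ball d \<rho> - {d} \<Longrightarrow> deriv (deriv f) x = v x * f x"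
    "\<And>x. x \<in> ball d \<rho> - {d} \<Longrightarrow> deriv (deriv g) x = v x * g x"
    "\<And>x. x \<in> ball d \<rho> - {d} \<Longrightarrow> wronskian f g x = 2 * of_nat n + 1"
    "(\<lambda>t. f (d + t)) has_laurent_expansion A" "(\<lambda>t. g (d + t)) has_laurent_expansion B"
    "\<And>i. i < - int n \<Longrightarrow> A $$ i = 0" "\<And>i. i < - int n \<Longrightarrow> B $$ i = 0"
    by (rule local_solution_basis[OF v(1,2) odd]) (assumption | rule that)+
  define s where "s = min r0 \<rho>"
  have s: "0 < s" "s \<le> r0" "s \<le> \<rho>" using r0 sol(1) by (auto simp: s_def)
  obtain \<xi> where \<xi>: "\<xi> holomorphic_on \<zeta> ` ball d s" "\<And>x. x \<in> ball d s \<Longrightarrow> \<xi> (\<zeta> x) = x" "open (\<zeta> ` ball d s)"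
    using inverse_chart[OF s(1,2)] by blast
  have b: "b \<in> \<zeta> ` ball d s" using \<zeta>(3) s(1) by (auto intro!: image_eqI[of _ _ d])
  obtain r where r: "r > 0" "ball b r \<subseteq> \<zeta> ` ball d s" using \<xi>(3) b open_contains_ball by blast
  have \<xi>z: "\<xi> z \<in> ball d s" "\<zeta> (\<xi> z) = z" if "z \<in> ball b r" for z using that r(2) \<xi>(2) by auto
  have \<xi>b: "\<xi> b = d" using \<xi>(2)[of d] s(1) \<zeta>(3) by simp
  have \<xi>nd: "\<xi> z \<noteq> d" if "z \<in> ball b r - {b}" for z using \<xi>z[of z] that \<zeta>(3) by auto
  have \<xi>h: "\<xi> holomorphic_on ball b r" using \<xi>(1) r(2) by (rule holomorphic_on_subset)
  obtain Z where Z: "(\<lambda>t. \<zeta> (d + t) - b) has_laurent_expansion Z" "\<And>i. i < 1 \<Longrightarrow> Z $$ i = 0" "Z $$ 1 \<noteq> 0"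
    using \<zeta>_expansion by blast
  have Hz: "H z \<noteq> 0" if "z \<in> ball b r" for z
    using that r(2) s(2) by (intro H(2)) (force simp: image_def)
  have Hh: "H holomorphic_on ball b r" 
    using r(2) s(2) by (intro holomorphic_on_subset[OF H(1)]) (force simp: image_def)
  have "\<exists>Y. Y holomorphic_on ball b r \<and> (\<forall>z\<in>U. Y z = y z)"
    if U: "open U" "connected U" "U \<subseteq> ball b r - {b}" and y: "y holomorphic_on U" "solves_ode2 p q y U" for U y
  proof -
    define S where "S = \<xi> ` U"
    have \<xi>U: "\<xi> holomorphic_on U" using \<xi>h U by (auto intro: holomorphic_on_subset)
    have "inj_on \<xi> U" using \<xi>z U(3) by (intro inj_on_inverseI[of _ \<zeta>]) auto
    hence So: "open S" unfolding S_def by (rule open_mapping_thm3[OF \<xi>U U(1)])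
    have Sc: "connected S" unfolding S_def by (intro connected_continuous_image holomorphic_on_imp_continuous_on \<xi>U U)
    have Ssub: "S \<subseteq> ball d s - {d}" unfolding S_def using \<xi>z(1) \<xi>nd U(3) by blast
    have \<zeta>S: "\<zeta> ` S = U" unfolding S_def image_image using \<xi>z(2) U(3) by force
    define \<psi> where "\<psi> = (\<lambda>x. y (\<zeta> x) * H (\<zeta> x) / (\<zeta> x - b) ^ n)"
    have Sr0: "S \<subseteq> ball d r0 - {d}" using Ssub s by auto
    have \<psi>ode: "deriv (deriv \<psi>) x = v x * \<psi> x" if "x \<in> S" for x
      using transfer[OF So Sr0, of y] y that unfolding \<zeta>S \<psi>_def by blast
    have \<psi>h: "\<psi> holomorphic_on S" unfolding \<psi>_def
    proof (intro holomorphic_intros)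
      have z: "\<zeta> holomorphic_on S" using \<zeta>(1) Sr0 by (auto intro: holomorphic_on_subset)
      show "\<zeta> holomorphic_on S" by (rule z)
      show "(\<lambda>x. y (\<zeta> x)) holomorphic_on S" using holomorphic_on_compose[OF z] y \<zeta>S by (simp add: o_def)
      have "H holomorphic_on \<zeta> ` S" using \<zeta>S U(3) Hh by (auto intro: holomorphic_on_subset)
      thus "(\<lambda>x. H (\<zeta> x)) holomorphic_on S" using holomorphic_on_compose[OF z] by (simp add: o_def)
      fix x assume "x \<in> S"
      hence "\<zeta> x \<noteq> b" using \<zeta>_neq Sr0 by blast
      thus "(\<zeta> x - b) ^ n \<noteq> 0" by simp
    qed
    have S\<rho>: "S \<subseteq> ball d \<rho> - {d}" using Ssub s by auto
    \<comment> \<open>the same combination makes sense on the whole punctured disc and continues \<open>\<psi>\<close>\<close>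
    obtain \<alpha> \<beta> where \<alpha>\<beta>: "\<And>x. x \<in> S \<Longrightarrow> \<psi> x = \<alpha> * f x + \<beta> * g x"
    proof (rule solution_space_two_dimensional[OF So Sc _ _ \<psi>h _ _ \<psi>ode])
      show "f holomorphic_on S" "g holomorphic_on S" using sol(2,3) S\<rho> by (auto intro: holomorphic_on_subset)
      show "deriv (deriv f) x = v x * f x" "deriv (deriv g) x = v x * g x" "wronskian f g x = 2 * of_nat n + 1" if "x \<in> S" for x
      proof -
        have "x \<in> ball d \<rho> - {d}" using that S\<rho> by blast
        thus "deriv (deriv f) x = v x * f x" "deriv (deriv g) x = v x * g x" "wronskian f g x = 2 * of_nat n + 1"
          by (rule sol(4), rule sol(5), rule sol(6))
      qed
      have "(of_nat (2 * n + 1) :: complex) \<noteq> 0" by (simp only: of_nat_eq_0_iff)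
      thus "(2 * of_nat n + 1 :: complex) \<noteq> 0" by (simp add: add.commute)
    qed (assumption, rule that, assumption)
    define T where "T = (\<lambda>x. (\<alpha> * f x + \<beta> * g x) * (\<zeta> x - b) ^ n)"
    define F where "F = fls_const \<alpha> * A + fls_const \<beta> * B"
    have F: "(\<lambda>t. \<alpha> * f (d + t) + \<beta> * g (d + t)) has_laurent_expansion F"
      unfolding F_def by (intro laurent_expansion_intros sol)
    have F0: "F $$ i = 0" if "i < - int n" for i using sol(9,10) that by (simp add: F_def)
    obtain P where P: "(\<lambda>t. (\<alpha> * f (d + t) + \<beta> * g (d + t)) * (\<zeta> (d + t) - b) ^ n) has_laurent_expansion P" "\<And>i. i < - int n + int n \<Longrightarrow> P $$ i = 0"
      using has_laurent_expansion_mult_power[of "\<lambda>x. \<alpha> * f x + \<beta> * g x" d F "\<lambda>x. \<zeta> x - b" Z "- int n" n, OF F Z(1,2) F0] by blast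
    have "(T \<longlongrightarrow> P $$ 0) (at d)"
      using has_laurent_expansion_imp_tendsto[of T d P] P fls_subdegree_ge0I[of P] by (simp add: T_def)
    moreover have "filterlim \<xi> (at d) (at b)"
    proof -
      have "isCont \<xi> b" using holomorphic_on_imp_continuous_on[OF \<xi>h] r(1) by (auto simp: continuous_on_eq_continuous_at)
      hence "(\<xi> \<longlongrightarrow> d) (at b)" using \<xi>b by (simp add: isCont_def)
      moreover have "eventually (\<lambda>z. z \<in> ball b r - {b}) (at b)" using r(1) by (intro eventually_at_in_open) auto
      hence "eventually (\<lambda>z. \<xi> z \<in> UNIV - {d}) (at b)" by eventually_elim (use \<xi>nd in auto)
      ultimately show ?thesis unfolding filterlim_at by auto
    qed
    ultimately have lim: "((\<lambda>z. T (\<xi> z)) \<longlongrightarrow> P $$ 0) (at b)" by (rule filterlim_compose)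
    have "isCont H b" using holomorphic_on_imp_continuous_on[OF Hh] r(1) by (auto simp: continuous_on_eq_continuous_at)
    hence "(H \<longlongrightarrow> H b) (at b)" by (simp add: isCont_def)
    hence lim: "((\<lambda>z. T (\<xi> z) / H z) \<longlongrightarrow> P $$ 0 / H b) (at b)" using lim Hz[of b] r(1) by (intro tendsto_divide) auto
    have "(\<lambda>z. T (\<xi> z) / H z) holomorphic_on ball b r - {b}"
    proof (intro holomorphic_on_divide)
      have "\<xi> ` (ball b r - {b}) \<subseteq> ball d s - {d}" using \<xi>z(1) \<xi>nd by blast
      moreover have "T holomorphic_on ball d s - {d}" unfolding T_def
        by (intro holomorphic_intros holomorphic_on_subset[OF sol(2)] holomorphic_on_subset[OF sol(3)] holomorphic_on_subset[OF \<zeta>(1)]) (use s in auto)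
      ultimately show "(\<lambda>z. T (\<xi> z)) holomorphic_on ball b r - {b}"
        using holomorphic_on_compose_gen[of \<xi> "ball b r - {b}" T "ball d s - {d}"] \<xi>h by (auto simp: o_def intro: holomorphic_on_subset)
      show "H holomorphic_on ball b r - {b}" using Hh by (rule holomorphic_on_subset) auto
    qed (use Hz in auto)
    from holomorphic_extension_limit[OF this lim r(1)]
    obtain Y where Y: "Y holomorphic_on ball b r" "\<And>z. z \<in> ball b r - {b} \<Longrightarrow> Y z = T (\<xi> z) / H z" by blast
    have "Y z = y z" if z: "z \<in> U" for z
    proof -
      have zb: "z \<in> ball b r - {b}" using z U(3) by auto
      have "T (\<xi> z) = \<psi> (\<xi> z) * (\<zeta> (\<xi> z) - b) ^ n" using \<alpha>\<beta>[of "\<xi> z"] z by (simp add: T_def S_def)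
      also have "\<dots> = y z * H z" using zb \<xi>z(2)[of z] by (simp add: \<psi>_def)
      finally show ?thesis using Y(2)[OF zb] Hz[of z] zb by simp
    qed
    thus ?thesis using Y(1) by blast
  qed
  thus ?thesis unfolding false_singular_point_def using r(1) by blast
qed

text \<open>
  Two independent solutions at a nearby ordinary point continue to the punctured disc with poles of order
  at most \<open>n\<close> at \<open>d\<close>. Without a term of order \<open>- n\<close> in either of them, both would be multiples of the
  solution starting at \<open>n + 1\<close>, contradicting their independence.
\<close>
lemma false_imp_formal_solution:
  assumes "false_singular_point p q b"
  shows "\<exists>A. fls_deriv (fls_deriv A) = V * A \<and> (\<forall>i< - int n. A $$ i = 0) \<and> A $$ (- int n) \<noteq> 0"
proof -
  obtain r where r': "r > 0" "\<forall>U y. open U \<and> connected U \<and> U \<subseteq> ball b r - {b} \<and>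
        y holomorphic_on U \<and> solves_ode2 p q y U \<longrightarrow> (\<exists>Y. Y holomorphic_on ball b r \<and> (\<forall>z\<in>U. Y z = y z))"
    using assms unfolding false_singular_point_def by (elim exE conjE)
  have r: "r > 0" "\<exists>Y. Y holomorphic_on ball b r \<and> (\<forall>z\<in>U. Y z = y z)"
    if "open U" "connected U" "U \<subseteq> ball b r - {b}" "y holomorphic_on U" "solves_ode2 p q y U" for U y
    by (rule r'(1), rule r'(2)[rule_format]) (intro conjI that)
  have "isCont \<zeta> d" using holomorphic_on_imp_continuous_on[OF \<zeta>(1)] r0 by (auto simp: continuous_on_eq_continuous_at)
  then obtain s1 where s1: "s1 > 0" "\<And>x. dist x d < s1 \<Longrightarrow> dist (\<zeta> x) (\<zeta> d) < r"
    using r'(1) unfolding continuous_at_eps_delta by (metis dist_commute)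
  define s where "s = min r0 s1"
  have s: "0 < s" "s \<le> r0" "s \<le> s1" using r0 s1 by (auto simp: s_def)
  have \<zeta>s: "\<zeta> x \<in> ball b r - {b}" if "x \<in> ball d s - {d}" for x
    using s1(2)[of x] that s \<zeta>(3) \<zeta>_neq[of x] by (auto simp: dist_commute)
  have \<zeta>s': "\<zeta> ` ball d s \<subseteq> ball b r" using s1(2) s \<zeta>(3) by (auto simp: dist_commute)
  obtain \<xi> where \<xi>: "\<xi> holomorphic_on \<zeta> ` ball d s" "\<And>x. x \<in> ball d s \<Longrightarrow> \<xi> (\<zeta> x) = x" "open (\<zeta> ` ball d s)"
    using inverse_chart[OF s(1,2)] by blast
  \<comment> \<open>an ordinary point has pole strength \<open>0\<close>, so \<open>local_solution_basis\<close> applies there as well\<close>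
  define x0 where "x0 = d + of_real (s / 2)"
  have x0: "x0 \<in> ball d s - {d}" using s by (auto simp: x0_def dist_norm)
  have "v analytic_on {x0}"
    using v(3) x0 s(2) unfolding analytic_at by (intro exI[of _ "ball d r0 - {d}"]) auto
  then obtain V0 where V0: "(\<lambda>t. v (x0 + t)) has_laurent_expansion V0" "\<And>i. i < 0 \<Longrightarrow> V0 $$ i = 0"
    using analytic_has_laurent_expansion by metis
  have ps0: "pole_strength 0 V0" using V0(2) by (simp add: pole_strength_def)
  have "V0 $$ i = 0" if "odd i" "i < 2 * int 0 + 1" for i
  proof -
    have "i < 0" using that by presburger
    thus ?thesis by (rule V0(2))
  qed
  note odd0 = this
  obtain \<rho> f g A B where sol: "\<rho> > 0" "f holomorphic_on ball x0 \<rho> - {x0}" "g holomorphic_on ball x0 \<rho> - {x0}"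
    "\<And>x. x \<in> ball x0 \<rho> - {x0} \<Longrightarrow> deriv (deriv f) x = v x * f x"
    "\<And>x. x \<in> ball x0 \<rho> - {x0} \<Longrightarrow> deriv (deriv g) x = v x * g x"
    "\<And>x. x \<in> ball x0 \<rho> - {x0} \<Longrightarrow> wronskian f g x = 2 * of_nat 0 + 1"
    by (rule local_solution_basis[OF V0(1) ps0 odd0]) (assumption | rule that)+
  have "open ((ball x0 \<rho> - {x0}) \<inter> (ball d s - {d}))" by (intro open_Int open_Diff) auto
  moreover have "(ball x0 \<rho> - {x0}) \<inter> (ball d s - {d}) \<noteq> {}"
  proof -
    have "eventually (\<lambda>x. x \<in> ball x0 \<rho> - {x0}) (at x0)" using sol(1) by (intro eventually_at_in_open) auto
    moreover have "eventually (\<lambda>x. x \<in> ball d s - {d}) (at x0)" using x0 by (intro eventually_at_in_open') auto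
    ultimately have "eventually (\<lambda>x. x \<in> (ball x0 \<rho> - {x0}) \<inter> (ball d s - {d})) (at x0)" by eventually_elim auto
    thus ?thesis using eventually_happens trivial_limit_at by blast
  qed
  ultimately obtain x1 e where x1: "e > 0" "ball x1 e \<subseteq> (ball x0 \<rho> - {x0}) \<inter> (ball d s - {d})"
    by (meson all_not_in_conv openE)
  define S where "S = ball x1 e"
  have S: "open S" "connected S" "S \<subseteq> ball x0 \<rho> - {x0}" "S \<subseteq> ball d s - {d}" "x1 \<in> S" "S \<subseteq> ball d r0 - {d}"
    using x1 s by (auto simp: S_def)
  define U where "U = \<zeta> ` S"
  have \<zeta>Sh: "\<zeta> holomorphic_on S" using \<zeta>(1) S(6) by (auto intro: holomorphic_on_subset)
  have Uo: "open U" unfolding U_def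
    by (rule open_mapping_thm3[OF \<zeta>Sh S(1)]) (use \<zeta>(2) S(6) in \<open>auto intro: inj_on_subset\<close>)
  have Uc: "connected U" unfolding U_def by (intro connected_continuous_image holomorphic_on_imp_continuous_on \<zeta>Sh S)
  have Ub: "U \<subseteq> ball b r - {b}" unfolding U_def using \<zeta>s S(4) by blast
  have Us: "U \<subseteq> \<zeta> ` ball d s" unfolding U_def using S(4) by blast
  have Hh: "H holomorphic_on \<zeta> ` ball d s" by (rule holomorphic_on_subset[OF H(1) image_mono]) (use s(2) in auto)
  have Hnz: "H z \<noteq> 0" if "z \<in> \<zeta> ` ball d s" for z using that s(2) by (intro H(2)) (use s(2) in force)
  have \<zeta>h: "\<zeta> holomorphic_on ball d s" using \<zeta>(1) s(2) by (auto intro: holomorphic_on_subset)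
  obtain Z where Z: "(\<lambda>t. \<zeta> (d + t) - b) has_laurent_expansion Z" "\<And>i. i < 1 \<Longrightarrow> Z $$ i = 0" "Z $$ 1 \<noteq> 0"
    using \<zeta>_expansion by blast
  \<comment> \<open>every solution on \<open>S\<close> continues to a solution on the punctured disc, of moderate growth\<close>
  have ext: "\<exists>\<Psi> P. \<Psi> holomorphic_on ball d s - {d} \<and> (\<forall>x\<in>S. \<Psi> x = h x) \<and> (\<lambda>t. \<Psi> (d + t)) has_laurent_expansion P
     \<and> (\<forall>i< - int n. P $$ i = 0) \<and> fls_deriv (fls_deriv P) = V * P"
    if h: "h holomorphic_on S" "\<And>x. x \<in> S \<Longrightarrow> deriv (deriv h) x = v x * h x" for h
  proof -
    define y where "y = (\<lambda>z. h (\<xi> z) * (z - b) ^ n / H z)"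
    have \<xi>U: "\<xi> ` U \<subseteq> S" unfolding U_def using \<xi>(2) S(4) by force
    have yh: "y holomorphic_on U" unfolding y_def
    proof (intro holomorphic_intros)
      have "h \<circ> \<xi> holomorphic_on U"
        by (rule holomorphic_on_compose_gen[OF holomorphic_on_subset[OF \<xi>(1) Us] h(1) \<xi>U])
      thus "(\<lambda>z. h (\<xi> z)) holomorphic_on U" by (simp add: o_def)
      show "H holomorphic_on U" using Hh Us by (rule holomorphic_on_subset)
    qed (use Hnz Us in auto)
    have hy: "y (\<zeta> x) * H (\<zeta> x) / (\<zeta> x - b) ^ n = h x" if "x \<in> S" for x
    proof -
      have x: "x \<in> ball d s" "x \<in> ball d r0 - {d}" using that S by auto
      have "H (\<zeta> x) \<noteq> 0" using Hnz x(1) by blast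
      moreover have "\<zeta> x - b \<noteq> 0" using \<zeta>_neq[OF x(2)] by simp
      ultimately show ?thesis using \<xi>(2)[OF x(1)] by (simp add: y_def)
    qed
    have dd: "deriv (deriv (\<lambda>x. y (\<zeta> x) * H (\<zeta> x) / (\<zeta> x - b) ^ n)) x = deriv (deriv h) x" if "x \<in> S" for x
    proof -
      have "deriv (\<lambda>x. y (\<zeta> x) * H (\<zeta> x) / (\<zeta> x - b) ^ n) x' = deriv h x'" if "x' \<in> S" for x'
      proof (rule deriv_cong_ev[OF _ refl])
        show "eventually (\<lambda>x. y (\<zeta> x) * H (\<zeta> x) / (\<zeta> x - b) ^ n = h x) (nhds x')"
          using eventually_nhds_in_open[OF S(1) that] by eventually_elim (rule hy)
      qed
      note * = this
      show ?thesis
      proof (rule deriv_cong_ev[OF _ refl])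
        show "eventually (\<lambda>x'. deriv (\<lambda>x. y (\<zeta> x) * H (\<zeta> x) / (\<zeta> x - b) ^ n) x' = deriv h x') (nhds x)"
          using eventually_nhds_in_open[OF S(1) that] by eventually_elim (rule *)
      qed
    qed
    have "solves_ode2 p q y U"
      using transfer[OF S(1,6), of y] yh h(2) unfolding U_def[symmetric] by (simp add: hy dd)
    then obtain Y where Y: "Y holomorphic_on ball b r" "\<And>z. z \<in> U \<Longrightarrow> Y z = y z"
      using r(2)[OF Uo Uc Ub yh] by blast
    define N where "N = (\<lambda>x. Y (\<zeta> x) * H (\<zeta> x))"
    define \<Psi> where "\<Psi> = (\<lambda>x. N x / (\<zeta> x - b) ^ n)"
    have Nh: "N holomorphic_on ball d s" unfolding N_def
    proof (intro holomorphic_intros)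
      show "(\<lambda>x. Y (\<zeta> x)) holomorphic_on ball d s"
        using holomorphic_on_compose_gen[OF \<zeta>h Y(1) \<zeta>s'] by (simp add: o_def)
      show "(\<lambda>x. H (\<zeta> x)) holomorphic_on ball d s"
        using holomorphic_on_compose[OF \<zeta>h Hh] by (simp add: o_def)
    qed
    have \<Psi>h: "\<Psi> holomorphic_on ball d s - {d}" unfolding \<Psi>_def
      by (intro holomorphic_intros holomorphic_on_subset[OF Nh] holomorphic_on_subset[OF \<zeta>h]) (use \<zeta>_neq s(2) in auto)
    have \<Psi>S: "\<Psi> x = h x" if "x \<in> S" for x
      using hy[OF that] Y(2)[of "\<zeta> x"] that by (simp add: \<Psi>_def N_def U_def)
    have "N analytic_on {d}" using Nh s(1) by (auto simp: analytic_at intro!: exI[of _ "ball d s"])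
    then obtain F where F: "(\<lambda>t. N (d + t)) has_laurent_expansion F" "\<And>i. i < 0 \<Longrightarrow> F $$ i = 0"
      using analytic_has_laurent_expansion by metis
    obtain P where P: "(\<lambda>t. N (d + t) / (\<zeta> (d + t) - b) ^ n) has_laurent_expansion P" "\<And>i. i < 0 - int n \<Longrightarrow> P $$ i = 0"
      using has_laurent_expansion_divide_power[OF F(1) Z F(2)] by metis
    have P': "(\<lambda>t. \<Psi> (d + t)) has_laurent_expansion P" using P(1) by (simp add: \<Psi>_def)
    define D where "D = (\<lambda>x. deriv (deriv \<Psi>) x - v x * \<Psi> x)"
    have op: "open (ball d s - {d})" by (intro open_Diff) auto
    have Dh: "D holomorphic_on ball d s - {d}" unfolding D_def
      by (intro holomorphic_intros holomorphic_deriv[OF _ op] \<Psi>h holomorphic_on_subset[OF v(3)]) (use s(2) in auto)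
    have DS: "D x = 0" if "x \<in> S" for x
    proof -
      have 1: "deriv \<Psi> x' = deriv h x'" if "x' \<in> S" for x'
      proof (rule deriv_cong_ev[OF _ refl])
        show "eventually (\<lambda>x. \<Psi> x = h x) (nhds x')"
          using eventually_nhds_in_open[OF S(1) that] by eventually_elim (rule \<Psi>S)
      qed
      have "deriv (deriv \<Psi>) x = deriv (deriv h) x"
      proof (rule deriv_cong_ev[OF _ refl])
        show "eventually (\<lambda>x'. deriv \<Psi> x' = deriv h x') (nhds x)"
          using eventually_nhds_in_open[OF S(1) that] by eventually_elim (rule 1)
      qed
      thus ?thesis using h(2)[OF that] \<Psi>S[OF that] by (simp add: D_def)
    qed
    have conn: "connected (ball d s - {d})" by (rule connected_punctured_ball) simp
    have D0: "D x = 0" if "x \<in> ball d s - {d}" for x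
      by (rule analytic_continuation_open[of S "ball d s - {d}" D "\<lambda>_. 0"]) (use S op conn Dh DS that in auto)
    have "(\<lambda>t. D (d + t)) has_laurent_expansion fls_deriv (fls_deriv P) - V * P"
      unfolding D_def by (intro laurent_expansion_intros has_laurent_expansion_deriv_shift P' v)
    moreover have "(\<lambda>t. D (d + t)) has_laurent_expansion 0"
    proof -
      have "eventually (\<lambda>x. x \<in> ball d s - {d}) (at d)" using s by (intro eventually_at_in_open) auto
      hence "eventually (\<lambda>x. D x = 0) (at d)" by eventually_elim (rule D0)
      hence "eventually (\<lambda>t. D (d + t) = 0) (at 0)" by (simp add: eventually_at_to_0[of _ d] add.commute)
      thus ?thesis using has_laurent_expansion_cong[of "\<lambda>t. D (d + t)" "\<lambda>_. 0" 0 0] by simp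
    qed
    ultimately have "fls_deriv (fls_deriv P) - V * P = 0" by (rule has_laurent_expansion_unique)
    thus ?thesis using \<Psi>h \<Psi>S P' P(2) by (intro exI[of _ \<Psi>] exI[of _ P]) auto
  qed
  have fh: "f holomorphic_on S" and gh: "g holomorphic_on S" using sol(2,3) S(3) by (auto intro: holomorphic_on_subset)
  obtain F P where F: "F holomorphic_on ball d s - {d}" "\<And>x. x \<in> S \<Longrightarrow> F x = f x" "(\<lambda>t. F (d + t)) has_laurent_expansion P"
    "\<And>i. i < - int n \<Longrightarrow> P $$ i = 0" "fls_deriv (fls_deriv P) = V * P"
    using ext[OF fh] sol(4) S(3) by blast
  obtain G Q where G: "G holomorphic_on ball d s - {d}" "\<And>x. x \<in> S \<Longrightarrow> G x = g x" "(\<lambda>t. G (d + t)) has_laurent_expansion Q"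
    "\<And>i. i < - int n \<Longrightarrow> Q $$ i = 0" "fls_deriv (fls_deriv Q) = V * Q"
    using ext[OF gh] sol(5) S(3) by blast
  show ?thesis
  proof (rule ccontr)
    assume no: "\<not> ?thesis"
    have P0: "P $$ (- int n) = 0" and Q0: "Q $$ (- int n) = 0" using no F(4,5) G(4,5) by blast+
    obtain \<alpha> \<beta> where \<alpha>\<beta>: "\<alpha> \<noteq> 0 \<or> \<beta> \<noteq> 0" "\<alpha> * P $$ (int n + 1) + \<beta> * Q $$ (int n + 1) = 0"
    proof (cases "P $$ (int n + 1) = 0")
      case True
      thus ?thesis using that[of 1 0] by simp
    next
      case False
      thus ?thesis using that[of "- Q $$ (int n + 1)" "P $$ (int n + 1)"] by simp
    qed
    define R where "R = fls_const \<alpha> * P + fls_const \<beta> * Q"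
    have "fls_deriv (fls_deriv R) = V * R" unfolding R_def by (simp add: F(5) G(5) algebra_simps)
    hence "R $$ i = 0" for i
      by (rule formal_solution_coeff_zero[OF v(2), rotated]) (use F(4) G(4) P0 Q0 \<alpha>\<beta> in \<open>auto simp: R_def\<close>)
    hence R0: "R = 0" by (intro fls_eqI) simp
    define h where "h = (\<lambda>x. \<alpha> * F x + \<beta> * G x)"
    have "(\<lambda>t. h (d + t)) has_laurent_expansion R" unfolding h_def R_def by (intro laurent_expansion_intros F G)
    hence "h x = 0" if "x \<in> ball d s - {d}" for x
      using that F(1) G(1) s(1) unfolding R0 by (intro laurent_zero_on_punctured_ball[of h d s]) (auto simp: h_def intro!: holomorphic_intros)
    hence z: "\<alpha> * f x + \<beta> * g x = 0" if "x \<in> S" for x using that S(4) F(2) G(2) unfolding h_def by force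
    have fd: "(f has_field_derivative deriv f x1) (at x1)" and gd: "(g has_field_derivative deriv g x1) (at x1)"
      using fh gh S(1,5) by (auto intro: holomorphic_derivI)
    have "((\<lambda>x. \<alpha> * f x + \<beta> * g x) has_field_derivative \<alpha> * deriv f x1 + \<beta> * deriv g x1) (at x1)"
      by (intro DERIV_add DERIV_cmult fd gd)
    moreover have "((\<lambda>x. \<alpha> * f x + \<beta> * g x) has_field_derivative 0) (at x1)"
    proof (rule DERIV_cong_ev[THEN iffD2, of x1 x1 _ "\<lambda>_. 0"])
      show "eventually (\<lambda>x. \<alpha> * f x + \<beta> * g x = 0) (nhds x1)"
        using eventually_nhds_in_open[OF S(1,5)] by eventually_elim (rule z)
    qed auto
    ultimately have dz: "\<alpha> * deriv f x1 + \<beta> * deriv g x1 = 0" by (rule DERIV_unique)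
    have w: "f x1 * deriv g x1 - deriv f x1 * g x1 = 1"
    proof -
      have "x1 \<in> ball x0 \<rho> - {x0}" using S(3,5) by blast
      from sol(6)[OF this] show ?thesis by (simp add: wronskian_def)
    qed
    have "\<alpha> = (\<alpha> * f x1 + \<beta> * g x1) * deriv g x1 - (\<alpha> * deriv f x1 + \<beta> * deriv g x1) * g x1"
      using arg_cong[OF w, of "\<lambda>w. \<alpha> * w"] by (simp add: algebra_simps)
    hence "\<alpha> = 0" using z[OF S(5)] dz by simp
    moreover have "\<beta> = (\<alpha> * deriv f x1 + \<beta> * deriv g x1) * f x1 - (\<alpha> * f x1 + \<beta> * g x1) * deriv f x1"
      using arg_cong[OF w, of "\<lambda>w. \<beta> * w"] by (simp add: algebra_simps)
    hence "\<beta> = 0" using z[OF S(5)] dz by simp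
    ultimately show False using \<alpha>\<beta>(1) by simp
  qed
qed

end

section \<open>A partial fraction identity\<close>

lemma cubic_partial_fraction_double:
  fixes z p \<sigma> \<tau> :: complex
  defines "f \<equiv> (\<lambda>z. z ^ 3 + \<sigma> * z ^ 2 + \<tau> * z)" and "f' \<equiv> (\<lambda>z. 3 * z ^ 2 + 2 * \<sigma> * z + \<tau>)"
  assumes "z \<noteq> p"
  shows "f z / (z - p) ^ 2 = f p / (z - p) ^ 2 + f' p / (z - p) + z + 2 * p + \<sigma>"
proof -
  have "f z = f p + f' p * (z - p) + (z + 2 * p + \<sigma>) * (z - p) ^ 2"
    unfolding f_def f'_def by (simp add: power2_eq_square power3_eq_cube algebra_simps)
  thus ?thesis using assms(3) by (simp add: add_divide_distrib power2_eq_square)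
qed

lemma cubic_partial_fraction_distinct:
  fixes z p q \<sigma> \<tau> :: complex
  defines "f \<equiv> (\<lambda>z. z ^ 3 + \<sigma> * z ^ 2 + \<tau> * z)"
  assumes "z \<noteq> p" "z \<noteq> q" "p \<noteq> q"
  shows "f z / ((z - p) * (z - q)) = f p / (z - p) / (p - q) + f q / (z - q) / (q - p) + z + p + q + \<sigma>"
proof -
  have "f z * (p - q) = f p * (z - q) - f q * (z - p) + (z + p + q + \<sigma>) * ((z - p) * (z - q) * (p - q))"
    unfolding f_def by (simp add: power2_eq_square power3_eq_cube algebra_simps)
  hence "f z * (p - q) / ((z - p) * (z - q) * (p - q)) =
     (f p * (z - q) - f q * (z - p) + (z + p + q + \<sigma>) * ((z - p) * (z - q) * (p - q))) / ((z - p) * (z - q) * (p - q))"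
    by simp
  also have "\<dots> = f p / (z - p) / (p - q) - f q / (z - q) / (p - q) + (z + p + q + \<sigma>)"
    using assms(2-) by (simp add: add_divide_distrib diff_divide_distrib)
  also have "f q / (z - q) / (p - q) = - (f q / (z - q) / (q - p))"
    by (metis minus_diff_eq minus_divide_right)
  finally show ?thesis using assms(2-) by simp
qed

lemma cubic_partial_fraction_deriv:
  fixes z p \<sigma> \<tau> :: complex
  defines "f' \<equiv> (\<lambda>z. 3 * z ^ 2 + 2 * \<sigma> * z + \<tau>)"
  assumes "z \<noteq> p"
  shows "f' z / (z - p) = f' p / (z - p) + 3 * z + 3 * p + 2 * \<sigma>"
proof -
  have "f' z = f' p + (3 * z + 3 * p + 2 * \<sigma>) * (z - p)"
    unfolding f'_def by (simp add: power2_eq_square algebra_simps)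
  thus ?thesis using assms(2) by (simp add: add_divide_distrib)
qed

lemma square_of_sum:
  fixes g :: "'b \<Rightarrow> complex"
  assumes "finite I"
  shows "(\<Sum>i\<in>I. g i) ^ 2 = (\<Sum>i\<in>I. g i ^ 2) + (\<Sum>i\<in>I. \<Sum>j\<in>I - {i}. g i * g j)"
proof -
  have "(\<Sum>i\<in>I. g i) ^ 2 = (\<Sum>i\<in>I. \<Sum>j\<in>I. g i * g j)" by (simp add: power2_eq_square sum_product)
  also have "\<dots> = (\<Sum>i\<in>I. g i ^ 2 + (\<Sum>j\<in>I - {i}. g i * g j))"
    using assms by (intro sum.cong refl) (simp add: sum.remove power2_eq_square)
  finally show ?thesis by (simp add: sum.distrib)
qed

lemma sum_offdiag_swap:
  assumes "finite I"
  shows "(\<Sum>i\<in>I. \<Sum>j\<in>I - {i}. F i j) = (\<Sum>i\<in>I. \<Sum>j\<in>I - {i}. F j i :: complex)"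
proof -
  have "(\<Sum>i\<in>I. \<Sum>j\<in>I - {i}. F i j) = (\<Sum>i\<in>I. \<Sum>j\<in>I. if i \<noteq> j then F i j else 0)" for F :: "'a \<Rightarrow> 'a \<Rightarrow> complex"
  proof (rule sum.cong[OF refl])
    fix i assume "i \<in> I"
    show "(\<Sum>j\<in>I - {i}. F i j) = (\<Sum>j\<in>I. if i \<noteq> j then F i j else 0)"
      by (rule sum.mono_neutral_cong_left) (use assms in auto)
  qed
  note * = this
  show ?thesis unfolding *[of F] *[of "\<lambda>i j. F j i"]
    by (subst sum.swap) (intro sum.cong refl, auto)
qed

text \<open>
  Partial fractions separate the products over distinct poles in \<open>h\<^sup>2\<close>. The cubic factor leaves polynomial
  parts which are linear in \<open>z\<close>; their slopes add up to \<open>4 * H ^ 2 - 2 * H\<close>, and their constant terms to \<open>K\<close>.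
\<close>
theorem logarithmic_derivative_partial_fractions:
  fixes I :: "complex set" and w :: "complex \<Rightarrow> complex" and \<sigma> \<tau> :: complex
  defines "f \<equiv> (\<lambda>z. z ^ 3 + \<sigma> * z ^ 2 + \<tau> * z)" and "f' \<equiv> (\<lambda>z. 3 * z ^ 2 + 2 * \<sigma> * z + \<tau>)"
  defines "h \<equiv> (\<lambda>z. - (\<Sum>p\<in>I. w p / (z - p)))" and "h' \<equiv> (\<lambda>z. \<Sum>p\<in>I. w p / (z - p) ^ 2)"
  defines "H \<equiv> \<Sum>p\<in>I. w p"
  assumes fin: "finite I"
  obtains K where "\<And>z. z \<notin> I \<Longrightarrow> 4 * f z * (h' z + h z ^ 2) + 2 * f' z * h z =
    (\<Sum>p\<in>I. 4 * (w p + w p ^ 2) * f p / (z - p) ^ 2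
       + ((4 * w p ^ 2 + 2 * w p) * f' p + 8 * w p * f p * (\<Sum>q\<in>I - {p}. w q / (p - q))) / (z - p))
    + (4 * H ^ 2 - 2 * H) * z + K"
proof -
  define K where "K = (\<Sum>p\<in>I. 4 * (w p + w p ^ 2) * (2 * p + \<sigma>))
     + 4 * (\<Sum>p\<in>I. \<Sum>q\<in>I - {p}. w p * w q * (p + q + \<sigma>)) - 2 * (\<Sum>p\<in>I. w p * (3 * p + 2 * \<sigma>))"
  show ?thesis
  proof (rule that[of K])
    fix z assume z: "z \<notin> I"
    have zp: "z \<noteq> p" if "p \<in> I" for p using that z by auto
    have A: "f z * (\<Sum>p\<in>I. (w p + w p ^ 2) / (z - p) ^ 2) =
      (\<Sum>p\<in>I. (w p + w p ^ 2) * (f p / (z - p) ^ 2)) + (\<Sum>p\<in>I. (w p + w p ^ 2) * (f' p / (z - p)))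
        + z * (\<Sum>p\<in>I. w p + w p ^ 2) + (\<Sum>p\<in>I. (w p + w p ^ 2) * (2 * p + \<sigma>))"
      unfolding sum_distrib_left sum.distrib[symmetric]
    proof (intro sum.cong refl)
      fix p assume "p \<in> I"
      have "f z * ((w p + w p ^ 2) / (z - p) ^ 2) = (w p + w p ^ 2) * (f z / (z - p) ^ 2)" by simp
      also have "f z / (z - p) ^ 2 = f p / (z - p) ^ 2 + f' p / (z - p) + z + 2 * p + \<sigma>"
        unfolding f_def f'_def by (rule cubic_partial_fraction_double[OF zp[OF \<open>p \<in> I\<close>]])
      finally show "f z * ((w p + w p ^ 2) / (z - p) ^ 2) = (w p + w p ^ 2) * (f p / (z - p) ^ 2) + (w p + w p ^ 2) * (f' p / (z - p))
        + z * (w p + w p ^ 2) + (w p + w p ^ 2) * (2 * p + \<sigma>)"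
        by (simp only: distrib_left distrib_right mult.commute add_ac)
    qed
    have B: "f z * (\<Sum>p\<in>I. \<Sum>q\<in>I - {p}. w p / (z - p) * (w q / (z - q))) =
      (\<Sum>p\<in>I. \<Sum>q\<in>I - {p}. w p * w q * (f p / (z - p) / (p - q))) + (\<Sum>p\<in>I. \<Sum>q\<in>I - {p}. w p * w q * (f q / (z - q) / (q - p)))
        + z * (\<Sum>p\<in>I. \<Sum>q\<in>I - {p}. w p * w q) + (\<Sum>p\<in>I. \<Sum>q\<in>I - {p}. w p * w q * (p + q + \<sigma>))"
      unfolding sum_distrib_left sum.distrib[symmetric]
    proof (intro sum.cong refl)
      fix p q assume p: "p \<in> I" and q: "q \<in> I - {p}"
      have "f z * (w p / (z - p) * (w q / (z - q))) = w p * w q * (f z / ((z - p) * (z - q)))" by simp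
      also have "f z / ((z - p) * (z - q)) = f p / (z - p) / (p - q) + f q / (z - q) / (q - p) + z + p + q + \<sigma>"
        unfolding f_def by (rule cubic_partial_fraction_distinct) (use zp p q in auto)
      finally show "f z * (w p / (z - p) * (w q / (z - q))) = w p * w q * (f p / (z - p) / (p - q)) + w p * w q * (f q / (z - q) / (q - p))
        + z * (w p * w q) + w p * w q * (p + q + \<sigma>)"
        by (simp only: distrib_left distrib_right mult.commute add_ac)
    qed
    have B': "(\<Sum>p\<in>I. \<Sum>q\<in>I - {p}. w p * w q * (f q / (z - q) / (q - p))) = (\<Sum>p\<in>I. \<Sum>q\<in>I - {p}. w p * w q * (f p / (z - p) / (p - q)))"
      using sum_offdiag_swap[OF fin, of "\<lambda>p q. w p * w q * (f q / (z - q) / (q - p))"] by (simp add: mult.commute)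
    have C: "f' z * (\<Sum>p\<in>I. w p / (z - p)) = (\<Sum>p\<in>I. w p * (f' p / (z - p))) + 3 * z * H + (\<Sum>p\<in>I. w p * (3 * p + 2 * \<sigma>))"
      unfolding H_def sum_distrib_left sum.distrib[symmetric]
    proof (intro sum.cong refl)
      fix p assume "p \<in> I"
      have "f' z * (w p / (z - p)) = w p * (f' z / (z - p))" by simp
      also have "f' z / (z - p) = f' p / (z - p) + 3 * z + 3 * p + 2 * \<sigma>"
        unfolding f'_def by (rule cubic_partial_fraction_deriv[OF zp[OF \<open>p \<in> I\<close>]])
      finally show "f' z * (w p / (z - p)) = w p * (f' p / (z - p)) + 3 * z * w p + w p * (3 * p + 2 * \<sigma>)"
        by (simp add: distrib_left)
    qed
    have hh: "h' z + h z ^ 2 = (\<Sum>p\<in>I. (w p + w p ^ 2) / (z - p) ^ 2) + (\<Sum>p\<in>I. \<Sum>q\<in>I - {p}. w p / (z - p) * (w q / (z - q)))"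
      unfolding h_def h'_def power2_minus square_of_sum[OF fin] by (simp add: sum.distrib add_divide_distrib power_divide)
    have HH: "H ^ 2 = (\<Sum>p\<in>I. w p ^ 2) + (\<Sum>p\<in>I. \<Sum>q\<in>I - {p}. w p * w q)"
      unfolding H_def by (rule square_of_sum[OF fin])
    define s1 where "s1 = (\<Sum>p\<in>I. (w p + w p ^ 2) * (f p / (z - p) ^ 2))"
    define s2 where "s2 = (\<Sum>p\<in>I. (w p + w p ^ 2) * (f' p / (z - p)))"
    define s3 where "s3 = (\<Sum>p\<in>I. \<Sum>q\<in>I - {p}. w p * w q * (f p / (z - p) / (p - q)))"
    define s4 where "s4 = (\<Sum>p\<in>I. w p * (f' p / (z - p)))"
    define k1 where "k1 = (\<Sum>p\<in>I. (w p + w p ^ 2) * (2 * p + \<sigma>))"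
    define k2 where "k2 = (\<Sum>p\<in>I. \<Sum>q\<in>I - {p}. w p * w q * (p + q + \<sigma>))"
    define k3 where "k3 = (\<Sum>p\<in>I. w p * (3 * p + 2 * \<sigma>))"
    define g where "g = (\<Sum>p\<in>I. \<Sum>q\<in>I - {p}. w p * w q)"
    define g2 where "g2 = (\<Sum>p\<in>I. w p ^ 2)"
    have R: "(\<Sum>p\<in>I. 4 * (w p + w p ^ 2) * f p / (z - p) ^ 2
       + ((4 * w p ^ 2 + 2 * w p) * f' p + 8 * w p * f p * (\<Sum>q\<in>I - {p}. w q / (p - q))) / (z - p)) = 4 * s1 + 4 * s2 - 2 * s4 + 8 * s3"
    proof -
      have "4 * s1 + 4 * s2 - 2 * s4 + 8 * s3 = (\<Sum>p\<in>I. 4 * ((w p + w p ^ 2) * (f p / (z - p) ^ 2)) + 4 * ((w p + w p ^ 2) * (f' p / (z - p)))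
         - 2 * (w p * (f' p / (z - p))) + 8 * (\<Sum>q\<in>I - {p}. w p * w q * (f p / (z - p) / (p - q))))"
        unfolding s1_def s2_def s3_def s4_def by (simp only: sum_distrib_left[symmetric] sum.distrib sum_subtractf)
      also have "\<dots> = (\<Sum>p\<in>I. 4 * (w p + w p ^ 2) * f p / (z - p) ^ 2
       + ((4 * w p ^ 2 + 2 * w p) * f' p + 8 * w p * f p * (\<Sum>q\<in>I - {p}. w q / (p - q))) / (z - p))"
      proof (intro sum.cong refl)
        fix p assume "p \<in> I"
        have "(\<Sum>q\<in>I - {p}. w p * w q * (f p / (z - p) / (p - q))) = w p * f p / (z - p) * (\<Sum>q\<in>I - {p}. w q / (p - q))"
          unfolding sum_distrib_left by (intro sum.cong refl) simp
        thus "4 * ((w p + w p ^ 2) * (f p / (z - p) ^ 2)) + 4 * ((w p + w p ^ 2) * (f' p / (z - p)))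
         - 2 * (w p * (f' p / (z - p))) + 8 * (\<Sum>q\<in>I - {p}. w p * w q * (f p / (z - p) / (p - q)))
         = 4 * (w p + w p ^ 2) * f p / (z - p) ^ 2
       + ((4 * w p ^ 2 + 2 * w p) * f' p + 8 * w p * f p * (\<Sum>q\<in>I - {p}. w q / (p - q))) / (z - p)"
          by (simp add: add_divide_distrib algebra_simps)
      qed
      finally show ?thesis by simp
    qed
    have "4 * f z * (h' z + h z ^ 2) + 2 * f' z * h z =
      4 * (f z * (\<Sum>p\<in>I. (w p + w p ^ 2) / (z - p) ^ 2)) + 4 * (f z * (\<Sum>p\<in>I. \<Sum>q\<in>I - {p}. w p / (z - p) * (w q / (z - q))))
       - 2 * (f' z * (\<Sum>p\<in>I. w p / (z - p)))"
      unfolding hh by (simp add: h_def algebra_simps)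
    also have "\<dots> = 4 * (s1 + s2 + z * (H + g2) + k1) + 4 * (s3 + s3 + z * g + k2) - 2 * (s4 + 3 * z * H + k3)"
      unfolding A B B' C unfolding s1_def s2_def s3_def s4_def k1_def k2_def k3_def g_def g2_def H_def by (simp only: sum.distrib)
    also have "\<dots> = (4 * s1 + 4 * s2 - 2 * s4 + 8 * s3) + (4 * (g2 + g) - 2 * H) * z + (4 * k1 + 4 * k2 - 2 * k3)"
      by (simp add: algebra_simps)
    also have "g2 + g = H ^ 2" unfolding HH g2_def g_def ..
    also have "4 * k1 + 4 * k2 - 2 * k3 = K"
      unfolding K_def k1_def k2_def k3_def by (simp only: sum_distrib_left mult.assoc)
    finally show "4 * f z * (h' z + h z ^ 2) + 2 * f' z * h z =
    (\<Sum>p\<in>I. 4 * (w p + w p ^ 2) * f p / (z - p) ^ 2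
       + ((4 * w p ^ 2 + 2 * w p) * f' p + 8 * w p * f p * (\<Sum>q\<in>I - {p}. w q / (p - q))) / (z - p))
    + (4 * H ^ 2 - 2 * H) * z + K" unfolding R .
  qed
qed

section \<open>The coefficients of the Fuchsian equation\<close>

locale fuchs_parameters =
  fixes a :: complex and M :: nat and m n :: "nat \<Rightarrow> nat" and b :: "nat \<Rightarrow> complex"
  assumes a: "a \<notin> {0, 1}" and b_inj: "inj_on b {1..M}" and b: "\<And>k. k \<in> {1..M} \<Longrightarrow> b k \<notin> {0, 1, a}"
begin

text \<open>
  In the coordinate \<open>z\<close>, the equation of the Weierstrass function reads \<open>z'\<^sup>2 = 4 (e\<^sub>2 - e\<^sub>1) f(z)\<close>.
\<close>
definition f :: "complex \<Rightarrow> complex" where "f z = z * (z - 1) * (z - a)"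
definition f' :: "complex \<Rightarrow> complex" where "f' z = 3 * z ^ 2 - 2 * (a + 1) * z + a"
text \<open>
  The logarithmic derivative of the gauge factor that multiplies \<open>y\<close>.
\<close>
definition h :: "complex \<Rightarrow> complex" where
  "h z = - (of_nat (m 1) / 2 / z + of_nat (m 2) / 2 / (z - 1) + of_nat (m 3) / 2 / (z - a)
       + (\<Sum>k=1..M. of_nat (n k) / (z - b k)))"
definition h' :: "complex \<Rightarrow> complex" where
  "h' z = of_nat (m 1) / 2 / z ^ 2 + of_nat (m 2) / 2 / (z - 1) ^ 2 + of_nat (m 3) / 2 / (z - a) ^ 2
       + (\<Sum>k=1..M. of_nat (n k) / (z - b k) ^ 2)"
definition sing :: "complex set" where "sing = {0, 1, a} \<union> b ` {1..M}"

text \<open>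
  The potential as a function of \<open>z\<close>, up to the factor \<open>e\<^sub>2 - e\<^sub>1\<close> and an additive constant.
\<close>
definition potential_z :: "complex \<Rightarrow> complex" where
  "potential_z z = of_nat (m 0 * (m 0 + 1)) * z + of_nat (m 1 * (m 1 + 1)) * (f' 0 / z)
     + of_nat (m 2 * (m 2 + 1)) * (f' 1 / (z - 1)) + of_nat (m 3 * (m 3 + 1)) * (f' a / (z - a))
     + (\<Sum>k=1..M. of_nat (n k * (n k + 1)) * (4 * f (b k) / (z - b k) ^ 2 + 2 * f' (b k) / (z - b k)))"

definition w :: "complex \<Rightarrow> complex" where
  "w p = (if p = 0 then of_nat (m 1) / 2 else if p = 1 then of_nat (m 2) / 2 else if p = a then of_nat (m 3) / 2
     else of_nat (n (the_inv_into {1..M} b p)))"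

lemma w_simps: "w 0 = of_nat (m 1) / 2" "w 1 = of_nat (m 2) / 2" "w a = of_nat (m 3) / 2"
  "k \<in> {1..M} \<Longrightarrow> w (b k) = of_nat (n k)"
  using a b[of k] the_inv_into_f_f[OF b_inj] by (auto simp: w_def)

lemma sum_sing: "(\<Sum>p\<in>sing. F p) = F 0 + F 1 + F a + (\<Sum>k=1..M. F (b k) :: complex)"
proof -
  have "(\<Sum>p\<in>sing. F p) = (\<Sum>p\<in>{0, 1, a}. F p) + (\<Sum>p\<in>b ` {1..M}. F p)"
  proof -
    have "{0, 1, a} \<inter> b ` {1..M} = {}"
    proof (rule equals0I)
      fix x assume "x \<in> {0, 1, a} \<inter> b ` {1..M}"
      then obtain k where "k \<in> {1..M}" "b k \<in> {0, 1, a}" by auto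
      thus False using b[of k] by simp
    qed
    thus ?thesis unfolding sing_def by (intro sum.union_disjoint) auto
  qed
  also have "(\<Sum>p\<in>b ` {1..M}. F p) = (\<Sum>k=1..M. F (b k))" by (subst sum.reindex[OF b_inj]) (simp only: o_def)
  also have "(\<Sum>p\<in>{0, 1, a}. F p) = F 0 + F 1 + F a" using a by auto
  finally show ?thesis .
qed

lemma sum_sing_remove:
  assumes k: "k \<in> {1..M}"
  shows "(\<Sum>p\<in>sing - {b k}. F p) = F 0 + F 1 + F a + (\<Sum>j\<in>{1..M} - {k}. F (b j) :: complex)"
proof -
  have "finite sing" "b k \<in> sing" using k by (auto simp: sing_def)
  hence "(\<Sum>p\<in>sing. F p) = F (b k) + (\<Sum>p\<in>sing - {b k}. F p)" by (rule sum.remove)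
  moreover have "(\<Sum>j=1..M. F (b j)) = F (b k) + (\<Sum>j\<in>{1..M} - {k}. F (b j))"
    using k by (intro sum.remove) auto
  ultimately show ?thesis using sum_sing[of F] by (simp add: algebra_simps)
qed

lemma f_cubic: "f z = z ^ 3 + (- (a + 1)) * z ^ 2 + a * z" 
  by (simp add: f_def power2_eq_square power3_eq_cube algebra_simps)

lemma f'_cubic: "f' z = 3 * z ^ 2 + 2 * (- (a + 1)) * z + a"
  by (simp add: f'_def algebra_simps)

lemma fuchs_rho_eq:
  assumes k: "k \<in> {1..M}"
  shows "fuchs_rho a M m n b k = of_nat (n k) * f' (b k) + 4 * f (b k) * (\<Sum>q\<in>sing - {b k}. w q / (b k - q))"
proof -
  have bk: "b k \<noteq> 0" "b k - 1 \<noteq> 0" "b k - a \<noteq> 0" using b[OF k] by auto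
  have "(\<Sum>q\<in>sing - {b k}. w q / (b k - q)) = of_nat (m 1) / 2 / b k + of_nat (m 2) / 2 / (b k - 1) + of_nat (m 3) / 2 / (b k - a)
     + (\<Sum>j\<in>{1..M} - {k}. of_nat (n j) / (b k - b j))"
    unfolding sum_sing_remove[OF k] by (simp add: w_simps)
  moreover have "4 * f (b k) * (of_nat (m 1) / 2 / b k) = 2 * (b k - 1) * (b k - a) * of_nat (m 1)" 
     "4 * f (b k) * (of_nat (m 2) / 2 / (b k - 1)) = 2 * b k * (b k - a) * of_nat (m 2)"
     "4 * f (b k) * (of_nat (m 3) / 2 / (b k - a)) = 2 * b k * (b k - 1) * of_nat (m 3)"
    unfolding f_def using bk by (simp_all add: field_simps)
  moreover have "4 * f (b k) * (\<Sum>j\<in>{1..M} - {k}. of_nat (n j) / (b k - b j)) =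
     4 * (\<Sum>j\<in>{1..M} - {k}. b k * (b k - 1) * (b k - a) / (b k - b j) * of_nat (n j))"
    unfolding sum_distrib_left f_def by (intro sum.cong refl) simp
  ultimately show ?thesis unfolding fuchs_rho_def f'_def
    by (simp only: distrib_left) (simp add: algebra_simps)
qed

text \<open>
  The partial fraction identity for the exponents \<open>w\<close> of the gauge factor. At \<open>0\<close>, \<open>1\<close>, \<open>a\<close> the cubic vanishes
  and \<open>4 w\<^sup>2 + 2 w = m (m + 1)\<close> gives the potential. At \<open>b\<^sub>k\<close> the coefficient \<open>4 n\<^sup>2 + 2 n\<close> splits into \<open>2 n (n + 1)\<close>,
  which belongs to the potential, and \<open>2 n\<^sup>2\<close>, which belongs to \<open>\<rho>\<^sub>k\<close>. With \<open>2 H = N - m\<^sub>0\<close>, the slope \<open>4 H\<^sup>2 - 2 H\<close> is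
  \<open>N (N - 2 m\<^sub>0 - 1) + m\<^sub>0 (m\<^sub>0 + 1)\<close>.
\<close>
lemma rational_identity:
  obtains K where "\<And>z. z \<notin> sing \<Longrightarrow> 4 * f z * (h' z + h z ^ 2) + 2 * f' z * h z =
     of_nat (fuchs_N M m n) * (of_nat (fuchs_N M m n) - 2 * of_nat (m 0) - 1) * z + fuchs_R a M m n b z + potential_z z + K"
proof -
  have fin: "finite sing" by (simp add: sing_def)
  obtain K where K: "\<And>z. z \<notin> sing \<Longrightarrow> 4 * f z * ((\<Sum>p\<in>sing. w p / (z - p) ^ 2) + (- (\<Sum>p\<in>sing. w p / (z - p))) ^ 2) + 2 * f' z * (- (\<Sum>p\<in>sing. w p / (z - p))) =
    (\<Sum>p\<in>sing. 4 * (w p + w p ^ 2) * f p / (z - p) ^ 2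
       + ((4 * w p ^ 2 + 2 * w p) * f' p + 8 * w p * f p * (\<Sum>q\<in>sing - {p}. w q / (p - q))) / (z - p))
    + (4 * (\<Sum>p\<in>sing. w p) ^ 2 - 2 * (\<Sum>p\<in>sing. w p)) * z + K"
    unfolding f_cubic f'_cubic
    by (rule logarithmic_derivative_partial_fractions[OF fin, of "- (a + 1)" a w]) (rule that[unfolded f_cubic f'_cubic], assumption)
  show ?thesis
  proof (rule that[of K])
    fix z assume z: "z \<notin> sing"
    have hs: "- (\<Sum>p\<in>sing. w p / (z - p)) = h z" unfolding sum_sing h_def by (simp add: w_simps)
    have hs': "(\<Sum>p\<in>sing. w p / (z - p) ^ 2) = h' z" unfolding sum_sing h'_def by (simp add: w_simps)
    define N :: complex where "N = of_nat (fuchs_N M m n)"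
    have H: "(\<Sum>p\<in>sing. w p) = (N - of_nat (m 0)) / 2"
    proof -
      have s: "{0..3} = {0, 1, 2, 3 :: nat}" by auto
      have "(\<Sum>p\<in>sing. w p) = of_nat (m 1) / 2 + of_nat (m 2) / 2 + of_nat (m 3) / 2 + (\<Sum>k=1..M. of_nat (n k))"
        unfolding sum_sing by (simp add: w_simps)
      moreover have "N = of_nat (m 0) + of_nat (m 1) + of_nat (m 2) + of_nat (m 3) + 2 * (\<Sum>k=1..M. of_nat (n k))"
        unfolding N_def fuchs_N_def s by simp
      ultimately show ?thesis by (simp add: field_simps)
    qed
    have f0: "f 0 = 0" "f 1 = 0" "f a = 0" by (simp_all add: f_def)
    have wm: "4 * (of_nat l / 2) ^ 2 + 2 * (of_nat l / 2) = (of_nat (l * (l + 1)) :: complex)" for l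
      by (simp add: power2_eq_square algebra_simps)
    have bs: "4 * (w (b k) + w (b k) ^ 2) * f (b k) / (z - b k) ^ 2
       + ((4 * w (b k) ^ 2 + 2 * w (b k)) * f' (b k) + 8 * w (b k) * f (b k) * (\<Sum>q\<in>sing - {b k}. w q / (b k - q))) / (z - b k)
      = of_nat (n k * (n k + 1)) * (4 * f (b k) / (z - b k) ^ 2 + 2 * f' (b k) / (z - b k)) + 2 * (of_nat (n k) * fuchs_rho a M m n b k / (z - b k))"
      if k: "k \<in> {1..M}" for k
    proof -
      define X where "X = (\<Sum>q\<in>sing - {b k}. w q / (b k - q))"
      define \<nu> :: complex where "\<nu> = of_nat (n k)"
      have wk: "w (b k) = \<nu>" using w_simps(4)[OF k] by (simp add: \<nu>_def)
      have \<rho>: "fuchs_rho a M m n b k = \<nu> * f' (b k) + 4 * f (b k) * X" using fuchs_rho_eq[OF k] by (simp add: X_def \<nu>_def)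
      have nn: "(of_nat (n k * (n k + 1)) :: complex) = \<nu> ^ 2 + \<nu>" by (simp add: \<nu>_def power2_eq_square algebra_simps)
      have "(4 * \<nu> ^ 2 + 2 * \<nu>) * f' (b k) + 8 * \<nu> * f (b k) * X = (\<nu> ^ 2 + \<nu>) * (2 * f' (b k)) + 2 * (\<nu> * (\<nu> * f' (b k) + 4 * f (b k) * X))"
        by (simp add: power2_eq_square algebra_simps)
      thus ?thesis unfolding X_def[symmetric] wk \<rho> nn \<nu>_def[symmetric]
        by (simp only: add_divide_distrib distrib_left times_divide_eq_right) (simp add: mult_ac add_ac)
    qed
    have S: "(\<Sum>p\<in>sing. 4 * (w p + w p ^ 2) * f p / (z - p) ^ 2
       + ((4 * w p ^ 2 + 2 * w p) * f' p + 8 * w p * f p * (\<Sum>q\<in>sing - {p}. w q / (p - q))) / (z - p))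
      = potential_z z - of_nat (m 0 * (m 0 + 1)) * z + fuchs_R a M m n b z"
    proof -
      have "(\<Sum>k=1..M. 4 * (w (b k) + w (b k) ^ 2) * f (b k) / (z - b k) ^ 2
       + ((4 * w (b k) ^ 2 + 2 * w (b k)) * f' (b k) + 8 * w (b k) * f (b k) * (\<Sum>q\<in>sing - {b k}. w q / (b k - q))) / (z - b k))
        = (\<Sum>k=1..M. of_nat (n k * (n k + 1)) * (4 * f (b k) / (z - b k) ^ 2 + 2 * f' (b k) / (z - b k))) + fuchs_R a M m n b z"
      proof -
        have R: "fuchs_R a M m n b z = (\<Sum>k=1..M. 2 * (of_nat (n k) * fuchs_rho a M m n b k / (z - b k)))"
          by (simp add: fuchs_R_def sum_distrib_left)
        show ?thesis unfolding R sum.distrib[symmetric] by (intro sum.cong refl bs)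
      qed
      thus ?thesis unfolding sum_sing potential_z_def f0 w_simps(1-3) wm by simp
    qed
    have zc: "4 * ((N - of_nat (m 0)) / 2) ^ 2 - 2 * ((N - of_nat (m 0)) / 2) = N * (N - 2 * of_nat (m 0) - 1) + of_nat (m 0 * (m 0 + 1))"
      by (simp add: power2_eq_square field_simps)
    have "4 * f z * (h' z + h z ^ 2) + 2 * f' z * h z =
      (potential_z z - of_nat (m 0 * (m 0 + 1)) * z + fuchs_R a M m n b z) + (N * (N - 2 * of_nat (m 0) - 1) + of_nat (m 0 * (m 0 + 1))) * z + K"
      using K[OF z] unfolding hs hs' H S zc .
    thus "4 * f z * (h' z + h z ^ 2) + 2 * f' z * h z =
     of_nat (fuchs_N M m n) * (of_nat (fuchs_N M m n) - 2 * of_nat (m 0) - 1) * z + fuchs_R a M m n b z + potential_z z + K"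
      unfolding N_def[symmetric] by (simp add: distrib_right)
  qed
qed

lemma fuchs_P_eq:
  assumes "z \<notin> sing"
  shows "fuchs_P a M m n b z = 2 * h z + f' z / (2 * f z)"
proof -
  have z: "z \<noteq> 0" "z - 1 \<noteq> 0" "z - a \<noteq> 0" using assms by (auto simp: sing_def)
  have "f' z = (z - 1) * (z - a) + z * (z - a) + z * (z - 1)" by (simp add: f'_def power2_eq_square algebra_simps)
  hence "f' z / (2 * f z) = 1 / 2 * (1 / z + 1 / (z - 1) + 1 / (z - a))"
    unfolding f_def using z by (simp add: field_simps)
  hence e: "2 * h z + f' z / (2 * f z) = 2 * h z + 1 / 2 * (1 / z + 1 / (z - 1) + 1 / (z - a))" by simp
  have d: "(1 - 2 * x) / t = 1 / t - 2 * (x / t)" "x / 2 / t = x / t / 2" for x t :: complex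
    by (simp_all add: diff_divide_distrib)
  have gen: "1 / 2 * ((u1 - 2 * p1) + (u2 - 2 * p2) + (u3 - 2 * p3)) - 2 * s = 2 * - (p1 / 2 + p2 / 2 + p3 / 2 + s) + 1 / 2 * (u1 + u2 + u3)"
    for u1 u2 u3 p1 p2 p3 s :: complex
    by (simp add: field_simps)
  show ?thesis unfolding e unfolding fuchs_P_def h_def d by (rule gen)
qed

lemma fuchs_Q_eq:
  "fuchs_Q a M m n b \<mu> z = (of_nat (fuchs_N M m n) * (of_nat (fuchs_N M m n) - 2 * of_nat (m 0) - 1) * z + \<mu> + fuchs_R a M m n b z) / (4 * f z)"
  by (simp add: fuchs_Q_def f_def Let_def mult.assoc)

lemma f_nonzero: "z \<notin> sing \<Longrightarrow> f z \<noteq> 0"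
  by (auto simp: f_def sing_def)

end

section \<open>Logarithmic derivatives\<close>

text \<open>
  Logarithmic derivatives turn the gauge factor, a product of powers of branches of square roots, into the
  sum \<open>h\<close> whichever branches are chosen.
\<close>
definition logder :: "(complex \<Rightarrow> complex) \<Rightarrow> complex \<Rightarrow> complex \<Rightarrow> bool" where
  "logder F z c \<longleftrightarrow> F z \<noteq> 0 \<and> (F has_field_derivative F z * c) (at z)"

lemma logder_mult: "logder F z c \<Longrightarrow> logder G z d \<Longrightarrow> logder (\<lambda>z. F z * G z) z (c + d)"
  unfolding logder_def by (auto intro!: derivative_eq_intros simp: algebra_simps)

lemma logder_const_1: "logder (\<lambda>z. 1) z 0"
  unfolding logder_def by auto

lemma logder_powi:
  assumes "logder F z c"
  shows "logder (\<lambda>z. F z powi k) z (of_int k * c)"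
proof -
  have nz: "F z \<noteq> 0" and d: "(F has_field_derivative F z * c) (at z)" using assms by (auto simp: logder_def)
  have "((\<lambda>z. F z powi k) has_field_derivative of_int k * F z powi (k - 1) * (F z * c)) (at z)"
    by (rule DERIV_power_int[OF d disjI2[OF nz]])
  also have "of_int k * F z powi (k - 1) * (F z * c) = F z powi k * (of_int k * c)"
    using nz by (simp add: power_int_diff)
  finally show ?thesis using nz by (simp add: logder_def)
qed

lemma logder_prod:
  assumes "finite A" "\<And>i. i \<in> A \<Longrightarrow> logder (F i) z (c i)"
  shows "logder (\<lambda>z. \<Prod>i\<in>A. F i z) z (\<Sum>i\<in>A. c i)"
  using assms by (induction A rule: finite_induct) (auto intro: logder_mult logder_const_1)

lemma logder_linear: "z \<noteq> p \<Longrightarrow> logder (\<lambda>z. z - p) z (1 / (z - p))"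
  unfolding logder_def by (auto intro!: derivative_eq_intros)

lemma logder_sqrt:
  assumes "open Z" "z \<in> Z" "r holomorphic_on Z" "\<And>z. z \<in> Z \<Longrightarrow> r z ^ 2 = z - p" "z \<noteq> p"
  shows "logder r z (1 / (2 * (z - p)))"
proof -
  have nz: "r z \<noteq> 0" using assms(4)[OF assms(2)] assms(5) by auto
  have d: "(r has_field_derivative deriv r z) (at z)" using assms by (auto intro: holomorphic_derivI)
  have "((\<lambda>z. r z ^ 2) has_field_derivative 2 * r z * deriv r z) (at z)"
    by (auto intro!: derivative_eq_intros d)
  moreover have "((\<lambda>z. r z ^ 2) has_field_derivative 1) (at z)"
  proof (rule DERIV_cong_ev[THEN iffD2, OF refl _ refl])
    show "eventually (\<lambda>z. r z ^ 2 = z - p) (nhds z)"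
      using eventually_nhds_in_open[OF assms(1,2)] by eventually_elim (rule assms(4))
    show "((\<lambda>z. z - p) has_field_derivative 1) (at z)" by (auto intro!: derivative_eq_intros)
  qed
  ultimately have "2 * r z * deriv r z = 1" by (rule DERIV_unique)
  hence "deriv r z = 1 / (2 * r z)" using nz by (simp add: field_simps)
  also have "\<dots> = r z / (2 * r z ^ 2)" using nz by (simp add: power2_eq_square)
  also have "\<dots> = r z * (1 / (2 * (z - p)))" using assms(4)[OF assms(2)] by simp
  finally have "deriv r z = r z * (1 / (2 * (z - p)))" .
  thus ?thesis using nz d by (simp add: logder_def)
qed

lemma open_image_nonzero_deriv:
  assumes "open S" "g holomorphic_on S" "\<And>x. x \<in> S \<Longrightarrow> deriv g x \<noteq> 0"
  shows "open (g ` S)"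
proof (subst open_subopen, clarify)
  fix x assume x: "x \<in> S"
  obtain r where r: "r > 0" "ball x r \<subseteq> S" "inj_on g (ball x r)"
    using has_complex_derivative_locally_injective[OF assms(2) x assms(1) assms(3)[OF x]] by blast
  have "open (g ` ball x r)"
    by (rule open_mapping_thm3[OF holomorphic_on_subset[OF assms(2) r(2)] open_ball r(3)])
  thus "\<exists>T. open T \<and> g x \<in> T \<and> T \<subseteq> g ` S" using r by (intro exI[of _ "g ` ball x r"]) auto
qed

section \<open>The change of variables\<close>

locale fuchs_lattice = nondegenerate_lattice \<omega>1 \<omega>3 + fuchs_parameters a M m n b
  for \<omega>1 \<omega>3 a :: complex and M :: nat and m n :: "nat \<Rightarrow> nat" and b :: "nat \<Rightarrow> complex" +
  fixes \<delta> :: "nat \<Rightarrow> complex"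
  assumes a_eq: "(we 3 - we 1) / (we 2 - we 1) = a"
    and \<delta>: "\<And>k. k \<in> {1..M} \<Longrightarrow> \<delta> k \<notin> \<Lambda>" "\<And>k. k \<in> {1..M} \<Longrightarrow> wp (\<delta> k) = we 1 + (we 2 - we 1) * b k"
begin

abbreviation "u \<equiv> elliptic_potential \<omega>1 \<omega>3 \<delta> M m n"
abbreviation "zc \<equiv> z_coord \<omega>1 \<omega>3"
definition \<kappa> :: complex where "\<kappa> = we 2 - we 1"

lemma \<kappa>_nz: "\<kappa> \<noteq> 0" using e_distinct by (simp add: \<kappa>_def)

lemma we_eq: "we 2 = we 1 + \<kappa>" "we 3 = we 1 + \<kappa> * a"
proof -
  show "we 2 = we 1 + \<kappa>" by (simp add: \<kappa>_def)
  have "we 3 - we 1 = a * \<kappa>" using a_eq \<kappa>_nz unfolding \<kappa>_def[symmetric] by (simp add: field_simps)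
  thus "we 3 = we 1 + \<kappa> * a" by (simp add: algebra_simps)
qed

lemma zc_eq: "zc x = (wp x - we 1) / \<kappa>" by (simp add: z_coord_def \<kappa>_def)

lemma wp_zc: "wp x = we 1 + \<kappa> * zc x" using \<kappa>_nz by (simp add: zc_eq)

lemma zc_half: "wp x = we i \<Longrightarrow> i \<in> {1,2,3} \<Longrightarrow> zc x \<in> {0, 1, a}"
  using \<kappa>_nz we_eq by (auto simp: zc_eq)

lemma zc_DERIV: "x \<notin> \<Lambda> \<Longrightarrow> (zc has_field_derivative deriv wp x / \<kappa>) (at x)"
  unfolding zc_eq[abs_def] by (auto intro!: derivative_eq_intros wp_DERIV simp: \<kappa>_nz)

lemma deriv_zc: "x \<notin> \<Lambda> \<Longrightarrow> deriv zc x = deriv wp x / \<kappa>"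
  by (rule DERIV_imp_deriv[OF zc_DERIV])

lemma zc_holomorphic: "zc holomorphic_on - \<Lambda>"
  using zc_DERIV lattice_open_complement by (subst holomorphic_on_open) auto

lemma deriv_zc_square:
  assumes "x \<notin> \<Lambda>"
  shows "deriv zc x ^ 2 = 4 * \<kappa> * f (zc x)"
proof -
  have "deriv zc x ^ 2 = (4 * (\<kappa> * zc x) * (\<kappa> * (zc x - 1)) * (\<kappa> * (zc x - a))) / \<kappa> ^ 2"
    unfolding deriv_zc[OF assms] power_divide wp_ode[OF assms] wp_zc[of x] we_eq by (simp add: algebra_simps)
  also have "\<dots> = 4 * \<kappa> * f (zc x)" using \<kappa>_nz by (simp add: f_def power2_eq_square)
  finally show ?thesis .
qed

lemma f_DERIV: "(f has_field_derivative f' z) (at z)"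
  unfolding f_def[abs_def] f'_def by (auto intro!: derivative_eq_intros simp: power2_eq_square algebra_simps)

lemma deriv_zc_nz:
  assumes "x \<notin> \<Lambda>" "zc x \<notin> {0, 1, a}"
  shows "deriv zc x \<noteq> 0"
  using deriv_zc_square[OF assms(1)] assms(2) \<kappa>_nz by (auto simp: f_def)

lemma deriv_deriv_zc:
  assumes "x \<notin> \<Lambda>" "zc x \<notin> {0, 1, a}"
  shows "deriv (deriv zc) x = 2 * \<kappa> * f' (zc x)"
proof -
  have d2: "(deriv zc has_field_derivative deriv (deriv zc) x) (at x)"
    by (rule holomorphic_derivI[OF holomorphic_deriv[OF zc_holomorphic lattice_open_complement] lattice_open_complement]) (use assms in simp)
  have d1: "(zc has_field_derivative deriv zc x) (at x)" using zc_DERIV[OF assms(1)] deriv_zc[OF assms(1)] by simp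
  have "((\<lambda>x. deriv zc x ^ 2) has_field_derivative 2 * deriv zc x * deriv (deriv zc) x) (at x)"
    by (auto intro!: derivative_eq_intros d2)
  moreover have "((\<lambda>x. deriv zc x ^ 2) has_field_derivative 4 * \<kappa> * (f' (zc x) * deriv zc x)) (at x)"
  proof (rule DERIV_cong_ev[THEN iffD2, OF refl _ refl])
    show "eventually (\<lambda>x. deriv zc x ^ 2 = 4 * \<kappa> * f (zc x)) (nhds x)"
      using eventually_nhds_in_open[OF lattice_open_complement, of x] assms(1)
      by (auto elim!: eventually_mono intro: deriv_zc_square)
    show "((\<lambda>x. 4 * \<kappa> * f (zc x)) has_field_derivative 4 * \<kappa> * (f' (zc x) * deriv zc x)) (at x)"
      by (intro DERIV_cmult DERIV_chain2[OF f_DERIV d1])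
  qed
  ultimately have "2 * deriv zc x * deriv (deriv zc) x = 4 * \<kappa> * (f' (zc x) * deriv zc x)" by (rule DERIV_unique)
  hence "(2 * deriv zc x) * (deriv (deriv zc) x - 2 * \<kappa> * f' (zc x)) = 0" by (simp add: algebra_simps)
  thus ?thesis using deriv_zc_nz[OF assms] by simp
qed

lemma zc_sing_half:
  assumes "zc x \<notin> sing" "i \<in> {1,2,3}"
  shows "x - hp i \<notin> \<Lambda>"
proof
  assume "x - hp i \<in> \<Lambda>"
  hence "wp x = we i" using wp_cong_lattice[OF _ half_period_notin_lattice] wp_half_period_value by metis
  from zc_half[OF this assms(2)] show False using assms(1) by (auto simp: sing_def)
qed

lemma zc_\<delta>: "k \<in> {1..M} \<Longrightarrow> zc (\<delta> k) = b k"
  using \<delta>(2)[of k] \<kappa>_nz by (simp add: zc_eq \<kappa>_def)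

lemma zc_sing_\<delta>:
  assumes "zc x \<notin> sing" "k \<in> {1..M}"
  shows "x - \<delta> k \<notin> \<Lambda>" "x + \<delta> k \<notin> \<Lambda>"
proof -
  have "zc x \<noteq> b k" using assms by (auto simp: sing_def)
  hence ne: "wp x \<noteq> wp (\<delta> k)" using zc_\<delta>[OF assms(2)] by (auto simp: zc_eq)
  show "x - \<delta> k \<notin> \<Lambda>" using wp_cong_lattice[of x "\<delta> k"] \<delta>(1)[OF assms(2)] ne by auto
  show "x + \<delta> k \<notin> \<Lambda>" using wp_cong_lattice[of x "- \<delta> k"] \<delta>(1)[OF assms(2)] ne by (auto simp: wp_even)
qed

lemma two_\<delta>:
  assumes k: "k \<in> {1..M}"
  shows "2 * \<delta> k \<notin> \<Lambda>"
proof
  assume "2 * \<delta> k \<in> \<Lambda>"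
  from half_lattice_cases[OF this] \<delta>(1)[OF k] obtain i where i: "i \<in> {1,2,3}" "\<delta> k - hp i \<in> \<Lambda>" by blast
  have "wp (\<delta> k) = we i" using wp_cong_lattice[OF i(2) half_period_notin_lattice] by (simp add: wp_half_period_value)
  from zc_half[OF this i(1)] show False using zc_\<delta>[OF k] b[OF k] by simp
qed

lemma potential_shift:
  assumes x: "x \<notin> \<Lambda>" "zc x \<notin> sing"
  shows "wp (x - hp 1) = we 1 + \<kappa> * (f' 0 / zc x)" "wp (x - hp 2) = we 2 + \<kappa> * (f' 1 / (zc x - 1))"
    "wp (x - hp 3) = we 3 + \<kappa> * (f' a / (zc x - a))"
proof -
  have nz: "zc x \<noteq> 0" "zc x - 1 \<noteq> 0" "zc x - a \<noteq> 0" using x(2) by (auto simp: sing_def)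
  have solve: "W = e + \<kappa> * (g / t)" if "(\<kappa> * t) * (W - e) = \<kappa> * (\<kappa> * g)" "t \<noteq> 0" for W e g t
  proof -
    have "t * (W - e) = \<kappa> * g" using that(1) \<kappa>_nz by (simp add: mult.assoc)
    hence "W - e = \<kappa> * g / t" using that(2) by (simp add: field_simps)
    thus ?thesis by (simp add: algebra_simps)
  qed
  have 1: "(\<kappa> * zc x) * (wp (x - hp 1) - we 1) = (we 1 - we 2) * (we 1 - we 3)"
    using wp_shift_half_period[of x 1 2 3] x zc_sing_half[OF x(2), of 1] by (simp add: wp_zc[of x])
  show "wp (x - hp 1) = we 1 + \<kappa> * (f' 0 / zc x)"
    by (rule solve) (use 1 nz in \<open>simp_all add: we_eq f'_def algebra_simps\<close>)
  have 2: "(\<kappa> * (zc x - 1)) * (wp (x - hp 2) - we 2) = (we 2 - we 1) * (we 2 - we 3)"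
    using wp_shift_half_period[of x 2 1 3] x zc_sing_half[OF x(2), of 2] by (simp add: wp_zc[of x] we_eq algebra_simps)
  show "wp (x - hp 2) = we 2 + \<kappa> * (f' 1 / (zc x - 1))"
    by (rule solve) (use 2 nz in \<open>simp_all add: we_eq f'_def algebra_simps\<close>)
  have 3: "(\<kappa> * (zc x - a)) * (wp (x - hp 3) - we 3) = (we 3 - we 1) * (we 3 - we 2)"
    using wp_shift_half_period[of x 3 1 2] x zc_sing_half[OF x(2), of 3] by (simp add: wp_zc[of x] we_eq algebra_simps)
  show "wp (x - hp 3) = we 3 + \<kappa> * (f' a / (zc x - a))"
    by (rule solve) (use 3 nz in \<open>simp_all add: we_eq f'_def power2_eq_square algebra_simps\<close>)
qed

lemma potential_pair:
  assumes k: "k \<in> {1..M}"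
  shows "\<exists>A. \<forall>x. x \<notin> \<Lambda> \<longrightarrow> zc x \<notin> sing \<longrightarrow>
    wp (x - \<delta> k) + wp (x + \<delta> k) = \<kappa> * (4 * f (b k) / (zc x - b k) ^ 2 + 2 * f' (b k) / (zc x - b k)) + A"
proof -
  define d where "d = wp (\<delta> k)"
  obtain A where A: "\<And>x. x \<notin> \<Lambda> \<Longrightarrow> x - \<delta> k \<notin> \<Lambda> \<Longrightarrow> x + \<delta> k \<notin> \<Lambda> \<Longrightarrow>
     (wp x - d)\<^sup>2 * (wp (x - \<delta> k) + wp (x + \<delta> k)) = 4 * (d - we 1) * (d - we 2) * (d - we 3)
       + 2 * ((d - we 2) * (d - we 3) + (d - we 1) * (d - we 3) + (d - we 1) * (d - we 2)) * (wp x - d)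
       + A * (wp x - d)\<^sup>2"
    using wp_pair[OF two_\<delta>[OF k]] unfolding d_def by metis
  have dd: "d - we 1 = \<kappa> * b k" "d - we 2 = \<kappa> * (b k - 1)" "d - we 3 = \<kappa> * (b k - a)"
    using \<delta>(2)[OF k] by (simp_all add: d_def we_eq algebra_simps)
  show ?thesis
  proof (intro exI[of _ A] allI impI)
    fix x assume x: "x \<notin> \<Lambda>" "zc x \<notin> sing"
    define t where "t = zc x - b k"
    have t: "t \<noteq> 0" using x(2) k by (auto simp: t_def sing_def)
    have wd: "wp x - d = \<kappa> * t" using \<delta>(2)[OF k] by (simp add: wp_zc[of x] d_def t_def \<kappa>_def algebra_simps)
    define W where "W = wp (x - \<delta> k) + wp (x + \<delta> k)"
    have "(\<kappa> * t) ^ 2 * W = 4 * (\<kappa> * b k) * (\<kappa> * (b k - 1)) * (\<kappa> * (b k - a))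
       + 2 * ((\<kappa> * (b k - 1)) * (\<kappa> * (b k - a)) + (\<kappa> * b k) * (\<kappa> * (b k - a)) + (\<kappa> * b k) * (\<kappa> * (b k - 1))) * (\<kappa> * t)
       + A * (\<kappa> * t) ^ 2"
      using A[OF x(1) zc_sing_\<delta>[OF x(2) k]] unfolding wd dd W_def .
    also have "\<dots> = (\<kappa> * t) ^ 2 * (\<kappa> * (4 * f (b k) / t ^ 2 + 2 * f' (b k) / t) + A)"
    proof -
      have "(\<kappa> * t) ^ 2 * (\<kappa> * (4 * f (b k) / t ^ 2 + 2 * f' (b k) / t) + A) =
        \<kappa> ^ 3 * (4 * f (b k)) * (t ^ 2 / t ^ 2) + \<kappa> ^ 3 * (2 * f' (b k)) * (t ^ 2 / t) + A * (\<kappa> * t) ^ 2"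
        by (simp add: power2_eq_square power3_eq_cube algebra_simps)
      also have "t ^ 2 / t ^ 2 = 1" using t by simp
      also have "t ^ 2 / t = t" using t by (simp add: power2_eq_square)
      finally show ?thesis by (simp add: f_def f'_def power2_eq_square power3_eq_cube algebra_simps)
    qed
    finally have "W = \<kappa> * (4 * f (b k) / t ^ 2 + 2 * f' (b k) / t) + A"
      using \<kappa>_nz t by (subst (asm) mult_left_cancel) auto
    thus "wp (x - \<delta> k) + wp (x + \<delta> k) = \<kappa> * (4 * f (b k) / (zc x - b k) ^ 2 + 2 * f' (b k) / (zc x - b k)) + A"
      by (simp only: W_def t_def)
  qed
qed

lemma potential_zc:
  obtains C0 where "\<And>x. x \<notin> \<Lambda> \<Longrightarrow> zc x \<notin> sing \<Longrightarrow> u x = \<kappa> * potential_z (zc x) + C0"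
proof -
  obtain A where A: "\<And>k x. k \<in> {1..M} \<Longrightarrow> x \<notin> \<Lambda> \<Longrightarrow> zc x \<notin> sing \<Longrightarrow>
    wp (x - \<delta> k) + wp (x + \<delta> k) = \<kappa> * (4 * f (b k) / (zc x - b k) ^ 2 + 2 * f' (b k) / (zc x - b k)) + A k"
    using bchoice[of "{1..M}" "\<lambda>k A. \<forall>x. x \<notin> \<Lambda> \<longrightarrow> zc x \<notin> sing \<longrightarrow>
    wp (x - \<delta> k) + wp (x + \<delta> k) = \<kappa> * (4 * f (b k) / (zc x - b k) ^ 2 + 2 * f' (b k) / (zc x - b k)) + A"] potential_pair
    by blast
  define c where "c j = (of_nat (m j * (m j + 1)) :: complex)" for j
  define c' where "c' k = (of_nat (n k * (n k + 1)) :: complex)" for k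
  show ?thesis
  proof (rule that[of "c 0 * we 1 + c 1 * we 1 + c 2 * we 2 + c 3 * we 3 + (\<Sum>k=1..M. c' k * A k)"])
    fix x assume x: "x \<notin> \<Lambda>" "zc x \<notin> sing"
    have s: "{1..3} = {1, 2, 3 :: nat}" by auto
    have s1: "(\<Sum>i=1..3. c i * wp (x - hp i)) = c 1 * wp (x - hp 1) + c 2 * wp (x - hp 2) + c 3 * wp (x - hp 3)"
      unfolding s by simp
    have s2: "(\<Sum>k=1..M. c' k * (wp (x - \<delta> k) + wp (x + \<delta> k))) =
      \<kappa> * (\<Sum>k=1..M. c' k * (4 * f (b k) / (zc x - b k) ^ 2 + 2 * f' (b k) / (zc x - b k))) + (\<Sum>k=1..M. c' k * A k)"
      unfolding sum_distrib_left sum.distrib[symmetric]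
    proof (intro sum.cong refl)
      fix k assume "k \<in> {1..M}"
      show "c' k * (wp (x - \<delta> k) + wp (x + \<delta> k)) = \<kappa> * (c' k * (4 * f (b k) / (zc x - b k) ^ 2 + 2 * f' (b k) / (zc x - b k))) + c' k * A k"
        unfolding A[OF \<open>k \<in> {1..M}\<close> x] by (simp only: distrib_left mult.left_commute)
    qed
    have "u x = c 0 * wp x + (\<Sum>i=1..3. c i * wp (x - hp i)) + (\<Sum>k=1..M. c' k * (wp (x - \<delta> k) + wp (x + \<delta> k)))"
      by (simp only: elliptic_potential_def c_def c'_def)
    also have "\<dots> = c 0 * (we 1 + \<kappa> * zc x) + (c 1 * (we 1 + \<kappa> * (f' 0 / zc x)) + c 2 * (we 2 + \<kappa> * (f' 1 / (zc x - 1)))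
       + c 3 * (we 3 + \<kappa> * (f' a / (zc x - a)))) + (\<kappa> * (\<Sum>k=1..M. c' k * (4 * f (b k) / (zc x - b k) ^ 2 + 2 * f' (b k) / (zc x - b k))) + (\<Sum>k=1..M. c' k * A k))"
      unfolding s1 s2 potential_shift[OF x] by (simp only: wp_zc[symmetric])
    also have "\<dots> = \<kappa> * (c 0 * zc x + c 1 * (f' 0 / zc x) + c 2 * (f' 1 / (zc x - 1)) + c 3 * (f' a / (zc x - a))
       + (\<Sum>k=1..M. c' k * (4 * f (b k) / (zc x - b k) ^ 2 + 2 * f' (b k) / (zc x - b k))))
       + (c 0 * we 1 + c 1 * we 1 + c 2 * we 2 + c 3 * we 3 + (\<Sum>k=1..M. c' k * A k))"
      by (simp only: distrib_left mult.left_commute add_ac)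
    finally show "u x = \<kappa> * potential_z (zc x) + (c 0 * we 1 + c 1 * we 1 + c 2 * we 2 + c 3 * we 3 + (\<Sum>k=1..M. c' k * A k))"
      by (simp only: potential_z_def c_def c'_def)
  qed
qed

lemma h_DERIV:
  assumes "z \<notin> sing"
  shows "(h has_field_derivative h' z) (at z)"
proof -
  have z: "z \<noteq> 0" "z - 1 \<noteq> 0" "z - a \<noteq> 0" and zb: "\<And>k. k \<in> {1..M} \<Longrightarrow> z - b k \<noteq> 0" using assms by (auto simp: sing_def)
  have inv: "((\<lambda>z. c / (z - p)) has_field_derivative - (c / (z - p) ^ 2)) (at z)" if "z - p \<noteq> 0" for c p
    using that by (auto intro!: derivative_eq_intros simp: power2_eq_square)
  have "(h has_field_derivative - (- (of_nat (m 1) / 2 / (z - 0) ^ 2) + - (of_nat (m 2) / 2 / (z - 1) ^ 2) + - (of_nat (m 3) / 2 / (z - a) ^ 2)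
     + (\<Sum>k=1..M. - (of_nat (n k) / (z - b k) ^ 2)))) (at z)"
  proof -
    have h0: "h = (\<lambda>z. - (of_nat (m 1) / 2 / (z - 0) + of_nat (m 2) / 2 / (z - 1) + of_nat (m 3) / 2 / (z - a)
       + (\<Sum>k=1..M. of_nat (n k) / (z - b k))))" by (simp add: h_def fun_eq_iff)
    show ?thesis unfolding h0 by (intro DERIV_minus DERIV_add DERIV_sum inv) (use z zb in auto)
  qed
  moreover have "- (- (of_nat (m 1) / 2 / (z - 0) ^ 2) + - (of_nat (m 2) / 2 / (z - 1) ^ 2) + - (of_nat (m 3) / 2 / (z - a) ^ 2)
     + (\<Sum>k=1..M. - (of_nat (n k) / (z - b k) ^ 2))) = h' z"
    by (simp add: h'_def sum_negf)
  ultimately show ?thesis by (simp only:)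
qed

text \<open>
  The change of variables with the additive constant \<open>C\<close> in the energy. The gauge factor \<open>G\<close> enters only through
  its logarithmic derivative, so that one statement covers all branches of the square roots.
\<close>
definition transforms_with_shift :: "complex \<Rightarrow> bool" where
  "transforms_with_shift C \<longleftrightarrow> (\<forall>\<mu> E S G y \<psi>. E = - \<kappa> * \<mu> + C \<longrightarrow> open S \<longrightarrow> S \<inter> \<Lambda> = {} \<longrightarrow> zc ` S \<inter> sing = {} \<longrightarrow>
     y holomorphic_on zc ` S \<longrightarrow> (\<forall>z\<in>zc ` S. logder G z (h z)) \<longrightarrow> (\<forall>x\<in>S. \<psi> x = y (zc x) * G (zc x)) \<longrightarrow>
     ((\<forall>x\<in>S. deriv (deriv \<psi>) x - u x * \<psi> x = E * \<psi> x) \<longleftrightarrow>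
      solves_ode2 (fuchs_P a M m n b) (fuchs_Q a M m n b \<mu>) y (zc ` S)))"

lemma transforms_with_shiftD:
  assumes "transforms_with_shift C" "E = - \<kappa> * \<mu> + C" "open S" "S \<inter> \<Lambda> = {}" "zc ` S \<inter> sing = {}"
    "y holomorphic_on zc ` S" "\<And>z. z \<in> zc ` S \<Longrightarrow> logder G z (h z)" "\<And>x. x \<in> S \<Longrightarrow> \<psi> x = y (zc x) * G (zc x)"
  shows "(\<forall>x\<in>S. deriv (deriv \<psi>) x - u x * \<psi> x = E * \<psi> x) \<longleftrightarrow>
    solves_ode2 (fuchs_P a M m n b) (fuchs_Q a M m n b \<mu>) y (zc ` S)"
  using assms unfolding transforms_with_shift_def by blast

text \<open>
  With \<open>z'\<^sup>2 = 4 \<kappa> f\<close> and \<open>z'' = 2 \<kappa> f'\<close>, the chain rule turns \<open>\<psi>'' - u \<psi> - E \<psi>\<close> into \<open>4 \<kappa> f G\<close> times the left-hand side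
  of a second-order equation for \<open>y\<close>. Its first-order coefficient is \<open>2 h + f' / (2 f)\<close>, and its zeroth-order
  coefficient is identified by \<open>rational_identity\<close>.
\<close>
theorem change_of_variables: "\<exists>C. transforms_with_shift C"
proof -
  obtain C0 where C0: "\<And>x. x \<notin> \<Lambda> \<Longrightarrow> zc x \<notin> sing \<Longrightarrow> u x = \<kappa> * potential_z (zc x) + C0" using potential_zc by blast
  obtain K where K: "\<And>z. z \<notin> sing \<Longrightarrow> 4 * f z * (h' z + h z ^ 2) + 2 * f' z * h z =
     of_nat (fuchs_N M m n) * (of_nat (fuchs_N M m n) - 2 * of_nat (m 0) - 1) * z + fuchs_R a M m n b z + potential_z z + K"
    using rational_identity by blast
  show ?thesis unfolding transforms_with_shift_def
  proof (intro exI[of _ "\<kappa> * K - C0"] allI impI)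
    fix \<mu> E S G y \<psi>
    assume E: "E = - \<kappa> * \<mu> + (\<kappa> * K - C0)" and S: "open S" "S \<inter> \<Lambda> = {}" "zc ` S \<inter> sing = {}"
      and y: "y holomorphic_on zc ` S" and G: "\<forall>z\<in>zc ` S. logder G z (h z)" and \<psi>': "\<forall>x\<in>S. \<psi> x = y (zc x) * G (zc x)"
    have \<psi>: "\<psi> x = y (zc x) * G (zc x)" if "x \<in> S" for x using \<psi>' that by blast
    define Z where "Z = zc ` S"
    have xS: "x \<notin> \<Lambda>" "zc x \<notin> sing" "zc x \<notin> {0, 1, a}" if "x \<in> S" for x using that S(2,3) by (auto simp: sing_def)
    have zh: "zc holomorphic_on S" using zc_holomorphic by (rule holomorphic_on_subset) (use S in auto)
    have Zo: "open Z" unfolding Z_def by (rule open_image_nonzero_deriv[OF S(1) zh]) (use deriv_zc_nz xS in blast)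
    have dz: "(zc has_field_derivative deriv zc x) (at x)" if "x \<in> S" for x using holomorphic_derivI[OF zh S(1) that] .
    have ddz: "(deriv zc has_field_derivative 2 * \<kappa> * f' (zc x)) (at x)" if "x \<in> S" for x
      using holomorphic_derivI[OF holomorphic_deriv[OF zh S(1)] S(1) that] deriv_deriv_zc[OF xS(1,3)[OF that]] by simp
    have dy: "(y has_field_derivative deriv y z) (at z)" if "z \<in> Z" for z using holomorphic_derivI[OF y[folded Z_def] Zo that] .
    have ddy: "(deriv y has_field_derivative deriv (deriv y) z) (at z)" if "z \<in> Z" for z
      using holomorphic_derivI[OF holomorphic_deriv[OF y[folded Z_def] Zo] Zo that] .
    have Gz: "G z \<noteq> 0" "(G has_field_derivative G z * h z) (at z)" if "z \<in> Z" for z using G that by (auto simp: Z_def logder_def)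
    define F where "F z = (deriv y z + h z * y z) * G z" for z
    have dyG: "((\<lambda>z. y z * G z) has_field_derivative F z) (at z)" if "z \<in> Z" for z
      using DERIV_mult[OF dy[OF that] Gz(2)[OF that]] by (simp add: F_def algebra_simps)
    have dF: "(F has_field_derivative (deriv (deriv y) z + (h' z * y z + h z * deriv y z)) * G z + (deriv y z + h z * y z) * (G z * h z)) (at z)" if "z \<in> Z" for z
    proof -
      have zs: "z \<notin> sing" using that S(3) by (auto simp: Z_def)
      have "((\<lambda>z. deriv y z + h z * y z) has_field_derivative deriv (deriv y) z + (h' z * y z + h z * deriv y z)) (at z)"
        using DERIV_add[OF ddy[OF that] DERIV_mult[OF h_DERIV[OF zs] dy[OF that]]] by (simp add: algebra_simps)
      from DERIV_mult[OF this Gz(2)[OF that]] show ?thesis unfolding F_def[abs_def] by (simp add: algebra_simps)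
    qed
    have d\<psi>: "deriv \<psi> x = F (zc x) * deriv zc x" if x: "x \<in> S" for x
    proof (rule DERIV_imp_deriv, rule DERIV_cong_ev[THEN iffD2, OF refl _ refl])
      show "eventually (\<lambda>x. \<psi> x = y (zc x) * G (zc x)) (nhds x)"
        using eventually_nhds_in_open[OF S(1) x] by eventually_elim (rule \<psi>)
      show "((\<lambda>x. y (zc x) * G (zc x)) has_field_derivative F (zc x) * deriv zc x) (at x)"
        by (rule DERIV_chain2[OF dyG dz]) (use x in \<open>auto simp: Z_def\<close>)
    qed
    have dd\<psi>: "deriv (deriv \<psi>) x = ((deriv (deriv y) z + (h' z * y z + h z * deriv y z)) * G z + (deriv y z + h z * y z) * (G z * h z)) * (deriv zc x) ^ 2
        + F z * (2 * \<kappa> * f' z)" if x: "x \<in> S" and z: "z = zc x" for x z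
    proof (rule DERIV_imp_deriv, rule DERIV_cong_ev[THEN iffD2, OF refl _ refl])
      show "eventually (\<lambda>x. deriv \<psi> x = F (zc x) * deriv zc x) (nhds x)"
        using eventually_nhds_in_open[OF S(1) x] by eventually_elim (rule d\<psi>)
      have zZ: "zc x \<in> Z" using x by (auto simp: Z_def)
      show "((\<lambda>x. F (zc x) * deriv zc x) has_field_derivative ((deriv (deriv y) z + (h' z * y z + h z * deriv y z)) * G z + (deriv y z + h z * y z) * (G z * h z)) * (deriv zc x) ^ 2
        + F z * (2 * \<kappa> * f' z)) (at x)"
        using DERIV_mult[OF DERIV_chain2[OF dF[OF zZ] dz[OF x]] ddz[OF x]] unfolding z by (simp only: power2_eq_square mult.assoc mult.commute)
    qed
    have main: "deriv (deriv \<psi>) x - u x * \<psi> x - E * \<psi> x = (4 * \<kappa> * f (zc x) * G (zc x)) *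
       (deriv (deriv y) (zc x) + fuchs_P a M m n b (zc x) * deriv y (zc x) + fuchs_Q a M m n b \<mu> (zc x) * y (zc x))" if x: "x \<in> S" for x
    proof -
      define z where "z = zc x"
      have zs: "z \<notin> sing" using xS(2)[OF x] by (simp add: z_def)
      have fz: "f z \<noteq> 0" using f_nonzero[OF zs] .
      define L where "L = of_nat (fuchs_N M m n) * (of_nat (fuchs_N M m n) - 2 * of_nat (m 0) - 1) * z + fuchs_R a M m n b z"
      have P: "4 * f z * fuchs_P a M m n b z = 4 * f z * (2 * h z) + 2 * f' z"
        unfolding fuchs_P_eq[OF zs] using fz by (simp add: distrib_left)
      have Q: "4 * f z * fuchs_Q a M m n b \<mu> z = L + \<mu>"
      proof -
        have "fuchs_Q a M m n b \<mu> z = (L + \<mu>) / (4 * f z)" by (simp add: fuchs_Q_eq L_def add_ac)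
        thus ?thesis using fz by simp
      qed
      have sq: "deriv zc x ^ 2 = 4 * \<kappa> * f z" using deriv_zc_square[OF xS(1)[OF x]] by (simp add: z_def)
      have uE: "u x + E = \<kappa> * (potential_z z + K - \<mu>)" using C0[OF xS(1,2)[OF x]] E by (simp add: z_def algebra_simps)
      have KK: "potential_z z + K = 4 * f z * (h' z + h z ^ 2) + 2 * f' z * h z - L" using K[OF zs] by (simp add: L_def)
      have \<psi>x: "\<psi> x = y z * G z" using \<psi>[OF x] by (simp add: z_def)
      have "deriv (deriv \<psi>) x - u x * \<psi> x - E * \<psi> x = deriv (deriv \<psi>) x - (u x + E) * (y z * G z)" unfolding \<psi>x by (simp add: algebra_simps)
      also have "\<dots> = ((deriv (deriv y) z + (h' z * y z + h z * deriv y z)) * G z + (deriv y z + h z * y z) * (G z * h z)) * (4 * \<kappa> * f z)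
        + (deriv y z + h z * y z) * G z * (2 * \<kappa> * f' z) - \<kappa> * (4 * f z * (h' z + h z ^ 2) + 2 * f' z * h z - L - \<mu>) * (y z * G z)"
        unfolding dd\<psi>[OF x z_def] sq uE KK F_def ..
      also have "\<dots> = \<kappa> * G z * (4 * f z * deriv (deriv y) z + (4 * f z * (2 * h z) + 2 * f' z) * deriv y z + (L + \<mu>) * y z)"
        by (simp add: power2_eq_square algebra_simps)
      also have "\<dots> = (4 * \<kappa> * f z * G z) * (deriv (deriv y) z + fuchs_P a M m n b z * deriv y z + fuchs_Q a M m n b \<mu> z * y z)"
        unfolding P[symmetric] Q[symmetric] by (simp add: algebra_simps)
      finally show ?thesis by (simp add: z_def)
    qed
    have "deriv (deriv \<psi>) x - u x * \<psi> x = E * \<psi> x \<longleftrightarrow>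
       deriv (deriv y) (zc x) + fuchs_P a M m n b (zc x) * deriv y (zc x) + fuchs_Q a M m n b \<mu> (zc x) * y (zc x) = 0" if x: "x \<in> S" for x
    proof -
      have "4 * \<kappa> * f (zc x) * G (zc x) \<noteq> 0"
        using \<kappa>_nz f_nonzero[OF xS(2)[OF x]] Gz(1)[of "zc x"] x by (auto simp: Z_def)
      thus ?thesis using main[OF x] by (metis eq_iff_diff_eq_0 mult_eq_0_iff)
    qed
    thus "(\<forall>x\<in>S. deriv (deriv \<psi>) x - u x * \<psi> x = E * \<psi> x) \<longleftrightarrow> solves_ode2 (fuchs_P a M m n b) (fuchs_Q a M m n b \<mu>) y (zc ` S)"
      unfolding solves_ode2_def by auto
  qed
qed

end

section \<open>Finite-gap potentials and odd Laurent coefficients\<close>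

text \<open>
  Among sufficiently many vectors of a finite-dimensional space, some vector is a combination of the earlier
  ones. The induction eliminates one coordinate \<open>s0\<close> with the help of a member \<open>v p\<close> that is nonzero there.
\<close>
lemma linear_recurrence_on_finite:
  fixes v :: "nat \<Rightarrow> 's \<Rightarrow> 'k :: field"
  assumes "finite S"
  shows "\<exists>g c. \<forall>s\<in>S. v g s = (\<Sum>i<g. c i * v i s)"
  using assms
proof (induction S arbitrary: v rule: finite_induct)
  case (insert s0 S)
  show ?case
  proof (cases "\<forall>j. v j s0 = 0")
    case True
    obtain g c where "\<forall>s\<in>S. v g s = (\<Sum>i<g. c i * v i s)" using insert.IH by blast
    with True show ?thesis by (intro exI[of _ g] exI[of _ c]) auto
  next
    case False
    then obtain p where p: "v p s0 \<noteq> 0" by blast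
    define w where "w j s = v (Suc p + j) s - v (Suc p + j) s0 / v p s0 * v p s" for j s
    obtain g c where gc: "\<forall>s\<in>S. w g s = (\<Sum>i<g. c i * w i s)" using insert.IH by blast
    have w0: "w j s0 = 0" for j using p by (simp add: w_def)
    have w: "w g s = (\<Sum>i<g. c i * w i s)" if "s \<in> insert s0 S" for s using gc w0 that by auto
    define e where "e j = v (Suc p + j) s0 / v p s0" for j
    define c' where "c' i = (if i < p then 0 else if i = p then e g - (\<Sum>i<g. c i * e i) else c (i - Suc p))" for i
    show ?thesis
    proof (intro exI[of _ "Suc p + g"] exI[of _ c'] ballI)
      fix s assume s: "s \<in> insert s0 S"
      have split: "{..<Suc p + g} = {..<p} \<union> {p} \<union> (\<lambda>i. Suc p + i) ` {..<g}"
      proof (intro set_eqI iffI)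
        fix x assume "x \<in> {..<Suc p + g}"
        thus "x \<in> {..<p} \<union> {p} \<union> (\<lambda>i. Suc p + i) ` {..<g}"
          by (cases "x \<le> p") (auto intro!: image_eqI[of _ _ "x - Suc p"])
      qed auto
      have "(\<Sum>i<Suc p + g. c' i * v i s) = (\<Sum>i<p. c' i * v i s) + c' p * v p s + (\<Sum>i\<in>(\<lambda>i. Suc p + i) ` {..<g}. c' i * v i s)"
        unfolding split by (subst sum.union_disjoint; (subst sum.union_disjoint)?) auto
      also have "(\<Sum>i<p. c' i * v i s) = 0" by (simp add: c'_def)
      also have "(\<Sum>i\<in>(\<lambda>i. Suc p + i) ` {..<g}. c' i * v i s) = (\<Sum>i<g. c i * v (Suc p + i) s)"
        by (subst sum.reindex) (auto simp: inj_on_def c'_def)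
      also have "\<dots> = (\<Sum>i<g. c i * w i s) + (\<Sum>i<g. c i * e i) * v p s"
        unfolding sum_distrib_right sum.distrib[symmetric] by (intro sum.cong refl) (simp add: w_def e_def algebra_simps)
      also have "(\<Sum>i<g. c i * w i s) = w g s" using w[OF s] by simp
      also have "0 + c' p * v p s + (w g s + (\<Sum>i<g. c i * e i) * v p s) = v (Suc p + g) s"
        by (simp add: c'_def w_def e_def algebra_simps)
      finally show "v (Suc p + g) s = (\<Sum>i<Suc p + g. c' i * v i s)" by simp
    qed
  qed
qed auto

lemma dp_eval_analytic:
  assumes "u analytic_on A"
  shows "dp_eval q u analytic_on A"
proof -
  have d: "(deriv ^^ i) u analytic_on A" for i
    by (induction i) (use assms in \<open>auto intro: analytic_deriv\<close>)
  show ?thesis unfolding dp_eval_def[abs_def] by (intro analytic_intros d)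
qed

lemma laurent_expansion_imp_eventually_analytic:
  assumes "(\<lambda>t. u (p + t)) has_laurent_expansion U"
  shows "eventually (\<lambda>x. u analytic_on {x}) (at p)"
proof -
  have "isolated_singularity_at u p" using assms by (rule has_laurent_expansion_isolated)
  then obtain r where r: "r > 0" "u analytic_on ball p r - {p}" by (auto simp: isolated_singularity_at_def)
  have "eventually (\<lambda>w. w \<in> ball p r - {p}) (at p)" using r by (intro eventually_at_in_open) auto
  thus ?thesis by eventually_elim (use r in \<open>auto intro: analytic_on_subset\<close>)
qed

text \<open>
  The relation between the \<open>J\<^sub>n(u)\<close> holds on a punctured neighbourhood of \<open>p\<close>, hence between the Laurent
  expansions.
\<close>
lemma finite_gap_potential_imp_odd_coeffs_zero:
  assumes fg: "finite_gap_potential u" and U: "(\<lambda>t. u (p + t)) has_laurent_expansion U" "pole_strength \<nu> U"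
    and i: "odd i" "i < 2 * int \<nu> + 1"
  shows "U $$ i = 0"
proof -
  obtain J g c d where J: "kdv_sequence J" and rel: "\<And>x. u analytic_on {x} \<Longrightarrow>
      dp_eval (J g) u x + (\<Sum>i=1..g. c i * dp_eval (J (g - i)) u x) = d"
    using fg unfolding finite_gap_potential_def by blast
  note expansion = U(1)
  interpret lenard_series \<nu> U "\<lambda>j. dp_fls U (J j)" by (rule kdv_sequence_lenard_series[OF J U(2)])
  have "(\<lambda>t. dp_eval (J g) u (p + t) + (\<Sum>i=1..g. c i * dp_eval (J (g - i)) u (p + t))) has_laurent_expansion
     dp_fls U (J g) + (\<Sum>i=1..g. fls_const (c i) * dp_fls U (J (g - i)))"
    by (intro laurent_expansion_intros dp_eval_has_laurent_expansion expansion)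
  moreover have "(\<lambda>t. dp_eval (J g) u (p + t) + (\<Sum>i=1..g. c i * dp_eval (J (g - i)) u (p + t))) has_laurent_expansion
     fls_const d \<longleftrightarrow> (\<lambda>t. d) has_laurent_expansion fls_const d"
    by (rule has_laurent_expansion_cong'[of _ "\<lambda>_. d" p _ _ p])
      (use laurent_expansion_imp_eventually_analytic[OF expansion] in \<open>auto elim!: eventually_mono dest: rel\<close>)
  ultimately have "dp_fls U (J g) + (\<Sum>i=1..g. fls_const (c i) * dp_fls U (J (g - i))) = fls_const d"
    by (intro has_laurent_expansion_unique) auto
  from linear_relation_imp_odd_coeffs_zero[OF this i] show ?thesis .
qed

context complex_lattice begin

text \<open>
  All \<open>J\<^sub>n(u)\<close> have poles of bounded order at the finitely many poles modulo periods, so their principal parts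
  lie in a finite-dimensional space. Some \<open>J\<^sub>g(u)\<close> therefore differs from a combination of the earlier ones by
  an elliptic function without poles, which is constant.
\<close>
theorem finite_gap_if_odd_coeffs_zero:
  assumes loc: "\<And>p. \<exists>\<nu> U. (\<lambda>t. u (p + t)) has_laurent_expansion U \<and> pole_strength \<nu> U \<and>
       (\<forall>i. odd i \<longrightarrow> i < 2 * int \<nu> + 1 \<longrightarrow> U $$ i = 0)"
    and per: "\<And>p v. v \<in> \<Lambda> \<Longrightarrow> eventually (\<lambda>x. u (x + v) = u x) (at p)"
    and R: "finite R" "\<And>p. (\<And>r. r \<in> R \<Longrightarrow> p - r \<notin> \<Lambda>) \<Longrightarrow> u analytic_on {p}"
  shows "finite_gap_potential u"
proof -
  obtain \<nu> U where U: "\<And>p. (\<lambda>t. u (p + t)) has_laurent_expansion U p" "\<And>p. pole_strength (\<nu> p) (U p)"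
     and odd: "\<And>p i. odd i \<Longrightarrow> i < 2 * int (\<nu> p) + 1 \<Longrightarrow> U p $$ i = 0"
  proof -
    have "\<forall>p. \<exists>z. (\<lambda>t. u (p + t)) has_laurent_expansion snd z \<and> pole_strength (fst z) (snd z) \<and>
       (\<forall>i. odd i \<longrightarrow> i < 2 * int (fst z) + 1 \<longrightarrow> snd z $$ i = 0)" using loc by (metis fst_conv snd_conv)
    then obtain z where "\<forall>p. (\<lambda>t. u (p + t)) has_laurent_expansion snd (z p) \<and> pole_strength (fst (z p)) (snd (z p)) \<and>
       (\<forall>i. odd i \<longrightarrow> i < 2 * int (fst (z p)) + 1 \<longrightarrow> snd (z p) $$ i = 0)" by (rule choice[THEN exE])
    thus ?thesis by (intro that[of "\<lambda>p. snd (z p)" "\<lambda>p. fst (z p)"]) auto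
  qed
  obtain J where J: "kdv_sequence J" using kdv_sequence_exists by blast
  have bound: "dp_fls (U p) (J j) $$ i = 0" if "i < - 2 * int (\<nu> p)" for p j i
  proof -
    interpret lenard_series "\<nu> p" "U p" "\<lambda>j. dp_fls (U p) (J j)" by (rule kdv_sequence_lenard_series[OF J U(2)])
    show ?thesis by (rule bounded_poles[OF odd]) (use that in auto)
  qed
  have Uper: "U (p + v) = U p" if "v \<in> \<Lambda>" for p v
    by (rule has_laurent_expansion_unique[OF U(1) has_laurent_expansion_translate[OF U(1) per[OF that]]])
  \<comment> \<open>one coordinate for each possible coefficient of a principal part\<close>
  define S where "S = (SIGMA r:R. {- 2 * int (\<nu> r)..<0})"
  have fin: "finite S" unfolding S_def using R(1) by (intro finite_SigmaI) auto
  obtain g c where gc: "\<forall>s\<in>S. dp_fls (U (fst s)) (J g) $$ snd s = (\<Sum>i<g. c i * dp_fls (U (fst s)) (J i) $$ snd s)"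
    using linear_recurrence_on_finite[OF fin, of "\<lambda>j s. dp_fls (U (fst s)) (J j) $$ snd s"] by blast
  define f where "f x = dp_eval (J g) u x - (\<Sum>i<g. c i * dp_eval (J i) u x)" for x
  define F where "F p = dp_fls (U p) (J g) - (\<Sum>i<g. fls_const (c i) * dp_fls (U p) (J i))" for p
  have fF: "(\<lambda>t. f (p + t)) has_laurent_expansion F p" for p
    unfolding f_def F_def by (intro laurent_expansion_intros dp_eval_has_laurent_expansion U)
  have F_nth: "F p $$ i = dp_fls (U p) (J g) $$ i - (\<Sum>j<g. c j * dp_fls (U p) (J j) $$ i)" for p i
    by (simp add: F_def fls_nth_sum)
  have reg: "F p $$ i = 0" if i: "i < 0" for p i
  proof (cases "\<exists>r\<in>R. p - r \<in> \<Lambda>")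
    case True
    then obtain r where r: "r \<in> R" "p - r \<in> \<Lambda>" by blast
    have "F p = F r" using Uper[OF r(2), of r] by (simp add: F_def)
    moreover have "F r $$ i = 0"
    proof (cases "i < - 2 * int (\<nu> r)")
      case True thus ?thesis by (simp add: F_nth bound)
    next
      case False
      hence "(r, i) \<in> S" using i r(1) by (auto simp: S_def)
      from bspec[OF gc this] show ?thesis by (simp add: F_nth)
    qed
    ultimately show ?thesis by simp
  next
    case False
    hence "u analytic_on {p}" using R(2) by blast
    hence "f analytic_on {p}" unfolding f_def by (intro analytic_intros dp_eval_analytic)
    then obtain B where B: "(\<lambda>t. f (p + t)) has_laurent_expansion B" "\<And>i. i < 0 \<Longrightarrow> B $$ i = 0"
      by (rule analytic_has_laurent_expansion) (rule that)
    have "F p = B" using fF B(1) by (rule has_laurent_expansion_unique)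
    thus ?thesis using B(2) i by simp
  qed
  have fper: "eventually (\<lambda>x. f (x + v) = f x) (at p)" if v: "v \<in> \<Lambda>" for p v
  proof -
    have "(\<lambda>t. f (p + v + t) - f (p + t)) has_laurent_expansion F (p + v) - F p"
      by (intro laurent_expansion_intros fF)
    moreover have "F (p + v) = F p" using Uper[OF v] by (simp add: F_def)
    ultimately have "(\<lambda>t. f ((p + t) + v) - f (p + t)) has_laurent_expansion 0" by (simp add: add_ac)
    from has_laurent_expansion_0_imp_eventually[of "\<lambda>x. f (x + v) - f x", OF this] show ?thesis by simp
  qed
  obtain d where d: "\<And>p. f analytic_on {p} \<Longrightarrow> f p = d"
    by (rule elliptic_regular_const[of f]) (use fF reg fper in blast)+
  have "dp_eval (J g) u x + (\<Sum>i=1..g. - c (g - i) * dp_eval (J (g - i)) u x) = d" if "u analytic_on {x}" for x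
  proof -
    have "f analytic_on {x}" unfolding f_def using that by (intro analytic_intros dp_eval_analytic)
    hence "f x = d" by (rule d)
    moreover have "(\<Sum>i=1..g. - c (g - i) * dp_eval (J (g - i)) u x) = (\<Sum>i<g. - c i * dp_eval (J i) u x)"
      using sum.nat_diff_reindex[of "\<lambda>i. - c i * dp_eval (J i) u x" g] by (simp add: sum.atLeast1_atMost_eq)
    ultimately show ?thesis by (simp add: f_def sum_negf)
  qed
  thus ?thesis unfolding finite_gap_potential_def using J
    by (intro exI[of _ J] conjI exI[of _ g] exI[of _ "\<lambda>i. - c (g - i)"] exI[of _ d]) auto
qed

end

context fuchs_lattice begin

section \<open>Poles and symmetries of the elliptic potential\<close>

definition regular_point :: "complex \<Rightarrow> bool" where
  "regular_point x \<longleftrightarrow> x \<notin> \<Lambda> \<and> (\<forall>i\<in>{1..3}. x - hp i \<notin> \<Lambda>) \<and> (\<forall>k\<in>{1..M}. x - \<delta> k \<notin> \<Lambda> \<and> x + \<delta> k \<notin> \<Lambda>)"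

lemma eventually_shift_not_in_lattice: "eventually (\<lambda>x. x + c \<notin> \<Lambda>) (at p)"
proof -
  obtain d where d: "d > 0" "\<And>x. x \<noteq> p + c \<Longrightarrow> dist x (p + c) < d \<Longrightarrow> x \<notin> \<Lambda>"
    using eventually_not_in_lattice[of "p + c"] unfolding eventually_at by auto
  have "x + c \<notin> \<Lambda>" if "x \<noteq> p" "dist x p < d" for x using d(2)[of "x + c"] that by (simp add: dist_norm)
  thus ?thesis unfolding eventually_at using d(1) by blast
qed

lemma eventually_regular_point: "eventually regular_point (at p)"
proof -
  have "eventually (\<lambda>x. \<forall>i\<in>{1..3}. x - hp i \<notin> \<Lambda>) (at p)"
    by (intro eventually_ball_finite ballI) (use eventually_shift_not_in_lattice[of "- c" for c] in auto)
  moreover have "eventually (\<lambda>x. \<forall>k\<in>{1..M}. x - \<delta> k \<notin> \<Lambda> \<and> x + \<delta> k \<notin> \<Lambda>) (at p)"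
    by (intro eventually_ball_finite ballI eventually_conj)
      (use eventually_shift_not_in_lattice[of "- c" for c] eventually_shift_not_in_lattice in auto)
  ultimately show ?thesis unfolding regular_point_def using eventually_not_in_lattice by (intro eventually_conj) auto
qed

lemma potential_analytic:
  assumes "regular_point x"
  shows "u analytic_on {x}"
proof -
  have "(\<lambda>y. wp (y - c)) analytic_on {x}" if "x - c \<notin> \<Lambda>" for c
    using analytic_at_shift[of wp x "- c"] wp_analytic[OF that] by simp
  moreover have "(\<lambda>y. wp (y + c)) analytic_on {x}" if "x + c \<notin> \<Lambda>" for c
    using analytic_at_shift[of wp x c] wp_analytic[OF that] by simp
  ultimately show ?thesis using assms wp_analytic unfolding elliptic_potential_def[abs_def] regular_point_def
    by (intro analytic_intros) blast+
qed

lemma potential_periodic: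
  assumes "v \<in> \<Lambda>" "regular_point x"
  shows "u (x + v) = u x"
proof -
  have "wp (x + v - c) = wp (x - c)" if "x - c \<notin> \<Lambda>" for c using wp_periodic[OF assms(1) that] by (simp add: algebra_simps)
  moreover have "wp (x + v + c) = wp (x + c)" if "x + c \<notin> \<Lambda>" for c using wp_periodic[OF assms(1) that] by (simp add: algebra_simps)
  ultimately show ?thesis using assms wp_periodic unfolding elliptic_potential_def regular_point_def
    by (intro arg_cong2[of _ _ _ _ "(+)"] sum.cong arg_cong2[of _ _ _ _ "(*)"] refl) blast+
qed

lemma potential_even:
  assumes "regular_point x"
  shows "u (- x) = u x"
proof -
  have "wp (- x - hp i) = wp (x - hp i)" if "i \<in> {1..3}" for i
  proof -
    have "wp (- x - hp i) = wp (x - hp i + 2 * hp i)" using wp_even[of "x + hp i"] by (simp add: algebra_simps)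
    also have "\<dots> = wp (x - hp i)" by (rule wp_periodic[OF two_half_period]) (use assms that in \<open>auto simp: regular_point_def\<close>)
    finally show ?thesis .
  qed
  moreover have "wp (- x - c) + wp (- x + c) = wp (x - c) + wp (x + c)" for c
  proof -
    have "- x - c = - (x + c)" "- x + c = - (x - c)" by simp_all
    thus ?thesis by (simp only: wp_even add.commute)
  qed
  ultimately show ?thesis unfolding elliptic_potential_def by (simp only: wp_even cong: sum.cong)
qed

text \<open>
  The coefficient of the double pole at \<open>p\<close>: the contributions of all summands of the potential centred at points
  congruent to \<open>p\<close>.
\<close>
definition strength :: "complex \<Rightarrow> complex" where
  "strength p = of_nat (m 0 * (m 0 + 1)) * (if p \<in> \<Lambda> then 1 else 0)
     + (\<Sum>i=1..3. of_nat (m i * (m i + 1)) * (if p - hp i \<in> \<Lambda> then 1 else 0))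
     + (\<Sum>k=1..M. of_nat (n k * (n k + 1)) * ((if p - \<delta> k \<in> \<Lambda> then 1 else 0) + (if p + \<delta> k \<in> \<Lambda> then 1 else 0)))"

lemma potential_laurent:
  obtains U where "(\<lambda>t. u (p + t)) has_laurent_expansion U" "\<And>i. i < -2 \<Longrightarrow> U $$ i = 0"
    "U $$ (-1) = 0" "U $$ (-2) = strength p"
proof -
  have "\<forall>p. \<exists>W. (\<lambda>t. wp (p + t)) has_laurent_expansion W \<and> (\<forall>i< -2. W $$ i = 0) \<and>
    W $$ (-1) = 0 \<and> W $$ (-2) = (if p \<in> \<Lambda> then 1 else 0)"
    by (rule allI, rule wp_laurent) blast
  then obtain W where W: "\<And>p. (\<lambda>t. wp (p + t)) has_laurent_expansion W p" "\<And>p i. i < -2 \<Longrightarrow> W p $$ i = 0"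
    "\<And>p. W p $$ (-1) = 0" "\<And>p. W p $$ (-2) = (if p \<in> \<Lambda> then 1 else 0)"
    using choice[of "\<lambda>p W. (\<lambda>t. wp (p + t)) has_laurent_expansion W \<and> (\<forall>i< -2. W $$ i = 0) \<and>
    W $$ (-1) = 0 \<and> W $$ (-2) = (if p \<in> \<Lambda> then 1 else 0)"] by blast
  define U where "U = fls_const (of_nat (m 0 * (m 0 + 1))) * W p
     + (\<Sum>i=1..3. fls_const (of_nat (m i * (m i + 1))) * W (p - hp i))
     + (\<Sum>k=1..M. fls_const (of_nat (n k * (n k + 1))) * (W (p - \<delta> k) + W (p + \<delta> k)))"
  have s: "(\<lambda>t. wp (p + t - c)) has_laurent_expansion W (p - c)" "(\<lambda>t. wp (p + t + c)) has_laurent_expansion W (p + c)" for c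
    using W(1)[of "p - c"] W(1)[of "p + c"] by (simp_all add: algebra_simps)
  show ?thesis
  proof (rule that[of U])
    show "(\<lambda>t. u (p + t)) has_laurent_expansion U" unfolding U_def elliptic_potential_def
      by (intro laurent_expansion_intros W s)
  qed (simp_all add: U_def strength_def fls_nth_sum W)
qed

lemma cong_half_period: "p - hp i \<in> \<Lambda> \<Longrightarrow> p \<notin> \<Lambda> \<and> wp p = we i"
  using wp_cong_lattice[OF _ half_period_notin_lattice] half_period_notin_lattice lattice_diff[of p "p - hp i"]
  by (auto simp: wp_half_period_value)

text \<open>
  The value of \<open>z\<close> tells the different centres of the summands apart, so at most one of them contributes to the
  pole at a given point.
\<close>
lemma cong_\<delta>:
  assumes "k \<in> {1..M}" "p - \<delta> k \<in> \<Lambda> \<or> p + \<delta> k \<in> \<Lambda>"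
  shows "p \<notin> \<Lambda> \<and> zc p = b k"
proof -
  have "p \<notin> \<Lambda>" using assms lattice_diff[of p "p - \<delta> k"] lattice_diff[of "p + \<delta> k" p] \<delta>(1) by auto
  moreover have "zc p = zc (\<delta> k)"
    using assms wp_cong_lattice[of p "\<delta> k"] wp_cong_lattice[of p "- \<delta> k"] \<delta>(1) by (auto simp: zc_eq wp_even)
  ultimately show ?thesis using zc_\<delta>[OF assms(1)] by simp
qed

lemma cong_\<delta>_unique:
  assumes "j \<in> {1..M}" "p - \<delta> j \<in> \<Lambda> \<or> p + \<delta> j \<in> \<Lambda>" "k \<in> {1..M}" "p - \<delta> k \<in> \<Lambda> \<or> p + \<delta> k \<in> \<Lambda>"
  shows "j = k"
proof (rule inj_onD[OF b_inj _ assms(1,3)])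
  show "b j = b k" using cong_\<delta>[OF assms(1,2)] cong_\<delta>[OF assms(3,4)] by simp
qed

lemma not_both_\<delta>: "k \<in> {1..M} \<Longrightarrow> p - \<delta> k \<in> \<Lambda> \<Longrightarrow> p + \<delta> k \<notin> \<Lambda>"
  using lattice_diff[of "p + \<delta> k" "p - \<delta> k"] two_\<delta>[of k] by auto

lemma strength_\<delta>:
  assumes k: "k \<in> {1..M}" and p: "p - \<delta> k \<in> \<Lambda> \<or> p + \<delta> k \<in> \<Lambda>"
  shows "strength p = of_nat (n k * (n k + 1))"
proof -
  have z: "p \<notin> \<Lambda>" "zc p = b k" using cong_\<delta>[OF k p] by auto
  have h: "p - hp i \<notin> \<Lambda>" if "i \<in> {1..3}" for i
  proof
    assume "p - hp i \<in> \<Lambda>"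
    moreover have "i \<in> {1,2,3}" using that by auto
    ultimately show False using cong_half_period[of p i] zc_half[of p i] b[OF k] z by simp
  qed
  have "(\<Sum>j=1..M. of_nat (n j * (n j + 1)) * ((if p - \<delta> j \<in> \<Lambda> then 1 else 0) + (if p + \<delta> j \<in> \<Lambda> then 1 else 0)))
     = (\<Sum>j=1..M. if j = k then of_nat (n k * (n k + 1)) else (0 :: complex))"
  proof (intro sum.cong refl)
    fix j assume j: "j \<in> {1..M}"
    have "\<not> (p - \<delta> j \<in> \<Lambda> \<or> p + \<delta> j \<in> \<Lambda>)" if "j \<noteq> k"
      using cong_\<delta>_unique[OF j _ k p] that by blast
    thus "of_nat (n j * (n j + 1)) * ((if p - \<delta> j \<in> \<Lambda> then 1 else 0) + (if p + \<delta> j \<in> \<Lambda> then 1 else 0))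
      = (if j = k then of_nat (n k * (n k + 1)) else (0 :: complex))"
      using p not_both_\<delta>[OF k, of p] by (cases "j = k") auto
  qed
  thus ?thesis using k z(1) h by (simp add: strength_def)
qed

lemma strength_half_period:
  assumes i: "i \<in> {1..3}" and p: "p - hp i \<in> \<Lambda>"
  shows "strength p = of_nat (m i * (m i + 1))"
proof -
  have z: "p \<notin> \<Lambda>" "wp p = we i" using cong_half_period[OF p] by auto
  have i': "i \<in> {1,2,3}" using i by auto
  have h: "\<not> (p - \<delta> k \<in> \<Lambda> \<or> p + \<delta> k \<in> \<Lambda>)" if "k \<in> {1..M}" for k
    using cong_\<delta>[OF that, of p] zc_half[OF z(2) i'] b[OF that] by auto
  have "(\<Sum>j=1..3. of_nat (m j * (m j + 1)) * (if p - hp j \<in> \<Lambda> then 1 else 0))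
     = (\<Sum>j=1..3. if j = i then of_nat (m i * (m i + 1)) else (0 :: complex))"
  proof (intro sum.cong refl)
    fix j :: nat assume j: "j \<in> {1..3}"
    have "j = i" if "p - hp j \<in> \<Lambda>"
    proof -
      have "j \<in> {1,2,3}" using j by auto
      thus ?thesis using cong_half_period[OF that] z i' e_distinct by auto
    qed
    thus "of_nat (m j * (m j + 1)) * (if p - hp j \<in> \<Lambda> then 1 else 0) = (if j = i then of_nat (m i * (m i + 1)) else (0 :: complex))"
      using p by (cases "j = i") auto
  qed
  thus ?thesis using i z(1) h by (simp add: strength_def del: atLeastAtMost_iff)
qed

lemma strength_lattice:
  assumes p: "p \<in> \<Lambda>"
  shows "strength p = of_nat (m 0 * (m 0 + 1))"
proof -
  have "p - hp i \<notin> \<Lambda>" for i using cong_half_period p by blast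
  moreover have "p - \<delta> k \<notin> \<Lambda>" "p + \<delta> k \<notin> \<Lambda>" if "k \<in> {1..M}" for k using cong_\<delta>[OF that] p by blast+
  ultimately show ?thesis using p by (simp add: strength_def)
qed

lemma strength_regular: "regular_point p \<Longrightarrow> strength p = 0"
  unfolding strength_def regular_point_def by (auto intro!: sum.neutral)

lemma pole_strength_ex:
  obtains \<nu> where "strength p = of_nat (\<nu> * (\<nu> + 1))" "regular_point p \<Longrightarrow> \<nu> = 0"
    "\<And>k. k \<in> {1..M} \<Longrightarrow> p - \<delta> k \<in> \<Lambda> \<or> p + \<delta> k \<in> \<Lambda> \<Longrightarrow> \<nu> = n k"
proof -
  consider "regular_point p" | "p \<in> \<Lambda>" | i where "i \<in> {1..3}" "p - hp i \<in> \<Lambda>" | k where "k \<in> {1..M}" "p - \<delta> k \<in> \<Lambda> \<or> p + \<delta> k \<in> \<Lambda>"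
    unfolding regular_point_def by blast
  thus ?thesis
  proof cases
    case 1 show ?thesis by (rule that[of 0]) (use 1 strength_regular[OF 1] in \<open>auto simp: regular_point_def\<close>)
  next
    case 2
    show ?thesis
    proof (rule that[of "m 0"])
      show "m 0 = n k" if "k \<in> {1..M}" "p - \<delta> k \<in> \<Lambda> \<or> p + \<delta> k \<in> \<Lambda>" for k
        using cong_\<delta>[OF that] 2 by simp
    qed (use 2 strength_lattice[OF 2] in \<open>auto simp: regular_point_def\<close>)
  next
    case 3
    show ?thesis
    proof (rule that[of "m i"])
      show "m i = n k" if "k \<in> {1..M}" "p - \<delta> k \<in> \<Lambda> \<or> p + \<delta> k \<in> \<Lambda>" for k
      proof -
        have "i \<in> {1,2,3}" using 3(1) by auto
        thus ?thesis using cong_\<delta>[OF that] cong_half_period[OF 3(2)] zc_half[of p i] b[OF that(1)] by simp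
      qed
    qed (use 3 strength_half_period[OF 3] in \<open>auto simp: regular_point_def\<close>)
  next
    case 4
    show ?thesis
    proof (rule that[of "n k"])
      show "n k = n j" if "j \<in> {1..M}" "p - \<delta> j \<in> \<Lambda> \<or> p + \<delta> j \<in> \<Lambda>" for j
        using cong_\<delta>_unique[OF that 4] by simp
    qed (use 4 strength_\<delta>[OF 4] in \<open>auto simp: regular_point_def\<close>)
  qed
qed

text \<open>
  The potential is even, and \<open>p\<close> is congruent to \<open>- p\<close>, so the potential is even about \<open>p\<close>.
\<close>
lemma potential_odd_coeffs_half_lattice:
  assumes "2 * p \<in> \<Lambda>" and U: "(\<lambda>t. u (p + t)) has_laurent_expansion U" and "odd i"
  shows "U $$ i = 0"
proof (rule laurent_expansion_even[OF U _ \<open>odd i\<close>])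
  have "eventually (\<lambda>t. regular_point (t + - p)) (at 0)"
    using eventually_regular_point[of "- p"] by (subst (asm) eventually_at_to_0)
  thus "eventually (\<lambda>t. u (p + - t) = u (p + t)) (at 0)"
  proof eventually_elim
    case (elim t)
    have "u (p + - t) = u (- (t + - p))" by simp
    also have "\<dots> = u (t + - p)" by (rule potential_even[OF elim])
    also have "\<dots> = u (t + - p + 2 * p)" by (rule potential_periodic[OF assms(1) elim, symmetric])
    also have "t + - p + 2 * p = p + t" by simp
    finally show ?case .
  qed
qed

lemma potential_odd_coeffs_reflect:
  assumes U: "(\<lambda>t. u (p + t)) has_laurent_expansion U" and V: "(\<lambda>t. u (- p + t)) has_laurent_expansion V" and "odd i"
  shows "V $$ i = - (U $$ i)"
proof (rule laurent_expansion_reflect[OF U _ \<open>odd i\<close>])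
  have "eventually (\<lambda>t. regular_point (t + - p)) (at 0)"
    using eventually_regular_point[of "- p"] by (subst (asm) eventually_at_to_0)
  hence "eventually (\<lambda>t. u (- p + t) = u (p + - t)) (at 0)"
    by eventually_elim (use potential_even in \<open>simp add: algebra_simps\<close>, metis minus_diff_eq potential_even)
  from has_laurent_expansion_cong[OF this refl] V show "(\<lambda>x. u (p + - x)) has_laurent_expansion V" by simp
qed

text \<open>
  By symmetry, no condition arises at the lattice points and half-periods, and the condition at \<open>- \<delta>\<^sub>k\<close> is the one
  at \<open>\<delta>\<^sub>k\<close>.
\<close>
lemma potential_finite_gap_iff:
  "finite_gap_potential u \<longleftrightarrow> (\<forall>k\<in>{1..M}. \<forall>U. (\<lambda>t. u (\<delta> k + t)) has_laurent_expansion U \<longrightarrow>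
     (\<forall>i. odd i \<longrightarrow> i < 2 * int (n k) + 1 \<longrightarrow> U $$ i = 0))" (is "_ \<longleftrightarrow> ?rhs")
proof
  assume fg: "finite_gap_potential u"
  show ?rhs
  proof (intro ballI allI impI)
    fix k U i assume k: "k \<in> {1..M}" and U: "(\<lambda>t. u (\<delta> k + t)) has_laurent_expansion U" and i: "odd i" "i < 2 * int (n k) + 1"
    obtain V where V: "(\<lambda>t. u (\<delta> k + t)) has_laurent_expansion V" "\<And>i. i < -2 \<Longrightarrow> V $$ i = 0"
      "V $$ (-1) = 0" "V $$ (-2) = strength (\<delta> k)" by (rule potential_laurent[of "\<delta> k"]) (rule that)
    have "U = V" using U V(1) by (rule has_laurent_expansion_unique)
    hence "pole_strength (n k) U" using V strength_\<delta>[OF k, of "\<delta> k"] by (simp add: pole_strength_def)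
    thus "U $$ i = 0" using finite_gap_potential_imp_odd_coeffs_zero[OF fg U _ i] by blast
  qed
next
  assume rhs: ?rhs
  show "finite_gap_potential u"
  proof (rule finite_gap_if_odd_coeffs_zero)
    define R where "R = {0} \<union> hp ` {1..3} \<union> \<delta> ` {1..M} \<union> (\<lambda>k. - \<delta> k) ` {1..M}"
    show "finite R" by (simp add: R_def)
    show "u analytic_on {p}" if "\<And>r. r \<in> R \<Longrightarrow> p - r \<notin> \<Lambda>" for p
    proof (rule potential_analytic, unfold regular_point_def, intro conjI ballI)
      show "p \<notin> \<Lambda>" using that[of 0] by (simp add: R_def)
      show "p - hp i \<notin> \<Lambda>" if "i \<in> {1..3}" for i using \<open>\<And>r. r \<in> R \<Longrightarrow> p - r \<notin> \<Lambda>\<close>[of "hp i"] that by (auto simp: R_def)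
      show "p - \<delta> k \<notin> \<Lambda>" "p + \<delta> k \<notin> \<Lambda>" if "k \<in> {1..M}" for k
        using \<open>\<And>r. r \<in> R \<Longrightarrow> p - r \<notin> \<Lambda>\<close>[of "\<delta> k"] \<open>\<And>r. r \<in> R \<Longrightarrow> p - r \<notin> \<Lambda>\<close>[of "- \<delta> k"] that by (auto simp: R_def)
    qed
    show per: "eventually (\<lambda>x. u (x + v) = u x) (at p)" if "v \<in> \<Lambda>" for p v
      using eventually_regular_point by eventually_elim (rule potential_periodic[OF that])
    show "\<exists>\<nu> U. (\<lambda>t. u (p + t)) has_laurent_expansion U \<and> pole_strength \<nu> U \<and>
       (\<forall>i. odd i \<longrightarrow> i < 2 * int \<nu> + 1 \<longrightarrow> U $$ i = 0)" for p
    proof -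
      obtain U where U: "(\<lambda>t. u (p + t)) has_laurent_expansion U" "\<And>i. i < -2 \<Longrightarrow> U $$ i = 0"
        "U $$ (-1) = 0" "U $$ (-2) = strength p" by (rule potential_laurent[of p]) (rule that)
      obtain \<nu> where \<nu>: "strength p = of_nat (\<nu> * (\<nu> + 1))" "regular_point p \<Longrightarrow> \<nu> = 0"
        "\<And>k. k \<in> {1..M} \<Longrightarrow> p - \<delta> k \<in> \<Lambda> \<or> p + \<delta> k \<in> \<Lambda> \<Longrightarrow> \<nu> = n k" by (rule pole_strength_ex[of p]) blast
      have "U $$ i = 0" if i: "odd i" "i < 2 * int \<nu> + 1" for i
      proof -
        consider "regular_point p" | "2 * p \<in> \<Lambda>" | k where "k \<in> {1..M}" "p - \<delta> k \<in> \<Lambda>" | k where "k \<in> {1..M}" "p + \<delta> k \<in> \<Lambda>"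
        proof -
          have "2 * p \<in> \<Lambda>" if "p \<in> \<Lambda>" using lattice_add[OF that that] by simp
          moreover have "2 * p \<in> \<Lambda>" if "p - hp i \<in> \<Lambda>" for i
            using lattice_add[OF lattice_add[OF that that] two_half_period[of i]] by (simp add: algebra_simps)
          ultimately show ?thesis using that unfolding regular_point_def by blast
        qed
        thus ?thesis
        proof cases
          case 1
          hence "i \<le> 0" using \<nu>(2) i by simp
          moreover have "i \<noteq> 0" "i \<noteq> -2" using i by auto
          ultimately consider "i = -1" | "i < -2" by linarith
          thus ?thesis by cases (use U in auto)
        next
          case 2 thus ?thesis using potential_odd_coeffs_half_lattice U(1) i(1) by blast
        next
          case 3
          have "(\<lambda>t. u (p + - (p - \<delta> k) + t)) has_laurent_expansion U"
            by (rule has_laurent_expansion_translate[OF U(1) per]) (use 3 in \<open>simp only: lattice_uminus_iff\<close>)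
          thus ?thesis using rhs 3(1) \<nu>(3)[OF 3(1)] 3(2) i by auto
        next
          case 4
          have m: "(\<lambda>t. u (p + - (p + \<delta> k) + t)) has_laurent_expansion U"
            by (rule has_laurent_expansion_translate[OF U(1) per]) (use 4 in \<open>simp only: lattice_uminus_iff\<close>)
          obtain V where V: "(\<lambda>t. u (\<delta> k + t)) has_laurent_expansion V" by (rule potential_laurent)
          have "V $$ i = 0" using rhs 4(1) \<nu>(3)[OF 4(1)] 4(2) V i by auto
          moreover have "U $$ i = - (V $$ i)" using potential_odd_coeffs_reflect[OF V _ i(1)] m by simp
          ultimately show ?thesis by simp
        qed
      qed
      moreover have "pole_strength \<nu> U" using U \<nu>(1) by (simp add: pole_strength_def)
      ultimately show ?thesis using U(1) by blast
    qed
  qed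
qed

section \<open>The Fuchsian equation at its apparent singularities\<close>

lemma finite_sing: "finite sing" by (simp add: sing_def)

lemma regular_point_if_zc: "x \<notin> \<Lambda> \<Longrightarrow> zc x \<notin> sing \<Longrightarrow> regular_point x"
  unfolding regular_point_def
proof (intro conjI ballI)
  assume x: "zc x \<notin> sing"
  show "x - hp i \<notin> \<Lambda>" if "i \<in> {1..3}" for i
  proof -
    have "i \<in> {1,2,3}" using that by auto
    thus ?thesis by (rule zc_sing_half[OF x])
  qed
qed (auto dest: zc_sing_\<delta>)

lemma logder_gauge:
  assumes "z \<notin> sing" "open Z" "z \<in> Z"
    and r1: "r1 holomorphic_on Z" "\<And>z. z \<in> Z \<Longrightarrow> r1 z ^ 2 = z"
    and r2: "r2 holomorphic_on Z" "\<And>z. z \<in> Z \<Longrightarrow> r2 z ^ 2 = z - 1"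
    and r3: "r3 holomorphic_on Z" "\<And>z. z \<in> Z \<Longrightarrow> r3 z ^ 2 = z - a"
  shows "logder (\<lambda>z. r1 z powi (- int (m 1)) * r2 z powi (- int (m 2)) * r3 z powi (- int (m 3))
     * (\<Prod>k=1..M. (z - b k) powi (- int (n k)))) z (h z)"
proof -
  have z: "z \<noteq> 0" "z \<noteq> 1" "z \<noteq> a" "\<And>k. k \<in> {1..M} \<Longrightarrow> z \<noteq> b k" using assms(1) by (auto simp: sing_def)
  have 1: "logder r1 z (1 / (2 * (z - 0)))" by (rule logder_sqrt[OF assms(2,3) r1(1)]) (use r1 z in auto)
  have 2: "logder r2 z (1 / (2 * (z - 1)))" by (rule logder_sqrt[OF assms(2,3) r2(1)]) (use r2 z in auto)
  have 3: "logder r3 z (1 / (2 * (z - a)))" by (rule logder_sqrt[OF assms(2,3) r3(1)]) (use r3 z in auto)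
  have "logder (\<lambda>z. r1 z powi (- int (m 1)) * r2 z powi (- int (m 2)) * r3 z powi (- int (m 3))
     * (\<Prod>k=1..M. (z - b k) powi (- int (n k)))) z (of_int (- int (m 1)) * (1 / (2 * (z - 0))) + of_int (- int (m 2)) * (1 / (2 * (z - 1)))
       + of_int (- int (m 3)) * (1 / (2 * (z - a))) + (\<Sum>k=1..M. of_int (- int (n k)) * (1 / (z - b k))))"
    by (intro logder_mult logder_powi logder_prod logder_linear 1 2 3 z) auto
  moreover have "of_int (- int (m 1)) * (1 / (2 * (z - 0))) + of_int (- int (m 2)) * (1 / (2 * (z - 1)))
       + of_int (- int (m 3)) * (1 / (2 * (z - a))) + (\<Sum>k=1..M. of_int (- int (n k)) * (1 / (z - b k))) = h z"
    by (simp add: h_def sum_negf)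
  ultimately show ?thesis by (simp only:)
qed

theorem change_of_variables_holds:
  "\<exists>C. \<forall>\<mu>. schroedinger_transforms_to_fuchs \<omega>1 \<omega>3 \<delta> a M m n b ((we 1 - we 2) * \<mu> + C) \<mu>"
proof -
  obtain C where C: "transforms_with_shift C" using change_of_variables by blast
  show ?thesis
  proof (intro exI[of _ C] allI)
    fix \<mu>
    show "schroedinger_transforms_to_fuchs \<omega>1 \<omega>3 \<delta> a M m n b ((we 1 - we 2) * \<mu> + C) \<mu>"
      unfolding schroedinger_transforms_to_fuchs_def
    proof (intro allI impI, elim conjE)
      fix S Z r1 r2 r3 y \<psi>
      assume S: "open S" "S \<inter> \<Lambda> = {}" and Z: "Z = zc ` S" and Zs: "Z \<inter> ({0, 1, a} \<union> b ` {1..M}) = {}"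
        and r1: "r1 holomorphic_on Z" "\<forall>z\<in>Z. (r1 z)\<^sup>2 = z" and r2: "r2 holomorphic_on Z" "\<forall>z\<in>Z. (r2 z)\<^sup>2 = z - 1"
        and r3: "r3 holomorphic_on Z" "\<forall>z\<in>Z. (r3 z)\<^sup>2 = z - a" and y: "y holomorphic_on Z"
        and \<psi>: "\<forall>x\<in>S. let z = zc x in \<psi> x = y z * r1 z powi (- int (m 1)) * r2 z powi (- int (m 2))
                 * r3 z powi (- int (m 3)) * (\<Prod>k=1..M. (z - b k) powi (- int (n k)))"
      have sing: "zc ` S \<inter> sing = {}" using Zs by (simp add: sing_def Z)
      have Zo: "open (zc ` S)"
      proof (rule open_image_nonzero_deriv[OF S(1)])
        show "zc holomorphic_on S" using zc_holomorphic by (rule holomorphic_on_subset) (use S in auto)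
        show "deriv zc x \<noteq> 0" if "x \<in> S" for x
          by (rule deriv_zc_nz) (use S(2) Zs that in \<open>auto simp: Z\<close>)
      qed
      show "(\<forall>x\<in>S. deriv (deriv \<psi>) x - u x * \<psi> x = ((we 1 - we 2) * \<mu> + C) * \<psi> x)
         \<longleftrightarrow> solves_ode2 (fuchs_P a M m n b) (fuchs_Q a M m n b \<mu>) y Z"
        unfolding Z
      proof (rule transforms_with_shiftD[OF C _ S sing y[unfolded Z]])
        show "(we 1 - we 2) * \<mu> + C = - \<kappa> * \<mu> + C" by (simp add: \<kappa>_def)
        show "logder (\<lambda>z. r1 z powi (- int (m 1)) * r2 z powi (- int (m 2)) * r3 z powi (- int (m 3))
           * (\<Prod>k=1..M. (z - b k) powi (- int (n k)))) z (h z)" if "z \<in> zc ` S" for z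
          by (rule logder_gauge[OF _ Zo that]) (use sing that r1 r2 r3 in \<open>auto simp: Z\<close>)
        show "\<psi> x = y (zc x) * (r1 (zc x) powi (- int (m 1)) * r2 (zc x) powi (- int (m 2)) * r3 (zc x) powi (- int (m 3))
           * (\<Prod>k=1..M. (zc x - b k) powi (- int (n k))))" if "x \<in> S" for x
          using bspec[OF \<psi> that] by (simp add: Let_def mult.assoc)
      qed
    qed
  qed
qed

text \<open>
  Near \<open>\<delta>\<^sub>k\<close> the function \<open>z\<close> is a chart because \<open>b\<^sub>k\<close> is not a branch point. The energy runs through all complex
  numbers together with \<open>\<mu>\<close>, which is what the converse direction needs; in the other direction, adding the
  energy to the potential changes no odd coefficient.
\<close>
lemma false_singular_point_iff:
  assumes k: "k \<in> {1..M}"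
  shows "(\<forall>\<mu>. false_singular_point (fuchs_P a M m n b) (fuchs_Q a M m n b \<mu>) (b k)) \<longleftrightarrow>
    (\<forall>U. (\<lambda>t. u (\<delta> k + t)) has_laurent_expansion U \<longrightarrow> (\<forall>i. odd i \<longrightarrow> i < 2 * int (n k) + 1 \<longrightarrow> U $$ i = 0))"
proof -
  obtain C where C: "transforms_with_shift C" using change_of_variables by blast
  obtain U where U: "(\<lambda>t. u (\<delta> k + t)) has_laurent_expansion U" "\<And>i. i < -2 \<Longrightarrow> U $$ i = 0"
      "U $$ (-1) = 0" "U $$ (-2) = strength (\<delta> k)" by (rule potential_laurent[of "\<delta> k"]) (rule that)
  have Uk: "pole_strength (n k) U" using U strength_\<delta>[OF k, of "\<delta> k"] by (simp add: pole_strength_def)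
  obtain \<rho> where \<rho>: "\<rho> > 0" "\<And>z. z \<in> sing \<Longrightarrow> z \<noteq> b k \<Longrightarrow> \<rho> \<le> dist (b k) z"
    using finite_set_avoid[OF finite_sing, of "b k"] by blast
  define B where "B = ball (b k) \<rho>"
  have avoid: "z \<notin> sing" if "z \<in> B" "z \<noteq> b k" for z using \<rho>(2)[of z] that by (auto simp: B_def)
  have bk: "b k \<noteq> 0" "b k \<noteq> 1" "b k \<noteq> a" using b[OF k] by auto
  have nz: "z \<noteq> 0" "z \<noteq> 1" "z \<noteq> a" if "z \<in> B" for z
    using avoid[OF that] bk by (cases "z = b k"; auto simp: sing_def)+
  have nzj: "z \<noteq> b j" if "z \<in> B" "j \<in> {1..M} - {k}" for z j
  proof (cases "z = b k")
    case True thus ?thesis using inj_onD[OF b_inj, of k j] k that by auto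
  next
    case False thus ?thesis using avoid[OF that(1)] that(2) by (auto simp: sing_def)
  qed
  have contr: "contractible B" unfolding B_def by (intro convex_imp_contractible convex_ball)
  have sqrt: "\<exists>r. r holomorphic_on B \<and> (\<forall>z\<in>B. r z ^ 2 = z - p)" if "\<And>z. z \<in> B \<Longrightarrow> z \<noteq> p" for p
  proof -
    have "(\<lambda>z. z - p) holomorphic_on B" by (intro holomorphic_intros)
    thus ?thesis by (rule contractible_imp_holomorphic_sqrt[OF _ contr]) (use that in auto)
  qed
  obtain r1 where r1: "r1 holomorphic_on B" "\<And>z. z \<in> B \<Longrightarrow> r1 z ^ 2 = z" using sqrt[of 0] nz by auto
  obtain r2 where r2: "r2 holomorphic_on B" "\<And>z. z \<in> B \<Longrightarrow> r2 z ^ 2 = z - 1" using sqrt[of 1] nz by auto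
  obtain r3 where r3: "r3 holomorphic_on B" "\<And>z. z \<in> B \<Longrightarrow> r3 z ^ 2 = z - a" using sqrt[of a] nz by auto
  have rnz: "r1 z \<noteq> 0" "r2 z \<noteq> 0" "r3 z \<noteq> 0" if "z \<in> B" for z
    using r1(2)[OF that] r2(2)[OF that] r3(2)[OF that] nz[OF that] by auto
  define H where "H z = r1 z powi (- int (m 1)) * r2 z powi (- int (m 2)) * r3 z powi (- int (m 3))
     * (\<Prod>j\<in>{1..M} - {k}. (z - b j) powi (- int (n j)))" for z
  have Hhol: "H holomorphic_on B" unfolding H_def
    by (intro holomorphic_intros r1 r2 r3) (use rnz nzj in auto)
  have Hnz: "H z \<noteq> 0" if "z \<in> B" for z unfolding H_def using rnz[OF that] nzj[OF that] by auto
  have Bo: "open B" by (simp add: B_def)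
  have G: "logder (\<lambda>z. H z / (z - b k) ^ n k) z (h z)" if "z \<in> B" "z \<noteq> b k" for z
  proof -
    have "H z / (z - b k) ^ n k = r1 z powi (- int (m 1)) * r2 z powi (- int (m 2)) * r3 z powi (- int (m 3))
       * (\<Prod>j=1..M. (z - b j) powi (- int (n j)))" for z
      unfolding H_def prod.remove[OF finite_atLeastAtMost k] by (simp only: power_int_minus power_int_of_nat divide_inverse mult_ac)
    thus ?thesis using logder_gauge[OF avoid[OF that] Bo that(1) r1 r2 r3] by (simp only:)
  qed
  define T where "T = - \<Lambda> \<inter> zc -` B"
  have To: "open T" unfolding T_def
    by (rule continuous_open_preimage[OF holomorphic_on_imp_continuous_on[OF zc_holomorphic] lattice_open_complement Bo])
  have dT: "\<delta> k \<in> T" using \<delta>(1)[OF k] zc_\<delta>[OF k] \<rho>(1) by (simp add: T_def B_def)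
  have zT: "zc holomorphic_on T" using zc_holomorphic by (rule holomorphic_on_subset) (auto simp: T_def)
  have dnz: "deriv zc (\<delta> k) \<noteq> 0" using deriv_zc_nz[OF \<delta>(1)[OF k]] zc_\<delta>[OF k] bk by simp
  obtain r0 where r0: "r0 > 0" "ball (\<delta> k) r0 \<subseteq> T" "inj_on zc (ball (\<delta> k) r0)"
    using has_complex_derivative_locally_injective[OF zT dT To dnz] by blast
  have zB: "zc ` ball (\<delta> k) r0 \<subseteq> B" using r0(2) by (auto simp: T_def)
  have ball: "x \<notin> \<Lambda>" "zc x \<in> B" "zc x \<noteq> b k" "zc x \<notin> sing" if "x \<in> ball (\<delta> k) r0 - {\<delta> k}" for x
  proof -
    show x: "x \<notin> \<Lambda>" "zc x \<in> B" using that r0(2) by (auto simp: T_def)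
    show "zc x \<noteq> b k" using inj_on_eq_iff[OF r0(3), of x "\<delta> k"] that r0(1) zc_\<delta>[OF k] by simp
    thus "zc x \<notin> sing" using avoid x by blast
  qed
  have transfer: "singular_point_transfer zc H (\<lambda>x. u x + E) (fuchs_P a M m n b) (fuchs_Q a M m n b \<mu>) (n k) (U + fls_const E) (\<delta> k) (b k) r0"
    if E: "E = - \<kappa> * \<mu> + C" for E \<mu>
  proof
    show "r0 > 0" "inj_on zc (ball (\<delta> k) r0)" "zc (\<delta> k) = b k" using r0 zc_\<delta>[OF k] by auto
    show "zc holomorphic_on ball (\<delta> k) r0" using zT r0(2) by (rule holomorphic_on_subset)
    show "H holomorphic_on zc ` ball (\<delta> k) r0" using Hhol zB by (rule holomorphic_on_subset)
    show "H z \<noteq> 0" if "z \<in> zc ` ball (\<delta> k) r0" for z using Hnz zB that by blast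
    show "(\<lambda>t. u (\<delta> k + t) + E) has_laurent_expansion U + fls_const E" by (intro laurent_expansion_intros U)
    show "pole_strength (n k) (U + fls_const E)" using Uk by (rule pole_strength_add_const)
    have "u analytic_on ball (\<delta> k) r0 - {\<delta> k}"
      by (subst analytic_on_analytic_at) (use ball regular_point_if_zc potential_analytic in blast)
    thus "(\<lambda>x. u x + E) holomorphic_on ball (\<delta> k) r0 - {\<delta> k}"
      by (intro holomorphic_intros analytic_imp_holomorphic)
  next
    fix S y assume S: "open S" "S \<subseteq> ball (\<delta> k) r0 - {\<delta> k}" "y holomorphic_on zc ` S"
    have inS: "x \<notin> \<Lambda>" "zc x \<in> B" "zc x \<noteq> b k" "zc x \<notin> sing" if "x \<in> S" for x
      using ball[OF subsetD[OF S(2) that]] by auto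
    have "(\<forall>x\<in>S. deriv (deriv (\<lambda>x. y (zc x) * H (zc x) / (zc x - b k) ^ n k)) x - u x * (y (zc x) * H (zc x) / (zc x - b k) ^ n k) =
        E * (y (zc x) * H (zc x) / (zc x - b k) ^ n k)) \<longleftrightarrow> solves_ode2 (fuchs_P a M m n b) (fuchs_Q a M m n b \<mu>) y (zc ` S)"
    proof (rule transforms_with_shiftD[OF C E S(1) _ _ S(3)])
      show "S \<inter> \<Lambda> = {}" "zc ` S \<inter> sing = {}" using inS by blast+
      show "logder (\<lambda>z. H z / (z - b k) ^ n k) z (h z)" if "z \<in> zc ` S" for z
        using that G inS(2,3) by auto
    qed simp
    thus "(\<forall>x\<in>S. deriv (deriv (\<lambda>x. y (zc x) * H (zc x) / (zc x - b k) ^ n k)) x =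
        (u x + E) * (y (zc x) * H (zc x) / (zc x - b k) ^ n k)) \<longleftrightarrow> solves_ode2 (fuchs_P a M m n b) (fuchs_Q a M m n b \<mu>) y (zc ` S)"
      by (simp only: distrib_right diff_eq_eq add.commute)
  qed
  show ?thesis
  proof
    assume false: "\<forall>\<mu>. false_singular_point (fuchs_P a M m n b) (fuchs_Q a M m n b \<mu>) (b k)"
    have "\<exists>A. fls_deriv (fls_deriv A) = (U + fls_const E) * A \<and> (\<forall>i< - int (n k). A $$ i = 0) \<and> A $$ (- int (n k)) \<noteq> 0" for E
    proof -
      define \<mu> where "\<mu> = (C - E) / \<kappa>"
      have "E = - \<kappa> * \<mu> + C" using \<kappa>_nz by (simp add: \<mu>_def)
      from transfer[OF this] show ?thesis by (rule singular_point_transfer.false_imp_formal_solution) (use false in blast)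
    qed
    from all_energies_imp_odd_coeffs_zero[OF Uk this]
    have "U $$ i = 0" if "odd i" "i < 2 * int (n k) + 1" for i using that by blast
    thus "\<forall>U. (\<lambda>t. u (\<delta> k + t)) has_laurent_expansion U \<longrightarrow> (\<forall>i. odd i \<longrightarrow> i < 2 * int (n k) + 1 \<longrightarrow> U $$ i = 0)"
      using has_laurent_expansion_unique[OF U(1)] by blast
  next
    assume "\<forall>U. (\<lambda>t. u (\<delta> k + t)) has_laurent_expansion U \<longrightarrow> (\<forall>i. odd i \<longrightarrow> i < 2 * int (n k) + 1 \<longrightarrow> U $$ i = 0)"
    hence odd: "U $$ i = 0" if "odd i" "i < 2 * int (n k) + 1" for i using U(1) that by blast
    show "\<forall>\<mu>. false_singular_point (fuchs_P a M m n b) (fuchs_Q a M m n b \<mu>) (b k)"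
    proof
      fix \<mu>
      show "false_singular_point (fuchs_P a M m n b) (fuchs_Q a M m n b \<mu>) (b k)"
      proof (rule singular_point_transfer.false_if_odd_coeffs_zero[OF transfer[OF refl]])
        fix i :: int assume i: "odd i" "i < 2 * int (n k) + 1"
        hence "i \<noteq> 0" by auto
        thus "(U + fls_const (- \<kappa> * \<mu> + C)) $$ i = 0" using odd[OF i] by simp
      qed
    qed
  qed
qed

end

section \<open>Finite-gap Fuchsian equations\<close>

unbundle no fps_syntax

theorem theorem1:
  fixes a :: complex and M :: nat and m n :: "nat \<Rightarrow> nat" and b :: "nat \<Rightarrow> complex"
    and \<omega>1 \<omega>3 :: complex and \<delta> :: "nat \<Rightarrow> complex"
  assumes "a \<notin> {0, 1}"
    and "inj_on b {1..M}"
    and "\<forall>k\<in>{1..M}. b k \<notin> {0, 1, a}"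
    and "\<omega>1 \<noteq> 0" and "Im (\<omega>3 / \<omega>1) \<noteq> 0"
    and "(weierstrass_e \<omega>1 \<omega>3 3 - weierstrass_e \<omega>1 \<omega>3 1)
         / (weierstrass_e \<omega>1 \<omega>3 2 - weierstrass_e \<omega>1 \<omega>3 1) = a"
    and "\<forall>k\<in>{1..M}. \<delta> k \<notin> period_lattice \<omega>1 \<omega>3 \<and>
           weierstrass_p \<omega>1 \<omega>3 (\<delta> k) =
             weierstrass_e \<omega>1 \<omega>3 1
             + (weierstrass_e \<omega>1 \<omega>3 2 - weierstrass_e \<omega>1 \<omega>3 1) * b k"
  shows "finite_gap_fuchs \<omega>1 \<omega>3 \<delta> a M m n b \<longleftrightarrow>
         (\<forall>k\<in>{1..M}. \<forall>\<mu>.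
            false_singular_point (fuchs_P a M m n b) (fuchs_Q a M m n b \<mu>) (b k))"
proof -
  have we12: "weierstrass_e \<omega>1 \<omega>3 1 \<noteq> weierstrass_e \<omega>1 \<omega>3 2" using assms(1,6) by auto
  moreover have "weierstrass_e \<omega>1 \<omega>3 1 \<noteq> weierstrass_e \<omega>1 \<omega>3 3" using assms(1,6) by auto
  moreover have "weierstrass_e \<omega>1 \<omega>3 2 \<noteq> weierstrass_e \<omega>1 \<omega>3 3"
  proof
    assume "weierstrass_e \<omega>1 \<omega>3 2 = weierstrass_e \<omega>1 \<omega>3 3"
    with assms(6) we12 have "a = 1" by simp
    with assms(1) show False by simp
  qed
  ultimately interpret fuchs_lattice \<omega>1 \<omega>3 a M m n b \<delta>
    by unfold_locales (use assms in blast)+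
  show ?thesis
    unfolding finite_gap_fuchs_def potential_finite_gap_iff using change_of_variables_holds false_singular_point_iff by blast
qed

end
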